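(* Let $\Omega\subset\mathbb{R}^3$ be an open bounded domain of class $Lip_{loc}$, $T>0$, $\nu>0$, and let $L$ be a hyperplane with $\Omega_L=\Omega\cap L\ne\varnothing$, written as $L=\{x\in\mathbb{R}^3: x_3=b-a_1x_1-a_2x_2\}$ with $a_1,a_2\neq0$. Then for any $u_{0L}\in H(\Omega_L)$ and $f_L\in L^2(0,T;V^*(\Omega_L))$ the problem $$\frac{\partial u_L}{\partial t}-\nu A_1u_L+B_1(u_L,u_L)=f_L\quad\text{on }(0,T)\times\Omega_L,$$ $$\operatorname{div}u_L=D_1u_{L1}+D_2u_{L2}-\tfrac12\big(a_1^{-1}D_1+a_2^{-1}D_2\big)u_{L3}=0,\quad x\in\Omega_L,\ t>0,$$ $$u_L(0,x)=u_{0L}(x),\ x\in\Omega_L;\qquad u_L|_{(0,T)\times\partial\Omega_L}=0$$ has a weak solution $u_L(t,x)$ that belongs to $\mathcal{V}(Q_L^T)$.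
   Context: $Lip_{loc}$ is the class of locally Lipschitz domains. Write $Q_L^T=(0,T)\times\Omega_L$ and $D_i=\partial/\partial x_i$. $\Omega_L$ is identified with its projection $P_{x_3}\Omega_L\subset\mathbb{R}^2$ onto the $(x_1,x_2)$-plane (a finite union of bounded domains of class $Lip_{loc}$, of positive measure), functions on $\Omega_L$ are regarded as functions of $(x_1,x_2)$, and integrals over $\Omega_L$ mean integrals over $P_{x_3}\Omega_L$ with respect to $dx_1dx_2$. For three-component functions $u,w$ of $(x_1,x_2)$ put $$A_1=D_1^2+D_2^2+\tfrac14\big(a_1^{-1}D_1+a_2^{-1}D_2\big)^2,\qquad B_1(u,w)=\Big[u_1D_1+u_2D_2-\tfrac12u_3\big(a_1^{-1}D_1+a_2^{-1}D_2\big)\Big]w .$$ $V(\Omega_L)$ and $H(\Omega_L)$ are the closures in $(W_0^{1,2}(\Omega_L))^3$ and $(L^2(\Omega_L))^3$ of the set of $\varphi\in(C_0^\infty(\Omega_L))^3$ with $D_1\varphi_1+D_2\varphi_2-\frac12(a_1^{-1}D_1+a_2^{-1}D_2)\varphi_3=0$; $V^*(\Omega_L)$ is the dual of $V(\Omega_L)$, and $\langle\cdot,\cdot\rangle_{\Omega_L}$ is the duality extending $\langle g,h\rangle_{\Omega_L}=\sum_{i=1}^3\int_{P_{x_3}\Omega_L}g_ih_i\,dx_1dx_2$. Put $$\mathcal{V}(Q_L^T)=\{w\in L^2(0,T;V(\Omega_L))\cap L^\infty(0,T;H(\Omega_L)):\ w'\in L^2(0,T;V^*(\Omega_L))\}.$$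 A weak solution is a function $u_L\in\mathcal{V}(Q_L^T)$ such that, for all $v\in V(\Omega_L)$ and almost every $t\in(0,T)$, $$\frac{d}{dt}\langle u_L,v\rangle_{\Omega_L}-\nu\langle A_1u_L,v\rangle_{\Omega_L}+\langle B_1(u_L,u_L),v\rangle_{\Omega_L}=\langle f_L,v\rangle_{\Omega_L},$$ and $\langle u_L(t),v\rangle_{\Omega_L}|_{t=0}=\langle u_{0L},v\rangle_{\Omega_L}$ for all $v\in H(\Omega_L)$. *)

theory Defs
  imports "HOL-Analysis.Analysis"
begin

text \<open>Function spaces are represented by sets of representatives: an element of a Lebesgue or
  Sobolev space over \<open>G\<close> is a total function of which only the values on \<open>G\<close> (up to null sets)
  matter, and the norms are seminorms on such functions.\<close>

text \<open>Near each boundary point, and in a suitable direction \<open>e\<close>, the set is the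
  strict epigraph of a Lipschitz function on the orthogonal complement of \<open>e\<close> (extended to the
  whole space along \<open>e\<close>).\<close>

definition Lip_loc_domain :: "'a::euclidean_space set \<Rightarrow> bool" where
  "Lip_loc_domain \<Omega> \<longleftrightarrow> open \<Omega> \<and> connected \<Omega> \<and> \<Omega> \<noteq> {} \<and>
     (\<forall>x\<in>frontier \<Omega>. \<exists>r>0. \<exists>e. norm e = 1 \<and> (\<exists>C g. C-lipschitz_on UNIV g \<and>
        \<Omega> \<inter> ball x r = {y \<in> ball x r. g (y - (y \<bullet> e) *\<^sub>R e) < y \<bullet> e}))"

definition proj12 :: "real^3 \<Rightarrow> real^2" where
  "proj12 x = vector [x $ 1, x $ 2]"

definition partial :: "'a::euclidean_space \<Rightarrow> ('a \<Rightarrow> 'b::real_normed_vector) \<Rightarrow> 'a \<Rightarrow> 'b" where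
  "partial e \<phi> x = frechet_derivative \<phi> (at x) e"

primrec Ck :: "nat \<Rightarrow> ('a::euclidean_space \<Rightarrow> 'b::real_normed_vector) \<Rightarrow> bool" where
  "Ck 0 \<phi> \<longleftrightarrow> continuous_on UNIV \<phi>"
| "Ck (Suc k) \<phi> \<longleftrightarrow> (\<forall>x. \<phi> differentiable (at x)) \<and> (\<forall>e\<in>Basis. Ck k (partial e \<phi>))"

text \<open>\<open>C\<^sub>0\<^sup>\<infinity>(G)\<close>, each function being extended by zero to the whole space.\<close>

definition test_functions ::
    "'a::euclidean_space set \<Rightarrow> ('a \<Rightarrow> 'b::real_normed_vector) set" where
  "test_functions G =
     {\<phi>. (\<forall>k. Ck k \<phi>) \<and> (\<exists>K. compact K \<and> K \<subseteq> G \<and> (\<forall>x. x \<notin> K \<longrightarrow> \<phi> x = 0))}"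

definition locally_integrable ::
    "'a::euclidean_space set \<Rightarrow> ('a \<Rightarrow> 'b::euclidean_space) \<Rightarrow> bool" where
  "locally_integrable G u \<longleftrightarrow> (\<forall>K. compact K \<and> K \<subseteq> G \<longrightarrow> integrable (lebesgue_on K) u)"

definition has_weak_partial :: "'a::euclidean_space set \<Rightarrow> 'a \<Rightarrow>
    ('a \<Rightarrow> 'b::euclidean_space) \<Rightarrow> ('a \<Rightarrow> 'b) \<Rightarrow> bool" where
  "has_weak_partial G e u g \<longleftrightarrow> locally_integrable G u \<and> locally_integrable G g \<and>
     (\<forall>\<phi>\<in>test_functions G.
        (\<integral>x. partial e \<phi> x *\<^sub>R u x \<partial>lebesgue_on G) = - (\<integral>x. \<phi> x *\<^sub>R g x \<partial>lebesgue_on G))"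

definition weak_partial :: "'a::euclidean_space set \<Rightarrow> 'a \<Rightarrow>
    ('a \<Rightarrow> 'b::euclidean_space) \<Rightarrow> 'a \<Rightarrow> 'b" where
  "weak_partial G e u = (SOME g. has_weak_partial G e u g)"

definition L2 :: "'a::euclidean_space set \<Rightarrow> ('a \<Rightarrow> 'b::euclidean_space) set" where
  "L2 G = {u. u \<in> borel_measurable (lebesgue_on G) \<and>
              integrable (lebesgue_on G) (\<lambda>x. (norm (u x))\<^sup>2)}"

definition L2_pairing :: "'a::euclidean_space set \<Rightarrow> ('a \<Rightarrow> 'b::euclidean_space) \<Rightarrow>
    ('a \<Rightarrow> 'b) \<Rightarrow> real" where
  "L2_pairing G u v = (\<integral>x. u x \<bullet> v x \<partial>lebesgue_on G)"

definition L2_norm :: "'a::euclidean_space set \<Rightarrow> ('a \<Rightarrow> 'b::euclidean_space) \<Rightarrow> real" where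
  "L2_norm G u = sqrt (\<integral>x. (norm (u x))\<^sup>2 \<partial>lebesgue_on G)"

definition W12 :: "'a::euclidean_space set \<Rightarrow> ('a \<Rightarrow> 'b::euclidean_space) set" where
  "W12 G = {u \<in> L2 G. \<forall>e\<in>Basis. \<exists>g\<in>L2 G. has_weak_partial G e u g}"

definition W12_norm :: "'a::euclidean_space set \<Rightarrow> ('a \<Rightarrow> 'b::euclidean_space) \<Rightarrow> real" where
  "W12_norm G u = sqrt ((L2_norm G u)\<^sup>2 + (\<Sum>e\<in>Basis. (L2_norm G (weak_partial G e u))\<^sup>2))"

definition closure_in :: "('a \<Rightarrow> 'b::real_normed_vector) set \<Rightarrow> (('a \<Rightarrow> 'b) \<Rightarrow> real) \<Rightarrow>
    ('a \<Rightarrow> 'b) set \<Rightarrow> ('a \<Rightarrow> 'b) set" where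
  "closure_in X N S = {u \<in> X. \<forall>\<epsilon>>0. \<exists>\<phi>\<in>S. N (\<lambda>x. u x - \<phi> x) < \<epsilon>}"

definition W12_0 :: "'a::euclidean_space set \<Rightarrow> ('a \<Rightarrow> 'b::euclidean_space) set" where
  "W12_0 G = closure_in (W12 G) (W12_norm G) (test_functions G)"

text \<open>An element of the dual of \<open>X\<close> is given by a total functional whose values outside \<open>X\<close> are
  irrelevant; boundedness makes it constant on classes of a.e. equal functions.\<close>

definition dual_space :: "('a \<Rightarrow> 'b::real_normed_vector) set \<Rightarrow> (('a \<Rightarrow> 'b) \<Rightarrow> real) \<Rightarrow>
    (('a \<Rightarrow> 'b) \<Rightarrow> real) set" where
  "dual_space X N = {F. (\<forall>v\<in>X. \<forall>w\<in>X. F (\<lambda>x. v x + w x) = F v + F w) \<and>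
     (\<forall>c. \<forall>v\<in>X. F (\<lambda>x. c *\<^sub>R v x) = c * F v) \<and> (\<exists>C. \<forall>v\<in>X. \<bar>F v\<bar> \<le> C * N v)}"

definition dual_norm :: "('a \<Rightarrow> 'b::real_normed_vector) set \<Rightarrow> (('a \<Rightarrow> 'b) \<Rightarrow> real) \<Rightarrow>
    (('a \<Rightarrow> 'b) \<Rightarrow> real) \<Rightarrow> real" where
  "dual_norm X N F = (SUP v\<in>{v \<in> X. N v \<le> 1}. \<bar>F v\<bar>)"

text \<open>Bochner measurability: almost everywhere the limit in the norm \<open>N\<close> of simple
  functions with values in \<open>X\<close>.\<close>

definition strongly_measurable :: "real \<Rightarrow> ('a \<Rightarrow> 'b::real_normed_vector) set \<Rightarrow>
    (('a \<Rightarrow> 'b) \<Rightarrow> real) \<Rightarrow> (real \<Rightarrow> 'a \<Rightarrow> 'b) \<Rightarrow> bool" where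
  "strongly_measurable T X N u \<longleftrightarrow> (AE t in lebesgue_on {0<..<T}. u t \<in> X) \<and>
     (\<exists>s. (\<forall>n. simple_function (lebesgue_on {0<..<T}) (s n) \<and> s n ` {0<..<T} \<subseteq> X) \<and>
        (AE t in lebesgue_on {0<..<T}. (\<lambda>n. N (\<lambda>x. u t x - s n t x)) \<longlonglongrightarrow> 0))"

definition L2_time :: "real \<Rightarrow> ('a \<Rightarrow> 'b::real_normed_vector) set \<Rightarrow>
    (('a \<Rightarrow> 'b) \<Rightarrow> real) \<Rightarrow> (real \<Rightarrow> 'a \<Rightarrow> 'b) set" where
  "L2_time T X N = {u. strongly_measurable T X N u \<and>
     integrable (lebesgue_on {0<..<T}) (\<lambda>t. (N (u t))\<^sup>2)}"

definition Linf_time :: "real \<Rightarrow> ('a \<Rightarrow> 'b::real_normed_vector) set \<Rightarrow>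
    (('a \<Rightarrow> 'b) \<Rightarrow> real) \<Rightarrow> (real \<Rightarrow> 'a \<Rightarrow> 'b) set" where
  "Linf_time T X N = {u. strongly_measurable T X N u \<and>
     (\<exists>C. AE t in lebesgue_on {0<..<T}. N (u t) \<le> C)}"

type_synonym vfield = "real^2 \<Rightarrow> real^3"

definition div_L :: "real \<Rightarrow> real \<Rightarrow> vfield \<Rightarrow> real^2 \<Rightarrow> real" where
  "div_L a1 a2 \<phi> x = partial (axis 1 1) \<phi> x $ 1 + partial (axis 2 1) \<phi> x $ 2
     - 1/2 * (inverse a1 * partial (axis 1 1) \<phi> x $ 3 + inverse a2 * partial (axis 2 1) \<phi> x $ 3)"

definition div_free_tests :: "real \<Rightarrow> real \<Rightarrow> (real^2) set \<Rightarrow> vfield set" where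
  "div_free_tests a1 a2 G = {\<phi> \<in> test_functions G. \<forall>x\<in>G. div_L a1 a2 \<phi> x = 0}"

definition V_space :: "real \<Rightarrow> real \<Rightarrow> (real^2) set \<Rightarrow> vfield set" where
  "V_space a1 a2 G = closure_in (W12_0 G) (W12_norm G) (div_free_tests a1 a2 G)"

definition H_space :: "real \<Rightarrow> real \<Rightarrow> (real^2) set \<Rightarrow> vfield set" where
  "H_space a1 a2 G = closure_in (L2 G) (L2_norm G) (div_free_tests a1 a2 G)"

definition L2_V_dual :: "real \<Rightarrow> real \<Rightarrow> real \<Rightarrow> (real^2) set \<Rightarrow> (real \<Rightarrow> vfield \<Rightarrow> real) set" where
  "L2_V_dual T a1 a2 G = L2_time T (dual_space (V_space a1 a2 G) (W12_norm G))
                                   (dual_norm (V_space a1 a2 G) (W12_norm G))"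

text \<open>The derivative \<open>w'\<close> is the distributional one, in \<open>V\<^sup>*\<close>, of \<open>w\<close> regarded as a
  \<open>V\<^sup>*\<close>-valued function through \<open>v \<mapsto> \<langle>w t, v\<rangle>\<close>; the identity defining it is an equality of
  functionals and is written out by evaluating both sides at \<open>v\<close>.\<close>

definition VQ_space :: "real \<Rightarrow> real \<Rightarrow> real \<Rightarrow> (real^2) set \<Rightarrow> (real \<Rightarrow> vfield) set" where
  "VQ_space T a1 a2 G =
     {w \<in> L2_time T (V_space a1 a2 G) (W12_norm G) \<inter> Linf_time T (H_space a1 a2 G) (L2_norm G).
        \<exists>w'\<in>L2_V_dual T a1 a2 G. \<forall>v\<in>V_space a1 a2 G.
          has_weak_partial {0<..<T} 1 (\<lambda>t. L2_pairing G (w t) v) (\<lambda>t. w' t v)}"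

text \<open>The functional \<open>v \<mapsto> \<langle>\<partial>\<^sub>e g, v\<rangle>\<close> on \<open>W12_0 G\<close> that extends the distributional derivative
  of a square integrable \<open>g\<close>.\<close>

definition dual_partial :: "(real^2) set \<Rightarrow> real^2 \<Rightarrow> vfield \<Rightarrow> vfield \<Rightarrow> real" where
  "dual_partial G e g v = - L2_pairing G g (weak_partial G e v)"

definition E_op :: "real \<Rightarrow> real \<Rightarrow> (real^2) set \<Rightarrow> vfield \<Rightarrow> vfield" where
  "E_op a1 a2 G w = (\<lambda>x. inverse a1 *\<^sub>R weak_partial G (axis 1 1) w x
                        + inverse a2 *\<^sub>R weak_partial G (axis 2 1) w x)"

text \<open>\<open>A1 a1 a2 G u v\<close> is \<open>\<langle>A\<^sub>1 u, v\<rangle>\<close>: in each second order term the inner derivative of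
  \<open>u \<in> W12 G\<close> is a square integrable function, the outer one a functional.\<close>

definition A1 :: "real \<Rightarrow> real \<Rightarrow> (real^2) set \<Rightarrow> vfield \<Rightarrow> vfield \<Rightarrow> real" where
  "A1 a1 a2 G u v =
     dual_partial G (axis 1 1) (weak_partial G (axis 1 1) u) v
   + dual_partial G (axis 2 1) (weak_partial G (axis 2 1) u) v
   + 1/4 * (inverse a1 * dual_partial G (axis 1 1) (E_op a1 a2 G u) v
          + inverse a2 * dual_partial G (axis 2 1) (E_op a1 a2 G u) v)"

definition B1 :: "real \<Rightarrow> real \<Rightarrow> (real^2) set \<Rightarrow> vfield \<Rightarrow> vfield \<Rightarrow> vfield" where
  "B1 a1 a2 G u w = (\<lambda>x. (u x $ 1) *\<^sub>R weak_partial G (axis 1 1) w x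
                        + (u x $ 2) *\<^sub>R weak_partial G (axis 2 1) w x
                        - (1/2 * u x $ 3) *\<^sub>R E_op a1 a2 G w x)"

text \<open>As \<open>u\<close> is only determined for almost every time, \<open>d/dt \<langle>u, v\<rangle>\<close> is the distributional
  derivative \<open>h\<close>, and the value at \<open>t = 0\<close> is that of the continuous representative \<open>q\<close> of
  \<open>t \<mapsto> \<langle>u t, v\<rangle>\<close>, whose existence is part of the definition. The divergence constraint and
  the zero boundary values are contained in the membership in \<open>VQ_space\<close>.\<close>

definition weak_solution :: "real \<Rightarrow> real \<Rightarrow> real \<Rightarrow> real \<Rightarrow> (real^2) set \<Rightarrow>
    (real \<Rightarrow> vfield \<Rightarrow> real) \<Rightarrow> vfield \<Rightarrow> (real \<Rightarrow> vfield) \<Rightarrow> bool" where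
  "weak_solution T \<nu> a1 a2 G f u0 u \<longleftrightarrow> u \<in> VQ_space T a1 a2 G \<and>
     (\<forall>v\<in>V_space a1 a2 G. \<exists>h. has_weak_partial {0<..<T} 1 (\<lambda>t. L2_pairing G (u t) v) h \<and>
        (AE t in lebesgue_on {0<..<T}.
           h t - \<nu> * A1 a1 a2 G (u t) v + L2_pairing G (B1 a1 a2 G (u t) (u t)) v = f t v)) \<and>
     (\<forall>v\<in>H_space a1 a2 G. \<exists>q. continuous_on {0..T} q \<and>
        (AE t in lebesgue_on {0<..<T}. q t = L2_pairing G (u t) v) \<and>
        q 0 = L2_pairing G u0 v)"

end

theory Submission
  imports Defs "HOL-Library.Function_Algebras" "HOL-Complex_Analysis.Great_Picard"
    "HOL-Computational_Algebra.Polynomial"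
begin

text \<open>The problem has the abstract form \<open>u' + a(u, _) + b(u, u, _) = f\<close> in \<open>V\<^sup>*\<close> with \<open>a\<close> coercive
  and \<open>b\<close> skew in its last two arguments. It is discretised in time by the implicit Euler scheme in
  which the advecting field is taken from the previous step: each step is then a linear problem solved
  by Lax-Milgram, and skewness gives the energy estimate. The approximations tested with a fixed element
  of \<open>V\<close> are equicontinuous in time, so a diagonal argument and Ehrling's inequality on the span of the
  countably many values of the scheme (from the compactness of \<open>V\<close> in \<open>H\<close>) give convergence in
  \<open>L\<^sup>2(0,T;H)\<close>; convex combinations converge strongly in \<open>L\<^sup>2(0,T;V)\<close>. Against solenoidal test
  functions all derivatives can be moved off the unknown, so the equation passes to the limit, and
  density extends it to \<open>V\<close>.

  On \<open>\<Omega>\<^sub>L\<close> the form \<open>b\<close> is skew since the transport velocity, with components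
  \<open>u\<^sub>1 - u\<^sub>3 / (2 a\<^sub>1)\<close> and \<open>u\<^sub>2 - u\<^sub>3 / (2 a\<^sub>2)\<close>, is divergence free, and it is bounded by
  Ladyzhenskaya's inequality because the domain is planar; coercivity is Poincare's inequality and
  compactness is Rellich's theorem.\<close>

section \<open>Semi-inner product spaces\<close>

text \<open>Elements of Lebesgue and Sobolev spaces are representatives with seminorms, so the
  Hilbert space theory is set up for semidefinite forms on subspaces of one function type. Limits
  are then determined only up to null elements, and equations are obtained by testing. The obstacle
  is to get, from bounds alone, a limit that is strongly measurable in \<open>V\<close>. Almost
  norm-minimal convex combinations of the tails converge strongly in L2(0,T;V). The approximations
  themselves converge in L2(0,T;H), and convexity of balls identifies the two limits. The lagged
  advecting field produces a second step function \<open>wn\<close>; the squared jumps kept in the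
  energy inequality force it to the limit of \<open>un\<close>. The planar bound of b by geometric
  means of H- and V-norms has a second use besides continuity: combined with the uniform H-bound it
  makes b(u,u,.) square integrable in time with values in the dual of \<open>V\<close>. This gives
  the modulus in time that is uniform in the step size, and the integrability of u'.\<close>

instantiation "fun" :: (type, real_vector) real_vector
begin

definition "scaleR c f = (\<lambda>x. c *\<^sub>R f x)"

instance
  by standard (simp_all add: scaleR_fun_def fun_eq_iff scaleR_add_right scaleR_add_left)

end

lemma scaleR_fun_apply [simp]: "(c *\<^sub>R f) x = c *\<^sub>R f x"
  by (simp add: scaleR_fun_def)

lemma null_squeeze:
  fixes f g :: "nat => real"
  assumes "\<And>n. 0 \<le> f n" "\<And>n. f n \<le> g n" "g \<longlonglongrightarrow> 0" shows "f \<longlonglongrightarrow> 0"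
  by (rule tendsto_sandwich[OF _ _ tendsto_const assms(3)]) (use assms in auto)

lemma inverse_Suc_null: "(\<lambda>n. 1 / real (Suc n)) \<longlonglongrightarrow> 0"
  using LIMSEQ_inverse_real_of_nat by (simp add: inverse_eq_divide)

text \<open>Definiteness is left out because functions that agree almost everywhere are distinct
  elements at distance 0. The carrier is a set, so that \<open>V\<close>, \<open>H\<close> and the
  spaces of step functions in time can be subspaces of existing types, with several forms on the
  same functions.\<close>

locale semi_ip =
  fixes X :: "'a::real_vector set" and ip :: "'a => 'a => real"
  assumes sub: "subspace X"
    and ip_sym: "x \<in> X ==> y \<in> X ==> ip x y = ip y x"
    and ip_add: "x \<in> X ==> y \<in> X ==> z \<in> X ==> ip (x + y) z = ip x z + ip y z"
    and ip_scale: "x \<in> X ==> z \<in> X ==> ip (c *\<^sub>R x) z = c * ip x z"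
    and ip_nonneg: "x \<in> X ==> ip x x \<ge> 0"
begin

definition nrm :: "'a => real" where "nrm x = sqrt (ip x x)"

definition Cauchy_seq :: "(nat => 'a) => bool" where
  "Cauchy_seq x \<longleftrightarrow> (\<forall>e>0. \<exists>N. \<forall>m\<ge>N. \<forall>n\<ge>N. nrm (x m - x n) < e)"

lemma mem [simp]: "0 \<in> X" "x \<in> X ==> y \<in> X ==> x + y \<in> X" "x \<in> X ==> c *\<^sub>R x \<in> X"
  "x \<in> X ==> y \<in> X ==> x - y \<in> X" "x \<in> X ==> - x \<in> X"
  using sub by (auto simp: subspace_0 subspace_add subspace_scale subspace_diff subspace_neg)

lemma ip_add2: "x \<in> X ==> y \<in> X ==> z \<in> X ==> ip z (x + y) = ip z x + ip z y"
  by (metis ip_add ip_sym mem(2))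

lemma ip_scale2: "x \<in> X ==> z \<in> X ==> ip z (c *\<^sub>R x) = c * ip z x"
  by (metis ip_scale ip_sym mem(3))

lemma ip_minus: "x \<in> X ==> z \<in> X ==> ip (- x) z = - ip x z"
  using ip_scale[of x z "-1"] by simp

lemma ip_minus2: "x \<in> X ==> z \<in> X ==> ip z (- x) = - ip z x"
  using ip_scale2[of x z "-1"] by simp

lemma ip_diff: "x \<in> X ==> y \<in> X ==> z \<in> X ==> ip (x - y) z = ip x z - ip y z"
  using ip_add[of x "- y" z] by (simp add: ip_minus)

lemma ip_diff2: "x \<in> X ==> y \<in> X ==> z \<in> X ==> ip z (x - y) = ip z x - ip z y"
  using ip_add2[of x "- y" z] by (simp add: ip_minus2)

lemma ip_zero [simp]: "z \<in> X ==> ip 0 z = 0" "z \<in> X ==> ip z 0 = 0"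
  using ip_scale[of 0 z 0] ip_scale2[of 0 z 0] by simp_all

lemmas ip_simps = ip_add ip_add2 ip_scale ip_scale2 ip_diff ip_diff2 ip_minus ip_minus2

lemma nrm_nonneg: "x \<in> X ==> nrm x \<ge> 0"
  by (simp add: nrm_def ip_nonneg)

lemma nrm_sq: "x \<in> X ==> (nrm x)^2 = ip x x"
  by (simp add: nrm_def ip_nonneg)

lemma nrm_zero [simp]: "nrm 0 = 0"
  by (simp add: nrm_def)

lemma nrm_scale: "x \<in> X ==> nrm (c *\<^sub>R x) = \<bar>c\<bar> * nrm x"
  by (simp add: nrm_def ip_simps real_sqrt_mult mult.assoc[symmetric])

lemma nrm_minus: "x \<in> X ==> nrm (- x) = nrm x"
  using nrm_scale[of x "-1"] by simp

lemma nrm_diff_sym: "x \<in> X ==> y \<in> X ==> nrm (x - y) = nrm (y - x)"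
  using nrm_minus[of "x - y"] by simp

lemma nrm_add_sq: "x \<in> X ==> y \<in> X ==> (nrm (x + y))^2 = (nrm x)^2 + 2 * ip x y + (nrm y)^2"
  by (simp add: nrm_sq ip_simps ip_sym[of y x])

lemma nrm_diff_sq: "x \<in> X ==> y \<in> X ==> (nrm (x - y))^2 = (nrm x)^2 - 2 * ip x y + (nrm y)^2"
  by (simp add: nrm_sq ip_simps ip_sym[of y x])

text \<open>The form at x - t y is nonnegative for the optimal t. For null y there is no optimal t:
  the expression is affine in t and bounded below only if its slope vanishes.\<close>

lemma CS: assumes "x \<in> X" "y \<in> X" shows "\<bar>ip x y\<bar> \<le> nrm x * nrm y"
proof -
  have q: "0 \<le> ip x x - 2 * t * ip x y + t^2 * ip y y" for t
    using ip_nonneg[of "x - t *\<^sub>R y"] assms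
    by (simp add: ip_simps ip_sym[of y x] power2_eq_square algebra_simps)
  have "(ip x y)^2 \<le> ip x x * ip y y"
  proof (cases "ip y y = 0")
    case True
    have "ip x y = 0"
    proof (rule ccontr)
      assume n: "ip x y \<noteq> 0"
      \<comment> \<open>At this t the affine function takes the value -1.\<close>
      show False using q[of "(ip x x + 1) / (2 * ip x y)"] True n by (simp add: field_simps)
    qed
    then show ?thesis using True by simp
  next
    case False
    then have p: "ip y y > 0" using ip_nonneg[of y] assms by simp
    show ?thesis using q[of "ip x y / ip y y"] p
      by (simp add: field_simps power2_eq_square)
  qed
  then have "sqrt ((ip x y)^2) \<le> sqrt (ip x x * ip y y)" by (rule real_sqrt_le_mono)
  then show ?thesis by (simp add: nrm_def real_sqrt_mult)
qed

lemma CS': "x \<in> X ==> y \<in> X ==> ip x y \<le> nrm x * nrm y"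
  using CS by (metis abs_le_D1)

lemma nrm_triangle: assumes "x \<in> X" "y \<in> X" shows "nrm (x + y) \<le> nrm x + nrm y"
proof (rule power2_le_imp_le)
  show "(nrm (x + y))^2 \<le> (nrm x + nrm y)^2"
    using CS'[OF assms] by (simp add: nrm_add_sq assms power2_sum)
qed (simp add: nrm_nonneg assms)

lemma nrm_triangle_diff: "x \<in> X ==> y \<in> X ==> nrm (x - y) \<le> nrm x + nrm y"
  using nrm_triangle[of x "- y"] by (simp add: nrm_minus)

lemma nrm_triangle3: "x \<in> X ==> y \<in> X ==> z \<in> X ==> nrm (x - z) \<le> nrm (x - y) + nrm (y - z)"
  using nrm_triangle[of "x - y" "y - z"] by simp

lemma nrm_triangle_rev: assumes "x \<in> X" "y \<in> X" shows "\<bar>nrm x - nrm y\<bar> \<le> nrm (x - y)"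
  using nrm_triangle[of "x - y" y] nrm_triangle[of "y - x" x] nrm_diff_sym[OF assms] assms
  by auto

lemma nrm_convex:
  assumes "x \<in> X" "y \<in> X" "nrm x \<le> e" "nrm y \<le> e" "0 \<le> c" "0 \<le> d" "c + d = 1"
  shows "nrm (c *\<^sub>R x + d *\<^sub>R y) \<le> e"
proof -
  have "nrm (c *\<^sub>R x + d *\<^sub>R y) \<le> c * nrm x + d * nrm y"
    using nrm_triangle[of "c *\<^sub>R x" "d *\<^sub>R y"] assms by (simp add: nrm_scale)
  also have "\<dots> \<le> c * e + d * e" using assms by (intro add_mono mult_left_mono)
  also have "\<dots> = e" using assms by (metis distrib_right mult_1)
  finally show ?thesis .
qed

lemma parallelogram:
  "x \<in> X ==> y \<in> X ==> (nrm (x - y))^2 = 2 * (nrm x)^2 + 2 * (nrm y)^2 - (nrm (x + y))^2"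
  by (simp add: nrm_add_sq nrm_diff_sq)

lemma nrm_sum_sq_le: "x \<in> X ==> y \<in> X ==> (nrm (x + y))^2 \<le> 2 * (nrm x)^2 + 2 * (nrm y)^2"
  using parallelogram[of x y] by (metis diff_add_cancel le_add_same_cancel2 zero_le_power2 add.commute)

lemma tendsto_nrm:
  assumes "\<And>n. x n \<in> X" "y \<in> X" "(\<lambda>n. nrm (x n - y)) \<longlonglongrightarrow> 0"
  shows "(\<lambda>n. nrm (x n)) \<longlonglongrightarrow> nrm y"
proof -
  have "(\<lambda>n. nrm (x n) - nrm y) \<longlonglongrightarrow> 0"
    by (rule Lim_null_comparison[OF _ assms(3)]) (auto intro!: always_eventually nrm_triangle_rev assms)
  then show ?thesis by (simp add: LIM_zero_iff)
qed

lemma tendsto_ip: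
  assumes "\<And>n. x n \<in> X" "y \<in> X" "z \<in> X" "(\<lambda>n. nrm (x n - y)) \<longlonglongrightarrow> 0"
  shows "(\<lambda>n. ip (x n) z) \<longlonglongrightarrow> ip y z"
proof -
  have "(\<lambda>n. ip (x n) z - ip y z) \<longlonglongrightarrow> 0"
  proof (rule Lim_null_comparison)
    show "\<forall>\<^sub>F n in sequentially. norm (ip (x n) z - ip y z) \<le> nrm (x n - y) * nrm z"
      using CS[of "x _ - y" z] assms by (auto intro!: always_eventually simp: ip_simps)
    show "(\<lambda>n. nrm (x n - y) * nrm z) \<longlonglongrightarrow> 0"
      using tendsto_mult_left_zero[OF assms(4)] .
  qed
  then show ?thesis by (simp add: LIM_zero_iff)
qed

lemma Cauchy_geometric:
  assumes x: "\<And>n. x n \<in> X" and q: "0 \<le> q" "q < 1"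
    and d: "\<And>n. nrm (x (Suc n) - x n) \<le> c * q ^ n"
  shows "Cauchy_seq x"
proof -
  have c: "c \<ge> 0" using d[of 0] nrm_nonneg[of "x 1 - x 0"] x by simp
  \<comment> \<open>The exact geometric sum, rather than its bound, makes the induction over k
    close.\<close>
  have "nrm (x (n + k) - x n) \<le> c * q ^ n * (1 - q ^ k) / (1 - q)" for n k
  proof (induction k)
    case (Suc k)
    have "nrm (x (n + Suc k) - x n) \<le> nrm (x (Suc (n + k)) - x (n + k)) + nrm (x (n + k) - x n)"
      using nrm_triangle3[OF x x x] by simp
    also have "\<dots> \<le> c * q ^ (n + k) + c * q ^ n * (1 - q ^ k) / (1 - q)"
      using d Suc by (intro add_mono) auto
    also have "\<dots> = c * q ^ n * (1 - q ^ Suc k) / (1 - q)"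
      using q by (simp add: field_simps power_add)
    finally show ?case .
  qed simp
  then have b: "nrm (x (n + k) - x n) \<le> c / (1 - q) * q ^ n" for n k
  proof -
    have "c * q ^ n * (1 - q ^ k) / (1 - q) \<le> c * q ^ n * 1 / (1 - q)"
      using q c by (intro divide_right_mono mult_left_mono) auto
    then show ?thesis using \<open>nrm (x (n + k) - x n) \<le> _\<close> by (simp add: field_simps)
  qed
  have t: "(\<lambda>n. 2 * (c / (1 - q) * q ^ n)) \<longlonglongrightarrow> 0"
    using q by (auto intro!: tendsto_mult_right_zero LIMSEQ_realpow_zero)
  show ?thesis unfolding Cauchy_seq_def
  proof (intro allI impI)
    fix e :: real assume "e > 0"
    then obtain N where N: "2 * (c / (1 - q) * q ^ N) < e"
      using order_tendstoD(2)[OF t, of e] by (auto simp: eventually_sequentially)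
    have "nrm (x m - x n) < e" if "m \<ge> N" "n \<ge> N" for m n
      using b[of N "m - N"] b[of N "n - N"] nrm_triangle3[of "x m" "x N" "x n"] that N x
        nrm_diff_sym[of "x N" "x n"] by auto
    then show "\<exists>N. \<forall>m\<ge>N. \<forall>n\<ge>N. nrm (x m - x n) < e" by blast
  qed
qed

text \<open>The Cauchy property is the parallelogram identity for almost minimal elements.\<close>

lemma minimising_sequence:
  assumes C: "\<And>m. C m \<subseteq> X" "\<And>m. convex (C m)" "\<And>m. C (Suc m) \<subseteq> C m"
    and z: "\<And>m. z m \<in> C m" "\<And>m. nrm (z m) \<le> K"
  obtains y where "\<And>m. y m \<in> C m" "Cauchy_seq y"
    "\<And>m x. x \<in> C m ==> nrm (y m) \<le> nrm x + 1 / Suc m"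
proof -
  define d where "d m = Inf (nrm ` C m)" for m
  have bb: "bdd_below (nrm ` C m)" for m
    using C(1) nrm_nonneg by (intro bdd_belowI[of _ 0]) auto
  have ne: "nrm ` C m \<noteq> {}" for m using z by auto
  have dle: "d m \<le> nrm x" if "x \<in> C m" for x m
    unfolding d_def using bb that by (intro cInf_lower) auto
  have "\<exists>y\<in>C m. nrm y < d m + 1 / Suc m" for m
    using cInf_lessD[OF ne[of m], of "d m + 1 / Suc m"] unfolding d_def by auto
  then obtain y where y: "\<And>m. y m \<in> C m" "\<And>m. nrm (y m) < d m + 1 / Suc m" by metis
  have dec: "C n \<subseteq> C m" if "m \<le> n" for m n
    using that C(3) by (rule lift_Suc_antimono_le[rotated])
  have inc: "incseq d"
    unfolding incseq_def d_def using dec bb ne by (auto intro!: cInf_superset_mono)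
  have dK: "d m \<le> K" for m using dle[OF z(1)] z(2) by (meson order_trans)
  have d0: "0 \<le> d m" for m unfolding d_def using C(1) nrm_nonneg ne by (intro cInf_greatest) auto
  have K0: "0 \<le> K" using d0 dK order_trans by blast
  \<comment> \<open>The sets shrink, so the infima d m of the norms increase; the bound K on the z m
    makes them converge.\<close>
  obtain l where l: "d \<longlonglongrightarrow> l" "\<And>m. d m \<le> l"
    using incseq_convergent[OF inc] dK by metis
  have est: "(nrm (y m - y n))^2 \<le> 4 * ((l + 1 / Suc m)^2 - (d m)^2)" if mn: "m \<le> n" for m n
  proof -
    have yX: "y m \<in> X" "y n \<in> X" using y C by auto
    have "y n \<in> C m" using y dec[OF mn] by auto
    \<comment> \<open>Nestedness puts y n into C m as well, so the midpoint of y m and y n has norm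
      at least d m, while both norms exceed the limit l by at most 1 / (m + 1).\<close>
    then have "(1/2) *\<^sub>R y m + (1/2) *\<^sub>R y n \<in> C m"
      using C(2)[of m] y(1)[of m] by (auto simp: convex_def)
    then have "d m \<le> nrm ((1/2) *\<^sub>R (y m + y n))" using dle by (simp add: scaleR_add_right)
    then have "2 * d m \<le> nrm (y m + y n)" using yX by (simp add: nrm_scale)
    then have a: "4 * (d m)^2 \<le> (nrm (y m + y n))^2"
      using power_mono[of "2 * d m" _ 2] d0[of m] by (simp add: power_mult_distrib)
    have "nrm (y m) \<le> l + 1 / Suc m" using y(2)[of m] l(2)[of m] by simp
    then have b: "(nrm (y m))^2 \<le> (l + 1 / Suc m)^2" using yX nrm_nonneg by (intro power_mono) auto
    have "1 / real (Suc n) \<le> 1 / Suc m" using mn by (simp add: frac_le)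
    then have "nrm (y n) \<le> l + 1 / Suc m" using y(2)[of n] l(2)[of n] by linarith
    then have c: "(nrm (y n))^2 \<le> (l + 1 / Suc m)^2" using yX nrm_nonneg by (intro power_mono) auto
    show ?thesis using parallelogram[OF yX] a b c by simp
  qed
  have "(\<lambda>m. 4 * ((l + 1 / Suc m)^2 - (d m)^2)) \<longlonglongrightarrow> 4 * ((l + 0)^2 - l^2)"
    using LIMSEQ_inverse_real_of_nat by (intro tendsto_intros l) (simp add: inverse_eq_divide)
  then have lim: "(\<lambda>m. 4 * ((l + 1 / Suc m)^2 - (d m)^2)) \<longlonglongrightarrow> 0" by simp
  have "Cauchy_seq y" unfolding Cauchy_seq_def
  proof (intro allI impI)
    fix e :: real assume e: "e > 0"
    then obtain N where N: "\<And>m. m \<ge> N ==> 4 * ((l + 1 / Suc m)^2 - (d m)^2) < e^2"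
      using order_tendstoD(2)[OF lim, of "e^2"] by (auto simp: eventually_sequentially)
    have *: "nrm (y m - y n) < e" if "m \<ge> N" "m \<le> n" for m n
      using est[OF that(2)] N[OF that(1)] e by (intro power2_less_imp_less[of _ e]) auto
    have "nrm (y m - y n) < e" if "m \<ge> N" "n \<ge> N" for m n
    proof (cases "m \<le> n")
      case False
      moreover have "y m \<in> X" "y n \<in> X" using y(1) C(1) by auto
      ultimately show ?thesis using *[of n m] that nrm_diff_sym[of "y m" "y n"] by simp
    qed (use * that in auto)
    then show "\<exists>N. \<forall>m\<ge>N. \<forall>n\<ge>N. nrm (y m - y n) < e" by blast
  qed
  moreover have "nrm (y m) \<le> nrm x + 1 / Suc m" if "x \<in> C m" for x m
    using y(2)[of m] dle[OF that] by simp
  ultimately show ?thesis using that y(1) by blast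
qed

text \<open>Replaces the extraction of a weakly convergent subsequence followed by Mazur's lemma: y
  m has almost minimal norm in the hull of the m-th tail. Membership in that hull later transfers
  convex properties of the tails to y.\<close>

lemma convex_combinations_Cauchy:
  assumes x: "\<And>n. x n \<in> X" "\<And>n. nrm (x n) \<le> K"
  obtains y where "\<And>m. y m \<in> convex hull (x ` {m..})" "Cauchy_seq y"
proof -
  have "x ` {m..} \<subseteq> X" for m using x by auto
  then have X: "convex hull (x ` {m..}) \<subseteq> X" for m
    using subspace_imp_convex[OF sub] by (simp add: hull_minimal)
  have dec: "convex hull x ` {Suc m..} \<subseteq> convex hull x ` {m..}" for m
    by (intro hull_mono image_mono) auto
  have xm: "x m \<in> convex hull x ` {m..}" for m by (intro hull_inc) auto
  obtain y where "\<And>m. y m \<in> convex hull (x ` {m..})" "Cauchy_seq y"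
    by (rule minimising_sequence[of "\<lambda>m. convex hull (x ` {m..})" x K])
      (use X x dec xm in \<open>auto\<close>)
  then show ?thesis by (rule that)
qed

end

section \<open>Riesz representation and the Lax-Milgram theorem\<close>

locale semi_hilbert = semi_ip +
  assumes complete: "(\<And>n. x n \<in> X) ==> Cauchy_seq x ==> \<exists>y\<in>X. (\<lambda>n. nrm (x n - y)) \<longlonglongrightarrow> 0"
begin

text \<open>An element w of minimal norm on the hyperplane \<phi> = 1 is orthogonal to the kernel of
  \<phi>, and w divided by \<open>ip w w\<close> represents \<phi>. Minimality comes from
  \<open>minimising_sequence\<close> with a constant family of sets.\<close>

lemma riesz:
  assumes add: "\<And>x y. x \<in> X ==> y \<in> X ==> \<phi> (x + y) = \<phi> x + \<phi> y"
    and scale: "\<And>c x. x \<in> X ==> \<phi> (c *\<^sub>R x) = c * \<phi> x"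
    and bound: "\<And>x. x \<in> X ==> \<bar>\<phi> x\<bar> \<le> K * nrm x"
  shows "\<exists>r\<in>X. \<forall>v\<in>X. ip r v = \<phi> v"
proof (cases "\<forall>v\<in>X. \<phi> v = 0")
  case True
  then show ?thesis by (auto intro!: bexI[of _ 0])
next
  case False
  then obtain v0 where v0: "v0 \<in> X" "\<phi> v0 \<noteq> 0" by auto
  have diff: "\<phi> (x - y) = \<phi> x - \<phi> y" if "x \<in> X" "y \<in> X" for x y
    using add[of x "(-1) *\<^sub>R y"] scale[of y "-1"] that by simp
  define z where "z = (1 / \<phi> v0) *\<^sub>R v0"
  define C where "C = {x \<in> X. \<phi> x = 1}"
  have z: "z \<in> C" using v0 by (simp add: C_def z_def scale)
  have conv: "convex C" unfolding convex_def C_def using add scale by auto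
  obtain y where y: "\<And>m. y m \<in> C" "Cauchy_seq y"
      "\<And>m x. x \<in> C ==> nrm (y m) \<le> nrm x + 1 / Suc m"
    by (rule minimising_sequence[of "\<lambda>_. C" "\<lambda>_. z" "nrm z"]) (use z conv in \<open>auto simp: C_def\<close>)
  have yX: "y m \<in> X" for m using y(1) by (simp add: C_def)
  obtain w where w: "w \<in> X" "(\<lambda>n. nrm (y n - w)) \<longlonglongrightarrow> 0"
    using complete[OF yX y(2)] by blast
  have "(\<lambda>n. \<phi> (y n) - \<phi> w) \<longlonglongrightarrow> 0"
  proof (rule Lim_null_comparison)
    show "\<forall>\<^sub>F n in sequentially. norm (\<phi> (y n) - \<phi> w) \<le> K * nrm (y n - w)"
      using bound[of "y _ - w"] yX w diff by (auto intro!: always_eventually)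
    show "(\<lambda>n. K * nrm (y n - w)) \<longlonglongrightarrow> 0" using tendsto_mult_right_zero[OF w(2)] .
  qed
  then have wC: "\<phi> w = 1" using y(1) by (auto simp: C_def LIMSEQ_const_iff)
  have min: "nrm w \<le> nrm x" if "x \<in> C" for x
  proof (rule LIMSEQ_le)
    show "(\<lambda>n. nrm (y n)) \<longlonglongrightarrow> nrm w" by (rule tendsto_nrm[OF yX w])
    have "(\<lambda>n. nrm x + 1 / Suc n) \<longlonglongrightarrow> nrm x + 0"
      using LIMSEQ_inverse_real_of_nat by (intro tendsto_intros) (simp add: inverse_eq_divide)
    then show "(\<lambda>n. nrm x + 1 / Suc n) \<longlonglongrightarrow> nrm x" by simp
    show "\<exists>N. \<forall>n\<ge>N. nrm (y n) \<le> nrm x + 1 / Suc n" using y(3)[OF that] by blast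
  qed
  have orth: "ip w v = 0" if v: "v \<in> X" "\<phi> v = 0" for v
  proof (rule ccontr)
    assume n: "ip w v \<noteq> 0"
    have q: "0 \<le> 2 * t * ip w v + t^2 * ip v v" for t
    proof -
      have "w + t *\<^sub>R v \<in> C" using w wC v by (simp add: C_def add scale)
      then have "nrm w \<le> nrm (w + t *\<^sub>R v)" by (rule min)
      then have "(nrm w)^2 \<le> (nrm (w + t *\<^sub>R v))^2" using w nrm_nonneg by (intro power_mono) auto
      then have "ip w w \<le> ip w w + (2 * t * ip w v + t * t * ip v v)"
        using w v by (simp add: nrm_sq ip_simps ip_sym[of v w] algebra_simps)
      then show ?thesis by (simp add: power2_eq_square)
    qed
    have pos: "ip v v + 1 > 0" using ip_nonneg[OF v(1)] by simp
    \<comment> \<open>Up to sign and the added 1 this is the optimal step from w in the direction v;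
      the 1 keeps the denominator positive when v is null.\<close>
    define s where "s = ip w v / (ip v v + 1)"
    have s: "ip w v = s * (ip v v + 1)" "s \<noteq> 0" using pos n by (auto simp: s_def)
    have "0 \<le> 2 * (- s) * ip w v + (- s)^2 * ip v v" by (rule q)
    also have "\<dots> = - (s^2 * (ip v v + 2))" by (simp add: s(1) power2_eq_square algebra_simps)
    also have "\<dots> < 0" using s pos by (simp add: zero_less_mult_iff)
    finally show False by simp
  qed
  \<comment> \<open>A null w would give \<phi> w = 0 by boundedness.\<close>
  have "nrm w > 0" using bound[OF w(1)] wC nrm_nonneg[OF w(1)] by (cases "nrm w = 0") auto
  then have p: "ip w w > 0" using nrm_sq[OF w(1)] by (metis zero_less_power)
  have "ip ((1 / ip w w) *\<^sub>R w) v = \<phi> v" if v: "v \<in> X" for v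
  proof -
    have "ip w (v - \<phi> v *\<^sub>R w) = 0" using orth v w wC by (simp add: diff scale)
    then have "ip w v = \<phi> v * ip w w" using v w by (simp add: ip_simps)
    then show ?thesis using p v w by (simp add: ip_simps)
  qed
  then show ?thesis using w by (intro bexI[of _ "(1 / ip w w) *\<^sub>R w"]) auto
qed

text \<open>The form need not be symmetric, so it is not itself an inner product. Riesz turns it
  into an operator A and the functional into r, and the damped iteration along the residual A u - r
  contracts in the seminorm.\<close>

lemma lax_milgram:
  assumes add1: "\<And>x y z. x \<in> X ==> y \<in> X ==> z \<in> X ==> \<beta> (x + y) z = \<beta> x z + \<beta> y z"
    and scale1: "\<And>c x z. x \<in> X ==> z \<in> X ==> \<beta> (c *\<^sub>R x) z = c * \<beta> x z"
    and add2: "\<And>x y z. x \<in> X ==> y \<in> X ==> z \<in> X ==> \<beta> z (x + y) = \<beta> z x + \<beta> z y"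
    and scale2: "\<And>c x z. x \<in> X ==> z \<in> X ==> \<beta> z (c *\<^sub>R x) = c * \<beta> z x"
    and bound: "\<And>x y. x \<in> X ==> y \<in> X ==> \<bar>\<beta> x y\<bar> \<le> K * nrm x * nrm y"
    and coercive: "\<And>x. x \<in> X ==> \<beta> x x \<ge> \<alpha> * (nrm x)^2" and \<alpha>: "\<alpha> > 0"
    and padd: "\<And>x y. x \<in> X ==> y \<in> X ==> \<phi> (x + y) = \<phi> x + \<phi> y"
    and pscale: "\<And>c x. x \<in> X ==> \<phi> (c *\<^sub>R x) = c * \<phi> x"
    and pbound: "\<And>x. x \<in> X ==> \<bar>\<phi> x\<bar> \<le> L * nrm x"
  shows "\<exists>u\<in>X. \<forall>v\<in>X. \<beta> u v = \<phi> v"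
proof -
  \<comment> \<open>The maximum guarantees \<alpha> \<le> M, so that 1 - \<alpha>^2 / M^2 is
    nonnegative and has the real root q.\<close>
  define M where "M = max K \<alpha>"
  have M: "M \<ge> \<alpha>" "M > 0" using \<alpha> by (auto simp: M_def)
  have bM: "\<bar>\<beta> x y\<bar> \<le> M * nrm x * nrm y" if "x \<in> X" "y \<in> X" for x y
    using bound[OF that] mult_right_mono[of K M "nrm x * nrm y"] nrm_nonneg that
    by (fastforce simp: M_def mult.assoc)
  have "\<exists>r\<in>X. \<forall>v\<in>X. ip r v = \<beta> u v" if "u \<in> X" for u
    using that add2 scale2 bM by (intro riesz[where K = "M * nrm u"]) auto
  then obtain A where A: "\<And>u. u \<in> X ==> A u \<in> X" "\<And>u v. u \<in> X ==> v \<in> X ==> ip (A u) v = \<beta> u v"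
    by metis
  obtain r where r: "r \<in> X" "\<And>v. v \<in> X ==> ip r v = \<phi> v"
    using riesz[of \<phi> L, OF padd pscale pbound] by blast
  \<comment> \<open>This value minimises 1 - 2 \<rho> \<alpha> + \<rho>^2 M^2, the bound for the
    square of the contraction factor; the minimum is 1 - \<alpha>^2 / M^2.\<close>
  define \<rho> where "\<rho> = \<alpha> / M^2"
  have \<rho>: "\<rho> > 0" using \<alpha> M by (simp add: \<rho>_def)
  define S where "S u = u - \<rho> *\<^sub>R (A u - r)" for u
  have SX: "S u \<in> X" if "u \<in> X" for u using that A r by (simp add: S_def)
  define q where "q = sqrt (1 - \<alpha>^2 / M^2)"
  have le1: "\<alpha>^2 / M^2 \<le> 1" using M \<alpha> by (simp add: power_mono)
  then have q: "0 \<le> q" "q < 1" using M \<alpha> by (auto simp: q_def)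
  have contr: "nrm (S u - S w) \<le> q * nrm (u - w)" if u: "u \<in> X" and w: "w \<in> X" for u w
  proof (rule power2_le_imp_le)
    define d where "d = u - w"
    define z where "z = A u - A w"
    have X: "d \<in> X" "z \<in> X" using u w A by (auto simp: d_def z_def)
    have \<beta>d: "\<beta> d v = \<beta> u v - \<beta> w v" if "v \<in> X" for v
      using add1[of u "(-1) *\<^sub>R w" v] scale1[of w v "-1"] that u w by (simp add: d_def)
    have z: "ip z v = \<beta> d v" if "v \<in> X" for v using that u w A by (simp add: z_def ip_simps \<beta>d)
    have "S u - S w = d - \<rho> *\<^sub>R z" by (simp add: S_def d_def z_def algebra_simps)
    then have "(nrm (S u - S w))^2 = (nrm d)^2 - 2 * \<rho> * \<beta> d d + \<rho>^2 * (nrm z)^2"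
      using X \<rho> by (simp add: nrm_diff_sq nrm_scale power_mult_distrib ip_simps z ip_sym[of d z])
    moreover have "nrm z \<le> M * nrm d"
    proof (cases "nrm z = 0")
      case True then show ?thesis using M nrm_nonneg[OF X(1)] by simp
    next
      case False
      have "(nrm z)^2 = \<beta> d z" using X z by (simp add: nrm_sq)
      also have "\<dots> \<le> M * nrm d * nrm z" using bM[OF X] by linarith
      finally show ?thesis using False nrm_nonneg[OF X(2)] by (simp add: power2_eq_square)
    qed
    then have "(nrm z)^2 \<le> (M * nrm d)^2"
      using nrm_nonneg[OF X(2)] by (rule power_mono)
    then have "(nrm z)^2 \<le> M^2 * (nrm d)^2" by (simp add: power_mult_distrib)
    then have "\<rho>^2 * (nrm z)^2 \<le> \<rho>^2 * (M^2 * (nrm d)^2)" by (intro mult_left_mono) auto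
    moreover have "2 * \<rho> * \<beta> d d \<ge> 2 * \<rho> * (\<alpha> * (nrm d)^2)"
      using coercive[OF X(1)] \<rho> by (intro mult_left_mono) auto
    ultimately have "(nrm (S u - S w))^2 \<le> (nrm d)^2 - 2 * \<rho> * (\<alpha> * (nrm d)^2) + \<rho>^2 * (M^2 * (nrm d)^2)"
      by linarith
    also have "\<dots> = (1 - \<alpha>^2 / M^2) * (nrm d)^2"
    proof -
      have "\<rho> * \<alpha> = \<alpha>^2 / M^2" "\<rho>^2 * M^2 = \<alpha>^2 / M^2"
        using M by (simp_all add: \<rho>_def power2_eq_square)
      then have "2 * \<rho> * (\<alpha> * (nrm d)^2) = 2 * (\<alpha>^2 / M^2) * (nrm d)^2"
        "\<rho>^2 * (M^2 * (nrm d)^2) = \<alpha>^2 / M^2 * (nrm d)^2"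
        by (metis mult.assoc)+
      then show ?thesis by (simp add: left_diff_distrib)
    qed
    also have "\<dots> = (q * nrm d)^2" using le1 by (simp add: q_def power_mult_distrib)
    finally show "(nrm (S u - S w))^2 \<le> (q * nrm (u - w))^2" by (simp add: d_def)
  qed (use q u w nrm_nonneg in auto)
  define x where "x n = (S ^^ n) 0" for n
  have xX: "x n \<in> X" for n unfolding x_def by (induction n) (auto simp: SX)
  have xS: "x (Suc n) = S (x n)" for n by (simp add: x_def)
  have step: "nrm (x (Suc n) - x n) \<le> nrm (x 1 - x 0) * q ^ n" for n
  proof (induction n)
    case (Suc n)
    have "nrm (x (Suc (Suc n)) - x (Suc n)) \<le> q * nrm (x (Suc n) - x n)"
      using contr[OF xX xX, of "Suc n" n] by (simp add: xS)
    also have "\<dots> \<le> q * (nrm (x 1 - x 0) * q ^ n)" using Suc q by (intro mult_left_mono)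
    finally show ?case by (simp add: algebra_simps)
  qed simp
  have C: "Cauchy_seq x" by (rule Cauchy_geometric[OF xX q step])
  obtain u where u: "u \<in> X" "(\<lambda>n. nrm (x n - u)) \<longlonglongrightarrow> 0" using complete[OF xX C] by blast
  have "\<beta> u v = \<phi> v" if v: "v \<in> X" for v
  proof -
    have "(\<lambda>n. \<beta> (x n) v - \<beta> u v) \<longlonglongrightarrow> 0"
    proof (rule Lim_null_comparison)
      have "\<beta> (x n) v - \<beta> u v = \<beta> (x n - u) v" for n
        using add1[of "x n" "(-1) *\<^sub>R u" v] scale1[of u v "-1"] v u xX by simp
      then show "\<forall>\<^sub>F n in sequentially. norm (\<beta> (x n) v - \<beta> u v) \<le> M * nrm (x n - u) * nrm v"
        using bM[of "x _ - u" v] u v xX by (auto intro!: always_eventually)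
      show "(\<lambda>n. M * nrm (x n - u) * nrm v) \<longlonglongrightarrow> 0"
        using tendsto_mult_left_zero[OF tendsto_mult_right_zero[OF u(2)]] .
    qed
    then have 1: "(\<lambda>n. \<beta> (x n) v) \<longlonglongrightarrow> \<beta> u v" by (simp add: LIM_zero_iff)
    have 2: "(\<lambda>n. ip (x n) v) \<longlonglongrightarrow> ip u v" by (rule tendsto_ip[OF xX u(1) v u(2)])
    \<comment> \<open>A fixed point of S would be available only up to null elements; the limit of
      the tested recursion gives the equation directly.\<close>
    have "ip (x (Suc n)) v = ip (x n) v - \<rho> * (\<beta> (x n) v - \<phi> v)" for n
      using A xX r v by (simp add: xS S_def ip_simps)
    then have "(\<lambda>n. \<rho> * (\<beta> (x n) v - \<phi> v)) = (\<lambda>n. ip (x n) v - ip (x (Suc n)) v)" by simp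
    moreover have "(\<lambda>n. ip (x n) v - ip (x (Suc n)) v) \<longlonglongrightarrow> ip u v - ip u v"
      using 2 LIMSEQ_Suc[OF 2] by (intro tendsto_diff)
    moreover have "(\<lambda>n. \<rho> * (\<beta> (x n) v - \<phi> v)) \<longlonglongrightarrow> \<rho> * (\<beta> u v - \<phi> v)"
      using 1 by (intro tendsto_intros)
    ultimately have "\<rho> * (\<beta> u v - \<phi> v) = 0" using LIMSEQ_unique by fastforce
    then show ?thesis using \<rho> by simp
  qed
  then show ?thesis using u by blast
qed

end

section \<open>Square integrable functions\<close>

text \<open>The bound is asked for large n only, which is what the tail of a Cauchy sequence
  provides.\<close>

lemma Fatou_real:
  fixes f :: "nat => 'a => real"
  assumes f: "\<And>n. integrable M (f n)" "\<And>n x. x \<in> space M ==> 0 \<le> f n x"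
    and g: "g \<in> borel_measurable M" "AE x in M. (\<lambda>n. f n x) \<longlonglongrightarrow> g x"
    and C: "\<And>n. n \<ge> N ==> (\<integral>x. f n x \<partial>M) \<le> C"
  shows "integrable M g" "(\<integral>x. g x \<partial>M) \<le> C"
proof -
  have [measurable]: "\<And>n. f n \<in> borel_measurable M" using f by auto
  have "0 \<le> (\<integral>x. f N x \<partial>M)" using f by (intro Bochner_Integration.integral_nonneg)
  then have C0: "0 \<le> C" using C[of N] by simp
  have gn: "AE x in M. 0 \<le> g x"
    using g(2) AE_space by eventually_elim (use f(2) in \<open>auto intro: LIMSEQ_le_const\<close>)
  have "(\<integral>\<^sup>+x. ennreal (g x) \<partial>M) = (\<integral>\<^sup>+x. liminf (\<lambda>n. ennreal (f n x)) \<partial>M)"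
  proof (rule nn_integral_cong_AE)
    show "AE x in M. ennreal (g x) = liminf (\<lambda>n. ennreal (f n x))"
      using g(2)
    proof eventually_elim
      fix x assume "(\<lambda>n. f n x) \<longlonglongrightarrow> g x"
      then have "(\<lambda>n. ennreal (f n x)) \<longlonglongrightarrow> ennreal (g x)" by (rule tendsto_ennrealI)
      then show "ennreal (g x) = liminf (\<lambda>n. ennreal (f n x))"
        by (simp add: lim_imp_Liminf)
    qed
  qed
  also have "\<dots> \<le> liminf (\<lambda>n. \<integral>\<^sup>+x. ennreal (f n x) \<partial>M)" by (rule nn_integral_liminf) auto
  also have "\<dots> = liminf (\<lambda>n. ennreal (\<integral>x. f n x \<partial>M))"
    using f by (simp add: nn_integral_eq_integral AE_I2)
  also have "\<dots> \<le> limsup (\<lambda>n. ennreal (\<integral>x. f n x \<partial>M))" by (simp add: Liminf_le_Limsup)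
  also have "\<dots> \<le> ennreal C"
    by (rule Limsup_bounded) (use C in \<open>auto simp: eventually_sequentially intro: ennreal_leI\<close>)
  finally have le: "(\<integral>\<^sup>+x. ennreal (g x) \<partial>M) \<le> ennreal C" .
  show i: "integrable M g"
    using le gn g(1) by (intro integrableI_nonneg) (auto simp: order.strict_trans1)
  show "(\<integral>x. g x \<partial>M) \<le> C"
    using le C0 gn i by (simp add: nn_integral_eq_integral)
qed

text \<open>The squares weighted with 4^n still have summable integrals, since 4^n / 16^n = 4^(-n).
  Hence the weighted sum S is finite almost everywhere, and |g n| is at most sqrt S 2^(-n). This is
  the step from norm convergence at a rate to convergence almost everywhere.\<close>

lemma AE_geometric:
  fixes g :: "nat => 'a => real"
  assumes [measurable]: "\<And>n. g n \<in> borel_measurable M"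
    and i: "\<And>n. integrable M (\<lambda>x. (g n x)^2)" "\<And>n. (\<integral>x. (g n x)^2 \<partial>M) \<le> (1/16) ^ n"
  shows "AE x in M. \<exists>C. \<forall>n. \<bar>g n x\<bar> \<le> C * (1/2) ^ n"
proof -
  have "(\<integral>\<^sup>+x. (\<Sum>n. ennreal (4 ^ n * (g n x)^2)) \<partial>M) = (\<Sum>n. \<integral>\<^sup>+x. ennreal (4 ^ n * (g n x)^2) \<partial>M)"
    by (rule nn_integral_suminf) simp
  also have "\<dots> = (\<Sum>n. ennreal (4 ^ n * (\<integral>x. (g n x)^2 \<partial>M)))"
    using i by (simp add: nn_integral_eq_integral)
  also have "\<dots> \<le> (\<Sum>n. ennreal ((1/4) ^ n))"
  proof (intro suminf_le ennreal_leI)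
    fix n show "4 ^ n * (\<integral>x. (g n x)^2 \<partial>M) \<le> (1/4) ^ n"
    proof -
      have "4 ^ n * (\<integral>x. (g n x)^2 \<partial>M) \<le> 4 ^ n * (1/16) ^ n" by (intro mult_left_mono i) auto
      also have "\<dots> = (1/4 :: real) ^ n" unfolding power_mult_distrib[symmetric] by simp
      finally show ?thesis .
    qed
  qed auto
  also have "\<dots> = ennreal (\<Sum>n. (1/4) ^ n)"
    by (intro suminf_ennreal2 summable_geometric) auto
  also have "\<dots> < \<infinity>" by simp
  finally have fin: "(\<integral>\<^sup>+x. (\<Sum>n. ennreal (4 ^ n * (g n x)^2)) \<partial>M) \<noteq> \<infinity>" by simp
  have "AE x in M. (\<Sum>n. ennreal (4 ^ n * (g n x)^2)) \<noteq> \<infinity>"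
    by (rule nn_integral_PInf_AE) (use fin in auto)
  then show ?thesis
  proof eventually_elim
    fix x assume f: "(\<Sum>n. ennreal (4 ^ n * (g n x)^2)) \<noteq> \<infinity>"
    define S where "S = enn2real (\<Sum>n. ennreal (4 ^ n * (g n x)^2))"
    have "\<bar>g n x\<bar> \<le> sqrt S * (1/2) ^ n" for n
    proof -
      have "ennreal (4 ^ n * (g n x)^2) \<le> (\<Sum>n. ennreal (4 ^ n * (g n x)^2))"
      proof -
        have "(\<Sum>i\<in>{n}. ennreal (4 ^ i * (g i x)^2)) \<le> (\<Sum>i. ennreal (4 ^ i * (g i x)^2))"
          by (rule sum_le_suminf) auto
        then show ?thesis by simp
      qed
      also have "\<dots> = ennreal S" using f by (simp add: S_def less_top)
      finally have "4 ^ n * (g n x)^2 \<le> S" by (simp add: S_def)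
      then have "sqrt (4 ^ n * (g n x)^2) \<le> sqrt S" by (rule real_sqrt_le_mono)
      moreover have "sqrt (4 ^ n) = 2 ^ n" by (simp add: real_sqrt_power)
      ultimately have "2 ^ n * \<bar>g n x\<bar> \<le> sqrt S" by (simp add: real_sqrt_mult)
      then show ?thesis by (simp add: power_divide field_simps)
    qed
    then show "\<exists>C. \<forall>n. \<bar>g n x\<bar> \<le> C * (1/2) ^ n" by blast
  qed
qed

context semi_ip
begin

lemma Cauchy_subseq_rate:
  assumes "Cauchy_seq x" "0 < (c::real)"
  obtains r :: "nat => nat" where "strict_mono r" "\<And>n. nrm (x (r (Suc n)) - x (r n)) \<le> c ^ n"
proof -
  have "\<forall>n. \<exists>N. \<forall>m\<ge>N. \<forall>k\<ge>N. nrm (x m - x k) < c ^ n"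
    using assms unfolding Cauchy_seq_def by simp
  then obtain N where N: "\<And>n m k. m \<ge> N n ==> k \<ge> N n ==> nrm (x m - x k) < c ^ n" by metis
  \<comment> \<open>The sum dominates N n, and adding n makes r strictly increasing.\<close>
  define r where "r n = (\<Sum>i\<le>n. N i) + n" for n
  have "strict_mono r" by (rule strict_monoI_Suc) (simp add: r_def)
  moreover have "r n \<ge> N n" for n
    using member_le_sum[of n "{..n}" N] by (simp add: r_def)
  moreover have "r (Suc n) \<ge> r n" for n by (simp add: r_def)
  ultimately have "r (Suc n) \<ge> N n" "r n \<ge> N n" for n
    using le_trans by blast+
  then have "nrm (x (r (Suc n)) - x (r n)) \<le> c ^ n" for n
    using N less_imp_le by blast
  with \<open>strict_mono r\<close> show ?thesis using that by blast
qed

lemma Cauchy_seq_subseq: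
  assumes "Cauchy_seq x" "strict_mono (r :: nat => nat)" shows "Cauchy_seq (x \<circ> r)"
  unfolding Cauchy_seq_def comp_def
proof (intro allI impI)
  fix e :: real assume "e > 0"
  then obtain N where "\<And>m n. m \<ge> N ==> n \<ge> N ==> nrm (x m - x n) < e"
    using assms(1) unfolding Cauchy_seq_def by blast
  then show "\<exists>N. \<forall>m\<ge>N. \<forall>n\<ge>N. nrm (x (r m) - x (r n)) < e"
    using seq_suble[OF assms(2)] le_trans by blast
qed

end

definition square_integrable :: "'a measure => ('a => 'b::euclidean_space) set" where
  "square_integrable M = {u \<in> borel_measurable M. integrable M (\<lambda>x. (norm (u x))^2)}"

definition inner_integral :: "'a measure => ('a => 'b::euclidean_space) => ('a => 'b) => real" where
  "inner_integral M u v = (\<integral>x. u x \<bullet> v x \<partial>M)"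

lemma integrable_inner_square_integrable:
  assumes "u \<in> square_integrable M" "v \<in> square_integrable M"
  shows "integrable M (\<lambda>x. u x \<bullet> v x)" "integrable M (\<lambda>x. norm (u x) * norm (v x))"
proof -
  have [measurable]: "u \<in> borel_measurable M" "v \<in> borel_measurable M"
    and i: "integrable M (\<lambda>x. (norm (u x))^2 + (norm (v x))^2)"
    using assms by (auto simp: square_integrable_def)
  have b: "norm (u x) * norm (v x) \<le> (norm (u x))^2 + (norm (v x))^2" for x
  proof -
    have "2 * (norm (u x) * norm (v x)) \<le> (norm (u x))^2 + (norm (v x))^2"
      using sum_squares_bound[of "norm (u x)" "norm (v x)"] by (simp add: mult.assoc)
    moreover have "0 \<le> norm (u x) * norm (v x)" by simp
    ultimately show ?thesis by linarith
  qed
  show "integrable M (\<lambda>x. u x \<bullet> v x)"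
    by (rule Bochner_Integration.integrable_bound[OF i])
      (use b Cauchy_Schwarz_ineq2 in \<open>auto intro!: AE_I2 intro: order_trans\<close>)
  show "integrable M (\<lambda>x. norm (u x) * norm (v x))"
    by (rule Bochner_Integration.integrable_bound[OF i]) (use b in \<open>auto intro!: AE_I2\<close>)
qed

lemma subspace_square_integrable: "subspace (square_integrable M :: ('a => 'b::euclidean_space) set)"
  unfolding subspace_def
proof (intro conjI ballI allI)
  show "(0 :: 'a => 'b) \<in> square_integrable M" by (simp add: square_integrable_def zero_fun_def)
  fix u v :: "'a => 'b" and c :: real
  assume u: "u \<in> square_integrable M"
  then show "c *\<^sub>R u \<in> square_integrable M"
    by (auto simp: square_integrable_def scaleR_fun_def power_mult_distrib)
  assume v: "v \<in> square_integrable M"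
  have "integrable M (\<lambda>x. (norm (u x))^2 + 2 * (u x \<bullet> v x) + (norm (v x))^2)"
    using u v integrable_inner_square_integrable[OF u v] by (auto simp: square_integrable_def)
  moreover have "(norm (u x))^2 + 2 * (u x \<bullet> v x) + (norm (v x))^2 = (norm (u x + v x))^2" for x
    by (simp add: power2_norm_eq_inner inner_add_left inner_add_right inner_commute)
  ultimately show "u + v \<in> square_integrable M"
    using u v by (auto simp: square_integrable_def plus_fun_def)
qed

interpretation sq: semi_ip "square_integrable M :: ('a => 'b::euclidean_space) set" "inner_integral M"
  for M :: "'a measure"
proof
  show "subspace (square_integrable M)" by (rule subspace_square_integrable)
  fix u v w :: "'a => 'b" and c :: real
  assume u: "u \<in> square_integrable M" and v: "v \<in> square_integrable M"
  show "inner_integral M u v = inner_integral M v u" by (simp add: inner_integral_def inner_commute)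
  show "inner_integral M (c *\<^sub>R u) v = c * inner_integral M u v" by (simp add: inner_integral_def)
  show "0 \<le> inner_integral M u u" by (simp add: inner_integral_def)
  assume w: "w \<in> square_integrable M"
  show "inner_integral M (u + v) w = inner_integral M u w + inner_integral M v w"
    using u v w by (simp add: inner_integral_def inner_add_left integrable_inner_square_integrable)
qed

lemma sq_nrm: "sq.nrm M u = sqrt (\<integral>x. (norm (u x))^2 \<partial>M)"
  by (simp add: sq.nrm_def inner_integral_def power2_norm_eq_inner)

lemma sq_nrm_sq: "(sq.nrm M u)^2 = (\<integral>x. (norm (u x))^2 \<partial>M)"
  by (simp add: sq_nrm)

text \<open>Riesz-Fischer: a subsequence with rate 4^(-n) converges almost everywhere by a
  telescoping series, and its pointwise limit is the limit in norm of the whole sequence.\<close>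

interpretation sq: semi_hilbert "square_integrable M :: ('a => 'b::euclidean_space) set" "inner_integral M"
  for M :: "'a measure"
proof
  fix x :: "nat => 'a => 'b"
  assume x: "\<And>n. x n \<in> square_integrable M" and C: "sq.Cauchy_seq M x"
  have [measurable]: "x n \<in> borel_measurable M" for n using x by (auto simp: square_integrable_def)
  obtain r where r: "strict_mono r" and rate: "\<And>n. sq.nrm M (x (r (Suc n)) - x (r n)) \<le> (1/4) ^ n"
    using sq.Cauchy_subseq_rate[OF C, of "1/4"] by auto
  define d where "d n t = norm (x (r (Suc n)) t - x (r n) t)" for n t
  have dsq: "x (r (Suc n)) - x (r n) \<in> square_integrable M" for n using x by simp
  have "AE t in M. \<exists>C. \<forall>n. \<bar>d n t\<bar> \<le> C * (1/2) ^ n"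
  proof (rule AE_geometric)
    show "d n \<in> borel_measurable M" for n unfolding d_def by measurable
    show "integrable M (\<lambda>t. (d n t)^2)" for n using dsq[of n] by (auto simp: square_integrable_def d_def)
    show "(\<integral>t. (d n t)^2 \<partial>M) \<le> (1/16) ^ n" for n
    proof -
      have "(\<integral>t. (d n t)^2 \<partial>M) = (sq.nrm M (x (r (Suc n)) - x (r n)))^2"
        by (simp add: sq_nrm_sq d_def)
      also have "\<dots> \<le> ((1/4) ^ n)^2" using rate dsq sq.nrm_nonneg by (intro power_mono) auto
      also have "\<dots> = (1/16) ^ n" by (simp add: power2_eq_square power_mult_distrib[symmetric])
      finally show ?thesis .
    qed
  qed
  then have conv: "AE t in M. convergent (\<lambda>n. x (r n) t)"
  proof eventually_elim
    fix t assume "\<exists>C. \<forall>n. \<bar>d n t\<bar> \<le> C * (1/2) ^ n"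
    then obtain c where c: "\<And>n. norm (x (r (Suc n)) t - x (r n) t) \<le> c * (1/2) ^ n" by (auto simp: d_def)
    have "summable (\<lambda>n. c * (1/2::real) ^ n)" by (intro summable_mult summable_geometric) auto
    then have "summable (\<lambda>n. x (r (Suc n)) t - x (r n) t)"
      by (rule summable_comparison_test'[where N = 0]) (use c in auto)
    then have "convergent (\<lambda>n. (\<Sum>i<n. x (r (Suc i)) t - x (r i) t) + x (r 0) t)"
      unfolding summable_iff_convergent by (intro convergent_add convergent_const)
    then show "convergent (\<lambda>n. x (r n) t)"
      by (simp add: sum_lessThan_telescope[of "\<lambda>i. x (r i) t"])
  qed
  define y where "y t = lim (\<lambda>n. x (r n) t)" for t
  have y[measurable]: "y \<in> borel_measurable M" unfolding y_def by (rule borel_measurable_lim_metric) simp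
  have lim: "AE t in M. (\<lambda>n. x (r n) t) \<longlonglongrightarrow> y t"
    using conv by eventually_elim (simp add: y_def convergent_LIMSEQ_iff)
  \<comment> \<open>Fatou along the subsequence turns a Cauchy bound for x n into a bound for its
    distance from y.\<close>
  have key: "integrable M (\<lambda>t. (norm (x n t - y t))^2) \<and> (\<integral>t. (norm (x n t - y t))^2 \<partial>M) \<le> e^2"
    if N: "\<And>m. m \<ge> N ==> sq.nrm M (x n - x m) \<le> e" for n N e
  proof -
    have f: "integrable M (\<lambda>t. (norm (x n t - x (r k) t))^2)" for k
      using sq.mem(4)[OF x[of n] x[of "r k"]] by (auto simp: square_integrable_def)
    have l: "AE t in M. (\<lambda>k. (norm (x n t - x (r k) t))^2) \<longlonglongrightarrow> (norm (x n t - y t))^2"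
      using lim by eventually_elim (auto intro!: tendsto_intros)
    have b: "(\<integral>t. (norm (x n t - x (r k) t))^2 \<partial>M) \<le> e^2" if "k \<ge> N" for k
    proof -
      have "sq.nrm M (x n - x (r k)) \<le> e" using N seq_suble[OF r, of k] that by (meson le_trans)
      then have "(sq.nrm M (x n - x (r k)))^2 \<le> e^2"
        using sq.nrm_nonneg[OF sq.mem(4)[OF x[of n] x[of "r k"]]] by (rule power_mono)
      then show ?thesis by (simp add: sq_nrm_sq)
    qed
    show ?thesis using Fatou_real[OF f _ _ l b, of N] by auto
  qed
  have "\<exists>N. \<forall>n\<ge>N. \<forall>m\<ge>N. sq.nrm M (x n - x m) < e" if "e > 0" for e
    using C that unfolding sq.Cauchy_seq_def by blast
  note CN = this
  obtain N where "\<forall>n\<ge>N. \<forall>m\<ge>N. sq.nrm M (x n - x m) < 1" using CN[of 1] by auto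
  then have "integrable M (\<lambda>t. (norm (x N t - y t))^2)" using key[of N N 1] by (simp add: less_imp_le)
  then have "x N - y \<in> square_integrable M" by (auto simp: square_integrable_def fun_diff_def)
  then have yS: "y \<in> square_integrable M" using sq.mem(4)[OF x[of N]] by fastforce
  moreover have "(\<lambda>n. sq.nrm M (x n - y)) \<longlonglongrightarrow> 0"
  proof (rule LIMSEQ_I)
    fix e :: real assume e: "e > 0"
    obtain N where N: "\<forall>n\<ge>N. \<forall>m\<ge>N. sq.nrm M (x n - x m) < e / 2" using CN[of "e / 2"] e by auto
    have "sq.nrm M (x n - y) < e" if "n \<ge> N" for n
    proof -
      have "(sq.nrm M (x n - y))^2 \<le> (e / 2)^2"
        using key[of N n "e / 2"] N that by (simp add: less_imp_le sq_nrm_sq)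
      then have "sq.nrm M (x n - y) \<le> e / 2" by (rule power2_le_imp_le) (use e in simp)
      then show ?thesis using e by simp
    qed
    moreover have "0 \<le> sq.nrm M (x n - y)" for n by (intro sq.nrm_nonneg sq.mem x yS)
    ultimately show "\<exists>N. \<forall>n\<ge>N. norm (sq.nrm M (x n - y) - 0) < e"
      by (intro exI[of _ N]) auto
  qed
  ultimately show "\<exists>y\<in>square_integrable M. (\<lambda>n. sq.nrm M (x n - y)) \<longlonglongrightarrow> 0" by blast
qed

lemma integral_CS:
  fixes g h :: "'a => real"
  assumes "g \<in> borel_measurable M" "h \<in> borel_measurable M"
    and "integrable M (\<lambda>x. (g x)^2)" "integrable M (\<lambda>x. (h x)^2)"
  shows "integrable M (\<lambda>x. g x * h x)"
    "(\<integral>x. g x * h x \<partial>M) \<le> sqrt (\<integral>x. (g x)^2 \<partial>M) * sqrt (\<integral>x. (h x)^2 \<partial>M)"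
proof -
  have s: "g \<in> square_integrable M" "h \<in> square_integrable M"
    using assms by (auto simp: square_integrable_def)
  show "integrable M (\<lambda>x. g x * h x)" using integrable_inner_square_integrable(1)[OF s] by simp
  show "(\<integral>x. g x * h x \<partial>M) \<le> sqrt (\<integral>x. (g x)^2 \<partial>M) * sqrt (\<integral>x. (h x)^2 \<partial>M)"
    using sq.CS'[OF s] by (simp add: sq_nrm inner_integral_def)
qed

lemma integrable_square_imp:
  fixes g :: "'a => real"
  assumes "finite_measure M" "g \<in> borel_measurable M" "integrable M (\<lambda>x. (g x)^2)"
  shows "integrable M g"
proof -
  interpret finite_measure M by fact
  show ?thesis using integral_CS(1)[of g M "\<lambda>_. 1"] assms by simp
qed

lemma integrable_simple_function_real:
  fixes g :: "'a => real"
  assumes "finite_measure M" "simple_function M g" shows "integrable M g"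
proof -
  interpret finite_measure M by fact
  have "finite (g ` space M)" using assms(2) by (simp add: simple_function_def)
  then obtain B where "\<And>x. x \<in> space M ==> norm (g x) \<le> B"
    using finite_imp_bounded[of "g ` space M"] by (auto simp: bounded_iff)
  then show ?thesis
    by (intro integrable_const_bound[of _ B]) (auto intro: borel_measurable_simple_function assms)
qed

section \<open>The abstract evolution problem\<close>

lemma simple_function_real_comp:
  "simple_function M y ==> simple_function M (\<lambda>t. g (y t) :: real)"
  using simple_function_compose1[of M y g] by simp

lemma sqrt_mult_le_add:
  assumes "0 \<le> x" "0 \<le> (y::real)" shows "sqrt (x * y) \<le> x + y"
proof (rule real_le_lsqrt)
  have "0 \<le> x * y" "0 \<le> x * x" "0 \<le> y * y" using assms by auto
  then show "x * y \<le> (x + y)^2" by (simp add: power2_eq_square algebra_simps)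
qed (use assms in auto)

lemma sum3_sq_le: "(x + y + z)^2 \<le> 3 * x^2 + 3 * y^2 + 3 * (z::real)^2"
  using sum_squares_bound[of x y] sum_squares_bound[of x z] sum_squares_bound[of y z]
  by (simp add: power2_eq_square algebra_simps)

lemma sum2_sq_le: "(x + y)^2 \<le> 2 * x^2 + 2 * (y::real)^2"
  using sum_squares_bound[of x y] by (simp add: power2_eq_square algebra_simps)

text \<open>\<open>b_bound\<close> has the form that Ladyzhenskaya's inequality gives for planar
  transport, \<open>compact\<close> is Rellich's theorem, and \<open>D0_a\<close> and
  \<open>D0_b\<close> say that against test elements the forms are continuous in the norm of H
  alone. \<open>f\<close> is linear and bounded by \<open>F t\<close> at every time, not just almost
  every time, so that the construction carries no exceptional set.\<close>

locale evolution = V: semi_hilbert V ipV + H: semi_ip H ipH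
  for V H :: "'a::real_vector set" and ipV ipH :: "'a => 'a => real" +
  fixes a :: "'a => 'a => real" and b :: "'a => 'a => 'a => real"
    and f :: "real => 'a => real" and F :: "real => real"
    and u0 :: 'a and T Ca \<alpha> Cb :: real and D0 :: "'a set"
  assumes VH: "v \<in> V ==> v \<in> H"
    and nrm_le: "v \<in> V ==> H.nrm v \<le> V.nrm v"
    and a_add1: "x \<in> V ==> y \<in> V ==> z \<in> V ==> a (x + y) z = a x z + a y z"
    and a_scale1: "x \<in> V ==> z \<in> V ==> a (c *\<^sub>R x) z = c * a x z"
    and a_add2: "x \<in> V ==> y \<in> V ==> z \<in> V ==> a z (x + y) = a z x + a z y"
    and a_scale2: "x \<in> V ==> z \<in> V ==> a z (c *\<^sub>R x) = c * a z x"
    and a_bound: "x \<in> V ==> y \<in> V ==> \<bar>a x y\<bar> \<le> Ca * V.nrm x * V.nrm y"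
    and a_coercive: "x \<in> V ==> \<alpha> * (V.nrm x)^2 \<le> a x x" and \<alpha>: "0 < \<alpha>"
    and b_add1: "x \<in> V ==> y \<in> V ==> z \<in> V ==> w \<in> V ==> b (x + y) z w = b x z w + b y z w"
    and b_scale1: "x \<in> V ==> z \<in> V ==> w \<in> V ==> b (c *\<^sub>R x) z w = c * b x z w"
    and b_add2: "x \<in> V ==> y \<in> V ==> z \<in> V ==> w \<in> V ==> b z (x + y) w = b z x w + b z y w"
    and b_scale2: "x \<in> V ==> z \<in> V ==> w \<in> V ==> b z (c *\<^sub>R x) w = c * b z x w"
    and b_skew: "x \<in> V ==> y \<in> V ==> z \<in> V ==> b x y z = - b x z y"
    and b_bound: "x \<in> V ==> y \<in> V ==> z \<in> V ==>
      \<bar>b x y z\<bar> \<le> Cb * sqrt (H.nrm x * V.nrm x) * sqrt (H.nrm z * V.nrm z) * V.nrm y"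
    and Ca: "0 \<le> Ca" and Cb: "0 \<le> Cb"
    and D0: "D0 \<subseteq> V" and dense: "v \<in> V ==> 0 < e ==> \<exists>d\<in>D0. V.nrm (v - d) < e"
    and D0_a: "v \<in> D0 ==> \<exists>K. \<forall>u\<in>V. \<bar>a u v\<bar> \<le> K * H.nrm u"
    and D0_b: "v \<in> D0 ==> \<exists>K. \<forall>u\<in>V. \<forall>w\<in>V. \<bar>b w v u\<bar> \<le> K * H.nrm w * H.nrm u"
    and compact: "(\<And>n::nat. xs n \<in> V) ==> (\<And>n. V.nrm (xs n) \<le> K) ==>
      \<exists>r. strict_mono (r :: nat => nat) \<and> H.Cauchy_seq (xs \<circ> r)"
    and T: "0 < T" and u0: "u0 \<in> H"
    and f_meas: "v \<in> V ==> (\<lambda>t. f t v) \<in> borel_measurable (lebesgue_on {0<..<T})"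
    and f_add: "x \<in> V ==> y \<in> V ==> f t (x + y) = f t x + f t y"
    and f_scale: "x \<in> V ==> f t (c *\<^sub>R x) = c * f t x"
    and f_bound: "x \<in> V ==> \<bar>f t x\<bar> \<le> F t * V.nrm x"
    and F_nonneg: "0 \<le> F t"
    and F_meas: "F \<in> borel_measurable (lebesgue_on {0<..<T})"
    and F_int: "integrable (lebesgue_on {0<..<T}) (\<lambda>t. (F t)^2)"
begin

abbreviation M :: "real measure" where "M \<equiv> lebesgue_on {0<..<T}"

lemma finM: "finite_measure M"
  by (rule finite_measure_lebesgue_on) simp

interpretation M: finite_measure M by (rule finM)

lemma spaceM [simp]: "space M = {0<..<T}" by simp

lemma meas_interval [measurable]: "(\<lambda>t. indicator {x<..y} t :: real) \<in> borel_measurable M"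
  "(\<lambda>t. indicator {..y} t :: real) \<in> borel_measurable M"
  by (rule measurable_restrict_space1, rule borel_measurable_indicator, simp)+

declare F_meas [measurable]

lemma F_integrable: "integrable M F"
  by (rule integrable_square_imp[OF finM F_meas F_int])

lemma a_diff1: "x \<in> V ==> y \<in> V ==> z \<in> V ==> a (x - y) z = a x z - a y z"
  using a_add1[of x "(-1) *\<^sub>R y" z] a_scale1[of y z "-1"] by simp

lemma a_diff2: "x \<in> V ==> y \<in> V ==> z \<in> V ==> a z (x - y) = a z x - a z y"
  using a_add2[of x "(-1) *\<^sub>R y" z] a_scale2[of y z "-1"] by simp

lemma b_diff1: "x \<in> V ==> y \<in> V ==> z \<in> V ==> w \<in> V ==> b (x - y) z w = b x z w - b y z w"
  using b_add1[of x "(-1) *\<^sub>R y" z w] b_scale1[of y z w "-1"] by simp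

lemma b_diff2: "x \<in> V ==> y \<in> V ==> z \<in> V ==> w \<in> V ==> b z (x - y) w = b z x w - b z y w"
  using b_add2[of x "(-1) *\<^sub>R y" z w] b_scale2[of y z w "-1"] by simp

lemma b_add3: "x \<in> V ==> y \<in> V ==> z \<in> V ==> w \<in> V ==> b z w (x + y) = b z w x + b z w y"
  using b_skew[of z w "x + y"] b_skew[of z w x] b_skew[of z w y] b_add2[of x y z w] by simp

lemma b_scale3: "x \<in> V ==> z \<in> V ==> w \<in> V ==> b z w (c *\<^sub>R x) = c * b z w x"
  using b_skew[of z w "c *\<^sub>R x"] b_skew[of z w x] b_scale2[of x z w c] by simp

lemma b_diff3: "x \<in> V ==> y \<in> V ==> z \<in> V ==> w \<in> V ==> b z w (x - y) = b z w x - b z w y"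
  using b_add3[of x "(-1) *\<^sub>R y" z w] b_scale3[of y z w "-1"] by simp

lemma b_alt: "x \<in> V ==> y \<in> V ==> b x y y = 0"
  using b_skew[of x y y] by simp

lemma b_bound': assumes "x \<in> V" "y \<in> V" "z \<in> V" shows "\<bar>b x y z\<bar> \<le> Cb * V.nrm x * V.nrm y * V.nrm z"
proof -
  have *: "sqrt (H.nrm w * V.nrm w) \<le> V.nrm w" "0 \<le> sqrt (H.nrm w * V.nrm w)" if "w \<in> V" for w
  proof -
    have "H.nrm w * V.nrm w \<le> V.nrm w * V.nrm w"
      using nrm_le[OF that] V.nrm_nonneg[OF that] by (intro mult_right_mono)
    then show "sqrt (H.nrm w * V.nrm w) \<le> V.nrm w"
      using V.nrm_nonneg[OF that] by (intro real_le_lsqrt) (auto simp: power2_eq_square)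
    show "0 \<le> sqrt (H.nrm w * V.nrm w)" using V.nrm_nonneg[OF that] H.nrm_nonneg[OF VH[OF that]] by simp
  qed
  have "\<bar>b x y z\<bar> \<le> Cb * sqrt (H.nrm x * V.nrm x) * sqrt (H.nrm z * V.nrm z) * V.nrm y"
    by (rule b_bound[OF assms])
  also have "\<dots> \<le> Cb * V.nrm x * V.nrm z * V.nrm y"
    using *[of x] *[of z] assms Cb V.nrm_nonneg
    by (intro mult_right_mono mult_mono mult_left_mono) auto
  finally show ?thesis by (simp add: mult_ac)
qed

lemma f_diff: "x \<in> V ==> y \<in> V ==> f t (x - y) = f t x - f t y"
  using f_add[of x "(-1) *\<^sub>R y" t] f_scale[of y t "-1"] by simp

lemma f_integrable: assumes "v \<in> V" shows "integrable M (\<lambda>t. f t v)"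
proof (rule Bochner_Integration.integrable_bound)
  show "integrable M (\<lambda>t. F t * V.nrm v)" using F_integrable by simp
  show "AE t in M. norm (f t v) \<le> norm (F t * V.nrm v)"
    using f_bound[OF assms] F_nonneg V.nrm_nonneg[OF assms] by simp
qed (rule f_meas[OF assms])

lemma integrable_indicator:
  "integrable M g ==> integrable M (\<lambda>s. indicator {x<..y} s * g s)"
  "integrable M g ==> integrable M (\<lambda>s. indicator {..y} s * g s)" for g :: "real => real"
proof -
  assume g: "integrable M g"
  then have [measurable]: "g \<in> borel_measurable M" by simp
  show "integrable M (\<lambda>s. indicator {x<..y} s * g s)" "integrable M (\<lambda>s. indicator {..y} s * g s)"
    by (rule Bochner_Integration.integrable_bound[OF g], measurable, simp add: indicator_def)+
qed

section \<open>The time discretisation\<close>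

definition \<tau> :: "nat => real" where "\<tau> N = T / real (Suc N)"

lemma \<tau>_pos: "\<tau> N > 0" using T by (simp add: \<tau>_def)

text \<open>\<open>f\<close> has no meaningful values at single times, so each step uses its
  integral over the cell.\<close>

definition load :: "nat => nat => 'a => real" where
  "load N k v = (\<integral>s. indicator {real k * \<tau> N<..real (Suc k) * \<tau> N} s * f s v \<partial>M)"

text \<open>Coercivity, with constant h \<alpha>, comes from \<open>a\<close>: the form
  \<open>ipH\<close> is nonnegative and \<open>b w x x\<close> vanishes by skewness. The size of the
  advecting field w therefore imposes no restriction on the step h.\<close>

lemma implicit_step:
  assumes "p \<in> H" "w \<in> V" "h > 0"
    and "\<And>x y. x \<in> V ==> y \<in> V ==> \<phi> (x + y) = \<phi> x + \<phi> y"
    and "\<And>c x. x \<in> V ==> \<phi> (c *\<^sub>R x) = c * \<phi> x"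
    and "\<And>x. x \<in> V ==> \<bar>\<phi> x\<bar> \<le> L * V.nrm x"
  shows "\<exists>u\<in>V. \<forall>v\<in>V. ipH u v + h * (a u v + b w u v) = ipH p v + \<phi> v"
proof (rule V.lax_milgram[where K = "1 + h * (Ca + Cb * V.nrm w)" and \<alpha> = "h * \<alpha>" and L = "H.nrm p + L"])
  fix x y assume x: "x \<in> V" and y: "y \<in> V"
  have "\<bar>ipH x y\<bar> \<le> V.nrm x * V.nrm y"
    using H.CS[OF VH[OF x] VH[OF y]] nrm_le[OF x] nrm_le[OF y] H.nrm_nonneg[OF VH[OF x]] H.nrm_nonneg[OF VH[OF y]]
      V.nrm_nonneg[OF x]
    by (meson mult_mono order_trans)
  moreover have "\<bar>h * (a x y + b w x y)\<bar> \<le> h * (Ca * V.nrm x * V.nrm y + Cb * V.nrm w * V.nrm x * V.nrm y)"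
    using a_bound[OF x y] b_bound'[OF assms(2) x y] assms(3) by (simp add: abs_mult)
  ultimately show "\<bar>ipH x y + h * (a x y + b w x y)\<bar> \<le> (1 + h * (Ca + Cb * V.nrm w)) * V.nrm x * V.nrm y"
    by (simp add: algebra_simps)
next
  fix x assume x: "x \<in> V"
  have "h * (\<alpha> * (V.nrm x)^2) \<le> h * a x x" using a_coercive[OF x] assms(3) by simp
  then show "h * \<alpha> * (V.nrm x)^2 \<le> ipH x x + h * (a x x + b w x x)"
    using H.ip_nonneg[OF VH[OF x]] x assms(2) by (simp add: b_alt)
  have "\<bar>ipH p x\<bar> \<le> H.nrm p * V.nrm x"
    using H.CS[OF assms(1) VH[OF x]] nrm_le[OF x] H.nrm_nonneg[OF assms(1)]
    by (meson mult_left_mono order_trans)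
  then show "\<bar>ipH p x + \<phi> x\<bar> \<le> (H.nrm p + L) * V.nrm x"
    using assms(6)[OF x] by (simp add: algebra_simps)
next
  show "0 < h * \<alpha>" using assms(3) \<alpha> by simp
qed (use assms VH in \<open>auto simp: H.ip_simps a_add1 a_add2 a_scale1 a_scale2 b_add2 b_add3 b_scale2 b_scale3 algebra_simps\<close>)

primrec U :: "nat => nat => 'a" where
  "U N 0 = u0"
| "U N (Suc k) = (SOME u. u \<in> V \<and> (\<forall>v\<in>V. ipH u v + \<tau> N * (a u v + b (if k = 0 then 0 else U N k) u v)
      = ipH (U N k) v + load N k v))"

text \<open>The advecting field of step \<open>Suc k\<close> is the previous value, except in the first step, where
  that value is the initial one and need not belong to \<open>V\<close>.\<close>

definition W :: "nat => nat => 'a" where "W N k = (if k = 0 then 0 else U N k)"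

lemma load_bound: assumes "v \<in> V" shows "\<bar>load N k v\<bar> \<le> (\<integral>s. F s \<partial>M) * V.nrm v"
proof -
  have "\<bar>load N k v\<bar> \<le> (\<integral>s. F s * V.nrm v \<partial>M)"
    unfolding load_def using f_bound[OF assms] F_nonneg V.nrm_nonneg[OF assms]
    by (intro order_trans[OF integral_abs_bound] integral_mono integrable_abs integrable_indicator f_integrable assms)
      (auto simp: F_integrable indicator_def)
  then show ?thesis by simp
qed

text \<open>Membership and equation are proved together, because the choice made in one step is
  backed by an existing solution only if the advecting field, which is the value of the step before,
  lies in V.\<close>

lemma U_step: "U N (Suc k) \<in> V \<and> (\<forall>v\<in>V. ipH (U N (Suc k)) v
    + \<tau> N * (a (U N (Suc k)) v + b (W N k) (U N (Suc k)) v) = ipH (U N k) v + load N k v)"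
proof (induction k)
  have ex: "\<exists>u. u \<in> V \<and> (\<forall>v\<in>V. ipH u v + \<tau> N * (a u v + b w u v) = ipH p v + load N k v)"
    if "p \<in> H" "w \<in> V" for p w k
  proof -
    have "\<exists>u\<in>V. \<forall>v\<in>V. ipH u v + \<tau> N * (a u v + b w u v) = ipH p v + load N k v"
      by (rule implicit_step[OF that \<tau>_pos _ _ load_bound])
        (auto simp: load_def f_add f_scale distrib_left mult.left_commute integrable_indicator f_integrable)
    then show ?thesis by blast
  qed
  {
    case 0
    show ?case using someI_ex[OF ex[OF u0 V.mem(1), of 0]] by (simp add: W_def)
  next
    case (Suc k)
    then show ?case using someI_ex[OF ex[OF VH, of "U N (Suc k)" "U N (Suc k)" "Suc k"]]
      by (simp add: W_def del: U.simps(2)) (simp add: U.simps(2)[of N "Suc k"] del: U.simps(2))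
  }
qed

declare U.simps(2) [simp del]

lemma U_V: "U N (Suc k) \<in> V" using U_step by blast

lemma U_H: "U N k \<in> H" by (cases k) (auto simp: u0 VH U_V)

lemma W_V: "W N k \<in> V" by (cases k) (auto simp: W_def U_V)

lemma U_eq: "v \<in> V ==> ipH (U N (Suc k)) v + \<tau> N * (a (U N (Suc k)) v + b (W N k) (U N (Suc k)) v)
    = ipH (U N k) v + load N k v"
  using U_step by blast

lemma measure_interval:
  "0 \<le> x ==> x \<le> y ==> y \<le> T ==> (\<integral>s. indicator {x<..y} s \<partial>M) = y - x"
  "x \<le> y ==> (\<integral>s. indicator {x<..y} s \<partial>M) \<le> y - x"
proof -
  have *: "(\<integral>s. indicator {x<..y} s \<partial>M) = measure lebesgue ({x<..y} \<inter> {0<..<T})" for x y :: real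
    by (simp add: measure_restrict_space Int_commute)
  show "(\<integral>s. indicator {x<..y} s \<partial>M) = y - x" if "0 \<le> x" "x \<le> y" "y \<le> T"
  proof (cases "y < T")
    case True
    then have "{x<..y} \<inter> {0<..<T} = {x<..y}" using that by auto
    then show ?thesis using that unfolding * by simp
  next
    case False
    \<comment> \<open>Here y = T, and the end point that is lost has measure 0.\<close>
    then have "{x<..y} \<inter> {0<..<T} = {x<..<y}" using that by auto
    then show ?thesis using that unfolding * by simp
  qed
  show "(\<integral>s. indicator {x<..y} s \<partial>M) \<le> y - x" if "x \<le> y"
  proof -
    have "measure lebesgue ({x<..y} \<inter> {0<..<T}) \<le> measure lebesgue {x..y}"
      by (rule measure_mono_fmeasurable) auto
    then show ?thesis using that unfolding * by simp
  qed
qed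

section \<open>The discrete energy estimate\<close>

lemma Young: "2 * (y * x) \<le> \<alpha> * x^2 + y^2 / \<alpha>" for x y :: real
proof -
  have "0 \<le> (\<alpha> * x - y)^2 / \<alpha>" using \<alpha> by simp
  then show ?thesis using \<alpha> by (simp add: power2_eq_square field_simps)
qed

text \<open>Young's inequality under the integral sign. Its V-term is half of what coercivity
  contributes in \<open>energy_step\<close>, so the other half survives.\<close>

lemma load_Young:
  assumes "v \<in> V"
  shows "2 * load N k v \<le> \<tau> N * \<alpha> * (V.nrm v)^2
    + (\<integral>s. indicator {real k * \<tau> N<..real (Suc k) * \<tau> N} s * (F s)^2 \<partial>M) / \<alpha>"
proof -
  let ?I = "indicator {real k * \<tau> N<..real (Suc k) * \<tau> N} :: real => real"
  have i1: "integrable M (\<lambda>s. ?I s * (\<alpha> * (V.nrm v)^2))"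
    by (rule integrable_indicator) (rule M.integrable_const)
  have i2: "integrable M (\<lambda>s. ?I s * (F s)^2 / \<alpha>)"
    using integrable_indicator(1)[OF F_int] by simp
  have "2 * load N k v = (\<integral>s. 2 * (?I s * f s v) \<partial>M)" by (simp add: load_def)
  also have "\<dots> \<le> (\<integral>s. ?I s * (\<alpha> * (V.nrm v)^2) + ?I s * (F s)^2 / \<alpha> \<partial>M)"
  proof (rule integral_mono)
    show "integrable M (\<lambda>s. 2 * (?I s * f s v))"
      by (intro integrable_mult_right integrable_indicator f_integrable assms)
    show "integrable M (\<lambda>s. ?I s * (\<alpha> * (V.nrm v)^2) + ?I s * (F s)^2 / \<alpha>)"
      by (rule Bochner_Integration.integrable_add[OF i1 i2])
    fix s
    have "2 * f s v \<le> 2 * (F s * V.nrm v)" using f_bound[OF assms, of s] by simp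
    also have "\<dots> \<le> \<alpha> * (V.nrm v)^2 + (F s)^2 / \<alpha>" by (rule Young)
    finally show "2 * (?I s * f s v) \<le> ?I s * (\<alpha> * (V.nrm v)^2) + ?I s * (F s)^2 / \<alpha>"
      by (simp add: indicator_def)
  qed
  also have "\<dots> = (\<integral>s. ?I s \<partial>M) * (\<alpha> * (V.nrm v)^2) + (\<integral>s. ?I s * (F s)^2 \<partial>M) / \<alpha>"
    unfolding Bochner_Integration.integral_add[OF i1 i2] by simp
  also have "\<dots> \<le> \<tau> N * (\<alpha> * (V.nrm v)^2) + (\<integral>s. ?I s * (F s)^2 \<partial>M) / \<alpha>"
  proof (intro add_right_mono mult_right_mono)
    have "real k * \<tau> N \<le> real (Suc k) * \<tau> N" using \<tau>_pos[of N] by simp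
    from measure_interval(2)[OF this] show "(\<integral>s. ?I s \<partial>M) \<le> \<tau> N" by (simp add: algebra_simps)
  qed (use \<alpha> in simp)
  finally show ?thesis by (simp add: mult_ac)
qed

text \<open>Twice the equation tested with the new value u, where 2 (u - p, u) = |u|^2 - |p|^2 + |u
  - p|^2 and the advective term drops out. The squared jump |u - p|^2 is kept, since it later
  compares \<open>un\<close> with \<open>wn\<close>.\<close>

lemma energy_step:
  "(H.nrm (U N (Suc k)))^2 + (H.nrm (U N (Suc k) - U N k))^2 + \<tau> N * \<alpha> * (V.nrm (U N (Suc k)))^2
   \<le> (H.nrm (U N k))^2 + (\<integral>s. indicator {real k * \<tau> N<..real (Suc k) * \<tau> N} s * (F s)^2 \<partial>M) / \<alpha>"
proof -
  let ?u = "U N (Suc k)" and ?p = "U N k"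
  have u: "?u \<in> V" by (rule U_V)
  have "ipH ?u ?u + \<tau> N * a ?u ?u = ipH ?p ?u + load N k ?u"
    using U_eq[OF u, of N k] b_alt[OF W_V u] by simp
  moreover have "(H.nrm (?u - ?p))^2 = (H.nrm ?u)^2 - 2 * ipH ?u ?p + (H.nrm ?p)^2"
    by (rule H.nrm_diff_sq[OF U_H U_H])
  moreover have "ipH ?u ?p = ipH ?p ?u" by (rule H.ip_sym[OF U_H U_H])
  moreover have "(H.nrm ?u)^2 = ipH ?u ?u" by (rule H.nrm_sq[OF U_H])
  moreover have "\<tau> N * (\<alpha> * (V.nrm ?u)^2) \<le> \<tau> N * a ?u ?u"
    using a_coercive[OF u] \<tau>_pos[of N] by (intro mult_left_mono) auto
  ultimately show ?thesis using load_Young[OF u, of N k] by simp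
qed

text \<open>Right-hand side of the summed energy inequality, hence a common bound for the squared
  H-norms, for the sum of the squared jumps, and for \<alpha> times the squared norm in
  L2(0,T;V).\<close>

definition E0 :: real where "E0 = (H.nrm u0)^2 + (\<integral>s. (F s)^2 \<partial>M) / \<alpha>"

lemma energy: "(H.nrm (U N n))^2 + (\<Sum>k<n. (H.nrm (U N (Suc k) - U N k))^2)
    + \<tau> N * \<alpha> * (\<Sum>k<n. (V.nrm (U N (Suc k)))^2) \<le> E0"
proof -
  \<comment> \<open>Cutting the integral off at the n-th node makes the right side telescope along
    the induction; the full integral is inserted only afterwards.\<close>
  have "(H.nrm (U N n))^2 + (\<Sum>k<n. (H.nrm (U N (Suc k) - U N k))^2)
    + \<tau> N * \<alpha> * (\<Sum>k<n. (V.nrm (U N (Suc k)))^2)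
    \<le> (H.nrm u0)^2 + (\<integral>s. indicator {..real n * \<tau> N} s * (F s)^2 \<partial>M) / \<alpha>"
  proof (induction n)
    case 0
    have "0 \<le> (\<integral>s. indicator {..0::real} s * (F s)^2 \<partial>M) / \<alpha>"
      using \<alpha> by (intro divide_nonneg_pos Bochner_Integration.integral_nonneg) auto
    then show ?case by simp
  next
    case (Suc n)
    have le: "real n * \<tau> N \<le> real (Suc n) * \<tau> N" using \<tau>_pos[of N] by simp
    have "indicator {..real (Suc n) * \<tau> N} s * (F s)^2 = indicator {..real n * \<tau> N} s * (F s)^2
        + indicator {real n * \<tau> N<..real (Suc n) * \<tau> N} s * (F s)^2" for s
      using le by (auto simp: indicator_def)
    then have "(\<integral>s. indicator {..real (Suc n) * \<tau> N} s * (F s)^2 \<partial>M)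
      = (\<integral>s. indicator {..real n * \<tau> N} s * (F s)^2 \<partial>M)
        + (\<integral>s. indicator {real n * \<tau> N<..real (Suc n) * \<tau> N} s * (F s)^2 \<partial>M)"
      by (simp add: integrable_indicator F_int)
    then have "(\<integral>s. indicator {..real (Suc n) * \<tau> N} s * (F s)^2 \<partial>M) / \<alpha>
      = (\<integral>s. indicator {..real n * \<tau> N} s * (F s)^2 \<partial>M) / \<alpha>
        + (\<integral>s. indicator {real n * \<tau> N<..real (Suc n) * \<tau> N} s * (F s)^2 \<partial>M) / \<alpha>"
      by (simp add: add_divide_distrib)
    then show ?case using Suc energy_step[of N n] by (simp add: distrib_left)
  qed
  also have "\<dots> \<le> E0"
    unfolding E0_def using \<alpha>
    by (intro add_left_mono divide_right_mono integral_mono integrable_indicator F_int) (auto simp: indicator_def)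
  finally show ?thesis .
qed

lemma E0_nonneg: "0 \<le> E0"
  using energy[of 0 0] order_trans[OF zero_le_power2[of "H.nrm u0"]] by simp

lemma U_bound: "H.nrm (U N k) \<le> sqrt E0"
proof (rule real_le_rsqrt)
  have "0 \<le> (\<Sum>j<k. (H.nrm (U N (Suc j) - U N j))^2)" by (intro sum_nonneg) auto
  moreover have "0 \<le> \<tau> N * \<alpha> * (\<Sum>j<k. (V.nrm (U N (Suc j)))^2)"
    using \<tau>_pos[of N] \<alpha> by (intro mult_nonneg_nonneg sum_nonneg) auto
  ultimately show "(H.nrm (U N k))^2 \<le> E0" using energy[of N k] by linarith
qed

lemma W_bound: "H.nrm (W N k) \<le> sqrt E0"
  using U_bound E0_nonneg by (simp add: W_def)

lemma sum_V_bound: "\<tau> N * (\<Sum>k<n. (V.nrm (U N (Suc k)))^2) \<le> E0 / \<alpha>"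
proof -
  have "0 \<le> (\<Sum>j<n. (H.nrm (U N (Suc j) - U N j))^2)" by (intro sum_nonneg) auto
  then have "\<tau> N * \<alpha> * (\<Sum>k<n. (V.nrm (U N (Suc k)))^2) \<le> E0"
    using energy[of N n] zero_le_power2[of "H.nrm (U N n)"] by linarith
  then show ?thesis using \<alpha> by (simp add: field_simps)
qed

text \<open>Shifting the index by one turns the sum into a part of that for \<open>U\<close>,
  because \<open>W N 0\<close> is 0.\<close>

lemma sum_W_bound: "\<tau> N * (\<Sum>k<n. (V.nrm (W N k))^2) \<le> E0 / \<alpha>"
proof -
  have "(\<Sum>k<n. (V.nrm (W N k))^2) \<le> (\<Sum>k<n. (V.nrm (U N (Suc k)))^2)"
  proof (cases n)
    case (Suc m)
    have "(\<Sum>k<n. (V.nrm (W N k))^2) = (\<Sum>k<m. (V.nrm (U N (Suc k)))^2)"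
      unfolding Suc sum.lessThan_Suc_shift by (simp add: W_def)
    then show ?thesis using Suc by simp
  qed simp
  then have "\<tau> N * (\<Sum>k<n. (V.nrm (W N k))^2) \<le> \<tau> N * (\<Sum>k<n. (V.nrm (U N (Suc k)))^2)"
    using \<tau>_pos[of N] by (intro mult_left_mono) auto
  then show ?thesis using sum_V_bound by (rule order_trans)
qed

text \<open>For k > 0 the summand is a jump from the energy inequality. For k = 0 it is the whole
  value \<open>U N 1\<close>, as \<open>W N 0\<close> is 0; this accounts for the second
  \<open>E0\<close>.\<close>

lemma sum_diff_bound: "(\<Sum>k<n. (H.nrm (U N (Suc k) - W N k))^2) \<le> 2 * E0"
proof (cases n)
  case (Suc m)
  have "(\<Sum>k<n. (H.nrm (U N (Suc k) - W N k))^2)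
    = (H.nrm (U N (Suc 0)))^2 + (\<Sum>k<m. (H.nrm (U N (Suc (Suc k)) - U N (Suc k)))^2)"
    unfolding Suc sum.lessThan_Suc_shift by (simp add: W_def)
  moreover have "(\<Sum>k<m. (H.nrm (U N (Suc (Suc k)) - U N (Suc k)))^2) \<le> (\<Sum>k<n. (H.nrm (U N (Suc k) - U N k))^2)"
    unfolding Suc sum.lessThan_Suc_shift by simp
  moreover have "\<dots> \<le> E0"
  proof -
    have "0 \<le> \<tau> N * \<alpha> * (\<Sum>j<n. (V.nrm (U N (Suc j)))^2)"
      using \<tau>_pos[of N] \<alpha> by (intro mult_nonneg_nonneg sum_nonneg) auto
    then show ?thesis using energy[of N n] zero_le_power2[of "H.nrm (U N n)"] by linarith
  qed
  moreover have "(H.nrm (U N (Suc 0)))^2 \<le> (sqrt E0)^2"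
    using U_bound H.nrm_nonneg[OF U_H] by (rule power_mono)
  ultimately show ?thesis using E0_nonneg by simp
qed (simp add: E0_nonneg)

text \<open>Index of the right end of the cell containing t; rounding up matches the left-open cells
  of an implicit scheme.\<close>

definition \<kappa> :: "nat => real => nat" where "\<kappa> N t = nat \<lceil>t / \<tau> N\<rceil>"

lemma \<kappa>_Suc: "real k * \<tau> N < t ==> t \<le> real (Suc k) * \<tau> N ==> \<kappa> N t = Suc k"
proof -
  assume *: "real k * \<tau> N < t" "t \<le> real (Suc k) * \<tau> N"
  have "\<lceil>t / \<tau> N\<rceil> = int (Suc k)"
    by (rule ceiling_unique) (use * \<tau>_pos[of N] in \<open>auto simp: field_simps\<close>)
  then show ?thesis by (simp add: \<kappa>_def)
qed

lemma \<kappa>_bounds: assumes "0 < t"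
  shows "0 < \<kappa> N t" "t \<le> real (\<kappa> N t) * \<tau> N" "real (\<kappa> N t) * \<tau> N < t + \<tau> N"
proof -
  have p: "0 < t / \<tau> N" using assms \<tau>_pos[of N] by simp
  then show 0: "0 < \<kappa> N t" by (simp add: \<kappa>_def)
  have e: "real (\<kappa> N t) = of_int \<lceil>t / \<tau> N\<rceil>"
    using p unfolding \<kappa>_def by (simp add: less_imp_le order.strict_implies_order)
  show "t \<le> real (\<kappa> N t) * \<tau> N"
    using iffD1[OF pos_divide_le_eq[OF \<tau>_pos[of N]] le_of_int_ceiling[of "t / \<tau> N"]] unfolding e .
  have "of_int \<lceil>t / \<tau> N\<rceil> < t / \<tau> N + 1" by linarith
  then show "real (\<kappa> N t) * \<tau> N < t + \<tau> N"
    using \<tau>_pos[of N] unfolding e by (simp add: field_simps)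
qed

lemma \<kappa>_le: "t < T ==> \<kappa> N t \<le> Suc N"
proof -
  assume "t < T"
  moreover have "real (Suc N) * \<tau> N = T" by (simp add: \<tau>_def)
  ultimately have "t / \<tau> N < real (Suc N)" using \<tau>_pos[of N] by (simp add: pos_divide_less_eq)
  then have "\<lceil>t / \<tau> N\<rceil> \<le> int (Suc N)"
    by (intro ceiling_le) (metis less_imp_le of_int_of_nat_eq)
  then show ?thesis unfolding \<kappa>_def nat_le_iff .
qed

lemma simple_\<kappa>: "simple_function M (\<kappa> N)"
  unfolding simple_function_def
proof (intro conjI ballI)
  have "\<kappa> N ` space M \<subseteq> {..Suc N}" using \<kappa>_le by auto
  then show "finite (\<kappa> N ` space M)" by (rule finite_subset) simp
  fix x assume "x \<in> \<kappa> N ` space M"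
  then have "0 < x" using \<kappa>_bounds(1) by auto
  then obtain k where x: "x = Suc k" by (auto simp: gr0_conv_Suc)
  have "\<kappa> N -` {x} \<inter> space M = {0<..<T} \<inter> {real k * \<tau> N<..real (Suc k) * \<tau> N}"
  proof (intro set_eqI iffI)
    fix t assume t: "t \<in> \<kappa> N -` {x} \<inter> space M"
    then show "t \<in> {0<..<T} \<inter> {real k * \<tau> N<..real (Suc k) * \<tau> N}"
      using \<kappa>_bounds(2,3)[of t N] x by (auto simp: algebra_simps)
  qed (use \<kappa>_Suc x in auto)
  also have "\<dots> \<in> sets M" by (subst sets_restrict_space) auto
  finally show "\<kappa> N -` {x} \<inter> space M \<in> sets M" .
qed

text \<open>Extended by 0 outside the open interval so that all values lie in V, which the initial
  value \<open>U N 0\<close> need not do.\<close>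

definition un :: "nat => real => 'a" where
  "un N t = (if 0 < t \<and> t < T then U N (\<kappa> N t) else 0)"

text \<open>\<open>\<kappa> N t\<close> is positive for t > 0, so the subtraction on natural numbers
  is exact.\<close>

definition wn :: "nat => real => 'a" where
  "wn N t = (if 0 < t \<and> t < T then W N (\<kappa> N t - 1) else 0)"

lemma simple_un: "simple_function M (un N)" and simple_wn: "simple_function M (wn N)"
proof -
  have "simple_function M (\<lambda>t. U N (\<kappa> N t))" "simple_function M (\<lambda>t. W N (\<kappa> N t - 1))"
    by (rule simple_function_compose1[OF simple_\<kappa>])+
  moreover have "simple_function M (un N) = simple_function M (\<lambda>t. U N (\<kappa> N t))"
    "simple_function M (wn N) = simple_function M (\<lambda>t. W N (\<kappa> N t - 1))"
    by (auto intro!: simple_function_cong simp: un_def wn_def)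
  ultimately show "simple_function M (un N)" "simple_function M (wn N)" by auto
qed

lemma un_V: "un N t \<in> V"
  using \<kappa>_bounds(1)[of t N] by (auto simp: un_def gr0_conv_Suc U_V)

lemma wn_V: "wn N t \<in> V" by (simp add: wn_def W_V)

lemma un_bound: "H.nrm (un N t) \<le> sqrt E0" using U_bound E0_nonneg by (simp add: un_def)

lemma wn_bound: "H.nrm (wn N t) \<le> sqrt E0" using W_bound E0_nonneg by (simp add: wn_def)

lemma integral_\<kappa>: "(\<integral>t. g (\<kappa> N t) \<partial>M) = \<tau> N * (\<Sum>k<Suc N. g (Suc k) :: real)"
proof -
  have i: "integrable M (\<lambda>t. g (\<kappa> N t))"
    by (rule integrable_simple_function_real[OF finM simple_function_real_comp[OF simple_\<kappa>]])
  have "n \<le> Suc N ==> (\<integral>t. indicator {..real n * \<tau> N} t * g (\<kappa> N t) \<partial>M) = \<tau> N * (\<Sum>k<n. g (Suc k))" for n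
  proof (induction n)
    case 0
    have "(\<integral>t. indicator {..0::real} t * g (\<kappa> N t) \<partial>M) = (\<integral>t. 0 \<partial>M)"
      by (rule Bochner_Integration.integral_cong) (auto simp: indicator_def)
    then show ?case by simp
  next
    case (Suc n)
    let ?I = "indicator {real n * \<tau> N<..real (Suc n) * \<tau> N} :: real => real"
    have le: "real n * \<tau> N \<le> real (Suc n) * \<tau> N" using \<tau>_pos[of N] by simp
    have "real (Suc n) * \<tau> N \<le> real (Suc N) * \<tau> N"
      using Suc.prems \<tau>_pos[of N] by (intro mult_right_mono) auto
    also have "\<dots> = T" by (simp add: \<tau>_def)
    finally have leT: "real (Suc n) * \<tau> N \<le> T" .
    have "indicator {..real (Suc n) * \<tau> N} t * g (\<kappa> N t)
        = indicator {..real n * \<tau> N} t * g (\<kappa> N t) + ?I t * g (Suc n)" for t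
      using le \<kappa>_Suc[of n N t] by (auto simp: indicator_def)
    then have "(\<integral>t. indicator {..real (Suc n) * \<tau> N} t * g (\<kappa> N t) \<partial>M)
      = (\<integral>t. indicator {..real n * \<tau> N} t * g (\<kappa> N t) + ?I t * g (Suc n) \<partial>M)" by simp
    also have "\<dots> = (\<integral>t. indicator {..real n * \<tau> N} t * g (\<kappa> N t) \<partial>M) + (\<integral>t. ?I t * g (Suc n) \<partial>M)"
      by (intro Bochner_Integration.integral_add integrable_indicator i) (rule M.integrable_const)
    also have "(\<integral>t. ?I t * g (Suc n) \<partial>M) = (\<integral>t. ?I t \<partial>M) * g (Suc n)" by simp
    also have "(\<integral>t. ?I t \<partial>M) = real (Suc n) * \<tau> N - real n * \<tau> N"
      using \<tau>_pos[of N] by (intro measure_interval(1) le leT) auto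
    finally show ?case using Suc by (simp add: algebra_simps)
  qed
  from this[of "Suc N"] have "(\<integral>t. indicator {..T} t * g (\<kappa> N t) \<partial>M) = \<tau> N * (\<Sum>k<Suc N. g (Suc k))"
    by (simp add: \<tau>_def)
  moreover have "(\<integral>t. indicator {..T} t * g (\<kappa> N t) \<partial>M) = (\<integral>t. g (\<kappa> N t) \<partial>M)"
    by (rule Bochner_Integration.integral_cong) (auto simp: indicator_def)
  ultimately show ?thesis by simp
qed

lemma integral_un: "(\<integral>t. (V.nrm (un N t))^2 \<partial>M) \<le> E0 / \<alpha>"
proof -
  have "(\<integral>t. (V.nrm (un N t))^2 \<partial>M) = (\<integral>t. (V.nrm (U N (\<kappa> N t)))^2 \<partial>M)"
    by (rule Bochner_Integration.integral_cong) (auto simp: un_def)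
  then show ?thesis using sum_V_bound[of N "Suc N"] integral_\<kappa>[of "\<lambda>k. (V.nrm (U N k))^2" N] by simp
qed

lemma integral_wn: "(\<integral>t. (V.nrm (wn N t))^2 \<partial>M) \<le> E0 / \<alpha>"
proof -
  have "(\<integral>t. (V.nrm (wn N t))^2 \<partial>M) = (\<integral>t. (V.nrm (W N (\<kappa> N t - 1)))^2 \<partial>M)"
    by (rule Bochner_Integration.integral_cong) (auto simp: wn_def)
  then show ?thesis using sum_W_bound[of N "Suc N"] integral_\<kappa>[of "\<lambda>k. (V.nrm (W N (k - 1)))^2" N] by simp
qed

text \<open>The squared differences have a sum bounded independently of N and each cell has length
  \<open>\<tau> N\<close>, so the lagged step function has the same limit in L2(0,T;H).\<close>

lemma integral_un_wn: "(\<integral>t. (H.nrm (un N t - wn N t))^2 \<partial>M) \<le> 2 * E0 * \<tau> N"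
proof -
  have "(\<integral>t. (H.nrm (un N t - wn N t))^2 \<partial>M) = (\<integral>t. (H.nrm (U N (\<kappa> N t) - W N (\<kappa> N t - 1)))^2 \<partial>M)"
    by (rule Bochner_Integration.integral_cong) (auto simp: un_def wn_def)
  also have "\<dots> = \<tau> N * (\<Sum>k<Suc N. (H.nrm (U N (Suc k) - W N k))^2)"
    using integral_\<kappa>[of "\<lambda>k. (H.nrm (U N k - W N (k - 1)))^2" N] by simp
  also have "\<dots> \<le> \<tau> N * (2 * E0)"
    using sum_diff_bound[where n = "Suc N"] \<tau>_pos[of N] by (intro mult_left_mono) auto
  finally show ?thesis by (simp add: mult_ac)
qed

section \<open>The integrated equation and equicontinuity in time\<close>

text \<open>A density for the increments of the scheme: its integral over a cell is the change of
  \<open>ipH (U N k) v\<close>, because \<open>f\<close> is integrated there and the other terms are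
  constant.\<close>

definition R :: "nat => 'a => real => real" where
  "R N v s = f s v - a (un N s) v - b (wn N s) (un N s) v"

text \<open>Bounds the norm of \<open>R N v s\<close> as a functional of v. Only first powers of
  V-norms occur, since the H-norms are replaced by the energy bound; this is what makes it square
  integrable in time.\<close>

definition maj :: "nat => real => real" where
  "maj N s = F s + Ca * V.nrm (un N s) + Cb * sqrt E0 * (V.nrm (un N s) + V.nrm (wn N s))"

text \<open>The factors 3 come from the square of a sum of three terms. In 12 one further factor 2
  splits the square of a sum of two V-norms, and another counts the integrals of \<open>un\<close>
  and \<open>wn\<close>.\<close>

definition K0 :: real where "K0 = 3 * (\<integral>s. (F s)^2 \<partial>M) + 3 * Ca^2 * (E0 / \<alpha>) + 12 * Cb^2 * E0 * (E0 / \<alpha>)"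

lemma simple_pair: "simple_function M (\<lambda>s. g (wn N s) (un N s) :: real)"
  by (rule simple_function_compose2[OF simple_wn simple_un])

lemma pair_integrable: "integrable M (\<lambda>s. g (wn N s) (un N s) :: real)"
  by (rule integrable_simple_function_real[OF finM simple_pair])

lemma pair_measurable: "(\<lambda>s. g (wn N s) (un N s) :: real) \<in> borel_measurable M"
  by (rule borel_measurable_integrable[OF pair_integrable])

lemma R_integrable: "v \<in> V ==> integrable M (R N v)"
  unfolding R_def using pair_integrable[of "\<lambda>w u. a u v" N] pair_integrable[of "\<lambda>w u. b w u v" N] f_integrable
  by auto

text \<open>Skewness moves the test element into the middle slot, where only its V-norm counts and
  geometric means are left for u and w. Their H-parts are bounded by the energy, and the root of the
  product of the V-norms is at most their sum.\<close>

lemma b_majorant: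
  assumes "w \<in> V" "u \<in> V" "v \<in> V" and "H.nrm w \<le> sqrt E0" "H.nrm u \<le> sqrt E0"
  shows "\<bar>b w u v\<bar> \<le> Cb * sqrt E0 * (V.nrm u + V.nrm w) * V.nrm v"
proof -
  have nn: "0 \<le> H.nrm w" "0 \<le> H.nrm u" "0 \<le> V.nrm w" "0 \<le> V.nrm u" "0 \<le> V.nrm v"
    using assms VH V.nrm_nonneg H.nrm_nonneg by auto
  have "\<bar>b w u v\<bar> \<le> Cb * sqrt (H.nrm w * V.nrm w) * sqrt (H.nrm u * V.nrm u) * V.nrm v"
    using b_bound[OF assms(1,3,2)] b_skew[OF assms(1-3)] by simp
  also have "\<dots> = Cb * (sqrt (H.nrm w * H.nrm u) * sqrt (V.nrm w * V.nrm u)) * V.nrm v"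
    by (simp add: real_sqrt_mult mult_ac)
  also have "\<dots> \<le> Cb * (sqrt E0 * (V.nrm w + V.nrm u)) * V.nrm v"
  proof -
    have e: "0 \<le> sqrt E0" using E0_nonneg by simp
    have "H.nrm w * H.nrm u \<le> sqrt E0 * sqrt E0" using assms(4,5) nn e by (intro mult_mono)
    then have 1: "sqrt (H.nrm w * H.nrm u) \<le> sqrt E0" using E0_nonneg by simp
    have 2: "sqrt (V.nrm w * V.nrm u) \<le> V.nrm w + V.nrm u" using nn by (intro sqrt_mult_le_add)
    have "sqrt (H.nrm w * H.nrm u) * sqrt (V.nrm w * V.nrm u) \<le> sqrt E0 * (V.nrm w + V.nrm u)"
      using nn by (intro mult_mono 1 2 e) simp
    then show ?thesis using nn Cb by (intro mult_right_mono mult_left_mono)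
  qed
  finally show ?thesis by (simp add: mult_ac add_ac)
qed

lemma R_bound: assumes "v \<in> V" shows "\<bar>R N v s\<bar> \<le> maj N s * V.nrm v"
proof -
  have "\<bar>f s v\<bar> \<le> F s * V.nrm v" "\<bar>a (un N s) v\<bar> \<le> Ca * V.nrm (un N s) * V.nrm v"
    "\<bar>b (wn N s) (un N s) v\<bar> \<le> Cb * sqrt E0 * (V.nrm (un N s) + V.nrm (wn N s)) * V.nrm v"
    using f_bound a_bound b_majorant assms un_V wn_V un_bound wn_bound by auto
  then show ?thesis by (simp add: R_def maj_def distrib_right)
qed

lemma maj_measurable [measurable]: "maj N \<in> borel_measurable M"
proof -
  have "(\<lambda>s. Ca * V.nrm (un N s) + Cb * sqrt E0 * (V.nrm (un N s) + V.nrm (wn N s))) \<in> borel_measurable M"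
    by (rule pair_measurable[of "\<lambda>w u. Ca * V.nrm u + Cb * sqrt E0 * (V.nrm u + V.nrm w)"])
  then have "(\<lambda>s. F s + (Ca * V.nrm (un N s) + Cb * sqrt E0 * (V.nrm (un N s) + V.nrm (wn N s)))) \<in> borel_measurable M"
    using F_meas by (rule borel_measurable_add[rotated])
  then show ?thesis unfolding maj_def[abs_def] by (simp add: add.assoc)
qed

lemma maj_sq: "integrable M (\<lambda>s. (maj N s)^2)" "(\<integral>s. (maj N s)^2 \<partial>M) \<le> K0"
proof -
  define h where "h s = 3 * (F s)^2 + (3 * Ca^2 * (V.nrm (un N s))^2
    + (6 * Cb^2 * E0 * (V.nrm (un N s))^2 + 6 * Cb^2 * E0 * (V.nrm (wn N s))^2))" for s
  have iu: "integrable M (\<lambda>s. c * (V.nrm (un N s))^2)" "integrable M (\<lambda>s. c * (V.nrm (wn N s))^2)" for c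
    by (rule pair_integrable[of "\<lambda>w u. c * (V.nrm u)^2"], rule pair_integrable[of "\<lambda>w u. c * (V.nrm w)^2"])
  have ih: "integrable M h"
    unfolding h_def by (intro Bochner_Integration.integrable_add iu) (use F_int in simp)
  have le: "(maj N s)^2 \<le> h s" for s
  proof -
    have "(maj N s)^2 \<le> 3 * (F s)^2 + 3 * (Ca * V.nrm (un N s))^2 + 3 * (Cb * sqrt E0 * (V.nrm (un N s) + V.nrm (wn N s)))^2"
      unfolding maj_def by (rule sum3_sq_le)
    also have "(Cb * sqrt E0 * (V.nrm (un N s) + V.nrm (wn N s)))^2 = Cb^2 * E0 * (V.nrm (un N s) + V.nrm (wn N s))^2"
      using E0_nonneg by (simp add: power_mult_distrib)
    also have "\<dots> \<le> Cb^2 * E0 * (2 * (V.nrm (un N s))^2 + 2 * (V.nrm (wn N s))^2)"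
      using E0_nonneg by (intro mult_left_mono sum2_sq_le) auto
    finally show ?thesis by (simp add: h_def power_mult_distrib algebra_simps)
  qed
  show i: "integrable M (\<lambda>s. (maj N s)^2)"
    by (rule Bochner_Integration.integrable_bound[OF ih]) (use le in \<open>auto intro: order_trans abs_ge_self\<close>)
  have "(\<integral>s. (maj N s)^2 \<partial>M) \<le> (\<integral>s. h s \<partial>M)" by (rule integral_mono[OF i ih le])
  also have "\<dots> = 3 * (\<integral>s. (F s)^2 \<partial>M) + (3 * Ca^2 * (\<integral>s. (V.nrm (un N s))^2 \<partial>M)
    + (6 * Cb^2 * E0 * (\<integral>s. (V.nrm (un N s))^2 \<partial>M) + 6 * Cb^2 * E0 * (\<integral>s. (V.nrm (wn N s))^2 \<partial>M)))"
  proof -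
    have i3: "integrable M (\<lambda>s. 3 * (F s)^2)" using F_int by simp
    show ?thesis unfolding h_def
      by (subst Bochner_Integration.integral_add, (intro i3 iu Bochner_Integration.integrable_add)+)+ simp
  qed
  also have "\<dots> \<le> 3 * (\<integral>s. (F s)^2 \<partial>M) + (3 * Ca^2 * (E0 / \<alpha>)
    + (6 * Cb^2 * E0 * (E0 / \<alpha>) + 6 * Cb^2 * E0 * (E0 / \<alpha>)))"
    using E0_nonneg by (intro add_mono mult_left_mono integral_un integral_wn) auto
  finally show "(\<integral>s. (maj N s)^2 \<partial>M) \<le> K0" by (simp add: K0_def)
qed

lemma K0_nonneg: "0 \<le> K0"
  using maj_sq(2)[of 0] by (meson Bochner_Integration.integral_nonneg order_trans zero_le_power2)

lemma indicator_maj: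
  assumes "x \<le> y" shows "(\<integral>s. indicator {x<..y} s * maj N s \<partial>M) \<le> sqrt (y - x) * sqrt K0"
proof -
  have "(\<integral>s. indicator {x<..y} s * maj N s \<partial>M)
    \<le> sqrt (\<integral>s. (indicator {x<..y} s)^2 \<partial>M) * sqrt (\<integral>s. (maj N s)^2 \<partial>M)"
  proof (rule integral_CS)
    show "integrable M (\<lambda>s. (indicator {x<..y} s :: real)^2)"
    proof -
      have "(\<lambda>s. (indicator {x<..y} s :: real)^2) = (\<lambda>s. indicator {x<..y} s * 1)"
        by (auto simp: indicator_def)
      then show ?thesis using integrable_indicator(1)[OF M.integrable_const[of 1], of x y] by simp
    qed
  qed (auto simp: maj_sq)
  also have "\<dots> \<le> sqrt (y - x) * sqrt K0"
  proof (intro mult_mono real_sqrt_le_mono maj_sq)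
    have "(indicator {x<..y} s :: real)^2 = indicator {x<..y} s" for s :: real by (simp add: indicator_def)
    then show "(\<integral>s. (indicator {x<..y} s)^2 \<partial>M) \<le> y - x" using measure_interval(2)[OF assms] by simp
  qed (use assms in auto)
  finally show ?thesis .
qed

text \<open>Cauchy-Schwarz in time gives a Hoelder modulus with exponent 1/2 that is uniform in
  N.\<close>

lemma R_indicator_bound:
  assumes "v \<in> V" "x \<le> y"
  shows "\<bar>\<integral>s. indicator {x<..y} s * R N v s \<partial>M\<bar> \<le> sqrt (y - x) * sqrt K0 * V.nrm v"
proof -
  have im: "integrable M (maj N)" by (rule integrable_square_imp[OF finM maj_measurable maj_sq(1)])
  have "\<bar>\<integral>s. indicator {x<..y} s * R N v s \<partial>M\<bar> \<le> (\<integral>s. \<bar>indicator {x<..y} s * R N v s\<bar> \<partial>M)"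
    by (rule integral_abs_bound)
  also have "\<dots> \<le> (\<integral>s. indicator {x<..y} s * maj N s * V.nrm v \<partial>M)"
  proof (rule integral_mono)
    show "integrable M (\<lambda>s. \<bar>indicator {x<..y} s * R N v s\<bar>)"
      by (intro integrable_abs integrable_indicator R_integrable assms)
    show "integrable M (\<lambda>s. indicator {x<..y} s * maj N s * V.nrm v)"
      by (intro integrable_mult_left integrable_indicator im)
    show "\<bar>indicator {x<..y} s * R N v s\<bar> \<le> indicator {x<..y} s * maj N s * V.nrm v" for s
      using R_bound[OF assms(1), of N s] by (auto simp: indicator_def)
  qed
  also have "\<dots> = (\<integral>s. indicator {x<..y} s * maj N s \<partial>M) * V.nrm v" by simp
  also have "\<dots> \<le> sqrt (y - x) * sqrt K0 * V.nrm v"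
    by (intro mult_right_mono indicator_maj assms V.nrm_nonneg)
  finally show ?thesis .
qed

lemma indicator_split: "x \<le> y ==> indicator {..y} s = indicator {..x} s + (indicator {x<..y} s :: real)" for s :: real
  by (auto simp: indicator_def)

lemma integral_indicator_split:
  fixes g :: "real => real"
  assumes "integrable M g" "x \<le> y"
  shows "(\<integral>s. indicator {..y} s * g s \<partial>M) = (\<integral>s. indicator {..x} s * g s \<partial>M) + (\<integral>s. indicator {x<..y} s * g s \<partial>M)"
  unfolding indicator_split[OF assms(2)] distrib_right
  by (rule Bochner_Integration.integral_add) (intro integrable_indicator assms)+

lemma integrated_step:
  assumes v: "v \<in> V" and "n \<le> Suc N"
  shows "ipH (U N n) v = ipH u0 v + (\<integral>s. indicator {..real n * \<tau> N} s * R N v s \<partial>M)"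
  using assms(2)
proof (induction n)
  case 0
  have "(\<integral>s. indicator {..0::real} s * R N v s \<partial>M) = (\<integral>s. 0 \<partial>M)"
    by (rule Bochner_Integration.integral_cong) (auto simp: indicator_def)
  then show ?case by simp
next
  case (Suc n)
  let ?I = "indicator {real n * \<tau> N<..real (Suc n) * \<tau> N} :: real => real"
  let ?c = "a (U N (Suc n)) v + b (W N n) (U N (Suc n)) v"
  have le: "real n * \<tau> N \<le> real (Suc n) * \<tau> N" using \<tau>_pos[of N] by simp
  have "real (Suc n) * \<tau> N \<le> real (Suc N) * \<tau> N"
    using Suc.prems \<tau>_pos[of N] by (intro mult_right_mono) auto
  also have "\<dots> = T" by (simp add: \<tau>_def)
  finally have leT: "real (Suc n) * \<tau> N \<le> T" .
  have n0: "0 \<le> real n * \<tau> N" using \<tau>_pos[of N] by simp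
  have i1: "integrable M (\<lambda>s. ?I s * ?c)" by (rule integrable_indicator(1)[OF M.integrable_const])
  have "(\<integral>s. ?I s * R N v s \<partial>M) = (\<integral>s. ?I s * f s v - ?I s * ?c \<partial>M)"
  proof (rule Bochner_Integration.integral_cong)
    fix s assume "s \<in> space M"
    then show "?I s * R N v s = ?I s * f s v - ?I s * ?c"
      using \<kappa>_Suc[of n N s] by (auto simp: indicator_def R_def un_def wn_def)
  qed simp
  also have "\<dots> = load N n v - (\<integral>s. ?I s * ?c \<partial>M)"
    unfolding load_def by (rule Bochner_Integration.integral_diff[OF integrable_indicator(1)[OF f_integrable[OF v]] i1])
  also have "(\<integral>s. ?I s * ?c \<partial>M) = (\<integral>s. ?I s \<partial>M) * ?c" by (rule integral_mult_left_zero)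
  also have "(\<integral>s. ?I s \<partial>M) = real (Suc n) * \<tau> N - real n * \<tau> N"
    by (rule measure_interval(1)[OF n0 le leT])
  also have "\<dots> = \<tau> N" by (simp add: algebra_simps)
  finally have "(\<integral>s. ?I s * R N v s \<partial>M) = ipH (U N (Suc n)) v - ipH (U N n) v"
    using U_eq[OF v, of N n] by simp
  then show ?case
    using Suc integral_indicator_split[OF R_integrable[OF v] le, of N] by simp
qed

lemma integrated_un:
  assumes "v \<in> V" "0 < t" "t < T"
  shows "ipH (un N t) v = ipH u0 v + (\<integral>s. indicator {..real (\<kappa> N t) * \<tau> N} s * R N v s \<partial>M)"
  using integrated_step[OF assms(1) \<kappa>_le[OF assms(3)]] assms by (simp add: un_def)

text \<open>The nodes assigned to t and q are less than |t - q| + \<open>\<tau> N\<close> apart. The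
  extra step length reflects the jumps of \<open>un\<close> and disappears in the limit.\<close>

lemma equicontinuity:
  assumes v: "v \<in> V" and "0 < t" "t < T" "0 < q" "q < T"
  shows "\<bar>ipH (un N t) v - ipH (un N q) v\<bar> \<le> sqrt (\<bar>t - q\<bar> + \<tau> N) * sqrt K0 * V.nrm v"
  using assms(2-)
proof (induction t q rule: linorder_wlog)
  case (sym t q)
  then show ?case by (simp add: abs_minus_commute)
next
  case (le t q)
  have k: "real (\<kappa> N t) * \<tau> N \<le> real (\<kappa> N q) * \<tau> N"
    using le \<tau>_pos[of N] unfolding \<kappa>_def
    by (intro mult_right_mono) (auto intro!: nat_mono ceiling_mono divide_right_mono)
  have "ipH (un N q) v - ipH (un N t) v
    = (\<integral>s. indicator {real (\<kappa> N t) * \<tau> N<..real (\<kappa> N q) * \<tau> N} s * R N v s \<partial>M)"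
    using le integrated_un[OF v] integral_indicator_split[OF R_integrable[OF v] k, of N] by simp
  then have "\<bar>ipH (un N q) v - ipH (un N t) v\<bar> \<le> sqrt (real (\<kappa> N q) * \<tau> N - real (\<kappa> N t) * \<tau> N) * sqrt K0 * V.nrm v"
    using R_indicator_bound[OF v k] by simp
  also have "\<dots> \<le> sqrt (\<bar>t - q\<bar> + \<tau> N) * sqrt K0 * V.nrm v"
    using \<kappa>_bounds(2)[of t N] \<kappa>_bounds(3)[of q N] le K0_nonneg V.nrm_nonneg[OF v]
    by (intro mult_right_mono) auto
  finally show ?case by (simp add: abs_minus_commute)
qed

text \<open>Arbitrary functions of simple functions are simple, so every real expression in the
  values of such y is integrable without a separate measurability argument. All approximations lie
  in this set.\<close>

definition S :: "(real => 'a) set" where "S = {y. simple_function M y \<and> (\<forall>t. y t \<in> V)}"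

lemma S_V: "y \<in> S ==> y t \<in> V" by (simp add: S_def)

lemma S_H: "y \<in> S ==> y t \<in> H" by (simp add: S_V VH)

lemma S_comp2_integrable: "y \<in> S ==> z \<in> S ==> integrable M (\<lambda>t. g (y t) (z t) :: real)"
  by (rule integrable_simple_function_real[OF finM simple_function_compose2]) (auto simp: S_def)

lemma S_comp_integrable: "y \<in> S ==> integrable M (\<lambda>t. g (y t) :: real)"
  by (rule S_comp2_integrable[of y y "\<lambda>u v. g u"])

lemma subspace_S: "subspace S"
  unfolding subspace_def
proof (intro conjI ballI allI)
  show "0 \<in> S" by (simp add: S_def zero_fun_def)
  fix y z :: "real => 'a" and c :: real
  assume y: "y \<in> S"
  then show "c *\<^sub>R y \<in> S" using simple_function_compose1[of M y "scaleR c"] by (simp add: S_def scaleR_fun_def)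
  assume z: "z \<in> S"
  show "y + z \<in> S" using y z simple_function_compose2[of M y z "(+)"] by (simp add: S_def plus_fun_def)
qed

text \<open>The seminorm of L2(0,T;V) on step functions. Completeness is not claimed here; limits
  are built pointwise in \<open>strong_limit\<close>.\<close>

sublocale VT: semi_ip S "\<lambda>y z. \<integral>t. ipV (y t) (z t) \<partial>M"
proof
  fix y z w :: "real => 'a" and c :: real
  assume y: "y \<in> S" and z: "z \<in> S"
  show "(\<integral>t. ipV (y t) (z t) \<partial>M) = (\<integral>t. ipV (z t) (y t) \<partial>M)"
    using y z by (simp add: V.ip_sym S_V)
  show "(\<integral>t. ipV ((c *\<^sub>R y) t) (z t) \<partial>M) = c * (\<integral>t. ipV (y t) (z t) \<partial>M)"
    using y z by (simp add: V.ip_simps S_V)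
  show "0 \<le> (\<integral>t. ipV (y t) (y t) \<partial>M)"
    using y by (simp add: V.ip_nonneg S_V)
  assume w: "w \<in> S"
  show "(\<integral>t. ipV ((y + z) t) (w t) \<partial>M) = (\<integral>t. ipV (y t) (w t) \<partial>M) + (\<integral>t. ipV (z t) (w t) \<partial>M)"
    using y z w by (simp add: V.ip_simps S_V S_comp2_integrable)
qed (rule subspace_S)

sublocale HT: semi_ip S "\<lambda>y z. \<integral>t. ipH (y t) (z t) \<partial>M"
proof
  fix y z w :: "real => 'a" and c :: real
  assume y: "y \<in> S" and z: "z \<in> S"
  show "(\<integral>t. ipH (y t) (z t) \<partial>M) = (\<integral>t. ipH (z t) (y t) \<partial>M)"
    using y z by (simp add: H.ip_sym S_H)
  show "(\<integral>t. ipH ((c *\<^sub>R y) t) (z t) \<partial>M) = c * (\<integral>t. ipH (y t) (z t) \<partial>M)"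
    using y z by (simp add: H.ip_simps S_H)
  show "0 \<le> (\<integral>t. ipH (y t) (y t) \<partial>M)"
    using y by (simp add: H.ip_nonneg S_H)
  assume w: "w \<in> S"
  show "(\<integral>t. ipH ((y + z) t) (w t) \<partial>M) = (\<integral>t. ipH (y t) (w t) \<partial>M) + (\<integral>t. ipH (z t) (w t) \<partial>M)"
    using y z w by (simp add: H.ip_simps S_H S_comp2_integrable)
qed (rule subspace_S)

lemma VT_nrm_sq: "y \<in> S ==> (VT.nrm y)^2 = (\<integral>t. (V.nrm (y t))^2 \<partial>M)"
  by (simp add: VT.nrm_sq V.nrm_sq S_V)

lemma HT_nrm_sq: "y \<in> S ==> (HT.nrm y)^2 = (\<integral>t. (H.nrm (y t))^2 \<partial>M)"
  by (simp add: HT.nrm_sq H.nrm_sq S_H)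

lemma un_S: "un N \<in> S" by (simp add: S_def simple_un un_V)

lemma wn_S: "wn N \<in> S" by (simp add: S_def simple_wn wn_V)

section \<open>Compactness of the approximations\<close>

text \<open>Normalised counterexamples for growing m are bounded in V, hence Cauchy in H along a
  subsequence, while their pairings with every d j tend to 0. This is incompatible with norm 1.
  Restricting x to the span of the d j makes these pairings determine the limit.\<close>

lemma ehrling:
  assumes d: "\<And>j::nat. d j \<in> V" and \<epsilon>: "0 < \<epsilon>"
  shows "\<exists>m. \<forall>x\<in>span (range d). (H.nrm x)^2 \<le> real m * (\<Sum>j<m. (ipH x (d j))^2) + \<epsilon> * (V.nrm x)^2"
proof (rule ccontr)
  assume "\<not> ?thesis"
  then have "\<forall>m. \<exists>x\<in>span (range d). (H.nrm x)^2 > real m * (\<Sum>j<m. (ipH x (d j))^2) + \<epsilon> * (V.nrm x)^2"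
    by (auto simp: not_le)
  then obtain x where x: "\<And>m. x m \<in> span (range d)"
    "\<And>m. (H.nrm (x m))^2 > real m * (\<Sum>j<m. (ipH (x m) (d j))^2) + \<epsilon> * (V.nrm (x m))^2"
    by metis
  have sV: "z \<in> V" if "z \<in> span (range d)" for z
    using that span_minimal[OF _ V.sub, of "range d"] d by auto
  have s0: "0 \<le> real m * (\<Sum>j<m. (ipH z (d j))^2)" for m z by (intro mult_nonneg_nonneg sum_nonneg) auto
  have pos: "0 < H.nrm (x m)" for m
  proof -
    have "0 < (H.nrm (x m))^2" using x(2)[of m] s0[of m "x m"] \<epsilon>
      by (smt (verit) mult_nonneg_nonneg zero_le_power2)
    then show ?thesis using H.nrm_nonneg[OF VH[OF sV[OF x(1)]], of m] by (auto simp: less_le)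
  qed
  define y where "y m = (1 / H.nrm (x m)) *\<^sub>R x m" for m
  have ys: "y m \<in> span (range d)" for m unfolding y_def using x(1) by (intro span_scale)
  have yV: "y m \<in> V" for m by (rule sV[OF ys])
  have yH: "y m \<in> H" for m by (rule VH[OF yV])
  have y1: "H.nrm (y m) = 1" for m
    using pos[of m] x(1)[of m] by (simp add: y_def H.nrm_scale VH sV)
  have y2: "real m * (\<Sum>j<m. (ipH (y m) (d j))^2) + \<epsilon> * (V.nrm (y m))^2 < 1" for m
  proof -
    define c where "c = 1 / H.nrm (x m)"
    have c: "0 < c" "c * H.nrm (x m) = 1" using pos[of m] by (auto simp: c_def)
    have "real m * (\<Sum>j<m. (ipH (y m) (d j))^2) + \<epsilon> * (V.nrm (y m))^2
       = c^2 * (real m * (\<Sum>j<m. (ipH (x m) (d j))^2) + \<epsilon> * (V.nrm (x m))^2)"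
    proof -
      have "(ipH (y m) (d j))^2 = c^2 * (ipH (x m) (d j))^2" for j
        using x(1)[of m] d by (simp add: y_def c_def[symmetric] H.ip_simps VH sV power_mult_distrib)
      moreover have "(V.nrm (y m))^2 = c^2 * (V.nrm (x m))^2"
        using x(1)[of m] by (simp add: y_def c_def[symmetric] V.nrm_scale sV power_mult_distrib)
      ultimately show ?thesis
        by (simp add: sum_distrib_left[symmetric] distrib_left mult.left_commute)
    qed
    also have "\<dots> < c^2 * (H.nrm (x m))^2" using x(2)[of m] c by (intro mult_strict_left_mono) auto
    also have "\<dots> = 1" using c by (metis power_mult_distrib power_one)
    finally show ?thesis .
  qed
  have yb: "V.nrm (y m) \<le> sqrt (1 / \<epsilon>)" for m
  proof (rule real_le_rsqrt)
    have "\<epsilon> * (V.nrm (y m))^2 \<le> 1" using y2[of m] s0[of m "y m"] by linarith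
    then show "(V.nrm (y m))^2 \<le> 1 / \<epsilon>" using \<epsilon> by (simp add: field_simps)
  qed
  obtain r where r: "strict_mono r" "H.Cauchy_seq (y \<circ> r)" using compact[of y "sqrt (1 / \<epsilon>)", OF yV yb] by auto
  have lim: "z \<in> H \<and> (\<lambda>n. ipH (y n) z) \<longlonglongrightarrow> 0" if "z \<in> span (range d)" for z
    using that
  proof (induction rule: span_induct_alt)
    case base
    then show ?case using yH by simp
  next
    case (step c x z)
    then obtain j where j: "x = d j" by auto
    have "(\<lambda>n. (ipH (y n) (d j))^2) \<longlonglongrightarrow> 0"
    proof (rule tendsto_sandwich[OF _ _ tendsto_const lim_1_over_n])
      show "\<forall>\<^sub>F n in sequentially. (ipH (y n) (d j))^2 \<le> 1 / real n"
        unfolding eventually_sequentially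
      proof (intro exI allI impI)
        fix n assume n: "Suc j \<le> n"
        have "(ipH (y n) (d j))^2 \<le> (\<Sum>j<n. (ipH (y n) (d j))^2)"
          using n by (intro member_le_sum) auto
        then have "real n * (ipH (y n) (d j))^2 \<le> real n * (\<Sum>j<n. (ipH (y n) (d j))^2)"
          by (intro mult_left_mono) auto
        moreover have "0 \<le> \<epsilon> * (V.nrm (y n))^2" using \<epsilon> by simp
        ultimately have "real n * (ipH (y n) (d j))^2 \<le> 1" using y2[of n] by linarith
        then show "(ipH (y n) (d j))^2 \<le> 1 / real n" using n by (simp add: field_simps)
      qed
    qed simp
    then have "(\<lambda>n. ipH (y n) (d j)) \<longlonglongrightarrow> 0" by (simp add: power_tendsto_0_iff)
    then have "(\<lambda>n. c * ipH (y n) (d j) + ipH (y n) z) \<longlonglongrightarrow> c * 0 + 0"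
      using step by (intro tendsto_intros) auto
    moreover have "z \<in> H" "d j \<in> H" using step(2) VH d by auto
    ultimately show ?case using yH by (simp add: j H.ip_simps)
  qed
  \<comment> \<open>No limit is taken in H, whose completeness is not assumed:
    \<open>y (r N)\<close> itself lies in the span, so pairings with it tend to 0, yet closeness to
    it keeps them at least 1/2.\<close>
  obtain N where N: "\<And>m n. m \<ge> N ==> n \<ge> N ==> H.nrm (y (r m) - y (r n)) < 1/2"
    using r(2)[unfolded H.Cauchy_seq_def comp_def, rule_format, of "1/2"] by auto
  have "1/2 \<le> ipH (y (r m)) (y (r N))" if m: "m \<ge> N" for m
  proof -
    have "1 = ipH (y (r m)) (y (r m))" using y1[of "r m"] H.nrm_sq[OF yH, of "r m"] by simp
    also have "\<dots> = ipH (y (r m)) (y (r m) - y (r N)) + ipH (y (r m)) (y (r N))"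
      using yH by (simp add: H.ip_simps)
    also have "ipH (y (r m)) (y (r m) - y (r N)) \<le> H.nrm (y (r m)) * H.nrm (y (r m) - y (r N))"
      using yH by (intro H.CS') auto
    also have "\<dots> \<le> 1/2" using N[OF m order_refl] y1 by simp
    finally show ?thesis by simp
  qed
  moreover have "(\<lambda>m. ipH (y (r m)) (y (r N))) \<longlonglongrightarrow> 0"
    using LIMSEQ_subseq_LIMSEQ[OF conjunct2[OF lim[OF ys[of "r N"]]] r(1)] by (simp add: comp_def)
  ultimately have "1/2 \<le> (0::real)" using LIMSEQ_le_const by blast
  then show False by simp
qed

lemma tau_tendsto: "\<tau> \<longlonglongrightarrow> 0"
  unfolding \<tau>_def by (rule LIMSEQ_Suc[OF lim_const_over_n])

text \<open>One sequence through the values of all schemes at once. \<open>Suc\<close> skips the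
  initial values, which need not lie in V.\<close>

definition node :: "nat => 'a" where
  "node j = U (fst (prod_decode j)) (Suc (snd (prod_decode j)))"

lemma node_V: "node j \<in> V" by (simp add: node_def U_V)

lemma un_span: "un N t \<in> span (range node)"
proof (cases "0 < t \<and> t < T")
  case True
  then obtain k where "\<kappa> N t = Suc k" using \<kappa>_bounds(1)[of t N] by (auto simp: gr0_conv_Suc)
  then have "un N t = node (prod_encode (N, k))" using True by (simp add: un_def node_def)
  then show ?thesis by (auto intro: span_base)
next
  case False
  then show ?thesis by (auto simp: un_def span_zero)
qed

lemma un_node_bound: "\<bar>ipH (un N t) (node j)\<bar> \<le> E0"
proof -
  have "\<bar>ipH (un N t) (node j)\<bar> \<le> H.nrm (un N t) * H.nrm (node j)"
    by (intro H.CS VH un_V node_V)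
  also have "\<dots> \<le> sqrt E0 * sqrt E0"
    using un_bound[of N t] U_bound H.nrm_nonneg[OF VH[OF un_V]] H.nrm_nonneg[OF VH[OF node_V]] E0_nonneg
    by (intro mult_mono) (auto simp: node_def)
  finally show ?thesis using E0_nonneg by simp
qed

text \<open>The Arzela-Ascoli argument for functions that are equicontinuous only up to the step
  length: a diagonal sequence handles rational times and all nodes, and the modulus carries
  convergence to every t because the step length tends to 0.\<close>

lemma weak_subsequence:
  obtains r where "strict_mono (r :: nat => nat)"
    "\<And>t j. 0 < t ==> t < T ==> convergent (\<lambda>n. ipH (un (r n) t) (node j))"
proof -
  define Q where "Q = ((\<rat> \<inter> {0<..<T}) \<times> (UNIV :: nat set))"
  have "countable Q" unfolding Q_def by (intro countable_SIGMA countable_Int1 countable_rat) auto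
  then obtain r :: "nat => nat" where r: "strict_mono r"
    "\<And>x. x \<in> Q ==> \<exists>l. (\<lambda>n. ipH (un (r n) (fst x)) (node (snd x))) \<longlonglongrightarrow> l"
    by (rule function_convergent_subsequence[where f = "\<lambda>n x. ipH (un n (fst x)) (node (snd x))" and M = E0])
      (use un_node_bound in auto)
  have "convergent (\<lambda>n. ipH (un (r n) t) (node j))" if t: "0 < t" "t < T" for t j
    unfolding Cauchy_convergent_iff[symmetric]
  proof (rule CauchyI)
    fix e :: real assume e: "0 < e"
    define C where "C = sqrt K0 * V.nrm (node j) + 1"
    have C: "0 < C" using K0_nonneg V.nrm_nonneg[OF node_V, of j]
      by (auto simp: C_def intro!: add_nonneg_pos)
    \<comment> \<open>Chosen so that sqrt (2 \<delta>) = e / (3 C), which controls the modulus once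
      |t - q| and the step length are both below \<delta>.\<close>
    define \<delta> where "\<delta> = (e / (3 * C))^2 / 2"
    have \<delta>: "0 < \<delta>" using e C by (simp add: \<delta>_def)
    \<comment> \<open>A rational time to the left of t stays inside the interval.\<close>
    have "max 0 (t - \<delta>) < t" using t \<delta> by auto
    then obtain q where q: "q \<in> \<rat>" "max 0 (t - \<delta>) < q" "q < t" using Rats_dense_in_real by blast
    have near: "\<bar>t - q\<bar> < \<delta>" "0 < q" "q < T" using q t by auto
    have "(\<lambda>n. \<tau> (r n)) \<longlonglongrightarrow> 0" using LIMSEQ_subseq_LIMSEQ[OF tau_tendsto r(1)] by (simp add: comp_def)
    then obtain N1 where N1: "\<And>n. n \<ge> N1 ==> \<tau> (r n) < \<delta>"
      using order_tendstoD(2)[of _ 0 sequentially \<delta>] \<delta> by (auto simp: eventually_sequentially)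
    have "(q, j) \<in> Q" using q near by (simp add: Q_def)
    then have "Cauchy (\<lambda>n. ipH (un (r n) q) (node j))" using r(2)[of "(q, j)"] LIMSEQ_imp_Cauchy by auto
    then obtain N2 where N2: "\<And>m n. m \<ge> N2 ==> n \<ge> N2 ==> \<bar>ipH (un (r m) q) (node j) - ipH (un (r n) q) (node j)\<bar> < e / 3"
      unfolding Cauchy_def dist_real_def using e by (drule_tac x = "e / 3" in spec) auto
    have step: "\<bar>ipH (un (r n) t) (node j) - ipH (un (r n) q) (node j)\<bar> < e / 3" if "n \<ge> N1" for n
    proof -
      have "\<bar>ipH (un (r n) t) (node j) - ipH (un (r n) q) (node j)\<bar>
        \<le> sqrt (\<bar>t - q\<bar> + \<tau> (r n)) * sqrt K0 * V.nrm (node j)"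
        by (rule equicontinuity[OF node_V t near(2,3)])
      also have "\<dots> = sqrt (\<bar>t - q\<bar> + \<tau> (r n)) * (C - 1)" by (simp add: C_def)
      also have "\<dots> \<le> sqrt (2 * \<delta>) * (C - 1)"
      proof (rule mult_right_mono)
        show "sqrt (\<bar>t - q\<bar> + \<tau> (r n)) \<le> sqrt (2 * \<delta>)"
          using near(1) N1[OF that] by (intro real_sqrt_le_mono) linarith
        show "0 \<le> C - 1" using K0_nonneg V.nrm_nonneg[OF node_V, of j] by (simp add: C_def)
      qed
      also have "sqrt (2 * \<delta>) = e / (3 * C)" using e C by (simp add: \<delta>_def)
      also have "e / (3 * C) * (C - 1) < e / (3 * C) * C" using e C by (intro mult_strict_left_mono) auto
      also have "\<dots> = e / 3" using C by simp
      finally show ?thesis .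
    qed
    have "norm (ipH (un (r m) t) (node j) - ipH (un (r n) t) (node j)) < e"
      if "m \<ge> max N1 N2" "n \<ge> max N1 N2" for m n
      using step[of m] step[of n] N2[of m n] that by (auto simp: abs_if split: if_splits)
    then show "\<exists>N. \<forall>m\<ge>N. \<forall>n\<ge>N. norm (ipH (un (r m) t) (node j) - ipH (un (r n) t) (node j)) < e" by blast
  qed
  then show ?thesis using that r(1) by blast
qed

text \<open>Ehrling's inequality integrated in time: the finitely many pairings converge in L2(0,T)
  by dominated convergence, and the remainder is \<epsilon> times the uniform bound in L2(0,T;V). It
  applies since all differences lie in the span of the nodes.\<close>

lemma strong_subsequence:
  obtains r where "strict_mono (r :: nat => nat)" "HT.Cauchy_seq (\<lambda>n. un (r n))"
proof -
  obtain r where r: "strict_mono (r :: nat => nat)"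
    and conv: "\<And>t j. 0 < t ==> t < T ==> convergent (\<lambda>n. ipH (un (r n) t) (node j))"
    using weak_subsequence by metis
  define c where "c j n t = ipH (un (r n) t) (node j)" for j n t
  define l where "l j t = lim (\<lambda>n. c j n t)" for j t
  have cm: "c j n \<in> borel_measurable M" for j n
    unfolding c_def by (rule borel_measurable_integrable[OF S_comp_integrable[OF un_S]])
  then have lm: "l j \<in> borel_measurable M" for j
    unfolding l_def by (rule borel_measurable_lim_metric)
  have cl: "(\<lambda>n. c j n t) \<longlonglongrightarrow> l j t" if "0 < t" "t < T" for j t
    unfolding l_def using conv[OF that, of j] by (simp add: c_def convergent_LIMSEQ_iff)
  have cb: "\<bar>c j n t\<bar> \<le> E0" for j n t unfolding c_def by (rule un_node_bound)
  have lb: "\<bar>l j t\<bar> \<le> E0" if "0 < t" "t < T" for j t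
    by (rule LIMSEQ_le_const2[OF tendsto_rabs[OF cl[OF that]]]) (use cb in auto)
  have dlb: "(c j n t - l j t)^2 \<le> (2 * E0)^2" if "0 < t" "t < T" for j n t
  proof -
    have "\<bar>c j n t - l j t\<bar> \<le> 2 * E0" using cb[of j n t] lb[OF that, of j] by linarith
    then have "\<bar>c j n t - l j t\<bar>^2 \<le> (2 * E0)^2" by (rule power_mono) simp
    then show ?thesis by simp
  qed
  have int: "integrable M (\<lambda>t. (c j n t - l j t)^2)" for j n
    by (rule M.integrable_const_bound[of _ "(2 * E0)^2"])
      (use dlb in \<open>auto intro!: AE_I2 borel_measurable_power borel_measurable_diff cm lm\<close>)
  have Lim: "(\<lambda>n. \<integral>t. (c j n t - l j t)^2 \<partial>M) \<longlonglongrightarrow> 0" for j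
  proof -
    have "(\<lambda>n. \<integral>t. (c j n t - l j t)^2 \<partial>M) \<longlonglongrightarrow> (\<integral>t. 0 \<partial>M)"
    proof (rule integral_dominated_convergence[where w = "\<lambda>_. (2 * E0)^2"])
      show "AE t in M. (\<lambda>n. (c j n t - l j t)^2) \<longlonglongrightarrow> 0"
      proof (rule AE_I2)
        fix t assume "t \<in> space M"
        then have "(\<lambda>n. (c j n t - l j t)^2) \<longlonglongrightarrow> (l j t - l j t)^2"
          by (intro tendsto_intros cl) auto
        then show "(\<lambda>n. (c j n t - l j t)^2) \<longlonglongrightarrow> 0" by simp
      qed
      show "AE t in M. norm ((c j n t - l j t)^2) \<le> (2 * E0)^2" for n
        using dlb by (auto intro!: AE_I2)
    qed (use borel_measurable_integrable[OF int] in \<open>auto intro: M.integrable_const\<close>)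
    then show ?thesis by simp
  qed
  have "HT.Cauchy_seq (\<lambda>n. un (r n))"
    unfolding HT.Cauchy_seq_def
  proof (intro allI impI)
    fix e :: real assume e: "0 < e"
    \<comment> \<open>\<open>4 * (E0 / \<alpha>)\<close> bounds the squared norm in L2(0,T;V) of a
      difference of two approximations, so the V-term of Ehrling's inequality stays below e^2 /
      2.\<close>
    define \<epsilon> where "\<epsilon> = e^2 / (2 * (4 * (E0 / \<alpha>) + 1))"
    have B: "0 \<le> E0 / \<alpha>" using E0_nonneg \<alpha> by simp
    have \<epsilon>: "0 < \<epsilon>" using e B by (simp add: \<epsilon>_def)
    obtain m where m: "\<And>x. x \<in> span (range node) ==>
        (H.nrm x)^2 \<le> real m * (\<Sum>j<m. (ipH x (node j))^2) + \<epsilon> * (V.nrm x)^2"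
      using ehrling[of node, OF node_V \<epsilon>] by blast
    \<comment> \<open>There are m pairings, each with weight m and with squared difference
      integrating to at most 4 \<eta>; the total 4 m^2 \<eta> is below e^2 / 2.\<close>
    define \<eta> where "\<eta> = e^2 / (8 * (real m * real m + 1))"
    have \<eta>: "0 < \<eta>" using e by (simp add: \<eta>_def add_nonneg_pos)
    have "\<forall>\<^sub>F n in sequentially. \<forall>j\<in>{..<m}. (\<integral>t. (c j n t - l j t)^2 \<partial>M) < \<eta>"
      using order_tendstoD(2)[OF Lim \<eta>] by (intro eventually_ball_finite) auto
    then obtain N where N: "\<And>n j. n \<ge> N ==> j < m ==> (\<integral>t. (c j n t - l j t)^2 \<partial>M) < \<eta>"
      by (auto simp: eventually_sequentially)
    have "HT.nrm (un (r p) - un (r n)) < e" if pn: "p \<ge> N" "n \<ge> N" for p n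
    proof -
      let ?x = "\<lambda>t. un (r p) t - un (r n) t"
      have xS: "un (r p) - un (r n) \<in> S" by (intro HT.mem un_S)
      have ip: "ipH (?x t) (node j) = c j p t - c j n t" for j t
        by (simp add: c_def H.ip_simps VH un_V node_V)
      have ic: "integrable M (\<lambda>t. (c j p t - c j n t)^2)" for j
        unfolding ip[symmetric] by (rule S_comp2_integrable[OF un_S un_S])
      have iV: "integrable M (\<lambda>t. (V.nrm (?x t))^2)" and iH: "integrable M (\<lambda>t. (H.nrm (?x t))^2)"
        by (rule S_comp2_integrable[OF un_S un_S])+
      have 1: "(\<integral>t. (c j p t - c j n t)^2 \<partial>M) \<le> 4 * \<eta>" if "j < m" for j
      proof -
        have "(\<integral>t. (c j p t - c j n t)^2 \<partial>M) \<le> (\<integral>t. 2 * (c j p t - l j t)^2 + 2 * (c j n t - l j t)^2 \<partial>M)"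
        proof (rule integral_mono[OF ic])
          show "integrable M (\<lambda>t. 2 * (c j p t - l j t)^2 + 2 * (c j n t - l j t)^2)"
            using int by simp
          show "(c j p t - c j n t)^2 \<le> 2 * (c j p t - l j t)^2 + 2 * (c j n t - l j t)^2" for t
            using sum2_sq_le[of "c j p t - l j t" "l j t - c j n t"] by (simp add: power2_commute)
        qed
        also have "\<dots> = 2 * (\<integral>t. (c j p t - l j t)^2 \<partial>M) + 2 * (\<integral>t. (c j n t - l j t)^2 \<partial>M)"
          using int by simp
        finally show ?thesis using N[OF pn(1) that] N[OF pn(2) that] by simp
      qed
      have 2: "(\<integral>t. (V.nrm (?x t))^2 \<partial>M) \<le> 4 * (E0 / \<alpha>)"
      proof -
        have "(\<integral>t. (V.nrm (?x t))^2 \<partial>M) = (VT.nrm (un (r p) - un (r n)))^2" using VT_nrm_sq[OF xS] by simp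
        also have "\<dots> \<le> 2 * (VT.nrm (un (r p)))^2 + 2 * (VT.nrm (un (r n)))^2"
          using VT.nrm_sum_sq_le[of "un (r p)" "- un (r n)"] by (simp add: un_S VT.nrm_minus)
        also have "\<dots> \<le> 2 * (E0 / \<alpha>) + 2 * (E0 / \<alpha>)"
          using integral_un by (intro add_mono mult_left_mono) (auto simp: VT_nrm_sq un_S)
        finally show ?thesis by simp
      qed
      have "(HT.nrm (un (r p) - un (r n)))^2 = (\<integral>t. (H.nrm (?x t))^2 \<partial>M)" using HT_nrm_sq[OF xS] by simp
      also have "\<dots> \<le> (\<integral>t. real m * (\<Sum>j<m. (c j p t - c j n t)^2) + \<epsilon> * (V.nrm (?x t))^2 \<partial>M)"
      proof (rule integral_mono[OF iH])
        show "integrable M (\<lambda>t. real m * (\<Sum>j<m. (c j p t - c j n t)^2) + \<epsilon> * (V.nrm (?x t))^2)"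
          using ic iV by simp
        show "(H.nrm (?x t))^2 \<le> real m * (\<Sum>j<m. (c j p t - c j n t)^2) + \<epsilon> * (V.nrm (?x t))^2" for t
          using m[OF span_diff[OF un_span un_span], of "r p" t "r n" t] by (simp add: ip)
      qed
      also have "\<dots> = real m * (\<Sum>j<m. (\<integral>t. (c j p t - c j n t)^2 \<partial>M)) + \<epsilon> * (\<integral>t. (V.nrm (?x t))^2 \<partial>M)"
        using ic iV by (simp add: Bochner_Integration.integral_sum)
      also have "\<dots> \<le> real m * (\<Sum>j<m. 4 * \<eta>) + \<epsilon> * (4 * (E0 / \<alpha>))"
        using 1 2 \<epsilon> by (intro add_mono mult_left_mono sum_mono) auto
      also have "\<dots> < e^2 / 2 + e^2 / 2"
      proof (rule add_strict_mono)
        have "real m * (\<Sum>j<m. 4 * \<eta>) = 4 * (real m * real m) * \<eta>" by simp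
        also have "\<dots> < 4 * (real m * real m + 1) * \<eta>" using \<eta> by (intro mult_strict_right_mono) auto
        also have "\<dots> = e^2 / 2"
        proof -
          have "real m * real m + 1 \<noteq> 0" by (smt (verit) zero_le_square)
          moreover have "4 * P * (e^2 / (8 * P)) = e^2 / 2" if "P \<noteq> 0" for P using that by simp
          ultimately show ?thesis unfolding \<eta>_def by blast
        qed
        finally show "real m * (\<Sum>j<m. 4 * \<eta>) < e^2 / 2" .
        have "\<epsilon> * (4 * (E0 / \<alpha>)) < \<epsilon> * (4 * (E0 / \<alpha>) + 1)" using \<epsilon> by (intro mult_strict_left_mono) auto
        also have "\<dots> = e^2 / 2"
        proof -
          have "4 * (E0 / \<alpha>) + 1 \<noteq> 0" using B by linarith
          moreover have "e^2 / (2 * P) * P = e^2 / 2" if "P \<noteq> 0" for P using that by simp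
          ultimately show ?thesis unfolding \<epsilon>_def by blast
        qed
        finally show "\<epsilon> * (4 * (E0 / \<alpha>)) < e^2 / 2" .
      qed
      finally have "(HT.nrm (un (r p) - un (r n)))^2 < e^2" by simp
      then show ?thesis by (rule power2_less_imp_less) (use e in simp)
    qed
    then show "\<exists>N. \<forall>m\<ge>N. \<forall>n\<ge>N. HT.nrm (un (r m) - un (r n)) < e" by blast
  qed
  then show ?thesis using that r by blast
qed

text \<open>Mazur's lemma in \<open>L\<^sup>2(0,T;V)\<close> yields step functions converging strongly to the limit,
  which gives its strong measurability.\<close>

lemma strong_limit:
  obtains r u z where "strict_mono (r :: nat => nat)" "\<And>t. u t \<in> V" "\<And>n::nat. z n \<in> S"
    "\<And>t. (\<lambda>n. V.nrm (z n t - u t)) \<longlonglongrightarrow> 0"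
    "integrable M (\<lambda>t. (V.nrm (u t))^2)" "\<And>t. H.nrm (u t) \<le> sqrt E0"
    "\<And>n. integrable M (\<lambda>t. (H.nrm (un (r n) t - u t))^2)"
    "(\<lambda>n. \<integral>t. (H.nrm (un (r n) t - u t))^2 \<partial>M) \<longlonglongrightarrow> 0"
proof -
  obtain r where r: "strict_mono (r :: nat => nat)" "HT.Cauchy_seq (\<lambda>n. un (r n))"
    using strong_subsequence by metis
  have b: "VT.nrm (un (r n)) \<le> sqrt (E0 / \<alpha>)" for n
    using integral_un by (intro real_le_rsqrt) (simp add: VT_nrm_sq un_S)
  obtain y where y: "\<And>m. y m \<in> convex hull ((\<lambda>n. un (r n)) ` {m..})" "VT.Cauchy_seq y"
    using VT.convex_combinations_Cauchy[of "\<lambda>n. un (r n)" "sqrt (E0 / \<alpha>)", OF un_S b] by metis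
  have "convex hull ((\<lambda>n. un (r n)) ` {m..}) \<subseteq> S" for m
    by (rule hull_minimal) (use un_S subspace_imp_convex[OF subspace_S] in auto)
  then have yS: "y m \<in> S" for m using y(1)[of m] by auto
  obtain \<rho> where \<rho>: "strict_mono \<rho>" and rate: "\<And>n. VT.nrm (y (\<rho> (Suc n)) - y (\<rho> n)) \<le> (1/4) ^ n"
    using VT.Cauchy_subseq_rate[OF y(2), of "1/4"] by auto
  have "AE t in M. \<exists>C. \<forall>n. \<bar>V.nrm (y (\<rho> (Suc n)) t - y (\<rho> n) t)\<bar> \<le> C * (1/2) ^ n"
  proof (rule AE_geometric)
    fix n
    have d: "y (\<rho> (Suc n)) - y (\<rho> n) \<in> S" by (intro VT.mem yS)
    show "(\<lambda>t. V.nrm (y (\<rho> (Suc n)) t - y (\<rho> n) t)) \<in> borel_measurable M"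
      by (rule borel_measurable_integrable[OF S_comp2_integrable[OF yS yS]])
    show "integrable M (\<lambda>t. (V.nrm (y (\<rho> (Suc n)) t - y (\<rho> n) t))^2)"
      by (rule S_comp2_integrable[OF yS yS])
    have "(\<integral>t. (V.nrm (y (\<rho> (Suc n)) t - y (\<rho> n) t))^2 \<partial>M) = (VT.nrm (y (\<rho> (Suc n)) - y (\<rho> n)))^2"
      using VT_nrm_sq[OF d] by simp
    also have "\<dots> \<le> ((1/4) ^ n)^2" by (rule power_mono[OF rate VT.nrm_nonneg[OF d]])
    also have "\<dots> = (1/16) ^ n" by (simp add: power2_eq_square power_mult_distrib[symmetric])
    finally show "(\<integral>t. (V.nrm (y (\<rho> (Suc n)) t - y (\<rho> n) t))^2 \<partial>M) \<le> (1/16) ^ n" .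
  qed
  then obtain Z where
    good: "\<And>t. t \<in> space M - Z ==> \<exists>C. \<forall>n. \<bar>V.nrm (y (\<rho> (Suc n)) t - y (\<rho> n) t)\<bar> \<le> C * (1/2) ^ n"
    and Z: "Z \<in> null_sets M"
    by (rule AE_E3) blast
  \<comment> \<open>Setting the step functions to 0 off the good set makes them Cauchy in V at every
    t, so completeness of V defines the limit u at all times.\<close>
  define A where "A = space M - Z"
  have A: "A \<in> sets M" using Z by (auto simp: A_def)
  define z where "z n t = (indicator A t :: real) *\<^sub>R y (\<rho> n) t" for n t
  have zS: "z n \<in> S" for n
    using simple_function_compose2[OF simple_function_indicator[OF A], of "y (\<rho> n)" scaleR] yS[of "\<rho> n"]
    by (auto simp: S_def z_def[abs_def])
  have zA: "AE t in M. t \<in> A" using AE_not_in[OF Z] AE_space by eventually_elim (simp add: A_def)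
  have zy: "AE t in M. z n t = y (\<rho> n) t" for n
    using zA by eventually_elim (simp add: z_def)
  have "V.Cauchy_seq (\<lambda>n. z n t)" for t
  proof (cases "t \<in> A")
    case True
    then obtain C where C: "\<And>n. \<bar>V.nrm (y (\<rho> (Suc n)) t - y (\<rho> n) t)\<bar> \<le> C * (1/2) ^ n"
      using good[of t] by (auto simp: A_def)
    show ?thesis
    proof (rule V.Cauchy_geometric[where q = "1/2" and c = C])
      show "V.nrm (z (Suc n) t - z n t) \<le> C * (1/2) ^ n" for n
        using C[of n] True by (simp add: z_def)
    qed (auto simp: S_V zS)
  next
    case False
    then show ?thesis by (simp add: z_def V.Cauchy_seq_def)
  qed
  then have "\<forall>t. \<exists>w\<in>V. (\<lambda>n. V.nrm (z n t - w)) \<longlonglongrightarrow> 0"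
    using V.complete[of "\<lambda>n. z n _"] S_V[OF zS] by blast
  then obtain u where u: "\<And>t. u t \<in> V" "\<And>t. (\<lambda>n. V.nrm (z n t - u t)) \<longlonglongrightarrow> 0" by metis
  have uH: "u t \<in> H" for t by (rule VH[OF u(1)])
  have zV: "z n t \<in> V" and zH: "z n t \<in> H" for n t using zS S_V S_H by auto

  have HzuLe: "H.nrm (z n t - u t) \<le> V.nrm (z n t - u t)" for n t
    by (intro nrm_le V.mem zV u)
  have zlimH: "(\<lambda>n. H.nrm (z n t - u t)) \<longlonglongrightarrow> 0" for t
    by (rule null_squeeze[OF H.nrm_nonneg[OF H.mem(4)[OF zH uH]] HzuLe u(2)])

  \<comment> \<open>A pointwise norm bound describes a convex set of step functions, so it passes
    from \<open>un\<close> to the convex combinations and further to their limit.\<close>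
  define B where "B = {w \<in> S. \<forall>t. H.nrm (w t) \<le> sqrt E0}"
  have "convex B"
    unfolding convex_def
  proof (intro ballI allI impI)
    fix p q and c d :: real
    assume p: "p \<in> B" and q: "q \<in> B" and cd: "0 \<le> c" "0 \<le> d" "c + d = 1"
    have "H.nrm (c *\<^sub>R p t + d *\<^sub>R q t) \<le> sqrt E0" for t
      using p q cd by (intro H.nrm_convex) (auto simp: B_def S_H)
    moreover have "c *\<^sub>R p + d *\<^sub>R q \<in> S" using p q by (simp add: B_def)
    ultimately show "c *\<^sub>R p + d *\<^sub>R q \<in> B" by (simp add: B_def)
  qed
  then have "convex hull ((\<lambda>n. un (r n)) ` {m..}) \<subseteq> B" for m
    by (intro hull_minimal) (auto simp: B_def un_S un_bound)
  then have yB: "H.nrm (y m t) \<le> sqrt E0" for m t using y(1)[of m] by (auto simp: B_def)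
  have zB: "H.nrm (z n t) \<le> sqrt E0" for n t
    using yB[of "\<rho> n" t] E0_nonneg by (simp add: z_def indicator_def)
  have ub: "H.nrm (u t) \<le> sqrt E0" for t
    by (rule LIMSEQ_le_const2[OF H.tendsto_nrm[of "\<lambda>n. z n t" "u t", OF zH uH zlimH]]) (use zB in auto)

  have zC: "VT.Cauchy_seq z"
  proof -
    have "VT.nrm (z n - z m) = VT.nrm (y (\<rho> n) - y (\<rho> m))" for n m
    proof -
      have "(\<integral>t. ipV ((z n - z m) t) ((z n - z m) t) \<partial>M) = (\<integral>t. ipV ((y (\<rho> n) - y (\<rho> m)) t) ((y (\<rho> n) - y (\<rho> m)) t) \<partial>M)"
      proof (rule integral_cong_AE)
        have d: "z n - z m \<in> S" "y (\<rho> n) - y (\<rho> m) \<in> S" by (intro VT.mem zS yS)+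
        show "(\<lambda>t. ipV ((z n - z m) t) ((z n - z m) t)) \<in> borel_measurable M"
          "(\<lambda>t. ipV ((y (\<rho> n) - y (\<rho> m)) t) ((y (\<rho> n) - y (\<rho> m)) t)) \<in> borel_measurable M"
          by (rule borel_measurable_integrable[OF S_comp_integrable[OF d(1)]],
              rule borel_measurable_integrable[OF S_comp_integrable[OF d(2)]])
        show "AE t in M. ipV ((z n - z m) t) ((z n - z m) t) = ipV ((y (\<rho> n) - y (\<rho> m)) t) ((y (\<rho> n) - y (\<rho> m)) t)"
          using zy[of n] zy[of m] by eventually_elim simp
      qed
      then show ?thesis by (simp add: VT.nrm_def)
    qed
    then show ?thesis using VT.Cauchy_seq_subseq[OF y(2) \<rho>] by (simp add: VT.Cauchy_seq_def comp_def)
  qed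
  have limd: "(\<lambda>m. V.nrm (z n t - z m t)) \<longlonglongrightarrow> V.nrm (z n t - u t)" for n t
  proof (rule V.tendsto_nrm)
    have "(\<lambda>m. V.nrm (u t - z m t)) \<longlonglongrightarrow> 0" using u(2)[of t] V.nrm_diff_sym[OF u(1) zV] by simp
    then show "(\<lambda>m. V.nrm (z n t - z m t - (z n t - u t))) \<longlonglongrightarrow> 0" by simp
  qed (intro V.mem zV u)+
  have mV: "(\<lambda>t. V.nrm (z n t - u t)) \<in> borel_measurable M" for n
  proof (rule borel_measurable_LIMSEQ_real)
    show "(\<lambda>m. V.nrm (z n t - z m t)) \<longlonglongrightarrow> V.nrm (z n t - u t)" for t by (rule limd)
    show "(\<lambda>t. V.nrm (z n t - z m t)) \<in> borel_measurable M" for m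
      by (rule borel_measurable_integrable[OF S_comp2_integrable[OF zS zS]])
  qed
  have tail: "integrable M (\<lambda>t. (V.nrm (z n t - u t))^2) \<and> (\<integral>t. (V.nrm (z n t - u t))^2 \<partial>M) \<le> e^2"
    if N: "\<And>m. m \<ge> N ==> VT.nrm (z n - z m) \<le> e" for n N e
  proof -
    have i: "integrable M (\<lambda>t. (V.nrm (z n t - z m t))^2)" for m by (rule S_comp2_integrable[OF zS zS])
    have l: "AE t in M. (\<lambda>m. (V.nrm (z n t - z m t))^2) \<longlonglongrightarrow> (V.nrm (z n t - u t))^2"
      by (intro AE_I2 tendsto_power limd)
    have bd: "(\<integral>t. (V.nrm (z n t - z m t))^2 \<partial>M) \<le> e^2" if "m \<ge> N" for m
    proof -
      have d: "z n - z m \<in> S" by (intro VT.mem zS)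
      have "(VT.nrm (z n - z m))^2 \<le> e^2" by (rule power_mono[OF N[OF that] VT.nrm_nonneg[OF d]])
      then show ?thesis using VT_nrm_sq[OF d] by simp
    qed
    have pm: "(\<lambda>t. (V.nrm (z n t - u t))^2) \<in> borel_measurable M" by (intro borel_measurable_power mV)
    show ?thesis using Fatou_real[OF i _ pm l bd, of N] by auto
  qed
  obtain N1 where N1: "\<forall>m\<ge>N1. \<forall>n\<ge>N1. VT.nrm (z m - z n) < 1"
    using zC unfolding VT.Cauchy_seq_def by (drule_tac x = 1 in spec) auto
  have mu: "(\<lambda>t. V.nrm (u t)) \<in> borel_measurable M"
  proof (rule borel_measurable_LIMSEQ_real)
    show "(\<lambda>n. V.nrm (z n t)) \<longlonglongrightarrow> V.nrm (u t)" for t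
      by (rule V.tendsto_nrm) (use zV u in auto)
    show "(\<lambda>t. V.nrm (z n t)) \<in> borel_measurable M" for n
      by (rule borel_measurable_integrable[OF S_comp_integrable[OF zS]])
  qed
  have ui: "integrable M (\<lambda>t. (V.nrm (u t))^2)"
  proof (rule Bochner_Integration.integrable_bound)
    show "integrable M (\<lambda>t. 2 * (V.nrm (z N1 t))^2 + 2 * (V.nrm (z N1 t - u t))^2)"
      using tail[of N1 N1 1] N1 S_comp_integrable[OF zS, of "\<lambda>w. (V.nrm w)^2" N1]
      by (intro Bochner_Integration.integrable_add integrable_mult_right) (auto intro: less_imp_le)
    show "(\<lambda>t. (V.nrm (u t))^2) \<in> borel_measurable M" by (intro borel_measurable_power mu)
    show "AE t in M. norm ((V.nrm (u t))^2) \<le> norm (2 * (V.nrm (z N1 t))^2 + 2 * (V.nrm (z N1 t - u t))^2)"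
    proof (rule AE_I2)
      fix t
      show "norm ((V.nrm (u t))^2) \<le> norm (2 * (V.nrm (z N1 t))^2 + 2 * (V.nrm (z N1 t - u t))^2)"
        using V.nrm_sum_sq_le[of "z N1 t" "- (z N1 t - u t)"] zV[of N1 t] u(1)[of t]
          V.nrm_minus[of "z N1 t - u t"] by simp
    qed
  qed

  have mH: "(\<lambda>t. H.nrm (un k t - u t)) \<in> borel_measurable M" for k
  proof (rule borel_measurable_LIMSEQ_real)
    show "(\<lambda>n. H.nrm (un k t - z n t)) \<longlonglongrightarrow> H.nrm (un k t - u t)" for t
    proof (rule H.tendsto_nrm)
      have "(\<lambda>m. H.nrm (u t - z m t)) \<longlonglongrightarrow> 0" using zlimH[of t] H.nrm_diff_sym[OF uH zH] by simp
      then show "(\<lambda>m. H.nrm (un k t - z m t - (un k t - u t))) \<longlonglongrightarrow> 0" by simp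
    qed (intro H.mem zH uH VH[OF un_V])+
    show "(\<lambda>t. H.nrm (un k t - z n t)) \<in> borel_measurable M" for n
      by (rule borel_measurable_integrable[OF S_comp2_integrable[OF un_S zS]])
  qed
  have Hb: "(H.nrm (un k t - u t))^2 \<le> 2 * (H.nrm (un k t - z n t))^2 + 2 * (V.nrm (z n t - u t))^2" for k n t
  proof -
    have uz: "un k t - z n t \<in> H" "z n t - u t \<in> H" using VH[OF un_V] zH uH by auto
    have "(H.nrm (un k t - u t))^2 \<le> 2 * (H.nrm (un k t - z n t))^2 + 2 * (H.nrm (z n t - u t))^2"
      using H.nrm_sum_sq_le[OF uz] by simp
    also have "(H.nrm (z n t - u t))^2 \<le> (V.nrm (z n t - u t))^2"
      by (rule power_mono[OF HzuLe H.nrm_nonneg[OF uz(2)]])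
    finally show ?thesis by simp
  qed
  have Hi: "integrable M (\<lambda>t. (H.nrm (un k t - u t))^2)" for k
  proof (rule Bochner_Integration.integrable_bound)
    show "integrable M (\<lambda>t. 2 * (H.nrm (un k t - z N1 t))^2 + 2 * (V.nrm (z N1 t - u t))^2)"
      using tail[of N1 N1 1] N1 S_comp2_integrable[OF un_S zS, of "\<lambda>w x. (H.nrm (w - x))^2"]
      by (intro Bochner_Integration.integrable_add integrable_mult_right) (auto intro: less_imp_le)
    show "AE t in M. norm ((H.nrm (un k t - u t))^2) \<le> norm (2 * (H.nrm (un k t - z N1 t))^2 + 2 * (V.nrm (z N1 t - u t))^2)"
      using Hb by (intro AE_I2) simp
  qed (intro borel_measurable_power mH)
  have "(\<lambda>n. \<integral>t. (H.nrm (un (r n) t - u t))^2 \<partial>M) \<longlonglongrightarrow> 0"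
  proof (rule LIMSEQ_I)
    fix e :: real assume e: "0 < e"
    \<comment> \<open>The final estimate is 4 d^2, so any d^2 below e / 4 would serve.\<close>
    define d where "d = sqrt (e / 5)"
    have d: "0 < d" "d^2 = e / 5" using e by (auto simp: d_def)
    obtain N where N: "\<And>m n. m \<ge> N ==> n \<ge> N ==> HT.nrm (un (r m) - un (r n)) < d"
      using r(2)[unfolded HT.Cauchy_seq_def, rule_format, OF d(1)] by blast
    obtain N2 where N2: "\<And>m n. m \<ge> N2 ==> n \<ge> N2 ==> VT.nrm (z m - z n) < d"
      using zC[unfolded VT.Cauchy_seq_def, rule_format, OF d(1)] by blast
    define k where "k = max N N2"
    have k: "k \<ge> N2" "\<rho> k \<ge> N" using seq_suble[OF \<rho>, of k] by (auto simp: k_def)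
    have zu: "integrable M (\<lambda>t. (V.nrm (z k t - u t))^2)" "(\<integral>t. (V.nrm (z k t - u t))^2 \<partial>M) \<le> d^2"
      using tail[of N2 k d] N2 k by (auto intro: less_imp_le)
    have "norm ((\<integral>t. (H.nrm (un (r n) t - u t))^2 \<partial>M) - 0) < e" if n: "n \<ge> N" for n
    proof -
      \<comment> \<open>From index N on, the sequence stays in a ball about \<open>un (r n)\<close>;
        balls are convex, so \<open>y (\<rho> k)\<close> stays there too. Thus the original
        sequence, and not only its convex combinations, converges to u in L2(0,T;H).\<close>
      define Bn where "Bn = {w \<in> S. HT.nrm (un (r n) - w) \<le> d}"
      have "convex Bn"
        unfolding convex_def
      proof (intro ballI allI impI)
        fix p q and c c' :: real
        assume p: "p \<in> Bn" and q: "q \<in> Bn" and cd: "0 \<le> c" "0 \<le> c'" "c + c' = 1"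
        have pq: "p \<in> S" "q \<in> S" using p q by (auto simp: Bn_def)
        have "un (r n) - (c *\<^sub>R p + c' *\<^sub>R q) = (c + c') *\<^sub>R un (r n) - (c *\<^sub>R p + c' *\<^sub>R q)" using cd by simp
        also have "\<dots> = c *\<^sub>R (un (r n) - p) + c' *\<^sub>R (un (r n) - q)"
          by (simp add: scaleR_left_distrib scaleR_right_diff_distrib)
        finally have eq: "un (r n) - (c *\<^sub>R p + c' *\<^sub>R q) = c *\<^sub>R (un (r n) - p) + c' *\<^sub>R (un (r n) - q)" .
        have "HT.nrm (un (r n) - (c *\<^sub>R p + c' *\<^sub>R q)) \<le> d"
          unfolding eq using p q pq cd un_S by (intro HT.nrm_convex) (auto simp: Bn_def)
        then show "c *\<^sub>R p + c' *\<^sub>R q \<in> Bn" using pq by (simp add: Bn_def)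
      qed
      moreover have "(\<lambda>n. un (r n)) ` {\<rho> k..} \<subseteq> Bn"
      proof (rule image_subsetI)
        fix i assume "i \<in> {\<rho> k..}"
        then have "i \<ge> N" using k by simp
        from less_imp_le[OF N[OF n this]] show "un (r i) \<in> Bn" by (simp add: Bn_def un_S)
      qed
      ultimately have "convex hull ((\<lambda>n. un (r n)) ` {\<rho> k..}) \<subseteq> Bn" by (intro hull_minimal)
      then have yk: "HT.nrm (un (r n) - y (\<rho> k)) \<le> d" using y(1)[of "\<rho> k"] by (auto simp: Bn_def)
      have dS: "un (r n) - y (\<rho> k) \<in> S" by (intro VT.mem yS un_S)
      have i1: "integrable M (\<lambda>t. (H.nrm (un (r n) t - z k t))^2)" by (rule S_comp2_integrable[OF un_S zS])
      have i2: "integrable M (\<lambda>t. (H.nrm (un (r n) t - y (\<rho> k) t))^2)" by (rule S_comp2_integrable[OF un_S yS])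
      have "(\<integral>t. (H.nrm (un (r n) t - z k t))^2 \<partial>M) = (\<integral>t. (H.nrm (un (r n) t - y (\<rho> k) t))^2 \<partial>M)"
        by (rule integral_cong_AE) (use i1 i2 zy[of k] in auto)
      also have "\<dots> = (HT.nrm (un (r n) - y (\<rho> k)))^2" using HT_nrm_sq[OF dS] by simp
      also have "\<dots> \<le> d^2" by (rule power_mono[OF yk HT.nrm_nonneg[OF dS]])
      finally have h: "(\<integral>t. (H.nrm (un (r n) t - z k t))^2 \<partial>M) \<le> d^2" .
      have "(\<integral>t. (H.nrm (un (r n) t - u t))^2 \<partial>M) \<le> (\<integral>t. 2 * (H.nrm (un (r n) t - z k t))^2 + 2 * (V.nrm (z k t - u t))^2 \<partial>M)"
        using i1 zu by (intro integral_mono Hi Hb) simp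
      also have "\<dots> = 2 * (\<integral>t. (H.nrm (un (r n) t - z k t))^2 \<partial>M) + 2 * (\<integral>t. (V.nrm (z k t - u t))^2 \<partial>M)"
        using i1 zu by simp
      also have "\<dots> \<le> 4 * d^2" using h zu by simp
      also have "\<dots> < e" using d e by simp
      finally show ?thesis by (simp add: Bochner_Integration.integral_nonneg)
    qed
    then show "\<exists>N. \<forall>n\<ge>N. norm ((\<integral>t. (H.nrm (un (r n) t - u t))^2 \<partial>M) - 0) < e" by blast
  qed
  then show ?thesis by (rule that[OF r(1) u(1) zS u(2) ui ub Hi])
qed

section \<open>Passage to the limit in the integrated equation\<close>

lemma H_const_bound:
  assumes "v \<in> D0"
  obtains K where "0 \<le> K" "\<And>u. u \<in> V ==> \<bar>a u v\<bar> \<le> K * H.nrm u"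
    "\<And>u w. u \<in> V ==> w \<in> V ==> \<bar>b w v u\<bar> \<le> K * H.nrm w * H.nrm u"
proof -
  obtain K1 where K1: "\<And>u. u \<in> V ==> \<bar>a u v\<bar> \<le> K1 * H.nrm u" using D0_a[OF assms] by auto
  obtain K2 where K2: "\<And>u w. u \<in> V ==> w \<in> V ==> \<bar>b w v u\<bar> \<le> K2 * H.nrm w * H.nrm u"
    using D0_b[OF assms] by auto
  define K where "K = \<bar>K1\<bar> + \<bar>K2\<bar>"
  have "\<bar>a u v\<bar> \<le> K * H.nrm u" if "u \<in> V" for u
    using K1[OF that] mult_right_mono[of K1 K "H.nrm u"] H.nrm_nonneg[OF VH[OF that]]
    by (fastforce simp: K_def)
  moreover have "\<bar>b w v u\<bar> \<le> K * H.nrm w * H.nrm u" if "u \<in> V" "w \<in> V" for u w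
    using K2[OF that] mult_right_mono[of K2 K "H.nrm w * H.nrm u"] H.nrm_nonneg[OF VH[OF that(1)]]
      H.nrm_nonneg[OF VH[OF that(2)]]
    by (fastforce simp: K_def mult.assoc)
  ultimately show ?thesis using that[of K] by (simp add: K_def)
qed

definition RL :: "(real => 'a) => 'a => real => real" where
  "RL u v s = f s v - a (u s) v - b (u s) (u s) v"

text \<open>The analogue of \<open>maj\<close> when the advecting and the advected field are both u,
  hence the factor 2.\<close>

definition majL :: "(real => 'a) => real => real" where
  "majL u s = F s + (Ca + 2 * Cb * sqrt E0) * V.nrm (u s)"

lemma RL_bound:
  assumes "v \<in> V" "u s \<in> V" "H.nrm (u s) \<le> sqrt E0"
  shows "\<bar>RL u v s\<bar> \<le> majL u s * V.nrm v"
proof -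
  have "\<bar>f s v\<bar> \<le> F s * V.nrm v" "\<bar>a (u s) v\<bar> \<le> Ca * V.nrm (u s) * V.nrm v"
    "\<bar>b (u s) (u s) v\<bar> \<le> Cb * sqrt E0 * (V.nrm (u s) + V.nrm (u s)) * V.nrm v"
    by (rule f_bound a_bound b_majorant; fact assms)+
  then show ?thesis by (simp add: RL_def majL_def algebra_simps)
qed

lemma tendsto_a:
  assumes "\<And>n. x n \<in> V" "y \<in> V" "v \<in> V" "(\<lambda>n. V.nrm (x n - y)) \<longlonglongrightarrow> 0"
  shows "(\<lambda>n. a (x n) v) \<longlonglongrightarrow> a y v"
proof -
  have "(\<lambda>n. a (x n) v - a y v) \<longlonglongrightarrow> 0"
  proof (rule Lim_null_comparison)
    show "\<forall>\<^sub>F n in sequentially. norm (a (x n) v - a y v) \<le> Ca * V.nrm (x n - y) * V.nrm v"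
      using a_bound[of "x _ - y" v] assms by (auto simp: a_diff1)
    show "(\<lambda>n. Ca * V.nrm (x n - y) * V.nrm v) \<longlonglongrightarrow> 0"
      by (intro tendsto_mult_left_zero tendsto_mult_right_zero assms)
  qed
  then show ?thesis by (simp add: LIM_zero_iff)
qed

lemma tendsto_b:
  assumes x: "\<And>n. x n \<in> V" and y: "y \<in> V" and v: "v \<in> V" and lim: "(\<lambda>n. V.nrm (x n - y)) \<longlonglongrightarrow> 0"
  shows "(\<lambda>n. b (x n) (x n) v) \<longlonglongrightarrow> b y y v"
proof -
  have "(\<lambda>n. b (x n) (x n) v - b y y v) \<longlonglongrightarrow> 0"
  proof (rule Lim_null_comparison)
    show "\<forall>\<^sub>F n in sequentially. norm (b (x n) (x n) v - b y y v)
        \<le> Cb * V.nrm (x n - y) * V.nrm (x n) * V.nrm v + Cb * V.nrm y * V.nrm (x n - y) * V.nrm v"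
    proof (rule always_eventually, rule allI)
      fix n
      have "b (x n) (x n) v - b y y v = b (x n - y) (x n) v + b y (x n - y) v"
        using x y v by (simp add: b_diff1 b_diff2)
      then show "norm (b (x n) (x n) v - b y y v)
          \<le> Cb * V.nrm (x n - y) * V.nrm (x n) * V.nrm v + Cb * V.nrm y * V.nrm (x n - y) * V.nrm v"
        using b_bound'[of "x n - y" "x n" v] b_bound'[of y "x n - y" v] x y v by (simp add: abs_le_iff)
    qed
    have "(\<lambda>n. Cb * V.nrm (x n - y) * V.nrm (x n) * V.nrm v + Cb * V.nrm y * V.nrm (x n - y) * V.nrm v)
      \<longlonglongrightarrow> Cb * 0 * V.nrm y * V.nrm v + Cb * V.nrm y * 0 * V.nrm v"
      by (intro tendsto_intros lim V.tendsto_nrm[OF x y lim])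
    then show "(\<lambda>n. Cb * V.nrm (x n - y) * V.nrm (x n) * V.nrm v + Cb * V.nrm y * V.nrm (x n - y) * V.nrm v)
      \<longlonglongrightarrow> 0" by simp
  qed
  then show ?thesis by (simp add: LIM_zero_iff)
qed

lemma indicator_integral_diff:
  fixes g h :: "real => real"
  assumes g: "integrable M g" and h: "integrable M h"
  shows "\<bar>(\<integral>s. indicator {..t} s * g s \<partial>M) - (\<integral>s. indicator {..t} s * h s \<partial>M)\<bar> \<le> (\<integral>s. \<bar>g s - h s\<bar> \<partial>M)"
proof -
  have i: "integrable M (\<lambda>s. indicator {..t} s * (g s - h s))"
    by (rule integrable_indicator(2)[OF Bochner_Integration.integrable_diff[OF g h]])
  have "(\<integral>s. indicator {..t} s * g s \<partial>M) - (\<integral>s. indicator {..t} s * h s \<partial>M) = (\<integral>s. indicator {..t} s * (g s - h s) \<partial>M)"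
    unfolding right_diff_distrib
    by (rule Bochner_Integration.integral_diff[OF integrable_indicator(2)[OF g] integrable_indicator(2)[OF h], symmetric])
  also have "\<bar>\<dots>\<bar> \<le> (\<integral>s. \<bar>indicator {..t} s * (g s - h s)\<bar> \<partial>M)" by (rule integral_abs_bound)
  also have "\<dots> \<le> (\<integral>s. \<bar>g s - h s\<bar> \<partial>M)"
  proof (rule integral_mono)
    show "integrable M (\<lambda>s. \<bar>indicator {..t} s * (g s - h s)\<bar>)" using i by (rule integrable_abs)
    show "integrable M (\<lambda>s. \<bar>g s - h s\<bar>)" using g h by simp
  qed (simp add: indicator_def)
  finally show ?thesis .
qed

text \<open>The integrated form carries the initial value and the weak time derivative at once. The
  step functions z are part of the result because they witness the strong measurability of u in
  V.\<close>

theorem existence: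
  obtains u z where "\<And>t. u t \<in> V" "\<And>n::nat. z n \<in> S"
    "\<And>t. (\<lambda>n. V.nrm (z n t - u t)) \<longlonglongrightarrow> 0"
    "integrable M (\<lambda>t. (V.nrm (u t))^2)" "\<And>t. H.nrm (u t) \<le> sqrt E0"
    "\<And>v. v \<in> V ==> integrable M (RL u v)"
    "\<And>v. v \<in> V ==> AE t in M. ipH (u t) v = ipH u0 v + (\<integral>s. indicator {..t} s * RL u v s \<partial>M)"
proof -
  obtain r u z where r: "strict_mono (r :: nat => nat)" and u: "\<And>t. u t \<in> V" and z: "\<And>n::nat. z n \<in> S"
    and zu: "\<And>t. (\<lambda>n. V.nrm (z n t - u t)) \<longlonglongrightarrow> 0"
    and ui: "integrable M (\<lambda>t. (V.nrm (u t))^2)" and ub: "\<And>t. H.nrm (u t) \<le> sqrt E0"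
    and Hi: "\<And>n. integrable M (\<lambda>t. (H.nrm (un (r n) t - u t))^2)"
    and Hl: "(\<lambda>n. \<integral>t. (H.nrm (un (r n) t - u t))^2 \<partial>M) \<longlonglongrightarrow> 0"
    by (rule strong_limit) blast
  have uH: "u t \<in> H" for t by (rule VH[OF u])
  have zV: "z n t \<in> V" for n t by (rule S_V[OF z])
  have unH: "un n t \<in> H" and wnH: "wn n t \<in> H" for n t by (auto intro: VH un_V wn_V)
  have ma: "(\<lambda>s. a (u s) v) \<in> borel_measurable M" if v: "v \<in> V" for v
  proof (rule borel_measurable_LIMSEQ_real)
    show "(\<lambda>n. a (z n t) v) \<longlonglongrightarrow> a (u t) v" for t by (rule tendsto_a[OF zV u v zu])
    show "(\<lambda>t. a (z n t) v) \<in> borel_measurable M" for n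
      by (rule borel_measurable_integrable[OF S_comp_integrable[OF z]])
  qed
  have mb: "(\<lambda>s. b (u s) (u s) v) \<in> borel_measurable M" if v: "v \<in> V" for v
  proof (rule borel_measurable_LIMSEQ_real)
    show "(\<lambda>n. b (z n t) (z n t) v) \<longlonglongrightarrow> b (u t) (u t) v" for t by (rule tendsto_b[OF zV u v zu])
    show "(\<lambda>t. b (z n t) (z n t) v) \<in> borel_measurable M" for n
      by (rule borel_measurable_integrable[OF S_comp_integrable[OF z]])
  qed
  have mnu: "(\<lambda>s. V.nrm (u s)) \<in> borel_measurable M"
  proof (rule borel_measurable_LIMSEQ_real)
    show "(\<lambda>n. V.nrm (z n t)) \<longlonglongrightarrow> V.nrm (u t)" for t by (rule V.tendsto_nrm[OF zV u zu])
    show "(\<lambda>t. V.nrm (z n t)) \<in> borel_measurable M" for n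
      by (rule borel_measurable_integrable[OF S_comp_integrable[OF z]])
  qed
  have imaj: "integrable M (majL u)"
    unfolding majL_def using integrable_square_imp[OF finM mnu ui] F_integrable by simp
  have mR: "RL u v \<in> borel_measurable M" if "v \<in> V" for v
    unfolding RL_def[abs_def] by (intro borel_measurable_diff f_meas ma mb that)
  have iR: "integrable M (RL u v)" if v: "v \<in> V" for v
  proof (rule Bochner_Integration.integrable_bound)
    show "integrable M (\<lambda>s. majL u s * V.nrm v)" using imaj by simp
    show "AE s in M. norm (RL u v s) \<le> norm (majL u s * V.nrm v)"
    proof (rule AE_I2)
      fix s
      have "\<bar>RL u v s\<bar> \<le> majL u s * V.nrm v" by (rule RL_bound[OF v u ub])
      then show "norm (RL u v s) \<le> norm (majL u s * V.nrm v)" by simp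
    qed
  qed (rule mR[OF v])

  have mp: "(\<lambda>t. H.nrm (un (r n) t - u t)) \<in> borel_measurable M" for n
  proof -
    have "(\<lambda>t. sqrt ((H.nrm (un (r n) t - u t))^2)) \<in> borel_measurable M"
      by (rule measurable_compose[OF borel_measurable_integrable[OF Hi] borel_measurable_sqrt])
    then show ?thesis using H.nrm_nonneg[OF H.mem(4)[OF unH uH]] by simp
  qed
  have ip: "integrable M (\<lambda>t. H.nrm (un (r n) t - u t))" for n
    by (rule integrable_square_imp[OF finM mp Hi])
  have iq: "integrable M (\<lambda>t. H.nrm (un n t - wn n t))" "integrable M (\<lambda>t. (H.nrm (un n t - wn n t))^2)" for n
    by (rule S_comp2_integrable[OF un_S wn_S])+
  \<comment> \<open>Square root of the total measure, the factor by which the L2-norm in time bounds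
    the L1-norm.\<close>
  define cT where "cT = sqrt (\<integral>t. (1::real)^2 \<partial>M)"
  have L12: "(\<integral>t. g t \<partial>M) \<le> sqrt (\<integral>t. (g t)^2 \<partial>M) * cT"
    if "integrable M g" "integrable M (\<lambda>t. (g t)^2)" for g :: "real => real"
    using integral_CS(2)[of g M "\<lambda>_. 1"] that M.integrable_const[of 1] by (simp add: cT_def)
  have HH: "0 \<le> H.nrm (un n t - u t)" "0 \<le> H.nrm (un n t - wn n t)" for n t
    using H.nrm_nonneg[OF H.mem(4)[OF unH uH]] H.nrm_nonneg[OF H.mem(4)[OF unH wnH]] by auto
  let ?p = "\<lambda>n. \<integral>t. H.nrm (un (r n) t - u t) \<partial>M"
  let ?q = "\<lambda>n. \<integral>t. H.nrm (un (r n) t - wn (r n) t) \<partial>M"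
  have plim: "?p \<longlonglongrightarrow> 0"
  proof (rule null_squeeze)
    show "?p n \<le> sqrt (\<integral>t. (H.nrm (un (r n) t - u t))^2 \<partial>M) * cT" for n by (rule L12[OF ip Hi])
    show "(\<lambda>n. sqrt (\<integral>t. (H.nrm (un (r n) t - u t))^2 \<partial>M) * cT) \<longlonglongrightarrow> 0"
      using tendsto_real_sqrt[OF Hl] by (intro tendsto_mult_left_zero) simp
  qed (intro Bochner_Integration.integral_nonneg HH)
  have taur: "(\<lambda>n. \<tau> (r n)) \<longlonglongrightarrow> 0" using LIMSEQ_subseq_LIMSEQ[OF tau_tendsto r] by (simp add: comp_def)
  have qlim: "?q \<longlonglongrightarrow> 0"
  proof (rule null_squeeze)
    show "?q n \<le> sqrt (2 * E0 * \<tau> (r n)) * cT" for n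
      using integral_un_wn by (intro order_trans[OF L12[OF iq]] mult_right_mono real_sqrt_le_mono) (auto simp: cT_def)
    have "(\<lambda>n. sqrt (2 * E0 * \<tau> (r n)) * cT) \<longlonglongrightarrow> sqrt (2 * E0 * 0) * cT" by (intro tendsto_intros taur)
    then show "(\<lambda>n. sqrt (2 * E0 * \<tau> (r n)) * cT) \<longlonglongrightarrow> 0" by simp
  qed (intro Bochner_Integration.integral_nonneg HH)

  have Rlim: "(\<lambda>n. \<integral>s. \<bar>R (r n) v s - RL u v s\<bar> \<partial>M) \<longlonglongrightarrow> 0" if vD: "v \<in> D0" for v
  proof -
    have v: "v \<in> V" using vD D0 by auto
    obtain K where K: "0 \<le> K" "\<And>u. u \<in> V ==> \<bar>a u v\<bar> \<le> K * H.nrm u"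
      "\<And>u w. u \<in> V ==> w \<in> V ==> \<bar>b w v u\<bar> \<le> K * H.nrm w * H.nrm u"
      by (rule H_const_bound[OF vD]) blast
    define c1 where "c1 = K + 2 * K * sqrt E0"
    define c2 where "c2 = K * sqrt E0"
    have le: "\<bar>R N v s - RL u v s\<bar> \<le> c1 * H.nrm (un N s - u s) + c2 * H.nrm (un N s - wn N s)" for N s
    proof -
      define d where "d = un N s - u s"
      define d' where "d' = wn N s - u s"
      have dV: "d \<in> V" "d' \<in> V" using un_V wn_V u by (auto simp: d_def d'_def)
      have "H.nrm d' \<le> H.nrm (wn N s - un N s) + H.nrm d"
        unfolding d'_def d_def by (rule H.nrm_triangle3[OF wnH unH uH])
      then have d': "H.nrm d' \<le> H.nrm (un N s - wn N s) + H.nrm d"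
        using H.nrm_diff_sym[OF wnH unH, of N s N s] by simp
      \<comment> \<open>Skewness puts v into the differentiated slot of both trilinear terms, so
        their difference is controlled by H-norms; convergence in L2(0,T;H) then suffices.\<close>
      have "R N v s - RL u v s = - a d v + (b (wn N s) v (un N s) - b (u s) v (u s))"
        using b_skew[OF wn_V un_V v, of N s N s] b_skew[OF u u v, of s s] a_diff1[OF un_V u v, of N s s]
        by (simp add: R_def RL_def d_def)
      also have "b (wn N s) v (un N s) - b (u s) v (u s) = b d' v (un N s) + b (u s) v d"
        using u un_V wn_V v by (simp add: d_def d'_def b_diff1 b_diff3)
      finally have "\<bar>R N v s - RL u v s\<bar> \<le> \<bar>a d v\<bar> + \<bar>b d' v (un N s)\<bar> + \<bar>b (u s) v d\<bar>" by linarith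
      also have "\<dots> \<le> K * H.nrm d + K * H.nrm d' * H.nrm (un N s) + K * H.nrm (u s) * H.nrm d"
        using K dV u un_V by (intro add_mono) auto
      also have "\<dots> \<le> K * H.nrm d + K * H.nrm d' * sqrt E0 + K * sqrt E0 * H.nrm d"
        using K(1) un_bound ub H.nrm_nonneg[OF VH[OF dV(1)]] H.nrm_nonneg[OF VH[OF dV(2)]]
        by (intro add_mono mult_left_mono mult_right_mono) auto
      also have "K * H.nrm d' * sqrt E0 \<le> K * (H.nrm (un N s - wn N s) + H.nrm d) * sqrt E0"
        using K(1) d' E0_nonneg by (intro mult_left_mono mult_right_mono) auto
      finally show ?thesis by (simp add: c1_def c2_def d_def algebra_simps)
    qed
    show ?thesis
    proof (rule null_squeeze)
      show "(\<integral>s. \<bar>R (r n) v s - RL u v s\<bar> \<partial>M) \<le> c1 * ?p n + c2 * ?q n" for n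
      proof -
        have "(\<integral>s. \<bar>R (r n) v s - RL u v s\<bar> \<partial>M) \<le>
          (\<integral>s. c1 * H.nrm (un (r n) s - u s) + c2 * H.nrm (un (r n) s - wn (r n) s) \<partial>M)"
          using R_integrable[OF v] iR[OF v] ip iq by (intro integral_mono le) auto
        then show ?thesis using ip iq by simp
      qed
      have "(\<lambda>n. c1 * ?p n + c2 * ?q n) \<longlonglongrightarrow> c1 * 0 + c2 * 0" by (intro tendsto_intros plim qlim)
      then show "(\<lambda>n. c1 * ?p n + c2 * ?q n) \<longlonglongrightarrow> 0" by simp
    qed (simp add: Bochner_Integration.integral_nonneg)
  qed

  \<comment> \<open>A further subsequence, to have convergence in H at almost every single
    time.\<close>
  obtain r' where r': "strict_mono (r' :: nat => nat)" "AE t in M. (\<lambda>n. H.nrm (un (r (r' n)) t - u t)) \<longlonglongrightarrow> 0"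
    using tendsto_L1_AE_subseq[of M "\<lambda>n t. H.nrm (un (r n) t - u t)", OF ip] plim H.nrm_nonneg[OF H.mem(4)[OF unH uH]] by auto
  have D0_eq: "AE t in M. ipH (u t) v = ipH u0 v + (\<integral>s. indicator {..t} s * RL u v s \<partial>M)" if vD: "v \<in> D0" for v
    using r'(2) AE_space
  proof eventually_elim
    fix t assume lim: "(\<lambda>n. H.nrm (un (r (r' n)) t - u t)) \<longlonglongrightarrow> 0" and "t \<in> space M"
    then have t: "0 < t" "t < T" by auto
    have v: "v \<in> V" using vD D0 by auto
    define k where "k n = r (r' n)" for n
    have l1: "(\<lambda>n. ipH (un (k n) t) v) \<longlonglongrightarrow> ipH (u t) v"
      unfolding k_def by (rule H.tendsto_ip) (use unH uH VH[OF v] lim in auto)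
    let ?J = "\<lambda>g. \<integral>s. indicator {..t} s * g s \<partial>M"
    have "(\<lambda>n. ?J (R (k n) v) - ?J (RL u v)) \<longlonglongrightarrow> 0"
    proof (rule Lim_null_comparison)
      show "\<forall>\<^sub>F n in sequentially. norm (?J (R (k n) v) - ?J (RL u v)) \<le> (\<integral>s. \<bar>R (k n) v s - RL u v s\<bar> \<partial>M)"
        using indicator_integral_diff[OF R_integrable[OF v] iR[OF v]] by (intro always_eventually) auto
      show "(\<lambda>n. \<integral>s. \<bar>R (k n) v s - RL u v s\<bar> \<partial>M) \<longlonglongrightarrow> 0"
        using LIMSEQ_subseq_LIMSEQ[OF Rlim[OF vD] r'(1)] by (simp add: comp_def k_def)
    qed
    then have l2: "(\<lambda>n. ?J (R (k n) v)) \<longlonglongrightarrow> ?J (RL u v)" by (simp add: LIM_zero_iff)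
    \<comment> \<open>\<open>integrated_un\<close> integrates up to the node above t and not up to
      t; the overshoot is shorter than one step.\<close>
    let ?E = "\<lambda>n. \<integral>s. indicator {t<..real (\<kappa> (k n) t) * \<tau> (k n)} s * R (k n) v s \<partial>M"
    have l3: "?E \<longlonglongrightarrow> 0"
    proof (rule Lim_null_comparison)
      show "\<forall>\<^sub>F n in sequentially. norm (?E n) \<le> sqrt (\<tau> (k n)) * sqrt K0 * V.nrm v"
      proof (rule always_eventually, rule allI)
        fix n
        have le: "t \<le> real (\<kappa> (k n) t) * \<tau> (k n)" by (rule \<kappa>_bounds(2)[OF t(1)])
        have "norm (?E n) \<le> sqrt (real (\<kappa> (k n) t) * \<tau> (k n) - t) * sqrt K0 * V.nrm v"
          using R_indicator_bound[OF v le] by simp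
        also have "\<dots> \<le> sqrt (\<tau> (k n)) * sqrt K0 * V.nrm v"
          using \<kappa>_bounds(3)[OF t(1), of "k n"] K0_nonneg V.nrm_nonneg[OF v]
          by (intro mult_right_mono) auto
        finally show "norm (?E n) \<le> sqrt (\<tau> (k n)) * sqrt K0 * V.nrm v" .
      qed
      have "(\<lambda>n. \<tau> (k n)) \<longlonglongrightarrow> 0" using LIMSEQ_subseq_LIMSEQ[OF taur r'(1)] by (simp add: comp_def k_def)
      then have "(\<lambda>n. sqrt (\<tau> (k n)) * sqrt K0 * V.nrm v) \<longlonglongrightarrow> sqrt 0 * sqrt K0 * V.nrm v"
        by (intro tendsto_intros)
      then show "(\<lambda>n. sqrt (\<tau> (k n)) * sqrt K0 * V.nrm v) \<longlonglongrightarrow> 0" by simp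
    qed
    have "ipH (un (k n) t) v = ipH u0 v + (?J (R (k n) v) + ?E n)" for n
      unfolding integrated_un[OF v t] integral_indicator_split[OF R_integrable[OF v] \<kappa>_bounds(2)[OF t(1), of "k n"]] ..
    then have "(\<lambda>n. ipH (un (k n) t) v) \<longlonglongrightarrow> ipH u0 v + (?J (RL u v) + 0)"
      by (simp only:) (intro tendsto_intros l2 l3)
    then show "ipH (u t) v = ipH u0 v + ?J (RL u v)" using LIMSEQ_unique[OF l1] by simp
  qed
  have eqV: "AE t in M. ipH (u t) v = ipH u0 v + (\<integral>s. indicator {..t} s * RL u v s \<partial>M)" if v: "v \<in> V" for v
  proof -
    have "\<exists>d\<in>D0. V.nrm (v - d) < 1 / real (Suc j)" for j by (rule dense[OF v]) simp
    then obtain d where d: "\<And>j. d j \<in> D0" "\<And>j. V.nrm (v - d j) < 1 / real (Suc j)" by metis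
    have dV: "d j \<in> V" for j using d D0 by auto
    have dH: "d j \<in> H" for j by (rule VH[OF dV])
    have vH: "v \<in> H" by (rule VH[OF v])
    have lim: "(\<lambda>j. V.nrm (d j - v)) \<longlonglongrightarrow> 0"
    proof (rule null_squeeze[OF _ _ inverse_Suc_null])
      show "V.nrm (d j - v) \<le> 1 / real (Suc j)" for j
        using d(2)[of j] V.nrm_diff_sym[OF v dV, of j] by simp
    qed (intro V.nrm_nonneg V.mem dV v)
    have limH: "(\<lambda>j. H.nrm (d j - v)) \<longlonglongrightarrow> 0"
      by (rule null_squeeze[OF _ _ lim]) (intro H.nrm_nonneg H.mem dH vH, intro nrm_le V.mem dV v)
    have hl: "(\<lambda>j. ipH w (d j)) \<longlonglongrightarrow> ipH w v" if w: "w \<in> H" for w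
      using H.tendsto_ip[OF dH vH w limH] H.ip_sym[OF w dH] H.ip_sym[OF w vH] by simp
    \<comment> \<open>A sequence of test elements, rather than all of \<open>D0\<close>, so that one
      null set serves every j.\<close>
    have "AE t in M. \<forall>j. ipH (u t) (d j) = ipH u0 (d j) + (\<integral>s. indicator {..t} s * RL u (d j) s \<partial>M)"
      unfolding AE_all_countable using D0_eq d by blast
    then show ?thesis
    proof eventually_elim
      fix t assume eq: "\<forall>j. ipH (u t) (d j) = ipH u0 (d j) + (\<integral>s. indicator {..t} s * RL u (d j) s \<partial>M)"
      let ?J = "\<lambda>w. \<integral>s. indicator {..t} s * RL u w s \<partial>M"
      have "(\<lambda>j. ?J (d j) - ?J v) \<longlonglongrightarrow> 0"
      proof (rule Lim_null_comparison)
        show "\<forall>\<^sub>F j in sequentially. norm (?J (d j) - ?J v) \<le> (\<integral>s. majL u s \<partial>M) * V.nrm (d j - v)"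
        proof (rule always_eventually, rule allI)
          fix j
          have dv: "d j - v \<in> V" using dV v by simp
          have "\<bar>?J (d j) - ?J v\<bar> \<le> (\<integral>s. \<bar>RL u (d j) s - RL u v s\<bar> \<partial>M)"
            by (rule indicator_integral_diff[OF iR[OF dV] iR[OF v]])
          also have "\<dots> \<le> (\<integral>s. majL u s * V.nrm (d j - v) \<partial>M)"
          proof (rule integral_mono)
            show "integrable M (\<lambda>s. \<bar>RL u (d j) s - RL u v s\<bar>)"
              by (rule integrable_abs[OF Bochner_Integration.integrable_diff[OF iR[OF dV] iR[OF v]]])
            show "integrable M (\<lambda>s. majL u s * V.nrm (d j - v))" using imaj by simp
            show "\<bar>RL u (d j) s - RL u v s\<bar> \<le> majL u s * V.nrm (d j - v)" for s
            proof -
              have "RL u (d j) s - RL u v s = RL u (d j - v) s"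
                using dV[of j] v u[of s] by (simp add: RL_def f_diff a_diff2 b_diff3)
              moreover have "\<bar>RL u (d j - v) s\<bar> \<le> majL u s * V.nrm (d j - v)" by (rule RL_bound[OF dv u ub])
              ultimately show ?thesis by simp
            qed
          qed
          finally show "norm (?J (d j) - ?J v) \<le> (\<integral>s. majL u s \<partial>M) * V.nrm (d j - v)" by simp
        qed
        show "(\<lambda>j. (\<integral>s. majL u s \<partial>M) * V.nrm (d j - v)) \<longlonglongrightarrow> 0"
          by (intro tendsto_mult_right_zero lim)
      qed
      then have "(\<lambda>j. ?J (d j)) \<longlonglongrightarrow> ?J v" by (simp add: LIM_zero_iff)
      then have "(\<lambda>j. ipH u0 (d j) + ?J (d j)) \<longlonglongrightarrow> ipH u0 v + ?J v" by (intro tendsto_intros hl u0)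
      then have "(\<lambda>j. ipH (u t) (d j)) \<longlonglongrightarrow> ipH u0 v + ?J v" using eq by simp
      then show "ipH (u t) v = ipH u0 v + ?J v" using LIMSEQ_unique[OF hl[OF uH]] by blast
    qed
  qed
  show ?thesis by (rule that[OF u z zu ui ub iR eqV])
qed

end

section \<open>Calculus of smooth functions\<close>

lemma partial_eqI: "(\<phi> has_derivative D) (at x) ==> partial e \<phi> x = D e"
  unfolding partial_def by (metis frechet_derivative_at)

lemma has_derivative_frechet: "\<phi> differentiable (at x) ==> (\<phi> has_derivative frechet_derivative \<phi> (at x)) (at x)"
  by (simp add: frechet_derivative_works)

lemma partial_const [simp]: "partial e (\<lambda>x. c) x = 0"
  by (rule partial_eqI) simp

lemma partial_linear:
  assumes "bounded_linear h" "\<phi> differentiable (at x)"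
  shows "partial e (\<lambda>x. h (\<phi> x)) x = h (partial e \<phi> x)"
  unfolding partial_def[of e \<phi>]
  by (rule partial_eqI) (rule bounded_linear.has_derivative[OF assms(1) has_derivative_frechet[OF assms(2)]])

lemma partial_add:
  assumes "\<phi> differentiable (at x)" "\<psi> differentiable (at x)"
  shows "partial e (\<lambda>x. \<phi> x + \<psi> x) x = partial e \<phi> x + partial e \<psi> x"
  unfolding partial_def[of e \<phi>] partial_def[of e \<psi>]
  by (rule partial_eqI) (intro has_derivative_add has_derivative_frechet assms)

lemma partial_diff:
  assumes "\<phi> differentiable (at x)" "\<psi> differentiable (at x)"
  shows "partial e (\<lambda>x. \<phi> x - \<psi> x) x = partial e \<phi> x - partial e \<psi> x"
  unfolding partial_def[of e \<phi>] partial_def[of e \<psi>]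
  by (rule partial_eqI) (intro has_derivative_diff has_derivative_frechet assms)

lemma partial_bilinear:
  assumes "bounded_bilinear h" "\<phi> differentiable (at x)" "\<psi> differentiable (at x)"
  shows "partial e (\<lambda>x. h (\<phi> x) (\<psi> x)) x = h (\<phi> x) (partial e \<psi> x) + h (partial e \<phi> x) (\<psi> x)"
  unfolding partial_def[of e \<phi>] partial_def[of e \<psi>]
  by (rule partial_eqI)
    (rule bounded_bilinear.FDERIV[OF assms(1) has_derivative_frechet[OF assms(2)] has_derivative_frechet[OF assms(3)]])

lemma partial_chain:
  fixes g :: "real => real"
  assumes "(g has_real_derivative g') (at (p x))" "p differentiable (at x)"
  shows "partial e (\<lambda>x. g (p x)) x = partial e p x * g'"
  unfolding partial_def[of e p]
proof (rule partial_eqI)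
  have "(g has_derivative (\<lambda>t. t * g')) (at (p x))"
    using assms(1) by (simp add: has_field_derivative_def mult_commute_abs)
  from has_derivative_compose[OF has_derivative_frechet[OF assms(2)] this]
  show "((\<lambda>x. g (p x)) has_derivative (\<lambda>t. frechet_derivative p (at x) t * g')) (at x)" by simp
qed

lemma Ck_differentiable: "Ck (Suc k) \<phi> ==> \<phi> differentiable (at x)" by simp

lemma Ck_partial: "Ck (Suc k) \<phi> ==> e \<in> Basis ==> Ck k (partial e \<phi>)" by simp

lemma Ck_SucD: "Ck (Suc k) \<phi> ==> Ck k \<phi>"
proof (induction k arbitrary: \<phi>)
  case 0
  then show ?case
    by (auto simp: continuous_on_eq_continuous_at intro: differentiable_imp_continuous_within)
next
  case (Suc k)
  then show ?case by (metis Ck.simps(2))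
qed

lemma Ck_const [simp]: "Ck k (\<lambda>x. c)"
proof (induction k arbitrary: c)
  case (Suc k)
  have "partial e (\<lambda>x. c) = (\<lambda>x. 0)" for e :: 'a by auto
  then show ?case using Suc by simp
qed simp

lemma Ck_linear: "bounded_linear h ==> Ck k \<phi> ==> Ck k (\<lambda>x. h (\<phi> x))"
proof (induction k arbitrary: \<phi>)
  case 0
  then show ?case by (auto intro: bounded_linear.continuous_on)
next
  case (Suc k)
  have "partial e (\<lambda>x. h (\<phi> x)) = (\<lambda>x. h (partial e \<phi> x))" for e
    using Suc.prems by (auto simp: partial_linear)
  moreover have "(\<lambda>x. h (\<phi> x)) differentiable (at x)" for x
    using bounded_linear.has_derivative[OF Suc.prems(1) has_derivative_frechet[OF Ck_differentiable[OF Suc.prems(2)]]]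
    by (rule differentiableI)
  ultimately show ?case using Suc by simp
qed

lemma Ck_add: "Ck k \<phi> ==> Ck k \<psi> ==> Ck k (\<lambda>x. \<phi> x + \<psi> x)"
proof (induction k arbitrary: \<phi> \<psi>)
  case 0
  then show ?case by (auto intro: continuous_on_add)
next
  case (Suc k)
  have "partial e (\<lambda>x. \<phi> x + \<psi> x) = (\<lambda>x. partial e \<phi> x + partial e \<psi> x)" for e
    using Suc.prems by (auto simp: partial_add)
  then show ?case using Suc by simp
qed

lemma Ck_bilinear: "bounded_bilinear h ==> Ck k \<phi> ==> Ck k \<psi> ==> Ck k (\<lambda>x. h (\<phi> x) (\<psi> x))"
proof (induction k arbitrary: \<phi> \<psi>)
  case 0
  then show ?case by (auto intro: bounded_bilinear.continuous_on)
next
  case (Suc k)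
  note h = Suc.prems(1)
  have "partial e (\<lambda>x. h (\<phi> x) (\<psi> x)) = (\<lambda>x. h (\<phi> x) (partial e \<psi> x) + h (partial e \<phi> x) (\<psi> x))" for e
    using Suc.prems by (auto simp: partial_bilinear)
  moreover have "(\<lambda>x. h (\<phi> x) (\<psi> x)) differentiable (at x)" for x
    by (rule differentiableI[OF bounded_bilinear.FDERIV[OF h has_derivative_frechet[OF Ck_differentiable[OF Suc.prems(2)]]
      has_derivative_frechet[OF Ck_differentiable[OF Suc.prems(3)]]]])
  moreover have "Ck k (\<lambda>x. h (\<phi> x) (partial e \<psi> x) + h (partial e \<phi> x) (\<psi> x))" if "e \<in> Basis" for e
    using Suc that by (intro Ck_add Suc.IH h) (auto intro: Ck_SucD Ck_partial simp del: Ck.simps(2))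
  ultimately show ?case by simp
qed

lemma Ck_mult: "Ck k \<phi> ==> Ck k \<psi> ==> Ck k (\<lambda>x. \<phi> x * \<psi> x :: real)"
  by (rule Ck_bilinear[OF bounded_bilinear_mult])

lemma Ck_diff: "Ck k \<phi> ==> Ck k \<psi> ==> Ck k (\<lambda>x. \<phi> x - \<psi> x)"
  using Ck_add[of k \<phi> "\<lambda>x. - \<psi> x"] Ck_linear[OF bounded_linear_minus[OF bounded_linear_ident], of k \<psi>] by simp

lemma Ck_prod: "finite I ==> (\<And>i. i \<in> I ==> Ck k (\<phi> i)) ==> Ck k (\<lambda>x. \<Prod>i\<in>I. \<phi> i x :: real)"
  by (induction I rule: finite_induct) (auto intro: Ck_mult)

lemma Ck_ident: "Ck k (\<lambda>x. x)"
proof (cases k)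
  case (Suc j)
  have "partial e (\<lambda>x. x) = (\<lambda>x. e)" for e :: 'a
    by (rule ext, rule partial_eqI) simp
  then show ?thesis using Suc by simp
qed simp

text \<open>g lists a function together with all its derivatives, so one induction over k, for all n
  simultaneously, replaces the higher order chain rule.\<close>

lemma Ck_chain:
  fixes g :: "nat => real => real"
  assumes g: "\<And>n t. (g n has_real_derivative g (Suc n) t) (at t)"
  shows "Ck k p ==> Ck k (\<lambda>x. g n (p x))"
proof (induction k arbitrary: n p)
  case 0
  have "continuous_on UNIV (g n)" using g DERIV_isCont by (intro continuous_at_imp_continuous_on) blast
  then show ?case using 0 by (auto intro: continuous_on_compose2)
next
  case (Suc k)
  have "partial e (\<lambda>x. g n (p x)) = (\<lambda>x. partial e p x * g (Suc n) (p x))" for e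
    using Suc.prems g by (auto simp: partial_chain)
  moreover have "(\<lambda>x. g n (p x)) differentiable (at x)" for x
    using g[of n "p x"] Suc.prems
    by (auto intro!: differentiable_compose[of "g n" p] simp: real_differentiable_def)
  moreover have "Ck k (\<lambda>x. partial e p x * g (Suc n) (p x))" if "e \<in> Basis" for e
    using Suc that by (intro Ck_mult Suc.IH) (auto intro: Ck_SucD Ck_partial simp del: Ck.simps(2))
  ultimately show ?case by simp
qed

subsection \<open>The smooth function exp(-1/t)\<close>

text \<open>The n-th derivative of exp (-1/t) for t > 0 is a polynomial in s = 1/t times exp (-s).
  Since d/dt = -s^2 d/ds, the polynomial p is followed by s^2 (p - p').\<close>

primrec flat_poly :: "nat => real poly" where
  "flat_poly 0 = 1"
| "flat_poly (Suc n) = [:0, 0, 1:] * (flat_poly n - pderiv (flat_poly n))"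

definition flat :: "nat => real => real" where
  "flat n t = (if 0 < t then poly (flat_poly n) (1 / t) * exp (- 1 / t) else 0)"

lemma poly_exp_tendsto_0: "((\<lambda>s. s ^ k * poly p s * exp (- s)) \<longlongrightarrow> 0) (at_top :: real filter)"
proof (induction p arbitrary: k)
  case (pCons c p)
  have "((\<lambda>s::real. c * (s ^ k / exp s) + s ^ Suc k * poly p s * exp (- s)) \<longlongrightarrow> c * 0 + 0) at_top"
    by (intro tendsto_intros tendsto_power_div_exp_0 pCons.IH)
  then show ?case by (simp add: exp_minus field_simps)
qed simp

text \<open>This is the difference quotient at 0, the one point where the differentiation rules give
  nothing; the exponential beats every polynomial in 1/t.\<close>

lemma flat_over_t: "((\<lambda>t. flat n t / t) \<longlongrightarrow> 0) (at 0)"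
proof (rule filterlim_split_at)
  show "((\<lambda>t. flat n t / t) \<longlongrightarrow> 0) (at_left 0)"
    by (rule tendsto_eventually) (auto simp: flat_def eventually_at_filter)
  have inv: "filterlim (\<lambda>t::real. 1 / t) at_top (at_right 0)"
    using filterlim_inverse_at_top_right by (simp add: inverse_eq_divide)
  have "((\<lambda>t. (1 / t) ^ 1 * poly (flat_poly n) (1 / t) * exp (- (1 / t))) \<longlongrightarrow> 0) (at_right 0)"
    by (rule filterlim_compose[OF poly_exp_tendsto_0 inv])
  then show "((\<lambda>t. flat n t / t) \<longlongrightarrow> 0) (at_right 0)"
    by (rule Lim_transform_eventually) (auto simp: flat_def eventually_at_filter)
qed

lemma flat_deriv: "(flat n has_real_derivative flat (Suc n) t) (at t)"
proof -
  consider "t > 0" | "t < 0" | "t = 0" by linarith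
  then show ?thesis
  proof cases
    case 1
    have "((\<lambda>t. poly (flat_poly n) (1 / t) * exp (- 1 / t)) has_real_derivative flat (Suc n) t) (at t)"
      using 1 by (auto intro!: derivative_eq_intros simp: flat_def power2_eq_square field_simps)
    moreover have "\<forall>\<^sub>F s in nhds t. poly (flat_poly n) (1 / s) * exp (- 1 / s) = flat n s"
      using eventually_nhds_in_open[of "{0<..}" t] 1 by (auto simp: flat_def elim!: eventually_mono)
    ultimately show ?thesis by (rule iffD1[OF DERIV_cong_ev[OF refl _ refl], rotated])
  next
    case 2
    have "\<forall>\<^sub>F s in nhds t. 0 = flat n s"
      using eventually_nhds_in_open[of "{..<0}" t] 2 by (auto simp: flat_def elim!: eventually_mono)
    moreover have "((\<lambda>t. 0) has_real_derivative flat (Suc n) t) (at t)" using 2 by (simp add: flat_def)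
    ultimately show ?thesis by (rule iffD1[OF DERIV_cong_ev[OF refl _ refl]])
  next
    case 3
    have "((\<lambda>h. (flat n (0 + h) - flat n 0) / h) \<longlongrightarrow> 0) (at 0)"
      using flat_over_t[of n] by (simp add: flat_def)
    then show ?thesis using 3 by (simp add: DERIV_def flat_def)
  qed
qed

lemma flat_pos: "0 < t ==> 0 < flat 0 t" and flat_zero: "t \<le> 0 ==> flat 0 t = 0" and flat_nonneg: "0 \<le> flat 0 t"
  by (auto simp: flat_def)

lemma Ck_exp: "Ck k p ==> Ck k (\<lambda>x. exp (p x) :: real)"
  by (rule Ck_chain[of "\<lambda>n. exp"]) (auto intro: DERIV_exp)

definition box_bump :: "'a::euclidean_space => 'a => 'a => real" where
  "box_bump a b x = (\<Prod>i\<in>Basis. flat 0 ((x - a) \<bullet> i) * flat 0 ((b - x) \<bullet> i))"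

lemma Ck_box_bump: "Ck k (box_bump a b)"
proof -
  have "Ck k (\<lambda>x. flat 0 ((x - a) \<bullet> i))" "Ck k (\<lambda>x. flat 0 ((b - x) \<bullet> i))" for i
  proof -
    have "Ck k (\<lambda>x. (x - a) \<bullet> i)" "Ck k (\<lambda>x. (b - x) \<bullet> i)"
      by (rule Ck_linear[OF bounded_linear_inner_left], rule Ck_diff[OF Ck_ident Ck_const])
        (rule Ck_linear[OF bounded_linear_inner_left], rule Ck_diff[OF Ck_const Ck_ident])
    then show "Ck k (\<lambda>x. flat 0 ((x - a) \<bullet> i))" "Ck k (\<lambda>x. flat 0 ((b - x) \<bullet> i))"
      using Ck_chain[of flat k "\<lambda>x. (x - a) \<bullet> i" 0, OF flat_deriv]
        Ck_chain[of flat k "\<lambda>x. (b - x) \<bullet> i" 0, OF flat_deriv] by blast+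
  qed
  then show ?thesis unfolding box_bump_def[abs_def] by (intro Ck_prod Ck_mult) auto
qed

lemma box_bump_pos: "x \<in> box a b ==> 0 < box_bump a b x"
  unfolding box_bump_def by (intro prod_pos mult_pos_pos flat_pos) (auto simp: mem_box inner_diff_left)

lemma box_bump_zero: "x \<notin> box a b ==> box_bump a b x = 0"
proof -
  assume "x \<notin> box a b"
  then obtain i where "i \<in> Basis" "x \<bullet> i \<le> a \<bullet> i \<or> b \<bullet> i \<le> x \<bullet> i" by (auto simp: mem_box not_less)
  then have "flat 0 ((x - a) \<bullet> i) * flat 0 ((b - x) \<bullet> i) = 0"
    by (auto simp: inner_diff_left flat_zero)
  with \<open>i \<in> Basis\<close> show ?thesis unfolding box_bump_def by (intro prod_zero) auto
qed

lemma box_bump_nonneg: "0 \<le> box_bump a b x"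
  using box_bump_pos[of x a b] box_bump_zero[of x a b] by fastforce

text \<open>With b for \<open>box_bump\<close>, 1 - exp (-n b) tends to 1 where b > 0 and stays 0
  where b = 0. These are explicit smooth functions approaching the indicator of an open box from
  below.\<close>

definition cutoff :: "'a::euclidean_space => 'a => nat => 'a => real" where
  "cutoff a b n x = 1 - exp (- (real n * box_bump a b x))"

lemma cutoff_bounds: "0 \<le> cutoff a b n x" "cutoff a b n x \<le> 1"
  using box_bump_nonneg[of a b x] by (auto simp: cutoff_def)

lemma cutoff_tendsto: "(\<lambda>n. cutoff a b n x) \<longlonglongrightarrow> indicator (box a b) x"
proof (cases "x \<in> box a b")
  case True
  have "filterlim (\<lambda>n. real n * box_bump a b x) at_top sequentially"
    by (subst mult.commute)
      (rule filterlim_tendsto_pos_mult_at_top[OF tendsto_const box_bump_pos[OF True] filterlim_real_sequentially])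
  then have "(\<lambda>n. exp (- (real n * box_bump a b x))) \<longlonglongrightarrow> 0"
    by (intro filterlim_compose[OF exp_at_bot]) (simp add: filterlim_uminus_at_bot)
  then have "(\<lambda>n. cutoff a b n x) \<longlonglongrightarrow> 1 - 0" unfolding cutoff_def by (intro tendsto_intros)
  then show ?thesis using True by simp
next
  case False
  then show ?thesis by (simp add: cutoff_def box_bump_zero)
qed

lemma cutoff_test: "cbox a b \<subseteq> G ==> cutoff a b n \<in> test_functions G"
proof -
  assume G: "cbox a b \<subseteq> G"
  have "Ck k (cutoff a b n)" for k
    unfolding cutoff_def[abs_def]
    by (intro Ck_diff Ck_const Ck_exp)
      (rule Ck_linear[OF bounded_linear_minus[OF bounded_linear_mult_right[of "real n"]] Ck_box_bump])
  moreover have "cutoff a b n x = 0" if "x \<notin> cbox a b" for x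
    using that box_subset_cbox[of a b] box_bump_zero[of x a b] by (auto simp: cutoff_def)
  ultimately show ?thesis using G unfolding test_functions_def
    by (auto intro!: exI[of _ "cbox a b"] simp del: Ck.simps)
qed

section \<open>Test functions\<close>

lemma test_Ck: "\<phi> \<in> test_functions G ==> Ck k \<phi>" by (simp add: test_functions_def)

lemma test_diff: "\<phi> \<in> test_functions G ==> \<phi> differentiable (at x)"
  using test_Ck[of \<phi> G "Suc 0"] by simp

lemma test_cont: "\<phi> \<in> test_functions G ==> continuous_on UNIV \<phi>"
  using test_Ck[of \<phi> G 0] by simp

lemma test_support:
  assumes "\<phi> \<in> test_functions G"
  obtains K where "compact K" "K \<subseteq> G" "\<And>x. x \<notin> K ==> \<phi> x = 0" "\<And>x e. x \<notin> K ==> partial e \<phi> x = 0"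
proof -
  obtain K where K: "compact K" "K \<subseteq> G" "\<And>x. x \<notin> K ==> \<phi> x = 0"
    using assms by (auto simp: test_functions_def)
  have "partial e \<phi> x = 0" if "x \<notin> K" for x e
  proof -
    have op: "open (- K)" using K(1) compact_imp_closed by (auto simp: open_Compl)
    have "(\<phi> has_derivative (\<lambda>_. 0)) (at x)"
      by (rule has_derivative_transform_within_open[of "\<lambda>_. 0" _ x UNIV "- K"])
        (use that K op in auto)
    then show ?thesis by (rule partial_eqI)
  qed
  then show ?thesis using that K by blast
qed

lemma test_outside: "\<phi> \<in> test_functions G ==> x \<notin> G ==> \<phi> x = 0"
  by (auto simp: test_functions_def)

lemma test_partial: "\<phi> \<in> test_functions G ==> e \<in> Basis ==> partial e \<phi> \<in> test_functions G"
proof -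
  assume \<phi>: "\<phi> \<in> test_functions G" and e: "e \<in> Basis"
  obtain K where "compact K" "K \<subseteq> G" "\<And>x. x \<notin> K ==> partial e \<phi> x = 0"
    by (rule test_support[OF \<phi>]) blast
  moreover have "Ck k (partial e \<phi>)" for k using test_Ck[OF \<phi>, of "Suc k"] e by simp
  ultimately show ?thesis unfolding test_functions_def by blast
qed

lemma test_linear:
  assumes h: "bounded_linear h" and \<phi>: "\<phi> \<in> test_functions G"
  shows "(\<lambda>x. h (\<phi> x)) \<in> test_functions G"
proof -
  obtain K where "compact K" "K \<subseteq> G" "\<And>x. x \<notin> K ==> \<phi> x = 0"
    using \<phi> unfolding test_functions_def by auto
  moreover have "Ck k (\<lambda>x. h (\<phi> x))" for k by (rule Ck_linear[OF h test_Ck[OF \<phi>]])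
  moreover have "h 0 = 0" using h by (simp add: bounded_linear.linear linear_0)
  ultimately show ?thesis unfolding test_functions_def
    by (auto intro!: exI[of _ K] simp del: Ck.simps)
qed

lemma test_add: "\<phi> \<in> test_functions G ==> \<psi> \<in> test_functions G ==> (\<lambda>x. \<phi> x + \<psi> x) \<in> test_functions G"
proof -
  assume a: "\<phi> \<in> test_functions G" "\<psi> \<in> test_functions G"
  obtain K K' where "compact K" "K \<subseteq> G" "\<And>x. x \<notin> K ==> \<phi> x = 0" "compact K'" "K' \<subseteq> G" "\<And>x. x \<notin> K' ==> \<psi> x = 0"
    using a unfolding test_functions_def by auto
  then have "compact (K \<union> K') \<and> K \<union> K' \<subseteq> G \<and> (\<forall>x. x \<notin> K \<union> K' \<longrightarrow> \<phi> x + \<psi> x = 0)" by auto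
  moreover have "Ck k (\<lambda>x. \<phi> x + \<psi> x)" for k using a by (intro Ck_add test_Ck)
  ultimately show ?thesis unfolding test_functions_def by blast
qed

lemma test_bilinear:
  assumes h: "bounded_bilinear h" and \<phi>: "\<phi> \<in> test_functions G" and \<psi>: "\<And>k. Ck k \<psi>"
  shows "(\<lambda>x. h (\<phi> x) (\<psi> x)) \<in> test_functions G"
proof -
  obtain K where "compact K" "K \<subseteq> G" "\<And>x. x \<notin> K ==> \<phi> x = 0"
    using \<phi> unfolding test_functions_def by auto
  moreover have "Ck k (\<lambda>x. h (\<phi> x) (\<psi> x))" for k by (rule Ck_bilinear[OF h test_Ck[OF \<phi>] \<psi>])
  ultimately show ?thesis unfolding test_functions_def using bounded_bilinear.zero_left[OF h] by auto
qed

lemma subspace_test: "subspace (test_functions G)"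
  unfolding subspace_def
proof (intro conjI ballI allI)
  show "0 \<in> test_functions G" using Ck_const[of _ 0] compact_empty by (auto simp: test_functions_def zero_fun_def)
qed (auto simp: plus_fun_def scaleR_fun_def intro: test_add test_linear[OF bounded_linear_scaleR_right])

section \<open>Weak derivatives\<close>

lemma integrable_on_lebesgue_on:
  fixes F :: "'a::euclidean_space => 'b::euclidean_space"
  assumes "integrable lborel F" "S \<in> sets lebesgue"
  shows "integrable (lebesgue_on S) F"
proof -
  have "integrable lebesgue F" using assms(1) integrable_completion[of F lborel] by auto
  from integrable_mult_indicator[OF assms(2) this] show ?thesis
    using assms(2) by (subst integrable_restrict_space) auto
qed

lemma integral_lebesgue_on_zero_outside:
  fixes F :: "'a::euclidean_space => 'b::euclidean_space"
  assumes "F \<in> borel_measurable borel" "S \<in> sets lebesgue" "\<And>x. x \<notin> S ==> F x = 0"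
  shows "(\<integral>x. F x \<partial>lebesgue_on S) = (\<integral>x. F x \<partial>lborel)"
proof -
  have "(\<integral>x. F x \<partial>lebesgue_on S) = (\<integral>x. indicator S x *\<^sub>R F x \<partial>lebesgue)"
    using assms(2) by (subst integral_restrict_space) auto
  also have "(\<lambda>x. indicator S x *\<^sub>R F x) = F" using assms(3) by (auto simp: indicator_def)
  also have "(\<integral>x. F x \<partial>lebesgue) = (\<integral>x. F x \<partial>lborel)" using assms(1) by (intro integral_completion) simp
  finally show ?thesis .
qed

lemma integrable_continuous_compact_support:
  fixes F :: "'a::euclidean_space => 'b::euclidean_space"
  assumes "continuous_on UNIV F" "compact K" "\<And>x. x \<notin> K ==> F x = 0"
  shows "integrable lborel F"
proof -
  have "integrable lborel (\<lambda>x. indicator K x *\<^sub>R F x)"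
    using assms by (intro borel_integrable_compact) (auto intro: continuous_on_subset)
  also have "(\<lambda>x. indicator K x *\<^sub>R F x) = F" using assms(3) by (auto simp: indicator_def)
  finally show ?thesis .
qed

lemma test_integrable: "\<phi> \<in> test_functions G ==> integrable lborel (\<phi> :: 'a::euclidean_space => 'b::euclidean_space)"
  by (rule test_support[of \<phi> G]) (auto intro: integrable_continuous_compact_support test_cont)

lemma test_bounded:
  assumes "\<phi> \<in> test_functions G"
  obtains B where "0 < B" "\<And>x. norm (\<phi> x) \<le> B"
proof -
  obtain K where K: "compact K" "\<And>x. x \<notin> K ==> \<phi> x = 0" by (rule test_support[OF assms]) blast
  have "bounded (\<phi> ` K)"
    using K by (intro compact_imp_bounded compact_continuous_image) (auto intro: continuous_on_subset[OF test_cont[OF assms]])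
  then obtain B where B: "0 < B" "\<And>x. x \<in> K ==> norm (\<phi> x) \<le> B" by (auto simp: bounded_pos)
  have "norm (\<phi> x) \<le> B" for x using B K by (cases "x \<in> K") auto
  then show ?thesis using B that by blast
qed

lemma lborel_integral_shift:
  fixes F :: "'a::euclidean_space => 'b::euclidean_space"
  assumes "F \<in> borel_measurable borel"
  shows "(\<integral>x. F (x + a) \<partial>lborel) = (\<integral>x. F x \<partial>lborel)"
proof -
  have "(\<integral>x. F x \<partial>lborel) = (\<integral>x. F x \<partial>distr lborel borel ((+) a))" by (simp add: lborel_distr_plus)
  also have "\<dots> = (\<integral>x. F (a + x) \<partial>lborel)" using assms by (intro integral_distr) auto
  finally show ?thesis by (simp add: add.commute)
qed

lemma test_line_deriv:
  fixes \<phi> :: "'a::euclidean_space => 'b::real_normed_vector"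
  assumes "\<phi> differentiable (at (x + s *\<^sub>R e))"
  shows "((\<lambda>s. \<phi> (x + s *\<^sub>R e)) has_vector_derivative partial e \<phi> (x + s *\<^sub>R e)) (at s)"
proof -
  have "((\<lambda>s. x + s *\<^sub>R e) has_derivative (\<lambda>h. h *\<^sub>R e)) (at s)"
    by (auto intro!: derivative_eq_intros)
  from has_derivative_compose[OF this has_derivative_frechet[OF assms]]
  have "((\<lambda>s. \<phi> (x + s *\<^sub>R e)) has_derivative (\<lambda>h. frechet_derivative \<phi> (at (x + s *\<^sub>R e)) (h *\<^sub>R e))) (at s)" .
  moreover have "linear (frechet_derivative \<phi> (at (x + s *\<^sub>R e)))"
    using has_derivative_frechet[OF assms] has_derivative_linear by blast
  ultimately show ?thesis
    by (simp add: has_vector_derivative_def partial_def linear_scale)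
qed

text \<open>Translation invariance makes the integral of each difference quotient vanish.\<close>

lemma integral_partial_real:
  fixes \<phi> :: "'a::euclidean_space => real"
  assumes \<phi>: "\<phi> \<in> test_functions G" and e: "e \<in> Basis"
  shows "(\<integral>x. partial e \<phi> x \<partial>lborel) = 0"
proof -
  obtain K where K: "compact K" "\<And>x. x \<notin> K ==> \<phi> x = 0" by (rule test_support[OF \<phi>]) blast
  obtain \<rho> where \<rho>: "\<And>x. x \<in> K ==> norm x \<le> \<rho>"
    using compact_imp_bounded[OF K(1)] by (auto simp: bounded_iff)
  obtain B where B: "0 < B" "\<And>x. norm (partial e \<phi> x) \<le> B" by (rule test_bounded[OF test_partial[OF \<phi> e]]) blast
  \<comment> \<open>Increments of at most 1 keep all difference quotients supported in one ball,
    where the mean value theorem bounds them by the supremum of the derivative.\<close>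
  define h where "h n = 1 / real (Suc n)" for n
  have h: "0 < h n" "h n \<le> 1" for n by (auto simp: h_def)
  have h0: "h \<longlonglongrightarrow> 0" unfolding h_def using LIMSEQ_inverse_real_of_nat by (simp add: inverse_eq_divide)
  define D where "D n x = (\<phi> (x + h n *\<^sub>R e) - \<phi> x) / h n" for n x
  have cont: "continuous_on UNIV \<phi>" by (rule test_cont[OF \<phi>])
  have bm: "\<phi> \<in> borel_measurable borel" by (rule borel_measurable_continuous_onI[OF cont])
  have bm2: "(\<lambda>x. \<phi> (x + c)) \<in> borel_measurable borel" for c
    by (intro borel_measurable_continuous_onI continuous_on_compose2[OF cont] continuous_intros) auto
  have i: "integrable lborel \<phi>" by (rule test_integrable[OF \<phi>])
  have i2: "integrable lborel (\<lambda>x. \<phi> (x + c))" for c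
  proof (rule integrable_continuous_compact_support[where K = "cball 0 (\<rho> + norm c)"])
    fix x :: 'a assume x: "x \<notin> cball 0 (\<rho> + norm c)"
    have "x + c \<notin> K"
    proof
      assume "x + c \<in> K"
      then have "norm (x + c) \<le> \<rho>" by (rule \<rho>)
      then have "norm x \<le> \<rho> + norm c" using norm_triangle_ineq4[of "x + c" c] by simp
      then show False using x by simp
    qed
    then show "\<phi> (x + c) = 0" by (rule K(2))
  next
    show "continuous_on UNIV (\<lambda>x. \<phi> (x + c))"
      by (intro continuous_on_compose2[OF cont] continuous_intros) auto
  qed auto
  have D0: "(\<integral>x. D n x \<partial>lborel) = 0" for n
    unfolding D_def using i i2 lborel_integral_shift[OF bm] by simp
  have lim: "(\<lambda>n. D n x) \<longlonglongrightarrow> partial e \<phi> x" for x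
  proof -
    have "((\<lambda>s. \<phi> (x + s *\<^sub>R e)) has_field_derivative partial e \<phi> (x + 0 *\<^sub>R e)) (at 0)"
      using test_line_deriv[of \<phi> x 0 e] test_diff[OF \<phi>] by (simp add: has_real_derivative_iff_has_vector_derivative)
    then have "((\<lambda>s. (\<phi> (x + s *\<^sub>R e) - \<phi> x) / s) \<longlongrightarrow> partial e \<phi> x) (at 0)"
      by (simp add: has_field_derivative_iff)
    moreover have "filterlim h (at 0) sequentially"
      using h0 h(1) by (auto simp: filterlim_at intro!: always_eventually) (metis less_irrefl)
    ultimately show ?thesis unfolding D_def by (rule filterlim_compose)
  qed
  have bound: "norm (D n x) \<le> B * indicator (cball 0 (\<rho> + 1)) x" for n x
  proof (cases "x \<in> cball 0 (\<rho> + 1)")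
    case True
    have "\<exists>z. 0 < z \<and> z < h n \<and> \<phi> (x + h n *\<^sub>R e) - \<phi> (x + 0 *\<^sub>R e) = (h n - 0) * partial e \<phi> (x + z *\<^sub>R e)"
      using test_line_deriv[of \<phi> x _ e] test_diff[OF \<phi>] h[of n]
      by (intro MVT2) (auto simp: has_real_derivative_iff_has_vector_derivative)
    then obtain z where "\<phi> (x + h n *\<^sub>R e) - \<phi> x = h n * partial e \<phi> (x + z *\<^sub>R e)" by auto
    then have "D n x = partial e \<phi> (x + z *\<^sub>R e)" using h[of n] by (simp add: D_def)
    then show ?thesis using True B by simp
  next
    case False
    have n1: "norm (h n *\<^sub>R e) \<le> 1" using h[of n] e by simp
    have "x \<notin> K" using False \<rho> by fastforce
    moreover have "x + h n *\<^sub>R e \<notin> K"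
    proof
      assume "x + h n *\<^sub>R e \<in> K"
      then have "norm (x + h n *\<^sub>R e) \<le> \<rho>" by (rule \<rho>)
      then have "norm x \<le> \<rho> + 1" using norm_triangle_ineq4[of "x + h n *\<^sub>R e" "h n *\<^sub>R e"] n1 by simp
      then show False using False by simp
    qed
    ultimately show ?thesis using K(2) B(1) by (simp add: D_def)
  qed
  have "(\<lambda>n. \<integral>x. D n x \<partial>lborel) \<longlonglongrightarrow> (\<integral>x. partial e \<phi> x \<partial>lborel)"
  proof (rule integral_dominated_convergence[where w = "\<lambda>x. B * indicator (cball 0 (\<rho> + 1)) x"])
    show "partial e \<phi> \<in> borel_measurable lborel"
      using borel_measurable_continuous_onI[OF test_cont[OF test_partial[OF \<phi> e]]] by simp
    show "D n \<in> borel_measurable lborel" for n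
      unfolding D_def[abs_def] using bm bm2 by simp
    have "emeasure lborel (cball (0::'a) (\<rho> + 1)) < \<infinity>" by (rule emeasure_bounded_finite) simp
    then show "integrable lborel (\<lambda>x. B * indicator (cball (0::'a) (\<rho> + 1)) x)"
      by (intro integrable_mult_right integrable_real_indicator) auto
  qed (use lim bound in auto)
  then show ?thesis using D0 LIMSEQ_unique[OF tendsto_const] by fastforce
qed

lemma integral_partial_zero:
  fixes \<phi> :: "'a::euclidean_space => 'b::euclidean_space"
  assumes \<phi>: "\<phi> \<in> test_functions G" and e: "e \<in> Basis"
  shows "(\<integral>x. partial e \<phi> x \<partial>lborel) = 0"
proof (rule euclidean_eqI)
  fix i :: 'b assume "i \<in> Basis"
  have "(\<integral>x. partial e \<phi> x \<partial>lborel) \<bullet> i = (\<integral>x. partial e \<phi> x \<bullet> i \<partial>lborel)"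
    using test_integrable[OF test_partial[OF \<phi> e]] by simp
  also have "\<dots> = (\<integral>x. partial e (\<lambda>x. \<phi> x \<bullet> i) x \<partial>lborel)"
    using partial_linear[OF bounded_linear_inner_left test_diff[OF \<phi>]] by simp
  also have "\<dots> = 0" by (rule integral_partial_real[OF test_linear[OF bounded_linear_inner_left \<phi>] e])
  finally show "(\<integral>x. partial e \<phi> x \<partial>lborel) \<bullet> i = 0 \<bullet> i" by simp
qed

lemma test_integral_lebesgue_on:
  fixes \<phi> :: "'a::euclidean_space => 'b::euclidean_space"
  assumes "open G" "continuous_on UNIV \<phi>" "\<And>x. x \<notin> G ==> \<phi> x = 0"
  shows "(\<integral>x. \<phi> x \<partial>lebesgue_on G) = (\<integral>x. \<phi> x \<partial>lborel)"
  using assms by (intro integral_lebesgue_on_zero_outside) (auto intro: borel_measurable_continuous_onI)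

lemma locally_integrable_test:
  fixes \<phi> :: "'a::euclidean_space => 'b::euclidean_space"
  assumes "\<phi> \<in> test_functions G" shows "locally_integrable G \<phi>"
  unfolding locally_integrable_def
  by (intro allI impI integrable_on_lebesgue_on test_integrable[OF assms]) (auto simp: compact_imp_closed)

lemma has_weak_partial_test:
  fixes \<phi> :: "'a::euclidean_space => 'b::euclidean_space"
  assumes G: "open G" and \<phi>: "\<phi> \<in> test_functions G" and e: "e \<in> Basis"
  shows "has_weak_partial G e \<phi> (partial e \<phi>)"
  unfolding has_weak_partial_def
proof (intro conjI ballI locally_integrable_test \<phi> test_partial[OF \<phi> e])
  fix \<psi> :: "'a => real" assume \<psi>: "\<psi> \<in> test_functions G"
  have t1: "(\<lambda>x. \<psi> x *\<^sub>R \<phi> x) \<in> test_functions G"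
    by (rule test_bilinear[OF bounded_bilinear_scaleR \<psi> test_Ck[OF \<phi>]])
  have t2: "(\<lambda>x. partial e \<psi> x *\<^sub>R \<phi> x) \<in> test_functions G"
    by (rule test_bilinear[OF bounded_bilinear_scaleR test_partial[OF \<psi> e] test_Ck[OF \<phi>]])
  have t3: "(\<lambda>x. \<psi> x *\<^sub>R partial e \<phi> x) \<in> test_functions G"
    by (rule test_bilinear[OF bounded_bilinear_scaleR \<psi> test_Ck[OF test_partial[OF \<phi> e]]])
  have "0 = (\<integral>x. partial e (\<lambda>x. \<psi> x *\<^sub>R \<phi> x) x \<partial>lborel)" by (rule integral_partial_zero[OF t1 e, symmetric])
  also have "\<dots> = (\<integral>x. \<psi> x *\<^sub>R partial e \<phi> x + partial e \<psi> x *\<^sub>R \<phi> x \<partial>lborel)"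
    using partial_bilinear[OF bounded_bilinear_scaleR test_diff[OF \<psi>] test_diff[OF \<phi>]] by simp
  also have "\<dots> = (\<integral>x. \<psi> x *\<^sub>R partial e \<phi> x \<partial>lborel) + (\<integral>x. partial e \<psi> x *\<^sub>R \<phi> x \<partial>lborel)"
    by (intro Bochner_Integration.integral_add test_integrable[OF t2] test_integrable[OF t3])
  finally show "(\<integral>x. partial e \<psi> x *\<^sub>R \<phi> x \<partial>lebesgue_on G) = - (\<integral>x. \<psi> x *\<^sub>R partial e \<phi> x \<partial>lebesgue_on G)"
    using test_integral_lebesgue_on[OF G test_cont[OF t2] test_outside[OF t2]]
      test_integral_lebesgue_on[OF G test_cont[OF t3] test_outside[OF t3]]
    by (simp add: eq_neg_iff_add_eq_0 add.commute)
qed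

text \<open>Integrals of g vanish over every Borel set: open boxes are an intersection-stable
  generator, and \<open>supp\<close> gives the integral over the whole space, which complements
  require. Integration over the sign sets of g then finishes.\<close>

lemma AE_zero_if_zero_on_boxes:
  fixes g :: "'a::euclidean_space => real"
  assumes g: "integrable lebesgue g" and box: "\<And>a b. (\<integral>x. indicator (box a b) x * g x \<partial>lebesgue) = 0"
    and supp: "\<And>x. x \<notin> box c d ==> g x = 0"
  shows "AE x in lebesgue. g x = 0"
proof -
  have gm: "g \<in> borel_measurable lebesgue" using g by simp
  have iA: "integrable lebesgue (\<lambda>x. indicator A x * g x)" if "A \<in> sets borel" for A
    using integrable_mult_indicator[OF _ g, of A] that by simp
  have tot: "(\<integral>x. g x \<partial>lebesgue) = 0"
  proof -
    have "(\<lambda>x. indicator (box c d) x * g x) = g"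
    proof
      fix x show "indicator (box c d) x * g x = g x" using supp by (cases "x \<in> box c d") auto
    qed
    then show ?thesis using box[of c d] by (simp only:)
  qed
  have all: "(\<integral>x. indicator A x * g x \<partial>lebesgue) = 0" if A: "A \<in> sets borel" for A
  proof -
    let ?B = "range (\<lambda>(a, b). box a b :: 'a set)"
    have s: "A \<in> sigma_sets UNIV ?B" using A by (simp add: borel_eq_box)
    have "Int_stable ?B" by (auto simp: Int_stable_def box_Int_box)
    moreover have "?B \<subseteq> Pow UNIV" by simp
    ultimately show ?thesis using s
    proof (induction rule: sigma_sets_induct_disjoint)
      case (compl A)
      then have A: "A \<in> sets borel" by (simp add: borel_eq_box)
      have "indicator (UNIV - A) x * g x = g x - indicator A x * g x" for x by (simp add: indicator_def)
      then show ?case using g iA[OF A] compl tot by simp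
    next
      case (union A)
      then have A: "A i \<in> sets borel" for i by (auto simp: borel_eq_box)
      have "(\<integral>x\<in>(\<Union>i. A i). g x \<partial>lebesgue) = (\<Sum>i. \<integral>x\<in>A i. g x \<partial>lebesgue)"
      proof (rule lebesgue_integral_countable_add)
        show "A i \<in> sets lebesgue" for i using A by simp
        show "A i \<inter> A j = {}" if "i \<noteq> j" for i j using union(1) that by (auto simp: disjoint_family_on_def)
        show "set_integrable lebesgue (\<Union>i. A i) g"
          using iA[of "\<Union>i. A i"] A by (auto simp: set_integrable_def)
      qed
      then show ?case using union by (simp add: set_lebesgue_integral_def)
    qed (auto simp: box)
  qed
  \<comment> \<open>The sign sets of g are only Lebesgue measurable, whereas the Dynkin argument
    covers Borel sets.\<close>
  obtain g' where g': "g' \<in> borel_measurable lborel" and ae0: "AE x in lborel. g x = g' x"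
    using completion_ex_borel_measurable_real[OF gm] by blast
  have ae: "AE x in lebesgue. g x = g' x" by (rule AE_completion[OF ae0])
  have g'i: "integrable lebesgue g'"
    using g ae measurable_completion[OF g'] by (subst integrable_cong_AE[of g' _ g]) auto
  have half: "AE x in lebesgue. s * g' x \<le> 0" for s :: real
  proof -
    define A where "A = {x. 0 < s * g' x}"
    have "A = {x \<in> space lborel. 0 < s * g' x}" by (simp add: A_def)
    also have "\<dots> \<in> sets lborel" using g' by measurable
    finally have A: "A \<in> sets borel" by simp
    have i: "integrable lebesgue (\<lambda>x. indicator A x * (s * g' x))"
      using integrable_mult_indicator[of A lebesgue "\<lambda>x. s * g' x"] g'i A by simp
    have "(\<integral>x. indicator A x * (s * g' x) \<partial>lebesgue) = (\<integral>x. s * (indicator A x * g x) \<partial>lebesgue)"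
      using ae i iA[OF A] by (intro integral_cong_AE) (auto elim!: eventually_mono)
    also have "\<dots> = 0" using all[OF A] by simp
    finally have "AE x in lebesgue. indicator A x * (s * g' x) = 0"
      using i by (subst (asm) integral_nonneg_eq_0_iff_AE) (auto simp: A_def indicator_def)
    then show ?thesis by eventually_elim (auto simp: A_def indicator_def not_less split: if_splits)
  qed
  show ?thesis using half[of 1] half[of "-1"] ae by eventually_elim auto
qed

lemma integrable_on_compact:
  assumes "locally_integrable G u" "compact K" "K \<subseteq> G"
  shows "integrable lebesgue (\<lambda>x. indicator K x *\<^sub>R u x)"
  using assms integrable_restrict_space[of K lebesgue u] compact_imp_closed[OF assms(2)]
  by (auto simp: locally_integrable_def)

text \<open>The fundamental lemma of the calculus of variations. The cutoffs converge boundedly to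
  indicators of boxes with closure in G, and countably many such boxes cover G.\<close>

lemma AE_zero_if_orthogonal_to_tests:
  fixes g :: "'a::euclidean_space => 'b::euclidean_space"
  assumes G: "open G" and loc: "locally_integrable G g"
    and orth: "\<And>\<phi>. \<phi> \<in> test_functions G ==> (\<integral>x. \<phi> x *\<^sub>R g x \<partial>lebesgue_on G) = 0"
  shows "AE x in lebesgue. x \<in> G \<longrightarrow> g x = 0"
proof -
  have small: "(\<integral>x. indicator (box a b) x *\<^sub>R g x \<partial>lebesgue) = 0" if ab: "cbox a b \<subseteq> G" for a b
  proof -
    have i: "integrable lebesgue (\<lambda>x. indicator (cbox a b) x *\<^sub>R g x)"
      by (rule integrable_on_compact[OF loc compact_cbox ab])
    have eq: "cutoff a b n x *\<^sub>R (indicator (cbox a b) x *\<^sub>R g x) = cutoff a b n x *\<^sub>R g x" for n x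
    proof (cases "x \<in> cbox a b")
      case False
      then have "x \<notin> box a b" using box_subset_cbox[of a b] by auto
      then show ?thesis by (simp add: cutoff_def box_bump_zero)
    qed simp
    have cm: "cutoff a b n \<in> borel_measurable lebesgue" for n
      using borel_measurable_continuous_onI[OF test_cont[OF cutoff_test[OF ab]]]
      by (intro measurable_completion) simp
    have "(\<lambda>n. \<integral>x. cutoff a b n x *\<^sub>R (indicator (cbox a b) x *\<^sub>R g x) \<partial>lebesgue) \<longlonglongrightarrow>
      (\<integral>x. indicator (box a b) x *\<^sub>R (indicator (cbox a b) x *\<^sub>R g x) \<partial>lebesgue)"
    proof (rule integral_dominated_convergence[where w = "\<lambda>x. norm (indicator (cbox a b) x *\<^sub>R g x)"])
      show "AE x in lebesgue. (\<lambda>n. cutoff a b n x *\<^sub>R (indicator (cbox a b) x *\<^sub>R g x)) \<longlonglongrightarrow>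
          indicator (box a b) x *\<^sub>R (indicator (cbox a b) x *\<^sub>R g x)"
        by (intro AE_I2 tendsto_scaleR cutoff_tendsto tendsto_const)
      show "AE x in lebesgue. norm (cutoff a b n x *\<^sub>R (indicator (cbox a b) x *\<^sub>R g x)) \<le> norm (indicator (cbox a b) x *\<^sub>R g x)" for n
      proof (rule AE_I2)
        fix x
        have "\<bar>cutoff a b n x\<bar> * norm (indicator (cbox a b) x *\<^sub>R g x) \<le> norm (indicator (cbox a b) x *\<^sub>R g x)"
          using cutoff_bounds[of a b n x] by (intro mult_left_le_one_le) auto
        then show "norm (cutoff a b n x *\<^sub>R (indicator (cbox a b) x *\<^sub>R g x)) \<le> norm (indicator (cbox a b) x *\<^sub>R g x)"
          by (simp only: norm_scaleR[of "cutoff a b n x"])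
      qed
      show "(\<lambda>x. indicator (box a b) x *\<^sub>R (indicator (cbox a b) x *\<^sub>R g x)) \<in> borel_measurable lebesgue"
        by (intro borel_measurable_scaleR borel_measurable_indicator borel_measurable_integrable[OF i]) auto
      show "(\<lambda>x. cutoff a b n x *\<^sub>R (indicator (cbox a b) x *\<^sub>R g x)) \<in> borel_measurable lebesgue" for n
        by (intro borel_measurable_scaleR cm borel_measurable_integrable[OF i])
      show "integrable lebesgue (\<lambda>x. norm (indicator (cbox a b) x *\<^sub>R g x))" by (rule integrable_norm[OF i])
    qed
    moreover have "(\<integral>x. cutoff a b n x *\<^sub>R (indicator (cbox a b) x *\<^sub>R g x) \<partial>lebesgue) = 0" for n
    proof -
      have e: "(\<lambda>x. indicator G x *\<^sub>R (cutoff a b n x *\<^sub>R g x)) = (\<lambda>x. cutoff a b n x *\<^sub>R g x)"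
      proof
        fix x show "indicator G x *\<^sub>R (cutoff a b n x *\<^sub>R g x) = cutoff a b n x *\<^sub>R g x"
          using test_outside[OF cutoff_test[OF ab], of x n] by (cases "x \<in> G") auto
      qed
      have "(\<integral>x. cutoff a b n x *\<^sub>R g x \<partial>lebesgue_on G) = (\<integral>x. indicator G x *\<^sub>R (cutoff a b n x *\<^sub>R g x) \<partial>lebesgue)"
        using G by (intro integral_restrict_space) auto
      then show ?thesis unfolding eq e using orth[OF cutoff_test[OF ab], of n] by simp
    qed
    moreover have "(\<lambda>x. indicator (box a b) x *\<^sub>R (indicator (cbox a b) x *\<^sub>R g x)) = (\<lambda>x. indicator (box a b) x *\<^sub>R g x)"
      using box_subset_cbox[of a b] by (auto simp: indicator_def fun_eq_iff)
    ultimately show ?thesis by (simp only:) (simp add: LIMSEQ_const_iff)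
  qed
  have comp: "AE x in lebesgue. x \<in> box c d \<longrightarrow> g x = 0" if cd: "cbox c d \<subseteq> G" for c d
  proof -
    have ic: "integrable lebesgue (\<lambda>x. indicator (cbox c d) x *\<^sub>R g x)"
      by (rule integrable_on_compact[OF loc compact_cbox cd])
    have ib: "integrable lebesgue (\<lambda>x. indicator A x *\<^sub>R g x)" if "A \<subseteq> cbox c d" "A \<in> sets borel" for A
    proof -
      have "(\<lambda>x. indicator A x *\<^sub>R (indicator (cbox c d) x *\<^sub>R g x)) = (\<lambda>x. indicator A x *\<^sub>R g x)"
        using that by (auto simp: indicator_def fun_eq_iff)
      moreover have "integrable lebesgue (\<lambda>x. indicator A x *\<^sub>R (indicator (cbox c d) x *\<^sub>R g x))"
        using that by (intro integrable_mult_indicator ic) auto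
      ultimately show ?thesis by (simp only:)
    qed
    have z: "AE x in lebesgue. indicator (box c d) x * (g x \<bullet> i) = 0" if i: "i \<in> Basis" for i
    proof (rule AE_zero_if_zero_on_boxes[where c = c and d = d])
      have "integrable lebesgue (\<lambda>x. (indicator (box c d) x *\<^sub>R g x) \<bullet> i)"
        using ib[OF box_subset_cbox] by (intro integrable_inner_left) auto
      then show "integrable lebesgue (\<lambda>x. indicator (box c d) x * (g x \<bullet> i))" by simp
      show "(\<integral>x. indicator (box a b) x * (indicator (box c d) x * (g x \<bullet> i)) \<partial>lebesgue) = 0" for a b
      proof (cases "box a b \<inter> box c d = {}")
        case True
        then have "(\<lambda>x. indicator (box a b) x * (indicator (box c d) x * (g x \<bullet> i))) = (\<lambda>x. 0)"
          by (auto simp: indicator_def fun_eq_iff)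
        then show ?thesis by (simp only:) simp
      next
        case False
        obtain p q where pq: "box a b \<inter> box c d = box p q" by (simp add: box_Int_box)
        \<comment> \<open>This fails for an empty open box, whose closed counterpart may be nonempty
          and leave G; hence the case distinction.\<close>
        have "cbox p q = closure (box p q)" using False pq by (simp add: closure_box)
        also have "\<dots> \<subseteq> closure (box c d)" using pq by (intro closure_mono) auto
        also have "\<dots> \<subseteq> cbox c d" by (intro closure_minimal box_subset_cbox closed_cbox)
        finally have sub: "cbox p q \<subseteq> G" "box p q \<subseteq> cbox c d" using cd box_subset_cbox[of p q] by auto
        have "(\<lambda>x. indicator (box a b) x * (indicator (box c d) x * (g x \<bullet> i))) = (\<lambda>x. (indicator (box p q) x *\<^sub>R g x) \<bullet> i)"
          unfolding pq[symmetric] by (auto simp: indicator_def fun_eq_iff)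
        moreover have "(\<integral>x. (indicator (box p q) x *\<^sub>R g x) \<bullet> i \<partial>lebesgue) = (\<integral>x. indicator (box p q) x *\<^sub>R g x \<partial>lebesgue) \<bullet> i"
          using ib[OF sub(2)] by (intro integral_inner_left) auto
        ultimately show ?thesis using small[OF sub(1)] by (simp only:) simp
      qed
    qed (auto simp: indicator_def)
    have "AE x in lebesgue. \<forall>i\<in>Basis. indicator (box c d) x * (g x \<bullet> i) = 0"
      using z by (subst AE_finite_all) auto
    then show ?thesis
    proof eventually_elim
      fix x assume "\<forall>i\<in>Basis. indicator (box c d) x * (g x \<bullet> i) = 0"
      then show "x \<in> box c d \<longrightarrow> g x = 0" by (auto simp: euclidean_all_zero_iff)
    qed
  qed
  obtain \<D> where D: "countable \<D>" "\<D> \<subseteq> Pow G" "\<And>X. X \<in> \<D> ==> \<exists>a b. X = cbox a b" "\<Union>\<D> = G"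
    using open_countable_Union_open_cbox[OF G] by metis
  have "AE x in lebesgue. \<forall>X\<in>\<D>. x \<in> X \<longrightarrow> g x = 0"
    unfolding AE_ball_countable[OF D(1)]
  proof
    fix X assume X: "X \<in> \<D>"
    then obtain a b where ab: "X = cbox a b" using D(3) by blast
    have "cbox a b \<subseteq> G" using X ab D(2) by auto
    note comp[OF this]
    \<comment> \<open>The cover consists of closed boxes, while vanishing is known on the open ones;
      their boundaries are null sets.\<close>
    moreover have "AE x in lebesgue. x \<notin> cbox a b - box a b"
      using negligible_frontier_interval[of a b] by (intro AE_not_in) (simp add: negligible_iff_null_sets)
    ultimately show "AE x in lebesgue. x \<in> X \<longrightarrow> g x = 0" by eventually_elim (auto simp: ab)
  qed
  then show ?thesis by eventually_elim (use D(4) in auto)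
qed

lemma AE_lebesgue_on: "open G ==> (AE x in lebesgue_on G. P x) \<longleftrightarrow> (AE x in lebesgue. x \<in> G \<longrightarrow> P x)"
  by (rule AE_restrict_space_iff) simp

lemma locally_integrable_test_mult:
  fixes u :: "'a::euclidean_space => 'b::euclidean_space"
  assumes G: "open G" and u: "locally_integrable G u" and \<phi>: "\<phi> \<in> test_functions G"
  shows "integrable (lebesgue_on G) (\<lambda>x. \<phi> x *\<^sub>R u x)"
proof -
  obtain K where K: "compact K" "K \<subseteq> G" "\<And>x. x \<notin> K ==> \<phi> x = 0" by (rule test_support[OF \<phi>]) blast
  obtain B where B: "0 < B" "\<And>x. norm (\<phi> x) \<le> B" by (rule test_bounded[OF \<phi>]) blast
  have i: "integrable lebesgue (\<lambda>x. indicator K x *\<^sub>R u x)" by (rule integrable_on_compact[OF u K(1,2)])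
  have m: "\<phi> \<in> borel_measurable lebesgue"
    using borel_measurable_continuous_onI[OF test_cont[OF \<phi>]] by (intro measurable_completion) simp
  have "integrable lebesgue (\<lambda>x. \<phi> x *\<^sub>R (indicator K x *\<^sub>R u x))"
  proof (rule Bochner_Integration.integrable_bound)
    show "integrable lebesgue (\<lambda>x. B * norm (indicator K x *\<^sub>R u x))" using i by (intro integrable_mult_right integrable_norm)
    show "AE x in lebesgue. norm (\<phi> x *\<^sub>R (indicator K x *\<^sub>R u x)) \<le> norm (B * norm (indicator K x *\<^sub>R u x))"
    proof (rule AE_I2)
      fix x
      have "\<bar>\<phi> x\<bar> * norm (indicator K x *\<^sub>R u x) \<le> B * norm (indicator K x *\<^sub>R u x)"
        using B(2)[of x] by (intro mult_right_mono) auto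
      then show "norm (\<phi> x *\<^sub>R (indicator K x *\<^sub>R u x)) \<le> norm (B * norm (indicator K x *\<^sub>R u x))"
        using B(1) by (simp add: abs_mult)
    qed
  qed (intro borel_measurable_scaleR m borel_measurable_integrable[OF i])
  moreover have "(\<lambda>x. \<phi> x *\<^sub>R (indicator K x *\<^sub>R u x)) = (\<lambda>x. indicator G x *\<^sub>R (\<phi> x *\<^sub>R u x))"
  proof
    fix x show "\<phi> x *\<^sub>R (indicator K x *\<^sub>R u x) = indicator G x *\<^sub>R (\<phi> x *\<^sub>R u x)"
      using K(2) K(3)[of x] by (cases "x \<in> K") auto
  qed
  ultimately have "integrable lebesgue (\<lambda>x. indicator G x *\<^sub>R (\<phi> x *\<^sub>R u x))" by (simp only:)
  then show ?thesis using G by (subst integrable_restrict_space) auto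
qed

lemma weak_partial_unique:
  fixes u :: "'a::euclidean_space => 'b::euclidean_space"
  assumes G: "open G" and g: "has_weak_partial G e u g" and g': "has_weak_partial G e u g'"
  shows "AE x in lebesgue_on G. g x = g' x"
proof -
  have l: "locally_integrable G g" "locally_integrable G g'" using g g' by (auto simp: has_weak_partial_def)
  have "AE x in lebesgue. x \<in> G \<longrightarrow> g x - g' x = 0"
  proof (rule AE_zero_if_orthogonal_to_tests[OF G])
    show "locally_integrable G (\<lambda>x. g x - g' x)" using l by (simp add: locally_integrable_def)
    fix \<phi> :: "'a => real" assume \<phi>: "\<phi> \<in> test_functions G"
    have "(\<integral>x. \<phi> x *\<^sub>R g x \<partial>lebesgue_on G) = (\<integral>x. \<phi> x *\<^sub>R g' x \<partial>lebesgue_on G)"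
      using g g' \<phi> unfolding has_weak_partial_def by (metis neg_equal_iff_equal)
    then show "(\<integral>x. \<phi> x *\<^sub>R (g x - g' x) \<partial>lebesgue_on G) = 0"
      using locally_integrable_test_mult[OF G l(1) \<phi>] locally_integrable_test_mult[OF G l(2) \<phi>]
      by (simp add: scaleR_diff_right)
  qed
  then show ?thesis by (simp add: AE_lebesgue_on[OF G])
qed

text \<open>The chosen representative is arbitrary on a null set, so everything about
  \<open>weak_partial\<close> is stated almost everywhere or through integrals.\<close>

lemma weak_partial_AE:
  fixes u :: "'a::euclidean_space => 'b::euclidean_space"
  assumes "open G" "has_weak_partial G e u g"
  shows "has_weak_partial G e u (weak_partial G e u)" "AE x in lebesgue_on G. weak_partial G e u x = g x"
proof -
  show *: "has_weak_partial G e u (weak_partial G e u)"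
    unfolding weak_partial_def by (rule someI[of "has_weak_partial G e u", OF assms(2)])
  show "AE x in lebesgue_on G. weak_partial G e u x = g x" by (rule weak_partial_unique[OF assms(1) * assms(2)])
qed

section \<open>The function spaces\<close>

context semi_ip
begin

definition cl :: "'a set => 'a set" where
  "cl S = {u \<in> X. \<forall>\<epsilon>>0. \<exists>\<phi>\<in>S. nrm (u - \<phi>) < \<epsilon>}"

lemma subspace_cl:
  assumes S: "subspace S" "S \<subseteq> X" shows "subspace (cl S)"
  unfolding subspace_def
proof (intro conjI ballI allI)
  show "0 \<in> cl S" using subspace_0[OF S(1)] by (auto simp: cl_def intro!: bexI[of _ 0])
  fix u v c assume u: "u \<in> cl S"
  have uX: "u \<in> X" using u by (simp add: cl_def)
  show "c *\<^sub>R u \<in> cl S"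
    unfolding cl_def mem_Collect_eq
  proof (intro conjI allI impI)
    fix \<epsilon> :: real assume \<epsilon>: "0 < \<epsilon>"
    have "0 < \<epsilon> / (\<bar>c\<bar> + 1)" using \<epsilon> by (simp add: add_nonneg_pos)
    then obtain \<phi> where \<phi>: "\<phi> \<in> S" "nrm (u - \<phi>) < \<epsilon> / (\<bar>c\<bar> + 1)"
      using u unfolding cl_def by blast
    have pX: "\<phi> \<in> X" using \<phi> S by auto
    have "nrm (c *\<^sub>R u - c *\<^sub>R \<phi>) = \<bar>c\<bar> * nrm (u - \<phi>)"
      using nrm_scale[of "u - \<phi>" c] uX pX by (simp add: scaleR_diff_right)
    also have "\<dots> \<le> (\<bar>c\<bar> + 1) * nrm (u - \<phi>)"
      using nrm_nonneg[of "u - \<phi>"] uX pX by (intro mult_right_mono) auto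
    also have "\<dots> < (\<bar>c\<bar> + 1) * (\<epsilon> / (\<bar>c\<bar> + 1))" using \<phi>(2) by (intro mult_strict_left_mono) auto
    also have "\<dots> = \<epsilon>" by (simp add: abs_ge_zero add_nonneg_eq_0_iff)
    finally show "\<exists>\<psi>\<in>S. nrm (c *\<^sub>R u - \<psi>) < \<epsilon>" using subspace_scale[OF S(1) \<phi>(1)] by blast
  qed (use uX in simp)
  assume v: "v \<in> cl S"
  have vX: "v \<in> X" using v by (simp add: cl_def)
  show "u + v \<in> cl S"
    unfolding cl_def mem_Collect_eq
  proof (intro conjI allI impI)
    fix \<epsilon> :: real assume \<epsilon>: "0 < \<epsilon>"
    then have h: "0 < \<epsilon> / 2" by simp
    obtain \<phi> where \<phi>: "\<phi> \<in> S" "nrm (u - \<phi>) < \<epsilon> / 2" using u h unfolding cl_def by blast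
    obtain \<psi> where \<psi>: "\<psi> \<in> S" "nrm (v - \<psi>) < \<epsilon> / 2" using v h unfolding cl_def by blast
    have X: "\<phi> \<in> X" "\<psi> \<in> X" using \<phi> \<psi> S by auto
    have e: "u + v - (\<phi> + \<psi>) = (u - \<phi>) + (v - \<psi>)" by simp
    have "nrm (u + v - (\<phi> + \<psi>)) \<le> nrm (u - \<phi>) + nrm (v - \<psi>)"
      unfolding e by (intro nrm_triangle mem X uX vX)
    then have "nrm (u + v - (\<phi> + \<psi>)) < \<epsilon>" using \<phi> \<psi> by linarith
    then show "\<exists>\<psi>\<in>S. nrm (u + v - \<psi>) < \<epsilon>" using subspace_add[OF S(1) \<phi>(1) \<psi>(1)] by blast
  qed (use uX vX in simp)
qed

lemma semi_ip_subset: "subspace Y ==> Y \<subseteq> X ==> semi_ip Y ip"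
  by unfold_locales (auto simp: subset_iff intro: ip_sym ip_add ip_scale ip_nonneg)

end

lemma (in semi_hilbert) semi_hilbert_cl:
  assumes S: "subspace S" "S \<subseteq> X" shows "semi_hilbert (cl S) ip"
proof -
  have clX: "cl S \<subseteq> X" by (auto simp: cl_def)
  interpret c: semi_ip "cl S" ip by (rule semi_ip_subset[OF subspace_cl[OF S] clX])
  show ?thesis
  proof
    fix x :: "nat => 'a" assume x: "\<And>n. x n \<in> cl S" and C: "c.Cauchy_seq x"
    have xX: "x n \<in> X" for n using x clX by blast
    obtain y where y: "y \<in> X" "(\<lambda>n. nrm (x n - y)) \<longlonglongrightarrow> 0" using complete[OF xX C] by blast
    have "y \<in> cl S"
      unfolding cl_def mem_Collect_eq
    proof (intro conjI allI impI y(1))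
      fix \<epsilon> :: real assume \<epsilon>: "0 < \<epsilon>"
      then obtain n where n: "nrm (x n - y) < \<epsilon> / 2"
        using order_tendstoD(2)[OF y(2), of "\<epsilon> / 2"] by (auto simp: eventually_sequentially)
      have h: "0 < \<epsilon> / 2" using \<epsilon> by simp
      obtain \<phi> where \<phi>: "\<phi> \<in> S" "nrm (x n - \<phi>) < \<epsilon> / 2" using x[of n] h unfolding cl_def by blast
      have "nrm (y - \<phi>) \<le> nrm (y - x n) + nrm (x n - \<phi>)"
        using S \<phi> by (intro nrm_triangle3 y xX) auto
      then show "\<exists>\<phi>\<in>S. nrm (y - \<phi>) < \<epsilon>" using \<phi> n nrm_diff_sym[OF y(1) xX, of n] by (intro bexI[of _ \<phi>]) auto
    qed
    then show "\<exists>y\<in>cl S. (\<lambda>n. nrm (x n - y)) \<longlonglongrightarrow> 0" using y by blast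
  qed
qed

lemma L2_eq: "L2 G = square_integrable (lebesgue_on G)"
  by (simp add: L2_def square_integrable_def)

lemma L2_pairing_eq: "L2_pairing G = inner_integral (lebesgue_on G)"
  by (simp add: L2_pairing_def inner_integral_def fun_eq_iff)

lemma L2_norm_eq: "L2_norm G = sq.nrm (lebesgue_on G)"
  by (simp add: L2_norm_def sq_nrm fun_eq_iff)

text \<open>The polar form of the square of \<open>W12_norm\<close>.\<close>

definition ipW :: "'a::euclidean_space set => ('a => 'b::euclidean_space) => ('a => 'b) => real" where
  "ipW G u v = L2_pairing G u v + (\<Sum>e\<in>Basis. L2_pairing G (weak_partial G e u) (weak_partial G e v))"

text \<open>True because Lebesgue measure is complete. It is used for weak derivatives, whose
  representatives are arbitrary on null sets.\<close>

lemma borel_measurable_AE_lebesgue_on: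
  fixes g h :: "'a::euclidean_space => 'b::euclidean_space"
  assumes G: "open G" and g: "g \<in> borel_measurable (lebesgue_on G)" and ae: "AE x in lebesgue_on G. g x = h x"
  shows "h \<in> borel_measurable (lebesgue_on G)"
proof -
  have s: "G \<inter> space lebesgue \<in> sets lebesgue" using G by simp
  have "(\<lambda>x. indicator G x *\<^sub>R g x) \<in> borel_measurable lebesgue"
    using g borel_measurable_restrict_space_iff[OF s, of g] by simp
  moreover have "AE x in lebesgue. indicator G x *\<^sub>R g x = indicator G x *\<^sub>R h x"
    using ae unfolding AE_lebesgue_on[OF G] by eventually_elim (auto simp: indicator_def)
  ultimately have "(\<lambda>x. indicator G x *\<^sub>R h x) \<in> borel_measurable lebesgue"
    by (rule borel_measurable_AE)
  then show ?thesis using borel_measurable_restrict_space_iff[OF s, of h] by simp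
qed

lemma L2_AE_cong:
  fixes g h :: "'a::euclidean_space => 'b::euclidean_space"
  assumes G: "open G" and g: "g \<in> L2 G" and ae: "AE x in lebesgue_on G. g x = h x"
  shows "h \<in> L2 G"
proof -
  have h: "h \<in> borel_measurable (lebesgue_on G)"
    using g by (intro borel_measurable_AE_lebesgue_on[OF G _ ae]) (simp add: L2_def)
  have "integrable (lebesgue_on G) (\<lambda>x. (norm (g x))^2) \<longleftrightarrow> integrable (lebesgue_on G) (\<lambda>x. (norm (h x))^2)"
    using g h ae by (intro integrable_cong_AE) (auto simp: L2_def)
  then show ?thesis using g h by (simp add: L2_def)
qed

lemma L2_locally_integrable:
  fixes u :: "'a::euclidean_space => 'b::euclidean_space"
  assumes G: "open G" and u: "u \<in> L2 G" shows "locally_integrable G u"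
  unfolding locally_integrable_def
proof (intro allI impI)
  fix K assume K: "compact K \<and> K \<subseteq> G"
  have Kl: "K \<in> sets lebesgue" "K \<in> lmeasurable" using K by (auto simp: compact_imp_closed lmeasurable_compact)
  have GK: "G \<inter> K = K" using K by auto
  have um: "u \<in> borel_measurable (lebesgue_on K)"
    using u K unfolding L2_def by (auto intro: measurable_restrict_mono)
  have "integrable lebesgue (\<lambda>x. indicator G x *\<^sub>R (norm (u x))^2)"
    using u G by (simp add: L2_def integrable_restrict_space)
  then have "integrable lebesgue (\<lambda>x. indicator K x *\<^sub>R (indicator G x *\<^sub>R (norm (u x))^2))"
    by (rule integrable_mult_indicator[OF Kl(1)])
  also have "(\<lambda>x. indicator K x *\<^sub>R (indicator G x *\<^sub>R (norm (u x))^2)) = (\<lambda>x. indicator K x *\<^sub>R (norm (u x))^2)"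
    using K by (auto simp: indicator_def fun_eq_iff)
  finally have "integrable (lebesgue_on K) (\<lambda>x. (norm (u x))^2)"
    using Kl by (subst integrable_restrict_space) auto
  then have "integrable (lebesgue_on K) (\<lambda>x. norm (u x))"
    using um by (rule_tac integrable_square_imp[OF finite_measure_lebesgue_on[OF Kl(2)], of "\<lambda>x. norm (u x)"]) auto
  then show "integrable (lebesgue_on K) u" using um by (simp add: integrable_norm_iff)
qed

lemma W12_partial:
  fixes u :: "'a::euclidean_space => 'b::euclidean_space"
  assumes G: "open G" and u: "u \<in> W12 G" and e: "e \<in> Basis"
  shows "has_weak_partial G e u (weak_partial G e u)" "weak_partial G e u \<in> L2 G"
proof -
  obtain g where g: "g \<in> L2 G" "has_weak_partial G e u g" using u e by (auto simp: W12_def)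
  show "has_weak_partial G e u (weak_partial G e u)" by (rule weak_partial_AE(1)[OF G g(2)])
  have "AE x in lebesgue_on G. g x = weak_partial G e u x"
    using weak_partial_AE(2)[OF G g(2)] by eventually_elim simp
  then show "weak_partial G e u \<in> L2 G" by (rule L2_AE_cong[OF G g(1)])
qed

lemma W12_L2: "u \<in> W12 G ==> u \<in> L2 G" by (simp add: W12_def)

lemma has_weak_partial_add:
  fixes u v :: "'a::euclidean_space => 'b::euclidean_space"
  assumes G: "open G" and e: "e \<in> Basis" and u: "has_weak_partial G e u g" and v: "has_weak_partial G e v h"
  shows "has_weak_partial G e (u + v) (g + h)"
  unfolding has_weak_partial_def
proof (intro conjI ballI)
  have l: "locally_integrable G u" "locally_integrable G v" "locally_integrable G g" "locally_integrable G h"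
    using u v by (auto simp: has_weak_partial_def)
  then show "locally_integrable G (u + v)" "locally_integrable G (g + h)"
    by (auto simp: locally_integrable_def plus_fun_def)
  fix \<phi> :: "'a => real" assume \<phi>: "\<phi> \<in> test_functions G"
  note i = locally_integrable_test_mult[OF G _ \<phi>] locally_integrable_test_mult[OF G _ test_partial[OF \<phi> e]]
  show "(\<integral>x. partial e \<phi> x *\<^sub>R (u + v) x \<partial>lebesgue_on G) = - (\<integral>x. \<phi> x *\<^sub>R (g + h) x \<partial>lebesgue_on G)"
    using u v \<phi> Bochner_Integration.integral_add[OF i(1)[OF l(3)] i(1)[OF l(4)]]
      Bochner_Integration.integral_add[OF i(2)[OF l(1)] i(2)[OF l(2)]]
    by (simp add: scaleR_add_right has_weak_partial_def)
qed

lemma has_weak_partial_scale: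
  fixes u :: "'a::euclidean_space => 'b::euclidean_space"
  assumes u: "has_weak_partial G e u g"
  shows "has_weak_partial G e (c *\<^sub>R u) (c *\<^sub>R g)"
  unfolding has_weak_partial_def
proof (intro conjI ballI)
  show "locally_integrable G (c *\<^sub>R u)" "locally_integrable G (c *\<^sub>R g)"
    using u by (auto simp: locally_integrable_def scaleR_fun_def has_weak_partial_def)
  fix \<phi> :: "'a => real" assume \<phi>: "\<phi> \<in> test_functions G"
  have "(\<integral>x. partial e \<phi> x *\<^sub>R u x \<partial>lebesgue_on G) = - (\<integral>x. \<phi> x *\<^sub>R g x \<partial>lebesgue_on G)"
    using u \<phi> by (simp add: has_weak_partial_def)
  moreover have "(\<lambda>x. partial e \<phi> x *\<^sub>R (c *\<^sub>R u) x) = (\<lambda>x. c *\<^sub>R (partial e \<phi> x *\<^sub>R u x))"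
    "(\<lambda>x. \<phi> x *\<^sub>R (c *\<^sub>R g) x) = (\<lambda>x. c *\<^sub>R (\<phi> x *\<^sub>R g x))"
    by (auto simp: mult.commute)
  ultimately show "(\<integral>x. partial e \<phi> x *\<^sub>R (c *\<^sub>R u) x \<partial>lebesgue_on G) = - (\<integral>x. \<phi> x *\<^sub>R (c *\<^sub>R g) x \<partial>lebesgue_on G)"
    by (simp only: integral_scaleR_right scaleR_minus_right)
qed

lemma W12_add:
  fixes u v :: "'a::euclidean_space => 'b::euclidean_space"
  assumes G: "open G" and u: "u \<in> W12 G" and v: "v \<in> W12 G"
  shows "u + v \<in> W12 G"
    "e \<in> Basis ==> AE x in lebesgue_on G. weak_partial G e (u + v) x = weak_partial G e u x + weak_partial G e v x"
proof -
  have h: "has_weak_partial G e (u + v) (weak_partial G e u + weak_partial G e v)"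
    "weak_partial G e u + weak_partial G e v \<in> L2 G" if e: "e \<in> Basis" for e
    using W12_partial[OF G u e] W12_partial[OF G v e] e
    by (auto intro: has_weak_partial_add[OF G] simp: L2_eq)
  then show "u + v \<in> W12 G" using W12_L2[OF u] W12_L2[OF v] by (auto simp: W12_def L2_eq)
  show "AE x in lebesgue_on G. weak_partial G e (u + v) x = weak_partial G e u x + weak_partial G e v x" if "e \<in> Basis"
    using weak_partial_AE(2)[OF G h(1)[OF that]] by simp
qed

lemma W12_scale:
  fixes u :: "'a::euclidean_space => 'b::euclidean_space"
  assumes G: "open G" and u: "u \<in> W12 G"
  shows "c *\<^sub>R u \<in> W12 G"
    "e \<in> Basis ==> AE x in lebesgue_on G. weak_partial G e (c *\<^sub>R u) x = c *\<^sub>R weak_partial G e u x"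
proof -
  have h: "has_weak_partial G e (c *\<^sub>R u) (c *\<^sub>R weak_partial G e u)"
    "c *\<^sub>R weak_partial G e u \<in> L2 G" if e: "e \<in> Basis" for e
    using W12_partial[OF G u e] by (auto intro: has_weak_partial_scale simp: L2_eq)
  then show "c *\<^sub>R u \<in> W12 G" using W12_L2[OF u] by (auto simp: W12_def L2_eq)
  show "AE x in lebesgue_on G. weak_partial G e (c *\<^sub>R u) x = c *\<^sub>R weak_partial G e u x" if "e \<in> Basis"
    using weak_partial_AE(2)[OF G h(1)[OF that]] by simp
qed

lemma L2_pairing_AE_cong:
  assumes "AE x in lebesgue_on G. u x = u' x" "AE x in lebesgue_on G. v x = v' x"
    and "u \<in> L2 G" "u' \<in> L2 G" "v \<in> L2 G" "v' \<in> L2 G"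
  shows "L2_pairing G u v = L2_pairing G u' v'"
  unfolding L2_pairing_def
proof (rule integral_cong_AE)
  show "AE x in lebesgue_on G. u x \<bullet> v x = u' x \<bullet> v' x" using assms(1,2) by eventually_elim simp
qed (use assms in \<open>auto simp: L2_def\<close>)

lemma test_L2:
  fixes \<phi> :: "'a::euclidean_space => 'b::euclidean_space"
  assumes G: "open G" and \<phi>: "\<phi> \<in> test_functions G" shows "\<phi> \<in> L2 G"
proof -
  have "\<phi> \<in> borel_measurable (lebesgue_on G)"
    using borel_measurable_continuous_onI[OF test_cont[OF \<phi>]]
    by (intro measurable_restrict_space1 measurable_completion) simp
  moreover have "integrable (lebesgue_on G) (\<lambda>x. (norm (\<phi> x))^2)"
  proof (rule test_support[OF \<phi>])
    fix K assume K: "compact K" "\<And>x. x \<notin> K ==> \<phi> x = 0"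
    have "integrable lborel (\<lambda>x. (norm (\<phi> x))^2)"
      using K by (intro integrable_continuous_compact_support[of _ K] continuous_intros test_cont[OF \<phi>]) auto
    then show ?thesis using G by (intro integrable_on_lebesgue_on) auto
  qed
  ultimately show ?thesis by (simp add: L2_def)
qed

lemma test_W12:
  fixes \<phi> :: "'a::euclidean_space => 'b::euclidean_space"
  assumes G: "open G" and \<phi>: "\<phi> \<in> test_functions G"
  shows "\<phi> \<in> W12 G" "e \<in> Basis ==> AE x in lebesgue_on G. weak_partial G e \<phi> x = partial e \<phi> x"
proof -
  have h: "has_weak_partial G e \<phi> (partial e \<phi>)" "partial e \<phi> \<in> L2 G" if "e \<in> Basis" for e
    by (rule has_weak_partial_test[OF G \<phi> that], rule test_L2[OF G test_partial[OF \<phi> that]])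
  then show "\<phi> \<in> W12 G" using test_L2[OF G \<phi>] unfolding W12_def by blast
  show "AE x in lebesgue_on G. weak_partial G e \<phi> x = partial e \<phi> x" if "e \<in> Basis"
    by (rule weak_partial_AE(2)[OF G h(1)[OF that]])
qed

lemma subspace_W12:
  assumes G: "open G" shows "subspace (W12 G :: ('a::euclidean_space => 'b::euclidean_space) set)"
  unfolding subspace_def
proof (intro conjI ballI allI)
  show "(0 :: 'a => 'b) \<in> W12 G" by (rule test_W12(1)[OF G subspace_0[OF subspace_test]])
  show "u + v \<in> W12 G" if "u \<in> W12 G" "v \<in> W12 G" for u v :: "'a => 'b" using that by (rule W12_add(1)[OF G])
  show "c *\<^sub>R u \<in> W12 G" if "u \<in> W12 G" for c and u :: "'a => 'b" using that by (rule W12_scale(1)[OF G])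
qed

lemma semi_ip_W12:
  assumes G: "open G"
  shows "semi_ip (W12 G :: ('a::euclidean_space => 'b::euclidean_space) set) (ipW G)"
proof
  fix u v w :: "'a => 'b" and c :: real
  assume u: "u \<in> W12 G" and v: "v \<in> W12 G"
  note L = W12_partial(2)[OF G] W12_L2
  show "ipW G u v = ipW G v u"
    unfolding ipW_def L2_pairing_eq using u v L unfolding L2_eq
    by (intro arg_cong2[where f = "(+)"] sum.cong sq.ip_sym refl) auto
  have "L2_pairing G (weak_partial G e (c *\<^sub>R u)) (weak_partial G e v) = c * L2_pairing G (weak_partial G e u) (weak_partial G e v)"
    if e: "e \<in> Basis" for e
  proof -
    have cL: "c *\<^sub>R weak_partial G e u \<in> L2 G" using L(1)[OF u e] by (simp add: L2_eq)
    have "L2_pairing G (weak_partial G e (c *\<^sub>R u)) (weak_partial G e v) = L2_pairing G (c *\<^sub>R weak_partial G e u) (weak_partial G e v)"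
      using W12_scale[OF G u] e cL L(1)[OF W12_scale(1)[OF G u] e] L(1)[OF v e] by (intro L2_pairing_AE_cong) auto
    also have "\<dots> = c * L2_pairing G (weak_partial G e u) (weak_partial G e v)"
      using L(1)[OF u e] L(1)[OF v e] by (simp add: L2_pairing_eq L2_eq sq.ip_simps)
    finally show ?thesis .
  qed
  then have "(\<Sum>e\<in>Basis. L2_pairing G (weak_partial G e (c *\<^sub>R u)) (weak_partial G e v))
    = c * (\<Sum>e\<in>Basis. L2_pairing G (weak_partial G e u) (weak_partial G e v))"
    by (simp add: sum_distrib_left)
  moreover have "L2_pairing G (c *\<^sub>R u) v = c * L2_pairing G u v"
    unfolding L2_pairing_eq by (rule sq.ip_scale) (use W12_L2[OF u] W12_L2[OF v] L2_eq in auto)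
  ultimately show "ipW G (c *\<^sub>R u) v = c * ipW G u v" by (simp add: ipW_def distrib_left)
  show "0 \<le> ipW G u u"
    unfolding ipW_def L2_pairing_eq using u L by (intro add_nonneg_nonneg sum_nonneg sq.ip_nonneg) (auto simp: L2_eq)
  assume w: "w \<in> W12 G"
  have "L2_pairing G (weak_partial G e (u + v)) (weak_partial G e w)
    = L2_pairing G (weak_partial G e u) (weak_partial G e w) + L2_pairing G (weak_partial G e v) (weak_partial G e w)"
    if e: "e \<in> Basis" for e
  proof -
    have sL: "weak_partial G e u + weak_partial G e v \<in> L2 G" using L(1)[OF u e] L(1)[OF v e] by (simp add: L2_eq)
    have "L2_pairing G (weak_partial G e (u + v)) (weak_partial G e w) = L2_pairing G (weak_partial G e u + weak_partial G e v) (weak_partial G e w)"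
      using W12_add[OF G u v] e sL L(1)[OF W12_add(1)[OF G u v] e] L(1)[OF w e] by (intro L2_pairing_AE_cong) auto
    also have "\<dots> = L2_pairing G (weak_partial G e u) (weak_partial G e w) + L2_pairing G (weak_partial G e v) (weak_partial G e w)"
      using L(1)[OF u e] L(1)[OF v e] L(1)[OF w e] by (simp add: L2_pairing_eq L2_eq sq.ip_simps)
    finally show ?thesis .
  qed
  then have "(\<Sum>e\<in>Basis. L2_pairing G (weak_partial G e (u + v)) (weak_partial G e w))
    = (\<Sum>e\<in>Basis. L2_pairing G (weak_partial G e u) (weak_partial G e w))
      + (\<Sum>e\<in>Basis. L2_pairing G (weak_partial G e v) (weak_partial G e w))"
    by (simp add: sum.distrib)
  moreover have "L2_pairing G (u + v) w = L2_pairing G u w + L2_pairing G v w"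
    unfolding L2_pairing_eq by (rule sq.ip_add) (use W12_L2[OF u] W12_L2[OF v] W12_L2[OF w] L2_eq in auto)
  ultimately show "ipW G (u + v) w = ipW G u w + ipW G v w" by (simp add: ipW_def)
qed (rule subspace_W12[OF G])

lemma W12_norm_eq:
  assumes G: "open G"
  shows "W12_norm G = (semi_ip.nrm (ipW G) :: ('a::euclidean_space => 'b::euclidean_space) => real)"
proof
  fix u :: "'a => 'b"
  have "(L2_norm G v)^2 = L2_pairing G v v" for v :: "'a => 'b"
    by (simp add: L2_norm_def L2_pairing_def power2_norm_eq_inner)
  then show "W12_norm G u = semi_ip.nrm (ipW G) u"
    by (simp add: W12_norm_def ipW_def semi_ip.nrm_def[OF semi_ip_W12[OF G]])
qed

lemma L2_nrm_AE_cong: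
  assumes "AE x in lebesgue_on G. u x = v x" "u \<in> L2 G" "v \<in> L2 G"
  shows "L2_norm G u = L2_norm G v"
proof -
  have "(\<integral>x. (norm (u x))^2 \<partial>lebesgue_on G) = (\<integral>x. (norm (v x))^2 \<partial>lebesgue_on G)"
    using assms by (intro integral_cong_AE) (auto simp: L2_def elim!: eventually_mono)
  then show ?thesis by (simp add: L2_norm_def)
qed

text \<open>Weak differentiation is a closed operator: for a fixed test function both sides of the
  defining identity are continuous in the L2-norm.\<close>

lemma has_weak_partial_limit:
  fixes u :: "'a::euclidean_space => 'b::euclidean_space"
  assumes G: "open G" and e: "e \<in> Basis"
    and x: "\<And>n. has_weak_partial G e (x n) (g n)" "\<And>n. x n \<in> L2 G" "\<And>n. g n \<in> L2 G"
    and u: "u \<in> L2 G" "(\<lambda>n. L2_norm G (x n - u)) \<longlonglongrightarrow> 0"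
    and h: "h \<in> L2 G" "(\<lambda>n. L2_norm G (g n - h)) \<longlonglongrightarrow> 0"
  shows "has_weak_partial G e u h"
  unfolding has_weak_partial_def
proof (intro conjI ballI L2_locally_integrable[OF G] u h)
  have conv: "(\<lambda>n. \<integral>x. \<phi> x *\<^sub>R y n x \<partial>lebesgue_on G) \<longlonglongrightarrow> (\<integral>x. \<phi> x *\<^sub>R z x \<partial>lebesgue_on G)"
    if \<phi>: "\<phi> \<in> test_functions G" and y: "\<And>n. y n \<in> L2 G" and z: "z \<in> L2 G" and l: "(\<lambda>n. L2_norm G (y n - z)) \<longlonglongrightarrow> 0"
    for \<phi> :: "'a => real" and y :: "nat => 'a => 'b" and z
  proof -
    have "(\<lambda>n. (\<integral>x. \<phi> x *\<^sub>R y n x \<partial>lebesgue_on G) - (\<integral>x. \<phi> x *\<^sub>R z x \<partial>lebesgue_on G)) \<longlonglongrightarrow> 0"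
    proof (rule Lim_null_comparison)
      show "(\<lambda>n. L2_norm G \<phi> * L2_norm G (y n - z)) \<longlonglongrightarrow> 0"
        by (intro tendsto_mult_right_zero l)
      show "\<forall>\<^sub>F n in sequentially. norm ((\<integral>x. \<phi> x *\<^sub>R y n x \<partial>lebesgue_on G) - (\<integral>x. \<phi> x *\<^sub>R z x \<partial>lebesgue_on G))
          \<le> L2_norm G \<phi> * L2_norm G (y n - z)"
      proof (rule always_eventually, rule allI)
        fix n
        have d: "y n - z \<in> L2 G" using y z by (simp add: L2_eq)
        have p: "\<phi> \<in> L2 G" by (rule test_L2[OF G \<phi>])
        note i = locally_integrable_test_mult[OF G L2_locally_integrable[OF G] \<phi>]
        have "(\<integral>x. \<phi> x *\<^sub>R y n x \<partial>lebesgue_on G) - (\<integral>x. \<phi> x *\<^sub>R z x \<partial>lebesgue_on G) = (\<integral>x. \<phi> x *\<^sub>R (y n - z) x \<partial>lebesgue_on G)"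
          using i[OF y] i[OF z] by (simp add: scaleR_diff_right)
        also have "norm \<dots> \<le> (\<integral>x. norm (\<phi> x *\<^sub>R (y n - z) x) \<partial>lebesgue_on G)" by (rule integral_norm_bound)
        also have "\<dots> = (\<integral>x. norm (\<phi> x) * norm ((y n - z) x) \<partial>lebesgue_on G)" by simp
        also have "\<dots> \<le> sqrt (\<integral>x. (norm (\<phi> x))^2 \<partial>lebesgue_on G) * sqrt (\<integral>x. (norm ((y n - z) x))^2 \<partial>lebesgue_on G)"
        proof (rule integral_CS)
          show "(\<lambda>x. norm (\<phi> x)) \<in> borel_measurable (lebesgue_on G)"
            by (rule measurable_compose[OF _ borel_measurable_norm]) (use p in \<open>simp add: L2_def\<close>)
          show "(\<lambda>x. norm ((y n - z) x)) \<in> borel_measurable (lebesgue_on G)"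
            by (rule measurable_compose[OF _ borel_measurable_norm]) (use d in \<open>simp add: L2_def fun_diff_def\<close>)
        qed (use p d in \<open>auto simp: L2_def\<close>)
        finally show "norm ((\<integral>x. \<phi> x *\<^sub>R y n x \<partial>lebesgue_on G) - (\<integral>x. \<phi> x *\<^sub>R z x \<partial>lebesgue_on G))
          \<le> L2_norm G \<phi> * L2_norm G (y n - z)" by (simp add: L2_norm_def)
      qed
    qed
    then show ?thesis by (simp add: LIM_zero_iff)
  qed
  fix \<phi> :: "'a => real" assume \<phi>: "\<phi> \<in> test_functions G"
  have c1: "(\<lambda>n. \<integral>y. partial e \<phi> y *\<^sub>R x n y \<partial>lebesgue_on G) \<longlonglongrightarrow> (\<integral>y. partial e \<phi> y *\<^sub>R u y \<partial>lebesgue_on G)"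
    by (rule conv[OF test_partial[OF \<phi> e] x(2) u])
  have c2: "(\<lambda>n. - (\<integral>y. \<phi> y *\<^sub>R g n y \<partial>lebesgue_on G)) \<longlonglongrightarrow> - (\<integral>y. \<phi> y *\<^sub>R h y \<partial>lebesgue_on G)"
    by (intro tendsto_minus conv[OF \<phi> x(3) h])
  have "(\<integral>y. partial e \<phi> y *\<^sub>R x n y \<partial>lebesgue_on G) = - (\<integral>y. \<phi> y *\<^sub>R g n y \<partial>lebesgue_on G)" for n
    using x(1)[of n] \<phi> by (simp add: has_weak_partial_def)
  then show "(\<integral>y. partial e \<phi> y *\<^sub>R u y \<partial>lebesgue_on G) = - (\<integral>y. \<phi> y *\<^sub>R h y \<partial>lebesgue_on G)"
    using LIMSEQ_unique[OF c1] c2 by simp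
qed

lemma W12_norm_sq: "(W12_norm G u)^2 = (L2_norm G u)^2 + (\<Sum>e\<in>Basis. (L2_norm G (weak_partial G e u))^2)"
  unfolding W12_norm_def by (intro real_sqrt_pow2 add_nonneg_nonneg sum_nonneg) auto

lemma L2_norm_nonneg: "0 \<le> L2_norm G u" by (simp add: L2_norm_def)

lemma W12_norm_nonneg: "0 \<le> W12_norm G u"
  unfolding W12_norm_def by (intro real_sqrt_ge_zero add_nonneg_nonneg sum_nonneg) auto

lemma L2_le_W12: "L2_norm G u \<le> W12_norm G u"
  unfolding W12_norm_def
proof (rule real_le_rsqrt)
  have "0 \<le> (\<Sum>e\<in>Basis. (L2_norm G (weak_partial G e u))^2)" by (intro sum_nonneg) simp
  then show "(L2_norm G u)^2 \<le> (L2_norm G u)^2 + (\<Sum>e\<in>Basis. (L2_norm G (weak_partial G e u))^2)" by simp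
qed

lemma partial_le_W12: assumes "e \<in> Basis" shows "L2_norm G (weak_partial G e u) \<le> W12_norm G u"
  unfolding W12_norm_def
proof (rule real_le_rsqrt)
  have "(L2_norm G (weak_partial G e u))^2 \<le> (\<Sum>e\<in>Basis. (L2_norm G (weak_partial G e u))^2)"
    using assms member_le_sum[of e Basis "\<lambda>e. (L2_norm G (weak_partial G e u))^2"] by simp
  then show "(L2_norm G (weak_partial G e u))^2 \<le> (L2_norm G u)^2 + (\<Sum>e\<in>Basis. (L2_norm G (weak_partial G e u))^2)"
    using zero_le_power2[of "L2_norm G u"] by linarith
qed

lemma W12_diff:
  fixes u v :: "'a::euclidean_space => 'b::euclidean_space"
  assumes G: "open G" and u: "u \<in> W12 G" and v: "v \<in> W12 G"
  shows "u - v \<in> W12 G"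
    "e \<in> Basis ==> AE x in lebesgue_on G. weak_partial G e (u - v) x = (weak_partial G e u - weak_partial G e v) x"
    "e \<in> Basis ==> L2_norm G (weak_partial G e (u - v)) = L2_norm G (weak_partial G e u - weak_partial G e v)"
proof -
  have m: "u - v = u + (-1) *\<^sub>R v" by (simp add: fun_eq_iff)
  have mv: "(-1) *\<^sub>R v \<in> W12 G" by (rule W12_scale(1)[OF G v])
  show uv: "u - v \<in> W12 G" unfolding m by (rule W12_add(1)[OF G u mv])
  show ae: "AE x in lebesgue_on G. weak_partial G e (u - v) x = (weak_partial G e u - weak_partial G e v) x" if "e \<in> Basis" for e
    using W12_add(2)[OF G u mv that] W12_scale(2)[OF G v that, of "-1"] unfolding m
    by eventually_elim simp
  show "L2_norm G (weak_partial G e (u - v)) = L2_norm G (weak_partial G e u - weak_partial G e v)" if "e \<in> Basis"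
    using W12_partial(2)[OF G uv that] W12_partial(2)[OF G u that] W12_partial(2)[OF G v that]
    by (intro L2_nrm_AE_cong ae that) (auto simp: L2_eq)
qed

text \<open>Functions and derivatives converge separately in L2, and closedness of weak
  differentiation identifies the limits of the derivatives.\<close>

lemma semi_hilbert_W12:
  assumes G: "open G"
  shows "semi_hilbert (W12 G :: ('a::euclidean_space => 'b::euclidean_space) set) (ipW G)"
proof -
  interpret W: semi_ip "W12 G :: ('a => 'b) set" "ipW G" by (rule semi_ip_W12[OF G])
  show ?thesis
  proof
    fix x :: "nat => 'a => 'b" assume x: "\<And>n. x n \<in> W12 G" and C: "W.Cauchy_seq x"
    have C': "\<exists>N. \<forall>m\<ge>N. \<forall>n\<ge>N. W12_norm G (x m - x n) < e" if "0 < e" for e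
      using C that unfolding W.Cauchy_seq_def W12_norm_eq[OF G] by blast
    have lim: "\<exists>y\<in>L2 G. (\<lambda>n. L2_norm G (h n - y)) \<longlonglongrightarrow> 0"
      if h: "\<And>n. h n \<in> L2 G" and le: "\<And>m n. L2_norm G (h m - h n) \<le> W12_norm G (x m - x n)" for h :: "nat => 'a => 'b"
    proof -
      have "sq.Cauchy_seq (lebesgue_on G) h"
        unfolding sq.Cauchy_seq_def L2_norm_eq[symmetric] using C' le by (meson le_less_trans)
      then show ?thesis
        using sq.complete[of h "lebesgue_on G"] h unfolding L2_eq L2_norm_eq by blast
    qed
    obtain u where u: "u \<in> L2 G" "(\<lambda>n. L2_norm G (x n - u)) \<longlonglongrightarrow> 0"
      using lim[of x] W12_L2[OF x] L2_le_W12 by blast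
    have "\<exists>y\<in>L2 G. (\<lambda>n. L2_norm G (weak_partial G e (x n) - y)) \<longlonglongrightarrow> 0" if e: "e \<in> Basis" for e
      using lim[of "\<lambda>n. weak_partial G e (x n)"] W12_partial(2)[OF G x e] partial_le_W12[OF e]
        W12_diff(3)[OF G x x e] by metis
    then obtain g where g: "\<And>e. e \<in> Basis ==> g e \<in> L2 G"
      "\<And>e. e \<in> Basis ==> (\<lambda>n. L2_norm G (weak_partial G e (x n) - g e)) \<longlonglongrightarrow> 0" by metis
    have hw: "has_weak_partial G e u (g e)" if e: "e \<in> Basis" for e
      by (rule has_weak_partial_limit[OF G e W12_partial(1)[OF G x e] W12_L2[OF x] W12_partial(2)[OF G x e] u g(1)[OF e] g(2)[OF e]])
    have uW: "u \<in> W12 G" using u g hw by (auto simp: W12_def)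
    have De: "L2_norm G (weak_partial G e (x n - u)) = L2_norm G (weak_partial G e (x n) - g e)" if e: "e \<in> Basis" for e n
    proof (rule L2_nrm_AE_cong)
      show "AE y in lebesgue_on G. weak_partial G e (x n - u) y = (weak_partial G e (x n) - g e) y"
        using W12_diff(2)[OF G x uW e, of n] weak_partial_AE(2)[OF G hw[OF e]] by eventually_elim simp
      show "weak_partial G e (x n - u) \<in> L2 G" by (rule W12_partial(2)[OF G W12_diff(1)[OF G x uW] e])
      show "weak_partial G e (x n) - g e \<in> L2 G" using W12_partial(2)[OF G x e] g(1)[OF e] by (simp add: L2_eq)
    qed
    have "(\<lambda>n. sqrt ((L2_norm G (x n - u))^2 + (\<Sum>e\<in>Basis. (L2_norm G (weak_partial G e (x n) - g e))^2)))
      \<longlonglongrightarrow> sqrt (0^2 + (\<Sum>e\<in>(Basis::'a set). 0^2))"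
      by (intro tendsto_intros u g(2))
    then have "(\<lambda>n. W12_norm G (x n - u)) \<longlonglongrightarrow> 0" by (simp add: W12_norm_def De)
    then show "\<exists>y\<in>W12 G. (\<lambda>n. W.nrm (x n - y)) \<longlonglongrightarrow> 0" using uW unfolding W12_norm_eq[OF G] by blast
  qed
qed

section \<open>Inequalities for test functions in the plane\<close>

abbreviation ax1 :: "real^2" where "ax1 \<equiv> axis 1 1"
abbreviation ax2 :: "real^2" where "ax2 \<equiv> axis 2 1"

lemma measurable_ennreal_continuous:
  "continuous_on UNIV f ==> (\<lambda>x. ennreal (f x)) \<in> borel_measurable borel"
  by (rule measurable_compose[OF borel_measurable_continuous_onI measurable_ennreal])

lemma Basis_real2: "(Basis :: (real^2) set) = {ax1, ax2}"
  by (auto simp: Basis_vec_def UNIV_2)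

lemma ax_Basis [simp]: "ax1 \<in> Basis" "ax2 \<in> Basis" by (auto simp: Basis_real2)

lemma ax_neq: "ax1 \<noteq> ax2" by (simp add: axis_eq_axis)

lemma sum_Basis_real2: "(\<Sum>e\<in>(Basis :: (real^2) set). f e) = f ax1 + f ax2"
  using ax_neq by (simp add: Basis_real2)

lemma prod_Basis_real2: "(\<Prod>e\<in>(Basis :: (real^2) set). f e) = f ax1 * f ax2"
  using ax_neq by (simp add: Basis_real2)

definition mk2 :: "real \<times> real => real^2" where
  "mk2 p = fst p *\<^sub>R ax1 + snd p *\<^sub>R ax2"

lemma mk2_inner: "mk2 p \<bullet> ax1 = fst p" "mk2 p \<bullet> ax2 = snd p"
  by (simp_all add: mk2_def inner_add_left inner_axis_axis)

lemma mk2_cont: "continuous_on S mk2"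
  unfolding mk2_def[abs_def] by (intro continuous_intros)

lemma mk2_measurable: "mk2 \<in> borel_measurable borel"
  by (rule borel_measurable_continuous_onI[OF mk2_cont])

text \<open>Lebesgue measure is determined by its values on boxes. The identification carries
  Tonelli's theorem from pairs of reals over to the vectors of the plane.\<close>

lemma lborel_real2: "lborel = distr lborel borel mk2"
proof (rule lborel_eqI)
  fix l u :: "real^2" assume le: "\<And>b. b \<in> Basis ==> l \<bullet> b \<le> u \<bullet> b"
  have "mk2 -` box l u = box (l \<bullet> ax1, l \<bullet> ax2) (u \<bullet> ax1, u \<bullet> ax2)"
    by (auto simp: mem_box Basis_real2 mk2_inner Basis_prod_def)
  then have "emeasure (distr lborel borel mk2) (box l u) = emeasure lborel (box (l \<bullet> ax1, l \<bullet> ax2) (u \<bullet> ax1, u \<bullet> ax2))"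
    using mk2_measurable by (subst emeasure_distr) auto
  also have "\<dots> = emeasure (lborel \<Otimes>\<^sub>M lborel) ({l \<bullet> ax1<..<u \<bullet> ax1} \<times> {l \<bullet> ax2<..<u \<bullet> ax2})"
    unfolding lborel_prod by (rule arg_cong[where f = "emeasure lborel"]) (auto simp: mem_box Basis_prod_def)
  also have "\<dots> = ennreal (u \<bullet> ax1 - l \<bullet> ax1) * ennreal (u \<bullet> ax2 - l \<bullet> ax2)"
    using le[of ax1] le[of ax2] by (subst lborel.emeasure_pair_measure_Times) auto
  also have "\<dots> = (\<Prod>b\<in>Basis. (u - l) \<bullet> b)"
    using le[of ax1] le[of ax2] by (simp add: prod_Basis_real2 inner_diff_left ennreal_mult)
  finally show "emeasure (distr lborel borel mk2) (box l u) = (\<Prod>b\<in>Basis. (u - l) \<bullet> b)" .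
qed simp

lemma nn_integral_real2:
  assumes f: "f \<in> borel_measurable borel"
  shows "(\<integral>\<^sup>+x. f x \<partial>lborel) = (\<integral>\<^sup>+s. \<integral>\<^sup>+t. f (mk2 (s, t)) \<partial>lborel \<partial>lborel)"
    "(\<integral>\<^sup>+x. f x \<partial>lborel) = (\<integral>\<^sup>+t. \<integral>\<^sup>+s. f (mk2 (s, t)) \<partial>lborel \<partial>lborel)"
proof -
  have m: "(\<lambda>p. f (mk2 p)) \<in> borel_measurable (lborel \<Otimes>\<^sub>M lborel)"
    unfolding lborel_prod using measurable_compose[OF mk2_measurable f] by simp
  have "(\<integral>\<^sup>+x. f x \<partial>lborel) = (\<integral>\<^sup>+p. f (mk2 p) \<partial>lborel)"
    using mk2_measurable f by (subst lborel_real2, subst nn_integral_distr) auto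
  then have e: "(\<integral>\<^sup>+x. f x \<partial>lborel) = (\<integral>\<^sup>+p. f (mk2 p) \<partial>(lborel \<Otimes>\<^sub>M lborel))"
    unfolding lborel_prod .
  show "(\<integral>\<^sup>+x. f x \<partial>lborel) = (\<integral>\<^sup>+s. \<integral>\<^sup>+t. f (mk2 (s, t)) \<partial>lborel \<partial>lborel)"
    unfolding e using lborel.nn_integral_fst[OF m] by simp
  show "(\<integral>\<^sup>+x. f x \<partial>lborel) = (\<integral>\<^sup>+t. \<integral>\<^sup>+s. f (mk2 (s, t)) \<partial>lborel \<partial>lborel)"
    unfolding e using lborel_pair.nn_integral_snd[OF m] by simp
qed

text \<open>Extended nonnegative values avoid asking whether the integral over the whole line is
  finite.\<close>

lemma nn_integral_deriv_bound:
  fixes h h' :: "real => real"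
  assumes d: "\<And>r. (h has_real_derivative h' r) (at r)" and c: "continuous_on UNIV h'"
    and z: "h a = 0" "a \<le> s"
  shows "ennreal (h s) \<le> (\<integral>\<^sup>+r. ennreal \<bar>h' r\<bar> \<partial>lborel)"
proof -
  have ci: "continuous_on {a..s} h'" by (rule continuous_on_subset[OF c]) simp
  have i: "integrable lborel (\<lambda>r. indicator {a..s} r *\<^sub>R h' r)"
    by (rule borel_integrable_compact[OF compact_Icc ci])
  have "(\<integral>r. indicator {a..s} r *\<^sub>R h' r \<partial>lborel) = h s - h a"
    by (rule integral_FTC_Icc[OF z(2) _ ci])
      (use d in \<open>auto intro: has_vector_derivative_at_within simp: has_real_derivative_iff_has_vector_derivative\<close>)
  then have "h s \<le> (\<integral>r. norm (indicator {a..s} r *\<^sub>R h' r) \<partial>lborel)"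
    using integral_norm_bound[of lborel "\<lambda>r. indicator {a..s} r *\<^sub>R h' r"] z by simp
  then have "ennreal (h s) \<le> ennreal (\<integral>r. norm (indicator {a..s} r *\<^sub>R h' r) \<partial>lborel)" by (rule ennreal_leI)
  also have "\<dots> = (\<integral>\<^sup>+r. ennreal (norm (indicator {a..s} r *\<^sub>R h' r)) \<partial>lborel)"
    using integrable_norm[OF i] by (intro nn_integral_eq_integral[symmetric]) auto
  also have "\<dots> \<le> (\<integral>\<^sup>+r. ennreal \<bar>h' r\<bar> \<partial>lborel)"
    by (intro nn_integral_mono ennreal_leI) (auto simp: indicator_def)
  finally show ?thesis .
qed

lemma partial_norm_sq:
  fixes \<phi> :: "'a::euclidean_space => 'b::euclidean_space"
  assumes "\<phi> differentiable (at x)"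
  shows "partial e (\<lambda>x. \<phi> x \<bullet> \<phi> x) x = 2 * (\<phi> x \<bullet> partial e \<phi> x)"
  using partial_bilinear[OF bounded_bilinear_inner assms assms] by (simp add: inner_commute)

lemma test_inner:
  assumes "\<phi> \<in> test_functions G" "\<psi> \<in> test_functions G"
  shows "(\<lambda>x. \<phi> x \<bullet> \<psi> x :: real) \<in> test_functions G"
  by (rule test_bilinear[OF bounded_bilinear_inner assms(1) test_Ck[OF assms(2)]])

lemma nn_integral_CS_test:
  fixes \<phi> :: "'a::euclidean_space => 'b::euclidean_space" and \<psi> :: "'a => 'c::euclidean_space"
  assumes G: "open G" and p: "\<phi> \<in> test_functions G" and q: "\<psi> \<in> test_functions G"
  shows "(\<integral>\<^sup>+x. ennreal (norm (\<phi> x) * norm (\<psi> x)) \<partial>lborel) \<le> ennreal (L2_norm G \<phi> * L2_norm G \<psi>)"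
proof -
  have m: "(\<lambda>x. norm (\<phi> x)) \<in> borel_measurable lborel" "(\<lambda>x. norm (\<psi> x)) \<in> borel_measurable lborel"
    using borel_measurable_continuous_onI[OF continuous_on_norm[OF test_cont[OF p]]]
      borel_measurable_continuous_onI[OF continuous_on_norm[OF test_cont[OF q]]] by auto
  have i: "integrable lborel (\<lambda>x. (norm (\<phi> x))^2)" "integrable lborel (\<lambda>x. (norm (\<psi> x))^2)"
    using test_integrable[OF test_inner[OF p p]] test_integrable[OF test_inner[OF q q]]
    by (simp_all add: power2_norm_eq_inner)
  have e: "(\<integral>x. (norm (\<phi> x))^2 \<partial>lborel) = (L2_norm G \<phi>)^2" "(\<integral>x. (norm (\<psi> x))^2 \<partial>lborel) = (L2_norm G \<psi>)^2"
    using test_integral_lebesgue_on[OF G test_cont[OF test_inner[OF p p]]] test_outside[OF p]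
      test_integral_lebesgue_on[OF G test_cont[OF test_inner[OF q q]]] test_outside[OF q]
    by (simp_all add: L2_norm_def power2_norm_eq_inner)
  have "(\<integral>\<^sup>+x. ennreal (norm (\<phi> x) * norm (\<psi> x)) \<partial>lborel) = ennreal (\<integral>x. norm (\<phi> x) * norm (\<psi> x) \<partial>lborel)"
    by (rule nn_integral_eq_integral[OF integral_CS(1)[OF m i]]) simp
  also have "\<dots> \<le> ennreal (L2_norm G \<phi> * L2_norm G \<psi>)"
    using integral_CS(2)[OF m i] unfolding e by (intro ennreal_leI) (simp add: L2_norm_nonneg)
  finally show ?thesis .
qed

text \<open>The value of g = |\<phi>|^2 at (s,t) is at most the integral of |D1 g| along the
  horizontal line, a function \<open>P1\<close> of t, and at most that of |D2 g| along the vertical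
  line, a function \<open>P2\<close> of s. So g^2 is bounded by a product of functions of separate
  variables, whose double integral factorises; |De g| \<le> 2 |\<phi>| |De \<phi>| gives the
  constant 4.\<close>

lemma ladyzhenskaya_test:
  fixes \<phi> :: "real^2 => 'b::euclidean_space"
  assumes G: "open G" and \<phi>: "\<phi> \<in> test_functions G"
  shows "(\<integral>x. ((norm (\<phi> x))^2)^2 \<partial>lebesgue_on G)
    \<le> 4 * (L2_norm G \<phi>)^2 * L2_norm G (partial ax1 \<phi>) * L2_norm G (partial ax2 \<phi>)"
proof -
  define g where "g x = \<phi> x \<bullet> \<phi> x" for x
  have gt: "g \<in> test_functions G" unfolding g_def[abs_def] by (rule test_inner[OF \<phi> \<phi>])
  have g0: "0 \<le> g x" for x by (simp add: g_def)
  obtain K where K: "compact K" "\<And>x. x \<notin> K ==> g x = 0" by (rule test_support[OF gt]) blast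
  obtain \<rho> where \<rho>: "\<And>x. x \<in> K ==> norm x \<le> \<rho>" using compact_imp_bounded[OF K(1)] by (auto simp: bounded_iff)
  define p where "p e x = ennreal (2 * (norm (\<phi> x) * norm (partial e \<phi> x)))" for e x
  have pm: "p e \<in> borel_measurable borel" if "e \<in> Basis" for e
    unfolding p_def[abs_def]
    by (intro measurable_ennreal_continuous continuous_intros test_cont[OF \<phi>] test_cont[OF test_partial[OF \<phi> that]])
  have dp: "ennreal \<bar>partial e g x\<bar> \<le> p e x" for e x
  proof -
    have "partial e g x = 2 * (\<phi> x \<bullet> partial e \<phi> x)" unfolding g_def[abs_def] by (rule partial_norm_sq[OF test_diff[OF \<phi>]])
    then show ?thesis unfolding p_def by (intro ennreal_leI) (simp add: abs_mult Cauchy_Schwarz_ineq2)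
  qed
  have line: "ennreal (g (x + s *\<^sub>R e)) \<le> (\<integral>\<^sup>+r. p e (x + r *\<^sub>R e) \<partial>lborel)"
    if e: "e \<in> Basis" and xe: "x \<bullet> e = 0" for x e and s :: real
  proof -
    \<comment> \<open>A point of the line with coordinate below -\<rho> lies outside the support, so
      g vanishes there and integration can start from it.\<close>
    define a where "a = min s (- (\<rho> + 1))"
    have "x + a *\<^sub>R e \<notin> K"
    proof
      assume "x + a *\<^sub>R e \<in> K"
      then have "norm (x + a *\<^sub>R e) \<le> \<rho>" by (rule \<rho>)
      moreover have "\<bar>(x + a *\<^sub>R e) \<bullet> e\<bar> \<le> norm (x + a *\<^sub>R e)" by (rule Basis_le_norm[OF e])
      moreover have "(x + a *\<^sub>R e) \<bullet> e = a" using e xe by (simp add: inner_add_left inner_Basis)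
      ultimately show False by (simp add: a_def)
    qed
    then have z: "g (x + a *\<^sub>R e) = 0" by (rule K(2))
    have "ennreal (g (x + s *\<^sub>R e)) \<le> (\<integral>\<^sup>+r. ennreal \<bar>partial e g (x + r *\<^sub>R e)\<bar> \<partial>lborel)"
    proof (rule nn_integral_deriv_bound[where a = a and h = "\<lambda>s. g (x + s *\<^sub>R e)"])
      show "((\<lambda>s. g (x + s *\<^sub>R e)) has_real_derivative partial e g (x + r *\<^sub>R e)) (at r)" for r
        using test_line_deriv[of g x r e, OF test_diff[OF gt]] by (simp add: has_real_derivative_iff_has_vector_derivative)
      show "continuous_on UNIV (\<lambda>r. partial e g (x + r *\<^sub>R e))"
        by (intro continuous_on_compose2[OF test_cont[OF test_partial[OF gt e]]] continuous_intros) auto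
    qed (use z in \<open>auto simp: a_def\<close>)
    also have "\<dots> \<le> (\<integral>\<^sup>+r. p e (x + r *\<^sub>R e) \<partial>lborel)" by (intro nn_integral_mono dp)
    finally show ?thesis .
  qed
  define P1 where "P1 t = (\<integral>\<^sup>+s. p ax1 (mk2 (s, t)) \<partial>lborel)" for t
  define P2 where "P2 s = (\<integral>\<^sup>+t. p ax2 (mk2 (s, t)) \<partial>lborel)" for s
  have b1: "ennreal (g (mk2 (s, t))) \<le> P1 t" for s t
    using line[of ax1 "t *\<^sub>R ax2" s] by (simp add: P1_def mk2_def inner_axis_axis add.commute)
  have b2: "ennreal (g (mk2 (s, t))) \<le> P2 s" for s t
    using line[of ax2 "s *\<^sub>R ax1" t] by (simp add: P2_def mk2_def inner_axis_axis)
  have pmm: "(\<lambda>q. p e (mk2 q)) \<in> borel_measurable (lborel \<Otimes>\<^sub>M lborel)" if "e \<in> Basis" for e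
    unfolding lborel_prod using measurable_compose[OF mk2_measurable pm[OF that]] by simp
  have mP2: "P2 \<in> borel_measurable lborel"
    unfolding P2_def[abs_def] using lborel.borel_measurable_nn_integral_fst[OF pmm[of ax2]] by simp
  have mP1: "P1 \<in> borel_measurable lborel"
  proof -
    have "(\<lambda>(t, s). p ax1 (mk2 (s, t))) \<in> borel_measurable (lborel \<Otimes>\<^sub>M lborel)"
      using measurable_compose[OF measurable_pair_swap' pmm[of ax1]] by (simp add: case_prod_beta')
    from lborel.borel_measurable_nn_integral_fst[OF this] show ?thesis unfolding P1_def[abs_def] by simp
  qed
  have gm: "(\<lambda>x. ennreal ((g x)^2)) \<in> borel_measurable borel"
    by (intro measurable_ennreal_continuous continuous_intros test_cont[OF gt])
  have "(\<integral>\<^sup>+x. ennreal ((g x)^2) \<partial>lborel) = (\<integral>\<^sup>+s. \<integral>\<^sup>+t. ennreal ((g (mk2 (s, t)))^2) \<partial>lborel \<partial>lborel)"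
    by (rule nn_integral_real2(1)[OF gm])
  also have "\<dots> \<le> (\<integral>\<^sup>+s. \<integral>\<^sup>+t. P2 s * P1 t \<partial>lborel \<partial>lborel)"
    using b1 b2 g0 by (intro nn_integral_mono) (simp add: power2_eq_square ennreal_mult mult_mono)
  also have "\<dots> = (\<integral>\<^sup>+s. P2 s * (\<integral>\<^sup>+t. P1 t \<partial>lborel) \<partial>lborel)"
    using mP1 by (simp add: nn_integral_cmult)
  also have "\<dots> = (\<integral>\<^sup>+s. P2 s \<partial>lborel) * (\<integral>\<^sup>+t. P1 t \<partial>lborel)"
    using mP2 by (rule nn_integral_multc)
  also have "(\<integral>\<^sup>+s. P2 s \<partial>lborel) = (\<integral>\<^sup>+x. p ax2 x \<partial>lborel)"
    unfolding P2_def by (rule nn_integral_real2(1)[OF pm, symmetric]) simp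
  also have "(\<integral>\<^sup>+t. P1 t \<partial>lborel) = (\<integral>\<^sup>+x. p ax1 x \<partial>lborel)"
    unfolding P1_def by (rule nn_integral_real2(2)[OF pm, symmetric]) simp
  also have "(\<integral>\<^sup>+x. p ax2 x \<partial>lborel) * (\<integral>\<^sup>+x. p ax1 x \<partial>lborel)
    \<le> ennreal (2 * (L2_norm G \<phi> * L2_norm G (partial ax2 \<phi>))) * ennreal (2 * (L2_norm G \<phi> * L2_norm G (partial ax1 \<phi>)))"
  proof (rule mult_mono)
    have "(\<integral>\<^sup>+x. p e x \<partial>lborel) \<le> ennreal (2 * (L2_norm G \<phi> * L2_norm G (partial e \<phi>)))" if e: "e \<in> Basis" for e
    proof -
      have "(\<lambda>x. ennreal (norm (\<phi> x) * norm (partial e \<phi> x))) \<in> borel_measurable borel"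
        by (intro measurable_ennreal_continuous continuous_intros test_cont[OF \<phi>] test_cont[OF test_partial[OF \<phi> e]])
      then have m: "(\<lambda>x. ennreal (norm (\<phi> x) * norm (partial e \<phi> x))) \<in> borel_measurable lborel" by simp
      have "(\<integral>\<^sup>+x. p e x \<partial>lborel) = 2 * (\<integral>\<^sup>+x. ennreal (norm (\<phi> x) * norm (partial e \<phi> x)) \<partial>lborel)"
        unfolding p_def using m by (subst nn_integral_cmult[symmetric]) (auto simp: ennreal_mult)
      also have "\<dots> \<le> 2 * ennreal (L2_norm G \<phi> * L2_norm G (partial e \<phi>))"
        by (intro mult_left_mono nn_integral_CS_test[OF G \<phi> test_partial[OF \<phi> e]]) simp
      also have "\<dots> = ennreal (2 * (L2_norm G \<phi> * L2_norm G (partial e \<phi>)))"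
        using L2_norm_nonneg[of G \<phi>] L2_norm_nonneg[of G "partial e \<phi>"] by (simp add: ennreal_mult)
      finally show ?thesis .
    qed
    then show "(\<integral>\<^sup>+x. p ax2 x \<partial>lborel) \<le> ennreal (2 * (L2_norm G \<phi> * L2_norm G (partial ax2 \<phi>)))"
      "(\<integral>\<^sup>+x. p ax1 x \<partial>lborel) \<le> ennreal (2 * (L2_norm G \<phi> * L2_norm G (partial ax1 \<phi>)))" by auto
  qed auto
  also have "\<dots> = ennreal (4 * (L2_norm G \<phi>)^2 * L2_norm G (partial ax1 \<phi>) * L2_norm G (partial ax2 \<phi>))"
    using L2_norm_nonneg[of G \<phi>] L2_norm_nonneg[of G "partial ax1 \<phi>"] L2_norm_nonneg[of G "partial ax2 \<phi>"]
    by (simp add: ennreal_mult[symmetric] power2_eq_square mult_ac)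
  finally have le: "(\<integral>\<^sup>+x. ennreal ((g x)^2) \<partial>lborel)
    \<le> ennreal (4 * (L2_norm G \<phi>)^2 * L2_norm G (partial ax1 \<phi>) * L2_norm G (partial ax2 \<phi>))" .
  have i: "integrable lborel (\<lambda>x. (g x)^2)"
    using test_integrable[OF test_inner[OF gt gt]] by (simp add: power2_eq_square)
  have "(\<integral>x. (g x)^2 \<partial>lborel) \<le> 4 * (L2_norm G \<phi>)^2 * L2_norm G (partial ax1 \<phi>) * L2_norm G (partial ax2 \<phi>)"
    using le i L2_norm_nonneg[of G "partial ax1 \<phi>"] L2_norm_nonneg[of G "partial ax2 \<phi>"]
    by (simp add: nn_integral_eq_integral)
  moreover have "(\<integral>x. ((norm (\<phi> x))^2)^2 \<partial>lebesgue_on G) = (\<integral>x. (g x)^2 \<partial>lborel)"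
  proof -
    have "(\<lambda>x. ((norm (\<phi> x))^2)^2) = (\<lambda>x. g x \<bullet> g x)"
      by (auto simp: g_def power2_norm_eq_inner) (simp add: power2_eq_square)
    moreover have "(\<lambda>x. (g x)^2) = (\<lambda>x. g x \<bullet> g x)" by (simp add: power2_eq_square)
    ultimately show ?thesis
      using test_integral_lebesgue_on[OF G test_cont[OF test_inner[OF gt gt]]] test_outside[OF gt] by simp
  qed
  ultimately show ?thesis by simp
qed

text \<open>Integrate the derivative of \<open>(x \<bullet> e) |\<phi>|\<^sup>2\<close> in the direction \<open>e\<close>.\<close>

lemma poincare_test:
  fixes \<phi> :: "'a::euclidean_space => 'b::euclidean_space"
  assumes G: "open G" and R: "0 \<le> \<rho>" "\<And>x. x \<in> G ==> norm x \<le> \<rho>" and \<phi>: "\<phi> \<in> test_functions G" and e: "e \<in> Basis"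
  shows "L2_norm G \<phi> \<le> 2 * \<rho> * L2_norm G (partial e \<phi>)"
proof -
  define g where "g x = \<phi> x \<bullet> \<phi> x" for x
  have gt: "g \<in> test_functions G" unfolding g_def[abs_def] by (rule test_inner[OF \<phi> \<phi>])
  have Ci: "Ck k (\<lambda>x. x \<bullet> e)" for k by (rule Ck_linear[OF bounded_linear_inner_left Ck_ident])
  have Ft: "(\<lambda>x. g x * (x \<bullet> e)) \<in> test_functions G" by (rule test_bilinear[OF bounded_bilinear_mult gt Ci])
  have dF: "partial e (\<lambda>x. g x * (x \<bullet> e)) x = g x + 2 * (\<phi> x \<bullet> partial e \<phi> x) * (x \<bullet> e)" for x
  proof -
    have d: "(\<lambda>x. x \<bullet> e) differentiable (at x)" using Ci[of "Suc 0"] by simp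
    have "partial e (\<lambda>x. x \<bullet> e) x = e \<bullet> e"
      by (rule partial_eqI[where D = "\<lambda>h. h \<bullet> e"]) (auto intro!: derivative_eq_intros)
    then have "partial e (\<lambda>x. x \<bullet> e) x = 1" using e by (simp add: inner_Basis)
    moreover have "partial e g x = 2 * (\<phi> x \<bullet> partial e \<phi> x)"
      unfolding g_def[abs_def] by (rule partial_norm_sq[OF test_diff[OF \<phi>]])
    ultimately show ?thesis using partial_bilinear[OF bounded_bilinear_mult test_diff[OF gt] d] by simp
  qed
  have i2: "integrable lborel (\<lambda>x. 2 * (\<phi> x \<bullet> partial e \<phi> x) * (x \<bullet> e))"
  proof -
    have "integrable lborel (\<lambda>x. (\<phi> x \<bullet> partial e \<phi> x) * (x \<bullet> e))"
      by (rule test_integrable[OF test_bilinear[OF bounded_bilinear_mult test_inner[OF \<phi> test_partial[OF \<phi> e]] Ci]])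
    from integrable_mult_right[OF this, of 2] show ?thesis by (simp add: mult.assoc)
  qed
  have "0 = (\<integral>x. g x + 2 * (\<phi> x \<bullet> partial e \<phi> x) * (x \<bullet> e) \<partial>lborel)"
    using integral_partial_zero[OF Ft e] unfolding dF by simp
  also have "\<dots> = (\<integral>x. g x \<partial>lborel) + (\<integral>x. 2 * (\<phi> x \<bullet> partial e \<phi> x) * (x \<bullet> e) \<partial>lborel)"
    by (rule Bochner_Integration.integral_add[OF test_integrable[OF gt] i2])
  finally have "(\<integral>x. g x \<partial>lborel) \<le> (\<integral>x. norm (2 * (\<phi> x \<bullet> partial e \<phi> x) * (x \<bullet> e)) \<partial>lborel)"
    using integral_norm_bound[of lborel "\<lambda>x. 2 * (\<phi> x \<bullet> partial e \<phi> x) * (x \<bullet> e)"] by (simp add: abs_le_iff)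
  also have "ennreal \<dots> \<le> ennreal (2 * \<rho> * (L2_norm G \<phi> * L2_norm G (partial e \<phi>)))"
  proof -
    have "ennreal (\<integral>x. norm (2 * (\<phi> x \<bullet> partial e \<phi> x) * (x \<bullet> e)) \<partial>lborel)
      = (\<integral>\<^sup>+x. ennreal (norm (2 * (\<phi> x \<bullet> partial e \<phi> x) * (x \<bullet> e))) \<partial>lborel)"
      using integrable_norm[OF i2] by (intro nn_integral_eq_integral[symmetric]) auto
    also have "\<dots> \<le> (\<integral>\<^sup>+x. ennreal (2 * \<rho>) * ennreal (norm (\<phi> x) * norm (partial e \<phi> x)) \<partial>lborel)"
    proof (rule nn_integral_mono)
      fix x
      have "norm (2 * (\<phi> x \<bullet> partial e \<phi> x) * (x \<bullet> e)) \<le> 2 * \<rho> * (norm (\<phi> x) * norm (partial e \<phi> x))"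
      proof (cases "x \<in> G")
        case True
        have "\<bar>x \<bullet> e\<bar> \<le> \<rho>" using Basis_le_norm[OF e, of x] R(2)[OF True] by simp
        then have "\<bar>\<phi> x \<bullet> partial e \<phi> x\<bar> * \<bar>x \<bullet> e\<bar> \<le> (norm (\<phi> x) * norm (partial e \<phi> x)) * \<rho>"
          by (intro mult_mono Cauchy_Schwarz_ineq2) auto
        then show ?thesis by (simp add: abs_mult mult_ac)
      qed (simp add: test_outside[OF \<phi>])
      then show "ennreal (norm (2 * (\<phi> x \<bullet> partial e \<phi> x) * (x \<bullet> e)))
          \<le> ennreal (2 * \<rho>) * ennreal (norm (\<phi> x) * norm (partial e \<phi> x))"
        using R(1) by (simp add: ennreal_mult[symmetric] ennreal_leI del: ennreal_mult')
    qed
    also have "\<dots> = ennreal (2 * \<rho>) * (\<integral>\<^sup>+x. ennreal (norm (\<phi> x) * norm (partial e \<phi> x)) \<partial>lborel)"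
    proof (rule nn_integral_cmult)
      have "(\<lambda>x. ennreal (norm (\<phi> x) * norm (partial e \<phi> x))) \<in> borel_measurable borel"
        by (intro measurable_ennreal_continuous continuous_intros test_cont[OF \<phi>] test_cont[OF test_partial[OF \<phi> e]])
      then show "(\<lambda>x. ennreal (norm (\<phi> x) * norm (partial e \<phi> x))) \<in> borel_measurable lborel" by simp
    qed
    also have "\<dots> \<le> ennreal (2 * \<rho>) * ennreal (L2_norm G \<phi> * L2_norm G (partial e \<phi>))"
      by (intro mult_left_mono nn_integral_CS_test[OF G \<phi> test_partial[OF \<phi> e]]) simp
    also have "\<dots> = ennreal (2 * \<rho> * (L2_norm G \<phi> * L2_norm G (partial e \<phi>)))"
      using R(1) L2_norm_nonneg[of G \<phi>] L2_norm_nonneg[of G "partial e \<phi>"] by (simp add: ennreal_mult)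
    finally show ?thesis .
  qed
  finally have le: "ennreal (\<integral>x. g x \<partial>lborel) \<le> ennreal (2 * \<rho> * (L2_norm G \<phi> * L2_norm G (partial e \<phi>)))"
    by (simp add: ennreal_leI)
  have sq: "(\<integral>x. g x \<partial>lborel) = (L2_norm G \<phi>)^2"
    using test_integral_lebesgue_on[OF G test_cont[OF gt] test_outside[OF gt]]
    by (simp add: L2_norm_def power2_norm_eq_inner g_def)
  have "(L2_norm G \<phi>)^2 \<le> 2 * \<rho> * (L2_norm G \<phi> * L2_norm G (partial e \<phi>))"
    using le unfolding sq using R(1) L2_norm_nonneg[of G \<phi>] L2_norm_nonneg[of G "partial e \<phi>"]
    by (simp add: ennreal_le_iff)
  then have "L2_norm G \<phi> * L2_norm G \<phi> \<le> L2_norm G \<phi> * (2 * \<rho> * L2_norm G (partial e \<phi>))"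
    by (simp add: power2_eq_square mult_ac)
  then show ?thesis
    using R(1) L2_norm_nonneg[of G \<phi>] L2_norm_nonneg[of G "partial e \<phi>"]
    by (cases "L2_norm G \<phi> = 0") auto
qed

section \<open>Rellich compactness\<close>

lemma nn_integral_shift:
  fixes f :: "'a::euclidean_space => ennreal"
  assumes "f \<in> borel_measurable borel"
  shows "(\<integral>\<^sup>+x. f (a + x) \<partial>lborel) = (\<integral>\<^sup>+x. f x \<partial>lborel)"
proof -
  have "(\<integral>\<^sup>+x. f x \<partial>lborel) = (\<integral>\<^sup>+x. f x \<partial>distr lborel borel ((+) a))" by (simp add: lborel_distr_plus)
  also have "\<dots> = (\<integral>\<^sup>+x. f (a + x) \<partial>lborel)" using assms by (intro nn_integral_distr) auto
  finally show ?thesis by simp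
qed

lemma frechet_sum_partial:
  fixes \<phi> :: "'a::euclidean_space => 'b::euclidean_space"
  assumes "\<phi> differentiable (at x)"
  shows "frechet_derivative \<phi> (at x) y = (\<Sum>e\<in>Basis. (y \<bullet> e) *\<^sub>R partial e \<phi> x)"
proof -
  have lin: "linear (frechet_derivative \<phi> (at x))"
    using has_derivative_frechet[OF assms] has_derivative_linear by blast
  have "frechet_derivative \<phi> (at x) y = frechet_derivative \<phi> (at x) (\<Sum>e\<in>Basis. (y \<bullet> e) *\<^sub>R e)"
    by (simp add: euclidean_representation)
  also have "\<dots> = (\<Sum>e\<in>Basis. (y \<bullet> e) *\<^sub>R partial e \<phi> x)"
    by (simp add: linear_sum[OF lin] linear_scale[OF lin] partial_def)
  finally show ?thesis .
qed

text \<open>The increment is the integral of the derivative along the segment. Cauchy-Schwarz is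
  applied twice: over the coordinate directions and over the parameter s.\<close>

lemma increment_bound:
  fixes \<phi> :: "'a::euclidean_space => 'b::euclidean_space"
  assumes \<phi>: "\<phi> \<in> test_functions G"
  defines "g \<equiv> \<lambda>x. \<Sum>e\<in>Basis. (norm (partial e \<phi> x))^2"
  shows "(norm (\<phi> (x + y) - \<phi> x))^2 \<le> (norm y)^2 * (\<integral>s. indicator {0..1} s * g (x + s *\<^sub>R y) \<partial>lborel)"
proof -
  define D where "D s = (\<Sum>e\<in>Basis. (y \<bullet> e) *\<^sub>R partial e \<phi> (x + s *\<^sub>R y))" for s
  have gc: "continuous_on UNIV g"
    unfolding g_def by (intro continuous_intros test_cont[OF test_partial[OF \<phi>]])
  have gc': "continuous_on UNIV (\<lambda>s. g (x + s *\<^sub>R y))"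
    by (intro continuous_on_compose2[OF gc] continuous_intros) auto
  have Dc: "continuous_on UNIV D"
    unfolding D_def[abs_def]
    by (intro continuous_intros continuous_on_compose2[OF test_cont[OF test_partial[OF \<phi>]]]) auto
  have der: "((\<lambda>s. \<phi> (x + s *\<^sub>R y)) has_vector_derivative D s) (at s)" for s
    using test_line_deriv[of \<phi> x s y, OF test_diff[OF \<phi>]] frechet_sum_partial[OF test_diff[OF \<phi>], of "x + s *\<^sub>R y" y]
    by (simp add: D_def partial_def)
  have ftc: "(\<integral>s. indicator {0..1} s *\<^sub>R D s \<partial>lborel) = \<phi> (x + 1 *\<^sub>R y) - \<phi> (x + 0 *\<^sub>R y)"
    by (rule integral_FTC_Icc) (use der Dc in \<open>auto intro: has_vector_derivative_at_within continuous_on_subset\<close>)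
  have Dle: "(norm (D s))^2 \<le> (norm y)^2 * g (x + s *\<^sub>R y)" for s
  proof -
    have "norm (D s) \<le> (\<Sum>e\<in>Basis. \<bar>y \<bullet> e\<bar> * norm (partial e \<phi> (x + s *\<^sub>R y)))"
      unfolding D_def by (rule order_trans[OF norm_sum]) simp
    also have "\<dots> \<le> L2_set (\<lambda>e. y \<bullet> e) Basis * L2_set (\<lambda>e. norm (partial e \<phi> (x + s *\<^sub>R y))) Basis"
      using L2_set_mult_ineq[of "\<lambda>e. y \<bullet> e" "\<lambda>e. norm (partial e \<phi> (x + s *\<^sub>R y))" Basis] by simp
    also have "L2_set (\<lambda>e. y \<bullet> e) Basis = norm y" by (simp add: L2_set_def norm_eq_sqrt_inner euclidean_inner[of y y] power2_eq_square)
    finally have "norm (D s) \<le> norm y * sqrt (g (x + s *\<^sub>R y))" by (simp add: L2_set_def g_def)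
    then have "(norm (D s))^2 \<le> (norm y * sqrt (g (x + s *\<^sub>R y)))^2" by (rule power_mono) simp
    moreover have "0 \<le> g (x + s *\<^sub>R y)" unfolding g_def by (intro sum_nonneg) auto
    ultimately show ?thesis by (simp add: power_mult_distrib)
  qed
  let ?I = "indicator {0..1} :: real => real"
  have Im: "?I \<in> borel_measurable lborel" by simp
  have Dm: "(\<lambda>s. ?I s * norm (D s)) \<in> borel_measurable lborel"
    using borel_measurable_continuous_onI[OF continuous_on_norm[OF Dc]] by simp
  have Isq: "(?I s)^2 = ?I s" for s by (simp add: indicator_def)
  have i1: "integrable lborel (\<lambda>s. (?I s)^2)" unfolding Isq by (intro integrable_real_indicator) auto
  have i2: "integrable lborel (\<lambda>s. (?I s * norm (D s))^2)"
  proof -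
    have "integrable lborel (\<lambda>s. ?I s *\<^sub>R (norm (D s))^2)"
      by (rule borel_integrable_compact) (auto intro!: continuous_intros continuous_on_subset[OF Dc])
    then show ?thesis by (simp add: power_mult_distrib Isq)
  qed
  have i3: "integrable lborel (\<lambda>s. ?I s * g (x + s *\<^sub>R y))"
    using borel_integrable_compact[of "{0..1::real}", OF _ continuous_on_subset[OF gc']] by simp
  have "norm (\<phi> (x + y) - \<phi> x) \<le> (\<integral>s. norm (?I s *\<^sub>R D s) \<partial>lborel)"
    using integral_norm_bound[of lborel "\<lambda>s. ?I s *\<^sub>R D s"] unfolding ftc by simp
  also have "\<dots> = (\<integral>s. ?I s * (?I s * norm (D s)) \<partial>lborel)"
    by (intro Bochner_Integration.integral_cong) (auto simp: indicator_def)
  also have "\<dots> \<le> sqrt (\<integral>s. (?I s)^2 \<partial>lborel) * sqrt (\<integral>s. (?I s * norm (D s))^2 \<partial>lborel)"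
    by (rule integral_CS(2)[OF Im Dm i1 i2])
  also have "(\<integral>s. (?I s)^2 \<partial>lborel) = 1" unfolding Isq by simp
  finally have "norm (\<phi> (x + y) - \<phi> x) \<le> sqrt (\<integral>s. (?I s * norm (D s))^2 \<partial>lborel)" by simp
  then have "(norm (\<phi> (x + y) - \<phi> x))^2 \<le> (sqrt (\<integral>s. (?I s * norm (D s))^2 \<partial>lborel))^2" by (rule power_mono) simp
  also have "\<dots> = (\<integral>s. (?I s * norm (D s))^2 \<partial>lborel)" by simp
  also have "\<dots> \<le> (\<integral>s. (norm y)^2 * (?I s * g (x + s *\<^sub>R y)) \<partial>lborel)"
    using Dle by (intro integral_mono i2 integrable_mult_right i3) (auto simp: indicator_def)
  finally show ?thesis by simp
qed

lemma nn_integral_norm_sq_test: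
  fixes \<phi> :: "'a::euclidean_space => 'b::euclidean_space"
  assumes G: "open G" and p: "\<phi> \<in> test_functions G"
  shows "(\<integral>\<^sup>+x. ennreal ((norm (\<phi> x))^2) \<partial>lborel) = ennreal ((L2_norm G \<phi>)^2)"
proof -
  have "(\<integral>x. (norm (\<phi> x))^2 \<partial>lborel) = (L2_norm G \<phi>)^2"
    using test_integral_lebesgue_on[OF G test_cont[OF test_inner[OF p p]]] test_outside[OF p]
    by (simp add: L2_norm_def power2_norm_eq_inner)
  moreover have "integrable lborel (\<lambda>x. (norm (\<phi> x))^2)"
    using test_integrable[OF test_inner[OF p p]] by (simp add: power2_norm_eq_inner)
  ultimately show ?thesis by (simp add: nn_integral_eq_integral)
qed

text \<open>\<open>increment_bound\<close> is integrated over x; after exchanging the integrals,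
  translation invariance removes the shift by s y.\<close>

lemma translation_test:
  fixes \<phi> :: "'a::euclidean_space => 'b::euclidean_space"
  assumes G: "open G" and \<phi>: "\<phi> \<in> test_functions G"
  shows "(\<integral>\<^sup>+x. ennreal ((norm (\<phi> (x + y) - \<phi> x))^2) \<partial>lborel)
    \<le> ennreal ((norm y)^2 * (\<Sum>e\<in>Basis. (L2_norm G (partial e \<phi>))^2))"
proof -
  define g where "g x = (\<Sum>e\<in>Basis. (norm (partial e \<phi> x))^2)" for x
  have g0: "0 \<le> g x" for x unfolding g_def by (intro sum_nonneg) auto
  have gc: "continuous_on UNIV g"
    unfolding g_def[abs_def] by (intro continuous_intros test_cont[OF test_partial[OF \<phi>]])
  have gi: "(\<integral>\<^sup>+x. ennreal (g x) \<partial>lborel) = ennreal (\<Sum>e\<in>Basis. (L2_norm G (partial e \<phi>))^2)"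
  proof -
    have "(\<integral>\<^sup>+x. ennreal (g x) \<partial>lborel) = (\<integral>\<^sup>+x. (\<Sum>e\<in>Basis. ennreal ((norm (partial e \<phi> x))^2)) \<partial>lborel)"
      by (simp add: g_def sum_ennreal)
    also have "\<dots> = (\<Sum>e\<in>Basis. \<integral>\<^sup>+x. ennreal ((norm (partial e \<phi> x))^2) \<partial>lborel)"
    proof (rule nn_integral_sum)
      fix e :: 'a assume "e \<in> Basis"
      then have "(\<lambda>x. ennreal ((norm (partial e \<phi> x))^2)) \<in> borel_measurable borel"
        by (intro measurable_ennreal_continuous continuous_intros test_cont[OF test_partial[OF \<phi>]])
      then show "(\<lambda>x. ennreal ((norm (partial e \<phi> x))^2)) \<in> borel_measurable lborel" by simp
    qed
    also have "\<dots> = (\<Sum>e\<in>Basis. ennreal ((L2_norm G (partial e \<phi>))^2))"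
      by (intro sum.cong refl nn_integral_norm_sq_test[OF G test_partial[OF \<phi>]])
    finally show ?thesis by (simp add: sum_ennreal)
  qed
  have gm: "(\<lambda>x. ennreal (g x)) \<in> borel_measurable borel" by (rule measurable_ennreal_continuous[OF gc])
  let ?F = "\<lambda>x s. ennreal (indicator {0..1::real} s * g (x + s *\<^sub>R y))"
  have Fm: "(\<lambda>(x, s). ?F x s) \<in> borel_measurable (lborel \<Otimes>\<^sub>M lborel)"
  proof -
    have 1: "(\<lambda>p::'a \<times> real. g (fst p + snd p *\<^sub>R y)) \<in> borel_measurable borel"
      by (intro borel_measurable_continuous_onI continuous_on_compose2[OF gc] continuous_intros) auto
    have 2: "(\<lambda>p::'a \<times> real. indicator {0..1::real} (snd p) :: real) \<in> borel_measurable borel"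
      by (rule measurable_compose[of snd borel borel "indicator {0..1}"])
        (auto intro!: borel_measurable_continuous_onI continuous_intros)
    have "(\<lambda>p::'a \<times> real. ennreal (indicator {0..1::real} (snd p) * g (fst p + snd p *\<^sub>R y))) \<in> borel_measurable borel"
      by (rule measurable_compose[OF borel_measurable_times[OF 2 1] measurable_ennreal])
    then show ?thesis unfolding lborel_prod by (simp add: case_prod_beta')
  qed
  have "(\<integral>\<^sup>+x. ennreal ((norm (\<phi> (x + y) - \<phi> x))^2) \<partial>lborel)
    \<le> (\<integral>\<^sup>+x. ennreal ((norm y)^2) * (\<integral>\<^sup>+s. ?F x s \<partial>lborel) \<partial>lborel)"
  proof (rule nn_integral_mono)
    fix x
    have gc': "continuous_on {0..1} (\<lambda>s. g (x + s *\<^sub>R y))"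
      by (intro continuous_on_compose2[OF gc] continuous_intros) auto
    have i: "integrable lborel (\<lambda>s. indicator {0..1} s * g (x + s *\<^sub>R y))"
      using borel_integrable_compact[OF compact_Icc gc'] by simp
    have "ennreal ((norm (\<phi> (x + y) - \<phi> x))^2)
      \<le> ennreal ((norm y)^2 * (\<integral>s. indicator {0..1} s * g (x + s *\<^sub>R y) \<partial>lborel))"
      by (intro ennreal_leI) (use increment_bound[OF \<phi>] in \<open>simp add: g_def\<close>)
    also have "\<dots> = ennreal ((norm y)^2) * ennreal (\<integral>s. indicator {0..1} s * g (x + s *\<^sub>R y) \<partial>lborel)"
      using g0 by (intro ennreal_mult Bochner_Integration.integral_nonneg) auto
    also have "ennreal (\<integral>s. indicator {0..1} s * g (x + s *\<^sub>R y) \<partial>lborel) = (\<integral>\<^sup>+s. ?F x s \<partial>lborel)"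
      using g0 by (intro nn_integral_eq_integral[symmetric] i) auto
    finally show "ennreal ((norm (\<phi> (x + y) - \<phi> x))^2) \<le> ennreal ((norm y)^2) * (\<integral>\<^sup>+s. ?F x s \<partial>lborel)" .
  qed
  also have "\<dots> = ennreal ((norm y)^2) * (\<integral>\<^sup>+x. \<integral>\<^sup>+s. ?F x s \<partial>lborel \<partial>lborel)"
    using lborel.borel_measurable_nn_integral_fst[OF Fm] by (intro nn_integral_cmult) simp
  also have "(\<integral>\<^sup>+x. \<integral>\<^sup>+s. ?F x s \<partial>lborel \<partial>lborel) = (\<integral>\<^sup>+s. \<integral>\<^sup>+x. ?F x s \<partial>lborel \<partial>lborel)"
    using lborel_pair.Fubini'[OF Fm] by simp
  also have "\<dots> = (\<integral>\<^sup>+s. indicator {0..1} s * (\<integral>\<^sup>+x. ennreal (g x) \<partial>lborel) \<partial>(lborel :: real measure))"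
  proof (rule nn_integral_cong)
    fix s :: real
    have "(\<integral>\<^sup>+x. ?F x s \<partial>lborel) = (\<integral>\<^sup>+x. indicator {0..1} s * ennreal (g (s *\<^sub>R y + x)) \<partial>lborel)"
      by (intro nn_integral_cong) (simp add: indicator_def add.commute)
    also have "\<dots> = indicator {0..1} s * (\<integral>\<^sup>+x. ennreal (g (s *\<^sub>R y + x)) \<partial>lborel)"
      using measurable_ennreal_continuous[of "\<lambda>x. g (s *\<^sub>R y + x)"] continuous_on_compose2[OF gc, of UNIV "\<lambda>x. s *\<^sub>R y + x"]
      by (intro nn_integral_cmult) (simp add: continuous_intros)
    finally show "(\<integral>\<^sup>+x. ?F x s \<partial>lborel) = indicator {0..1} s * (\<integral>\<^sup>+x. ennreal (g x) \<partial>lborel)"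
      using nn_integral_shift[OF gm, of "s *\<^sub>R y"] by simp
  qed
  also have "\<dots> = (\<integral>\<^sup>+x. ennreal (g x) \<partial>lborel)"
    by (subst nn_integral_multc) auto
  finally show ?thesis unfolding gi by (simp add: ennreal_mult sum_nonneg)
qed

section \<open>Comparison with averages over a square grid\<close>

definition cell :: "real => real^2 => int \<times> int" where
  "cell h x = (\<lfloor>(x \<bullet> ax1) / h\<rfloor>, \<lfloor>(x \<bullet> ax2) / h\<rfloor>)"

definition block :: "real => int \<times> int => (real^2) set" where
  "block h k = {z. cell h z = k}"

lemma block_eq:
  assumes "0 < h"
  shows "block h (i, j) = {z. real_of_int i * h \<le> z \<bullet> ax1 \<and> z \<bullet> ax1 < (real_of_int i + 1) * h \<and>
     real_of_int j * h \<le> z \<bullet> ax2 \<and> z \<bullet> ax2 < (real_of_int j + 1) * h}"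
  using assms by (auto simp: block_def cell_def floor_eq_iff pos_le_divide_eq pos_divide_less_eq)

lemma block_borel: assumes "0 < h" shows "block h k \<in> sets borel"
proof -
  obtain i j where k: "k = (i, j)" by (cases k)
  have m: "(\<lambda>z::real^2. z \<bullet> ax1) \<in> borel_measurable borel" "(\<lambda>z::real^2. z \<bullet> ax2) \<in> borel_measurable borel"
    by (auto intro!: borel_measurable_continuous_onI continuous_intros)
  have "{z \<in> space (borel :: (real^2) measure). real_of_int i * h \<le> z \<bullet> ax1 \<and> z \<bullet> ax1 < (real_of_int i + 1) * h \<and>
     real_of_int j * h \<le> z \<bullet> ax2 \<and> z \<bullet> ax2 < (real_of_int j + 1) * h} \<in> sets borel"
    using m by measurable
  then show ?thesis unfolding k block_eq[OF assms] by simp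
qed

lemma emeasure_block: assumes h: "0 < h" shows "emeasure lborel (block h k) = ennreal (h^2)"
proof -
  obtain i j where k: "k = (i, j)" by (cases k)
  let ?A = "{real_of_int i * h..<(real_of_int i + 1) * h}" and ?B = "{real_of_int j * h..<(real_of_int j + 1) * h}"
  have "emeasure lborel (block h k) = (\<integral>\<^sup>+x. indicator (block h k) x \<partial>lborel)"
    using block_borel[OF h] by simp
  also have "\<dots> = (\<integral>\<^sup>+s. \<integral>\<^sup>+t. indicator (block h k) (mk2 (s, t)) \<partial>lborel \<partial>lborel)"
    using block_borel[OF h] by (intro nn_integral_real2(1)) simp
  also have "\<dots> = (\<integral>\<^sup>+s. \<integral>\<^sup>+t. indicator ?A s * indicator ?B t \<partial>lborel \<partial>lborel)"
    by (intro nn_integral_cong) (auto simp: k block_eq[OF h] mk2_inner indicator_def)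
  also have "\<dots> = (\<integral>\<^sup>+s. indicator ?A s * ennreal h \<partial>lborel)"
    using h by (intro nn_integral_cong) (subst nn_integral_cmult, auto simp: algebra_simps)
  also have "\<dots> = ennreal h * ennreal h"
    using h by (subst nn_integral_multc) (auto simp: algebra_simps)
  finally show ?thesis using h by (simp add: ennreal_mult[symmetric] power2_eq_square)
qed

lemma finite_cells: assumes "bounded G" "0 < h" shows "finite (cell h ` G)"
proof -
  obtain \<rho> where \<rho>: "\<And>x. x \<in> G ==> norm x \<le> \<rho>" using assms(1) by (auto simp: bounded_iff)
  have "\<lfloor>(x \<bullet> e) / h\<rfloor> \<in> {\<lfloor>- \<rho> / h\<rfloor>..\<lfloor>\<rho> / h\<rfloor>}" if "x \<in> G" "e \<in> Basis" for x e :: "real^2"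
  proof -
    have "\<bar>x \<bullet> e\<bar> \<le> \<rho>" using Basis_le_norm[OF that(2), of x] \<rho>[OF that(1)] by linarith
    then have "- \<rho> \<le> x \<bullet> e" "x \<bullet> e \<le> \<rho>" by auto
    then have "- \<rho> / h \<le> (x \<bullet> e) / h" "(x \<bullet> e) / h \<le> \<rho> / h" using assms(2) by (auto intro: divide_right_mono simp del: divide_minus_left)
    then show ?thesis by (auto intro: floor_mono)
  qed
  then have "cell h ` G \<subseteq> {\<lfloor>- \<rho> / h\<rfloor>..\<lfloor>\<rho> / h\<rfloor>} \<times> {\<lfloor>- \<rho> / h\<rfloor>..\<lfloor>\<rho> / h\<rfloor>}"
    by (auto simp: cell_def)
  then show ?thesis by (rule finite_subset) auto
qed

text \<open>Not divided by the area h^2 of the cell; the powers of h reappear in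
  \<open>cell_average_bound\<close>.\<close>

definition cell_integral :: "real => (real^2 => 'b::euclidean_space) => int \<times> int => 'b" where
  "cell_integral h \<phi> k = (\<integral>z. indicator (block h k) z *\<^sub>R \<phi> z \<partial>lborel)"

lemma cell_integral_diff:
  assumes "0 < h" "integrable lborel \<phi>" "integrable lborel \<psi>"
  shows "cell_integral h (\<lambda>x. \<phi> x - \<psi> x) k = cell_integral h \<phi> k - cell_integral h \<psi> k"
proof -
  have "integrable lborel (\<lambda>z. indicator (block h k) z *\<^sub>R \<phi> z)" "integrable lborel (\<lambda>z. indicator (block h k) z *\<^sub>R \<psi> z)"
    using block_borel[OF assms(1), of k] assms(2,3) by (auto intro!: integrable_mult_indicator simp del: split_paired_All)
  then show ?thesis by (simp add: cell_integral_def scaleR_diff_right)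
qed

text \<open>h^2 times the value at x is the integral over its cell of the deviation from that value
  plus the cell integral. Cauchy-Schwarz on the cell contributes a factor h, and the square of the
  sum is split with a factor 2.\<close>

lemma cell_average_bound:
  fixes \<phi> :: "real^2 => 'b::euclidean_space"
  assumes h: "0 < h" and \<phi>: "\<phi> \<in> test_functions G"
  shows "ennreal ((norm (\<phi> x))^2) \<le> ennreal (2 / h^2) * (\<integral>\<^sup>+z. ennreal (indicator (block h (cell h x)) z * (norm (\<phi> x - \<phi> z))^2) \<partial>lborel)
    + ennreal (2 / h ^ 4 * (norm (cell_integral h \<phi> (cell h x)))^2)"
proof -
  let ?Q = "block h (cell h x)"
  let ?I = "indicator ?Q :: real^2 => real"
  define m where "m = cell_integral h \<phi> (cell h x)"
  have Qb: "?Q \<in> sets lborel" using block_borel[OF h] by simp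
  have mQ: "measure lborel ?Q = h^2" using emeasure_block[OF h] by (simp add: measure_def)
  have fQ: "emeasure lborel ?Q < \<infinity>" using emeasure_block[OF h] by simp
  obtain B where B: "\<And>x. norm (\<phi> x) \<le> B" by (rule test_bounded[OF \<phi>]) blast
  have \<phi>m: "\<phi> \<in> borel_measurable lborel" using borel_measurable_continuous_onI[OF test_cont[OF \<phi>]] by simp
  have iI: "integrable lborel ?I" using Qb fQ by (intro integrable_real_indicator)
  have i\<phi>: "integrable lborel (\<lambda>z. ?I z *\<^sub>R \<phi> z)" using Qb by (intro integrable_mult_indicator test_integrable[OF \<phi>])
  have ic: "integrable lborel (\<lambda>z. ?I z *\<^sub>R \<phi> x)" using iI by (intro integrable_scaleR_left) auto
  have Isq: "(?I z)^2 = ?I z" for z by (simp add: indicator_def)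
  have im: "?I \<in> borel_measurable lborel" using Qb by simp
  have dm: "(\<lambda>z. ?I z * norm (\<phi> x - \<phi> z)) \<in> borel_measurable lborel" using im \<phi>m by measurable
  have i2: "integrable lborel (\<lambda>z. (?I z * norm (\<phi> x - \<phi> z))^2)"
  proof (rule Bochner_Integration.integrable_bound)
    show "integrable lborel (\<lambda>z. ?I z * (2 * B)^2)" using iI by simp
    show "AE z in lborel. norm ((?I z * norm (\<phi> x - \<phi> z))^2) \<le> norm (?I z * (2 * B)^2)"
    proof (rule AE_I2)
      fix z
      have "norm (\<phi> x - \<phi> z) \<le> 2 * B" using norm_triangle_ineq4[of "\<phi> x" "\<phi> z"] B[of x] B[of z] by linarith
      then have "(norm (\<phi> x - \<phi> z))^2 \<le> (2 * B)^2" by (rule power_mono) simp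
      then show "norm ((?I z * norm (\<phi> x - \<phi> z))^2) \<le> norm (?I z * (2 * B)^2)" by (auto simp: indicator_def)
    qed
  qed (use dm in measurable)
  define A where "A = (\<integral>z. (?I z * norm (\<phi> x - \<phi> z))^2 \<partial>lborel)"
  have A0: "0 \<le> A" unfolding A_def by simp
  have "h^2 *\<^sub>R \<phi> x = (\<integral>z. ?I z *\<^sub>R \<phi> x \<partial>lborel)" using mQ Qb fQ by simp
  also have "\<dots> = (\<integral>z. ?I z *\<^sub>R (\<phi> x - \<phi> z) \<partial>lborel) + m"
    unfolding m_def cell_integral_def scaleR_diff_right using i\<phi> ic by simp
  finally have "norm (h^2 *\<^sub>R \<phi> x) \<le> norm (\<integral>z. ?I z *\<^sub>R (\<phi> x - \<phi> z) \<partial>lborel) + norm m"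
    by (simp add: norm_triangle_ineq)
  also have "norm (\<integral>z. ?I z *\<^sub>R (\<phi> x - \<phi> z) \<partial>lborel) \<le> (\<integral>z. norm (?I z *\<^sub>R (\<phi> x - \<phi> z)) \<partial>lborel)"
    by (rule integral_norm_bound)
  also have "\<dots> = (\<integral>z. ?I z * (?I z * norm (\<phi> x - \<phi> z)) \<partial>lborel)"
    by (intro Bochner_Integration.integral_cong) (auto simp: indicator_def)
  also have "\<dots> \<le> sqrt (\<integral>z. (?I z)^2 \<partial>lborel) * sqrt A"
    unfolding A_def by (rule integral_CS(2)[OF im dm]) (use iI i2 in \<open>auto simp: Isq\<close>)
  also have "sqrt (\<integral>z. (?I z)^2 \<partial>lborel) = h" unfolding Isq using mQ Qb fQ h by simp
  finally have "h^2 * norm (\<phi> x) \<le> h * sqrt A + norm m" by simp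
  then have "(h^2 * norm (\<phi> x))^2 \<le> (h * sqrt A + norm m)^2" by (rule power_mono) simp
  also have "\<dots> \<le> 2 * (h * sqrt A)^2 + 2 * (norm m)^2" by (rule sum2_sq_le)
  finally have "h ^ 4 * (norm (\<phi> x))^2 \<le> 2 * (h^2 * A) + 2 * (norm m)^2"
    using A0 by (simp add: power_mult_distrib)
  then have "(norm (\<phi> x))^2 \<le> (2 * (h^2 * A) + 2 * (norm m)^2) / h ^ 4"
    using h by (simp add: pos_le_divide_eq mult.commute)
  also have "\<dots> = 2 / h^2 * A + 2 / h ^ 4 * (norm m)^2"
    using h by (simp add: add_divide_distrib power2_eq_square power4_eq_xxxx)
  finally have "ennreal ((norm (\<phi> x))^2) \<le> ennreal (2 / h^2 * A + 2 / h ^ 4 * (norm m)^2)" by (rule ennreal_leI)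
  also have "\<dots> = ennreal (2 / h^2) * ennreal A + ennreal (2 / h ^ 4 * (norm m)^2)"
    using A0 ennreal_mult[of "2 / h^2" A] by (simp add: ennreal_plus)
  also have "ennreal A = (\<integral>\<^sup>+z. ennreal ((?I z * norm (\<phi> x - \<phi> z))^2) \<partial>lborel)"
    unfolding A_def by (rule nn_integral_eq_integral[OF i2, symmetric]) simp
  also have "\<dots> = (\<integral>\<^sup>+z. ennreal (?I z * (norm (\<phi> x - \<phi> z))^2) \<partial>lborel)"
    by (simp add: power_mult_distrib Isq)
  finally show ?thesis by (simp add: m_def)
qed

text \<open>Two points of a cell differ by a vector of the square \<open>C\<close>, so the deviation from the cell
  averages is an average of translation differences.\<close>

lemma grid_bound:
  fixes \<phi> :: "real^2 => 'b::euclidean_space"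
  assumes G: "open G" "bounded G" and h: "0 < h" and \<phi>: "\<phi> \<in> test_functions G"
    and \<eta>: "\<And>x. x \<in> G ==> norm (cell_integral h \<phi> (cell h x)) \<le> \<eta>" "0 \<le> \<eta>"
  shows "(L2_norm G \<phi>)^2 \<le> 16 * h^2 * (\<Sum>e\<in>Basis. (L2_norm G (partial e \<phi>))^2) + 2 / h ^ 4 * \<eta>^2 * measure lborel G"
proof -
  define S where "S = (\<Sum>e\<in>Basis. (L2_norm G (partial e \<phi>))^2)"
  have S0: "0 \<le> S" unfolding S_def by (intro sum_nonneg) simp
  define C where "C = cbox (- (h *\<^sub>R (ax1 + ax2))) (h *\<^sub>R (ax1 + ax2))"
  have C_iff: "y \<in> C \<longleftrightarrow> \<bar>y \<bullet> ax1\<bar> \<le> h \<and> \<bar>y \<bullet> ax2\<bar> \<le> h" for y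
    unfolding C_def by (auto simp: mem_box Basis_real2 inner_add_left inner_axis_axis)
  have eC: "emeasure lborel C = ennreal (4 * h^2)"
  proof -
    have v: "(h *\<^sub>R (ax1 + ax2)) \<bullet> ax1 = h" "(h *\<^sub>R (ax1 + ax2)) \<bullet> ax2 = h"
      by (simp_all add: inner_add_left inner_axis_axis)
    have "(\<Prod>b\<in>Basis. (h *\<^sub>R (ax1 + ax2) - - (h *\<^sub>R (ax1 + ax2))) \<bullet> b) = 4 * h^2"
      unfolding prod_Basis_real2 inner_diff_left inner_minus_left v by (simp add: power2_eq_square)
    moreover have "(- (h *\<^sub>R (ax1 + ax2))) \<bullet> b \<le> (h *\<^sub>R (ax1 + ax2)) \<bullet> b" if "b \<in> Basis" for b
      using that h v unfolding Basis_real2 inner_minus_left by auto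
    ultimately show ?thesis unfolding C_def by (subst emeasure_lborel_cbox) auto
  qed
  define J where "J x = (\<integral>\<^sup>+z. ennreal (indicator (block h (cell h x)) z * (norm (\<phi> x - \<phi> z))^2) \<partial>lborel)" for x
  let ?F = "\<lambda>x y. ennreal (indicator C y * (norm (\<phi> (x + y) - \<phi> x))^2)"
  have Jle: "J x \<le> (\<integral>\<^sup>+y. ?F x y \<partial>lborel)" for x
  proof -
    have m: "(\<lambda>z. ennreal (indicator (block h (cell h x)) z * (norm (\<phi> x - \<phi> z))^2)) \<in> borel_measurable borel"
      by (rule measurable_compose[OF _ measurable_ennreal],
          rule borel_measurable_times[OF borel_measurable_indicator[OF block_borel[OF h]]],
          intro borel_measurable_continuous_onI continuous_intros test_cont[OF \<phi>])
    have "J x = (\<integral>\<^sup>+y. ennreal (indicator (block h (cell h x)) (x + y) * (norm (\<phi> x - \<phi> (x + y)))^2) \<partial>lborel)"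
      unfolding J_def by (rule nn_integral_shift[OF m, symmetric])
    also have "\<dots> \<le> (\<integral>\<^sup>+y. ?F x y \<partial>lborel)"
    proof (intro nn_integral_mono ennreal_leI)
      fix y
      have "y \<in> C" if "cell h (x + y) = cell h x"
      proof -
        have "\<bar>y \<bullet> e\<bar> \<le> h" if "\<lfloor>((x + y) \<bullet> e) / h\<rfloor> = \<lfloor>(x \<bullet> e) / h\<rfloor>" for e
        proof -
          have "\<bar>((x + y) \<bullet> e) / h - (x \<bullet> e) / h\<bar> < 1" using that by linarith
          then have "\<bar>(y \<bullet> e) / h\<bar> < 1" by (simp add: inner_add_left add_divide_distrib)
          then show ?thesis using h by (simp add: abs_divide divide_less_eq)
        qed
        then show ?thesis using that unfolding C_iff by (simp add: cell_def)
      qed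
      then show "indicator (block h (cell h x)) (x + y) * (norm (\<phi> x - \<phi> (x + y)))^2 \<le> indicator C y * (norm (\<phi> (x + y) - \<phi> x))^2"
        by (auto simp: indicator_def block_def norm_minus_commute)
    qed
    finally show ?thesis .
  qed
  have Fm: "(\<lambda>(x, y). ?F x y) \<in> borel_measurable (lborel \<Otimes>\<^sub>M lborel)"
  proof -
    have 1: "(\<lambda>p::(real^2) \<times> (real^2). (norm (\<phi> (fst p + snd p) - \<phi> (fst p)))^2) \<in> borel_measurable borel"
      by (intro borel_measurable_continuous_onI continuous_intros continuous_on_compose2[OF test_cont[OF \<phi>]]) auto
    have 2: "(\<lambda>p::(real^2) \<times> (real^2). indicator C (snd p) :: real) \<in> borel_measurable borel"
      by (rule measurable_compose[of snd borel borel "indicator C"])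
        (auto simp: C_def intro!: borel_measurable_continuous_onI continuous_intros)
    have "(\<lambda>p::(real^2) \<times> (real^2). ennreal (indicator C (snd p) * (norm (\<phi> (fst p + snd p) - \<phi> (fst p)))^2)) \<in> borel_measurable borel"
      by (rule measurable_compose[OF borel_measurable_times[OF 2 1] measurable_ennreal])
    then show ?thesis unfolding lborel_prod by (simp add: case_prod_beta')
  qed
  have "(\<integral>\<^sup>+x. \<integral>\<^sup>+y. ?F x y \<partial>lborel \<partial>lborel) = (\<integral>\<^sup>+y. \<integral>\<^sup>+x. ?F x y \<partial>lborel \<partial>lborel)"
    using lborel_pair.Fubini'[OF Fm] by simp
  \<comment> \<open>Vectors in C satisfy |y|^2 \<le> 2 h^2, and C has area 4 h^2. The product 8 h^4
    S, multiplied by 2 / h^2, becomes the term 16 h^2 S of the claim.\<close>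
  also have "\<dots> \<le> (\<integral>\<^sup>+y. ennreal (2 * h^2 * S) * indicator C y \<partial>lborel)"
  proof (rule nn_integral_mono)
    fix y
    show "(\<integral>\<^sup>+x. ?F x y \<partial>lborel) \<le> ennreal (2 * h^2 * S) * indicator C y"
    proof (cases "y \<in> C")
      case True
      have "(norm y)^2 = (y \<bullet> ax1)^2 + (y \<bullet> ax2)^2"
        unfolding power2_norm_eq_inner by (subst euclidean_inner) (simp add: sum_Basis_real2 power2_eq_square)
      moreover have "(y \<bullet> ax1)^2 \<le> h^2" "(y \<bullet> ax2)^2 \<le> h^2"
        using True h unfolding C_iff by (auto simp: abs_le_square_iff[symmetric])
      ultimately have "(norm y)^2 \<le> 2 * h^2" by linarith
      then have "(norm y)^2 * S \<le> 2 * h^2 * S" using S0 by (rule mult_right_mono)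
      then have "ennreal ((norm y)^2 * S) \<le> ennreal (2 * h^2 * S)" by (rule ennreal_leI)
      with translation_test[OF G(1) \<phi>, of y] have "(\<integral>\<^sup>+x. ennreal ((norm (\<phi> (x + y) - \<phi> x))^2) \<partial>lborel) \<le> ennreal (2 * h^2 * S)"
        unfolding S_def by (rule order_trans)
      then show ?thesis using True by simp
    qed simp
  qed
  also have "\<dots> = ennreal (2 * h^2 * S) * ennreal (4 * h^2)"
    by (subst nn_integral_cmult) (auto simp: eC[symmetric] C_def)
  also have "\<dots> = ennreal (8 * h ^ 4 * S)"
    using S0 by (simp add: ennreal_mult[symmetric] power2_eq_square power4_eq_xxxx mult_ac)
  finally have FF: "(\<integral>\<^sup>+x. \<integral>\<^sup>+y. ?F x y \<partial>lborel \<partial>lborel) \<le> ennreal (8 * h ^ 4 * S)" .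
  have mF: "(\<lambda>x. \<integral>\<^sup>+y. ?F x y \<partial>lborel) \<in> borel_measurable lborel"
    using lborel.borel_measurable_nn_integral_fst[OF Fm] by simp
  have Gm: "G \<in> sets lborel" using G(1) by simp
  have fG: "emeasure lborel G < \<infinity>" using emeasure_bounded_finite[OF G(2)] by simp
  have "ennreal ((L2_norm G \<phi>)^2) = (\<integral>\<^sup>+x. ennreal ((norm (\<phi> x))^2) \<partial>lborel)"
    by (rule nn_integral_norm_sq_test[OF G(1) \<phi>, symmetric])
  also have "\<dots> \<le> (\<integral>\<^sup>+x. ennreal (2 / h^2) * (\<integral>\<^sup>+y. ?F x y \<partial>lborel) + ennreal (2 / h ^ 4 * \<eta>^2) * indicator G x \<partial>lborel)"
  proof (rule nn_integral_mono)
    fix x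
    show "ennreal ((norm (\<phi> x))^2) \<le> ennreal (2 / h^2) * (\<integral>\<^sup>+y. ?F x y \<partial>lborel) + ennreal (2 / h ^ 4 * \<eta>^2) * indicator G x"
    proof (cases "x \<in> G")
      case True
      have "(norm (cell_integral h \<phi> (cell h x)))^2 \<le> \<eta>^2" using \<eta>(1)[OF True] by (rule power_mono) simp
      then have "2 / h ^ 4 * (norm (cell_integral h \<phi> (cell h x)))^2 \<le> 2 / h ^ 4 * \<eta>^2"
        using h by (intro mult_left_mono) auto
      then have "ennreal (2 / h ^ 4 * (norm (cell_integral h \<phi> (cell h x)))^2) \<le> ennreal (2 / h ^ 4 * \<eta>^2)" by (rule ennreal_leI)
      moreover have "ennreal (2 / h^2) * J x \<le> ennreal (2 / h^2) * (\<integral>\<^sup>+y. ?F x y \<partial>lborel)"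
        by (rule mult_left_mono[OF Jle]) simp
      ultimately have "ennreal (2 / h^2) * J x + ennreal (2 / h ^ 4 * (norm (cell_integral h \<phi> (cell h x)))^2)
        \<le> ennreal (2 / h^2) * (\<integral>\<^sup>+y. ?F x y \<partial>lborel) + ennreal (2 / h ^ 4 * \<eta>^2)" by (intro add_mono)
      then show ?thesis using cell_average_bound[OF h \<phi>, of x] True unfolding J_def by (simp add: order_trans)
    next
      case False
      then show ?thesis using test_outside[OF \<phi>] by simp
    qed
  qed
  also have "\<dots> = ennreal (2 / h^2) * (\<integral>\<^sup>+x. \<integral>\<^sup>+y. ?F x y \<partial>lborel \<partial>lborel) + ennreal (2 / h ^ 4 * \<eta>^2) * emeasure lborel G"
    using mF Gm by (subst nn_integral_add) (auto simp: nn_integral_cmult)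
  also have "\<dots> \<le> ennreal (2 / h^2) * ennreal (8 * h ^ 4 * S) + ennreal (2 / h ^ 4 * \<eta>^2) * ennreal (measure lborel G)"
    using FF fG by (intro add_mono mult_left_mono) (auto simp: emeasure_eq_ennreal_measure)
  also have "\<dots> = ennreal (16 * h^2 * S + 2 / h ^ 4 * \<eta>^2 * measure lborel G)"
  proof -
    have e: "2 / h^2 * (8 * h ^ 4 * S) = 16 * h^2 * S" using h by (simp add: power2_eq_square power4_eq_xxxx)
    have "ennreal (2 / h^2) * ennreal (8 * h ^ 4 * S) = ennreal (16 * h^2 * S)"
      unfolding e[symmetric] using h S0 by (intro ennreal_mult[symmetric]) auto
    moreover have "ennreal (2 / h ^ 4 * \<eta>^2) * ennreal (measure lborel G) = ennreal (2 / h ^ 4 * \<eta>^2 * measure lborel G)"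
      using h by (intro ennreal_mult[symmetric]) auto
    ultimately show ?thesis using S0 by (simp add: ennreal_plus)
  qed
  finally show ?thesis using S0 unfolding S_def[symmetric] by (subst (asm) ennreal_le_iff) auto
qed

lemma test_norm_triangle:
  fixes \<phi> \<psi> :: "'a::euclidean_space => 'b::euclidean_space"
  assumes G: "open G" and p: "\<phi> \<in> test_functions G" and q: "\<psi> \<in> test_functions G"
  shows "L2_norm G (\<lambda>x. \<phi> x - \<psi> x) \<le> L2_norm G \<phi> + L2_norm G \<psi>"
  using sq.nrm_triangle_diff[of \<phi> "lebesgue_on G" \<psi>] test_L2[OF G p] test_L2[OF G q]
  by (simp add: L2_norm_eq L2_eq fun_diff_def)

text \<open>Along a diagonal subsequence all cell integrals converge, for all mesh sizes 1 / (j +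
  1). \<open>grid_bound\<close> then applies to differences: the mesh is fixed to make the gradient
  term small, and only finitely many cells of that mesh meet the bounded set G.\<close>

lemma rellich_test:
  fixes x :: "nat => real^2 => 'b::euclidean_space"
  assumes G: "open G" "bounded G" and x: "\<And>n. x n \<in> test_functions G"
    and K: "\<And>n. L2_norm G (x n) \<le> K" "\<And>n e. e \<in> Basis ==> L2_norm G (partial e (x n)) \<le> K"
  shows "\<exists>r. strict_mono (r :: nat => nat) \<and> (\<forall>\<epsilon>>0. \<exists>N. \<forall>m\<ge>N. \<forall>n\<ge>N. L2_norm G (\<lambda>y. x (r m) y - x (r n) y) < \<epsilon>)"
proof -
  have K0: "0 \<le> K" using K(1)[of 0] L2_norm_nonneg[of G "x 0"] by linarith
  define hh where "hh j = 1 / real (Suc j)" for j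
  have hh: "0 < hh j" for j by (simp add: hh_def)
  define \<mu> where "\<mu> = measure lborel G"
  have \<mu>0: "0 \<le> \<mu>" by (simp add: \<mu>_def)
  have Gm: "G \<in> sets lborel" using G(1) by simp
  have fG: "emeasure lborel G < \<infinity>" using emeasure_bounded_finite[OF G(2)] by simp
  have bd: "norm (cell_integral (hh (fst p)) (x n) (snd p)) \<le> sqrt \<mu> * K" for n and p :: "nat \<times> int \<times> int"
  proof -
    let ?I = "indicator G :: real^2 => real"
    have Isq: "(?I z)^2 = ?I z" for z by (simp add: indicator_def)
    have iI: "integrable lborel ?I" using Gm fG by (intro integrable_real_indicator)
    have nm: "(\<lambda>z. norm (x n z)) \<in> borel_measurable lborel"
      using borel_measurable_continuous_onI[OF continuous_on_norm[OF test_cont[OF x]]] by simp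
    have n2: "integrable lborel (\<lambda>z. (norm (x n z))^2)"
      using test_integrable[OF test_inner[OF x x]] by (simp add: power2_norm_eq_inner)
    have i: "integrable lborel (\<lambda>z. indicator (block (hh (fst p)) (snd p)) z *\<^sub>R x n z)"
      using block_borel[OF hh] by (intro integrable_mult_indicator test_integrable[OF x]) (simp del: split_paired_All)
    have "norm (cell_integral (hh (fst p)) (x n) (snd p)) \<le> (\<integral>z. norm (indicator (block (hh (fst p)) (snd p)) z *\<^sub>R x n z) \<partial>lborel)"
      unfolding cell_integral_def by (rule integral_norm_bound)
    also have "\<dots> \<le> (\<integral>z. ?I z * norm (x n z) \<partial>lborel)"
    proof (rule integral_mono)
      show "integrable lborel (\<lambda>z. norm (indicator (block (hh (fst p)) (snd p)) z *\<^sub>R x n z))" by (rule integrable_norm[OF i])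
      show "integrable lborel (\<lambda>z. ?I z * norm (x n z))"
        using integrable_mult_indicator[OF Gm integrable_norm[OF test_integrable[OF x]]] by simp
      show "norm (indicator (block (hh (fst p)) (snd p)) z *\<^sub>R x n z) \<le> ?I z * norm (x n z)" for z
        using test_outside[OF x, of z n] by (cases "z \<in> G") (auto simp: indicator_def)
    qed
    also have "\<dots> \<le> sqrt (\<integral>z. (?I z)^2 \<partial>lborel) * sqrt (\<integral>z. (norm (x n z))^2 \<partial>lborel)"
      using Gm by (intro integral_CS(2) nm n2) (use iI in \<open>auto simp: Isq\<close>)
    also have "(\<integral>z. (norm (x n z))^2 \<partial>lborel) = (L2_norm G (x n))^2"
      using test_integral_lebesgue_on[OF G(1) test_cont[OF test_inner[OF x x]]] test_outside[OF x]
      by (simp add: L2_norm_def power2_norm_eq_inner)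
    also have "(\<integral>z. (?I z)^2 \<partial>lborel) = \<mu>" unfolding Isq \<mu>_def using Gm fG by simp
    also have "sqrt \<mu> * sqrt ((L2_norm G (x n))^2) \<le> sqrt \<mu> * K"
      using K(1)[of n] L2_norm_nonneg[of G "x n"] by (intro mult_left_mono) (auto simp: \<mu>0)
    finally show ?thesis .
  qed
  obtain r :: "nat => nat" where r: "strict_mono r"
    and conv: "\<And>p. p \<in> UNIV ==> \<exists>l. (\<lambda>n. cell_integral (hh (fst p)) (x (r n)) (snd p)) \<longlonglongrightarrow> l"
    by (rule function_convergent_subsequence[of "UNIV :: (nat \<times> int \<times> int) set" "\<lambda>n p. cell_integral (hh (fst p)) (x n) (snd p)" "sqrt \<mu> * K"])
      (use bd in auto)
  have "\<exists>N. \<forall>m\<ge>N. \<forall>n\<ge>N. L2_norm G (\<lambda>y. x (r m) y - x (r n) y) < \<epsilon>" if \<epsilon>: "0 < \<epsilon>" for \<epsilon>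
  proof -
    \<comment> \<open>8 K^2 bounds the sum, over the two directions, of the squared norms of the
      derivatives of a difference, each at most (2 K)^2.\<close>
    have "(\<lambda>j. 16 * (hh j)^2 * (8 * K^2)) \<longlonglongrightarrow> 16 * 0^2 * (8 * K^2)"
      unfolding hh_def using LIMSEQ_inverse_real_of_nat by (intro tendsto_intros) (simp add: inverse_eq_divide)
    then have "\<forall>\<^sub>F j in sequentially. 16 * (hh j)^2 * (8 * K^2) < \<epsilon>^2 / 2"
      by (rule order_tendstoD(2)) (use \<epsilon> in simp)
    then obtain j where j: "16 * (hh j)^2 * (8 * K^2) < \<epsilon>^2 / 2" by (auto simp: eventually_sequentially)
    define h where "h = hh j"
    have h: "0 < h" by (simp add: h_def hh)
    \<comment> \<open>Makes the second term of \<open>grid_bound\<close> at most \<epsilon>^2 / 2;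
      the added 1 covers \<mu> = 0.\<close>
    define \<eta> where "\<eta> = sqrt (\<epsilon>^2 * h ^ 4 / (4 * (\<mu> + 1)))"
    have \<eta>: "0 < \<eta>" using \<epsilon> h \<mu>0 by (simp add: \<eta>_def)
    have \<eta>sq: "\<eta>^2 = \<epsilon>^2 * h ^ 4 / (4 * (\<mu> + 1))" using h \<mu>0 by (simp add: \<eta>_def)
    have "\<forall>\<^sub>F n in sequentially. \<forall>k\<in>cell h ` G. norm (cell_integral h (x (r n)) k - lim (\<lambda>n. cell_integral h (x (r n)) k)) < \<eta> / 2"
    proof (intro eventually_ball_finite finite_cells G h ballI)
      fix k assume "k \<in> cell h ` G"
      obtain l where l: "(\<lambda>n. cell_integral h (x (r n)) k) \<longlonglongrightarrow> l" using conv[of "(j, k)"] by (auto simp: h_def)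
      then have "(\<lambda>n. cell_integral h (x (r n)) k) \<longlonglongrightarrow> lim (\<lambda>n. cell_integral h (x (r n)) k)"
        using convergentI convergent_LIMSEQ_iff by blast
      from tendstoD[OF this, of "\<eta> / 2"] \<eta>
      show "\<forall>\<^sub>F n in sequentially. norm (cell_integral h (x (r n)) k - lim (\<lambda>n. cell_integral h (x (r n)) k)) < \<eta> / 2"
        by (simp add: dist_norm)
    qed
    then obtain N where N: "\<And>n k. n \<ge> N ==> k \<in> cell h ` G ==>
        norm (cell_integral h (x (r n)) k - lim (\<lambda>n. cell_integral h (x (r n)) k)) < \<eta> / 2"
      unfolding eventually_sequentially by blast
    have "L2_norm G (\<lambda>y. x (r m) y - x (r n) y) < \<epsilon>" if mn: "m \<ge> N" "n \<ge> N" for m n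
    proof -
      let ?d = "\<lambda>y. x (r m) y - x (r n) y"
      have dt: "?d \<in> test_functions G"
        using subspace_diff[OF subspace_test x x] by (simp add: fun_diff_def)
      have ci: "norm (cell_integral h ?d (cell h y)) \<le> \<eta>" if "y \<in> G" for y
      proof -
        have "cell_integral h ?d (cell h y) = cell_integral h (x (r m)) (cell h y) - cell_integral h (x (r n)) (cell h y)"
          by (rule cell_integral_diff[OF h test_integrable[OF x] test_integrable[OF x]])
        then show ?thesis
          using N[OF mn(1), of "cell h y"] N[OF mn(2), of "cell h y"] that
            norm_triangle_ineq4[of "cell_integral h (x (r m)) (cell h y) - lim (\<lambda>n. cell_integral h (x (r n)) (cell h y))"
              "cell_integral h (x (r n)) (cell h y) - lim (\<lambda>n. cell_integral h (x (r n)) (cell h y))"] by auto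
      qed
      have Se: "(L2_norm G (partial e ?d))^2 \<le> 4 * K^2" if e: "e \<in> Basis" for e
      proof -
        have "partial e ?d = (\<lambda>y. partial e (x (r m)) y - partial e (x (r n)) y)"
          using partial_diff[OF test_diff[OF x] test_diff[OF x]] by auto
        then have "L2_norm G (partial e ?d) \<le> L2_norm G (partial e (x (r m))) + L2_norm G (partial e (x (r n)))"
          using test_norm_triangle[OF G(1) test_partial[OF x e] test_partial[OF x e]] by simp
        also have "\<dots> \<le> 2 * K" using K(2)[OF e, of "r m"] K(2)[OF e, of "r n"] by simp
        finally have "(L2_norm G (partial e ?d))^2 \<le> (2 * K)^2" using L2_norm_nonneg by (rule power_mono)
        then show ?thesis by (simp add: power_mult_distrib)
      qed
      have S: "(\<Sum>e\<in>Basis. (L2_norm G (partial e ?d))^2) \<le> 8 * K^2"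
        using Se[of ax1] Se[of ax2] by (simp add: sum_Basis_real2)
      have "(L2_norm G ?d)^2 \<le> 16 * h^2 * (\<Sum>e\<in>Basis. (L2_norm G (partial e ?d))^2) + 2 / h ^ 4 * \<eta>^2 * \<mu>"
        unfolding \<mu>_def by (rule grid_bound[OF G h dt ci less_imp_le[OF \<eta>]])
      also have "16 * h^2 * (\<Sum>e\<in>Basis. (L2_norm G (partial e ?d))^2) \<le> 16 * h^2 * (8 * K^2)"
        by (intro mult_left_mono S) simp
      also have "16 * h^2 * (8 * K^2) < \<epsilon>^2 / 2" using j by (simp add: h_def)
      also have "2 / h ^ 4 * \<eta>^2 * \<mu> = \<epsilon>^2 / 2 * (\<mu> / (\<mu> + 1))"
        unfolding \<eta>sq using h \<mu>0 by (simp add: field_simps)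
      also have "\<dots> \<le> \<epsilon>^2 / 2 * 1" using \<mu>0 by (intro mult_left_mono) auto
      finally have "(L2_norm G ?d)^2 < \<epsilon>^2" by simp
      then show ?thesis by (rule power2_less_imp_less) (use \<epsilon> in simp)
    qed
    then show ?thesis by blast
  qed
  then show ?thesis using r by blast
qed

section \<open>Solenoidal fields in the plane\<close>

lemma closure_in_eq: "closure_in X N S = {u \<in> X. \<forall>\<epsilon>>0. \<exists>\<phi>\<in>S. N (u - \<phi>) < \<epsilon>}"
  unfolding closure_in_def fun_diff_def ..

lemma test_norm_partial:
  fixes \<phi> :: "'a::euclidean_space => 'b::euclidean_space"
  assumes G: "open G" and \<phi>: "\<phi> \<in> test_functions G" and e: "e \<in> Basis"
  shows "L2_norm G (weak_partial G e \<phi>) = L2_norm G (partial e \<phi>)"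
  by (rule L2_nrm_AE_cong[OF test_W12(2)[OF G \<phi> e] W12_partial(2)[OF G test_W12(1)[OF G \<phi>] e] test_L2[OF G test_partial[OF \<phi> e]]])

lemma tendsto_L2_norm:
  fixes u :: "'a::euclidean_space => 'b::euclidean_space"
  assumes "\<And>n. x n \<in> L2 G" "u \<in> L2 G" "\<And>n. L2_norm G (u - x n) \<le> d n" "d \<longlonglongrightarrow> 0"
  shows "(\<lambda>n. L2_norm G (x n)) \<longlonglongrightarrow> L2_norm G u"
proof -
  have "(\<lambda>n. sq.nrm (lebesgue_on G) (x n - u)) \<longlonglongrightarrow> 0"
  proof (rule null_squeeze[OF _ _ assms(4)])
    fix n
    have s: "x n \<in> square_integrable (lebesgue_on G)" "u \<in> square_integrable (lebesgue_on G)"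
      using assms by (simp_all add: L2_eq)
    show "0 \<le> sq.nrm (lebesgue_on G) (x n - u)" using L2_norm_nonneg[of G "x n - u"] by (simp add: L2_norm_eq)
    show "sq.nrm (lebesgue_on G) (x n - u) \<le> d n"
      using assms(3)[of n] sq.nrm_diff_sym[OF s] by (simp add: L2_norm_eq)
  qed
  from sq.tendsto_nrm[OF _ _ this] assms show ?thesis by (simp add: L2_norm_eq L2_eq)
qed

lemma W12_tendsto:
  fixes u :: "'a::euclidean_space => 'b::euclidean_space"
  assumes G: "open G" and x: "\<And>n. x n \<in> W12 G" and u: "u \<in> W12 G" and l: "(\<lambda>n. W12_norm G (u - x n)) \<longlonglongrightarrow> 0"
  shows "(\<lambda>n. L2_norm G (x n)) \<longlonglongrightarrow> L2_norm G u"
    "e \<in> Basis ==> (\<lambda>n. L2_norm G (weak_partial G e (x n))) \<longlonglongrightarrow> L2_norm G (weak_partial G e u)"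
proof -
  show "(\<lambda>n. L2_norm G (x n)) \<longlonglongrightarrow> L2_norm G u"
    by (rule tendsto_L2_norm[OF W12_L2[OF x] W12_L2[OF u] L2_le_W12 l])
  show "(\<lambda>n. L2_norm G (weak_partial G e (x n))) \<longlonglongrightarrow> L2_norm G (weak_partial G e u)" if e: "e \<in> Basis"
    by (rule tendsto_L2_norm[OF W12_partial(2)[OF G x e] W12_partial(2)[OF G u e] _ l])
      (simp add: W12_diff(3)[OF G u x e, symmetric] partial_le_W12[OF e])
qed

lemma geometric_null: "0 < (1/4::real) ^ n" "(\<lambda>n. (1/4::real) ^ n) \<longlonglongrightarrow> 0"
  by (simp_all add: LIMSEQ_realpow_zero)

text \<open>\<rho> is the radius of a ball about 0 containing G; it becomes the Poincare constant 2
  \<rho>.\<close>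

locale solenoidal =
  fixes a1 a2 \<rho> :: real and G :: "(real^2) set"
  assumes G: "open G" and \<rho>: "0 \<le> \<rho>" "\<And>x. x \<in> G ==> norm x \<le> \<rho>"
begin

abbreviation V :: "vfield set" where "V \<equiv> V_space a1 a2 G"
abbreviation H :: "vfield set" where "H \<equiv> H_space a1 a2 G"
abbreviation D0 :: "vfield set" where "D0 \<equiv> div_free_tests a1 a2 G"
abbreviation nW :: "vfield => real" where "nW \<equiv> W12_norm G"
abbreviation nL :: "vfield => real" where "nL \<equiv> L2_norm G"
abbreviation D :: "real^2 => vfield => vfield" where "D \<equiv> weak_partial G"

lemma bounded_G: "bounded G" using \<rho>(2) by (auto simp: bounded_iff)

lemma D0_test: "\<phi> \<in> D0 ==> \<phi> \<in> test_functions G" by (simp add: div_free_tests_def)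

lemma subspace_D0: "subspace D0"
  unfolding subspace_def
proof (intro conjI ballI allI)
  show "0 \<in> D0" using subspace_0[OF subspace_test] by (simp add: div_free_tests_def div_L_def zero_fun_def)
  fix u v c assume u: "u \<in> D0"
  have "div_L a1 a2 (c *\<^sub>R u) x = c * div_L a1 a2 u x" for x
    using partial_linear[OF bounded_linear_scaleR_right test_diff[OF D0_test[OF u]]]
    by (simp add: div_L_def scaleR_fun_def algebra_simps)
  then show "c *\<^sub>R u \<in> D0" using u subspace_scale[OF subspace_test D0_test[OF u]] by (simp add: div_free_tests_def)
  assume v: "v \<in> D0"
  have "div_L a1 a2 (u + v) x = div_L a1 a2 u x + div_L a1 a2 v x" for x
    using partial_add[OF test_diff[OF D0_test[OF u]] test_diff[OF D0_test[OF v]]]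
    by (simp add: div_L_def plus_fun_def algebra_simps)
  then show "u + v \<in> D0" using u v subspace_add[OF subspace_test D0_test[OF u] D0_test[OF v]]
    by (simp add: div_free_tests_def)
qed

lemma D0_W12: "D0 \<subseteq> W12 G" using test_W12(1)[OF G] D0_test by blast

lemma D0_L2: "D0 \<subseteq> L2 G" using test_L2[OF G] D0_test by blast

lemma V_W12: "v \<in> V ==> v \<in> W12 G" by (simp add: V_space_def W12_0_def closure_in_eq)

lemma V_L2: "v \<in> V ==> v \<in> L2 G" by (rule W12_L2[OF V_W12])

lemma V_D: "v \<in> V ==> e \<in> Basis ==> D e v \<in> L2 G" by (rule W12_partial(2)[OF G V_W12])

text \<open>Solenoidal test functions are test functions, so the closure taken in
  \<open>W12_0\<close> agrees with the closure taken in the complete space \<open>W12\<close>, and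
  completeness of V follows.\<close>

lemma V_eq: "V = {u \<in> W12 G. \<forall>\<epsilon>>0. \<exists>\<phi>\<in>D0. nW (u - \<phi>) < \<epsilon>}"
proof (intro set_eqI iffI)
  fix u assume "u \<in> {u \<in> W12 G. \<forall>\<epsilon>>0. \<exists>\<phi>\<in>D0. nW (u - \<phi>) < \<epsilon>}"
  then have u: "u \<in> W12 G" and d: "\<And>\<epsilon>. 0 < \<epsilon> ==> \<exists>\<phi>\<in>D0. nW (u - \<phi>) < \<epsilon>" by simp_all
  have "\<exists>\<phi>\<in>test_functions G. nW (u - \<phi>) < \<epsilon>" if "0 < \<epsilon>" for \<epsilon>
    using d[OF that] D0_test by (elim bexE) (rule bexI, assumption)
  then have "u \<in> W12_0 G" using u by (simp add: W12_0_def closure_in_eq)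
  then show "u \<in> V" using d by (simp add: V_space_def closure_in_eq)
qed (simp add: V_space_def W12_0_def closure_in_eq)

lemma V_eq_cl: "V = semi_ip.cl (W12 G) (ipW G) D0"
  unfolding semi_ip.cl_def[OF semi_ip_W12[OF G]] V_eq W12_norm_eq[OF G, symmetric] ..

lemma H_eq_cl: "H = sq.cl (lebesgue_on G) D0"
  unfolding sq.cl_def H_space_def closure_in_eq L2_norm_eq L2_eq ..

lemma semi_hilbert_V: "semi_hilbert V (ipW G)"
  unfolding V_eq_cl by (rule semi_hilbert.semi_hilbert_cl[OF semi_hilbert_W12[OF G] subspace_D0 D0_W12])

lemma subspace_H: "subspace H"
  unfolding H_eq_cl by (rule sq.subspace_cl[OF subspace_D0 D0_L2[unfolded L2_eq]])

lemma H_L2: "v \<in> H ==> v \<in> L2 G" by (simp add: H_space_def closure_in_eq)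

lemma semi_ip_H: "semi_ip H (L2_pairing G)"
  unfolding L2_pairing_eq by (rule sq.semi_ip_subset[OF subspace_H]) (use H_L2 in \<open>auto simp: L2_eq\<close>)

lemma subspace_V: "subspace V"
  using semi_hilbert_V by (simp add: semi_hilbert_def semi_ip_def)

lemma D0_V: "D0 \<subseteq> V"
  unfolding V_eq_cl semi_ip.cl_def[OF semi_ip_W12[OF G]]
proof (intro subsetI CollectI conjI allI impI)
  interpret W: semi_ip "W12 G :: vfield set" "ipW G" by (rule semi_ip_W12[OF G])
  fix \<phi> and \<epsilon> :: real assume \<phi>: "\<phi> \<in> D0" and \<epsilon>: "0 < \<epsilon>"
  have "semi_ip.nrm (ipW G) (\<phi> - \<phi>) < \<epsilon>"
    using \<epsilon> W.nrm_zero by simp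
  then show "\<exists>\<psi>\<in>D0. semi_ip.nrm (ipW G) (\<phi> - \<psi>) < \<epsilon>" using \<phi> by blast
qed (use D0_W12 in blast)

lemma V_dense: "v \<in> V ==> 0 < \<epsilon> ==> \<exists>\<phi>\<in>D0. nW (v - \<phi>) < \<epsilon>"
  by (simp add: V_space_def closure_in_eq)

lemma H_dense: "v \<in> H ==> 0 < \<epsilon> ==> \<exists>\<phi>\<in>D0. nL (v - \<phi>) < \<epsilon>"
  by (simp add: H_space_def closure_in_eq)

lemma V_H: assumes "v \<in> V" shows "v \<in> H"
proof -
  have "\<exists>\<phi>\<in>D0. nL (v - \<phi>) < \<epsilon>" if "0 < \<epsilon>" for \<epsilon>
    using V_dense[OF assms that] L2_le_W12 le_less_trans by blast
  then show ?thesis using V_L2[OF assms] by (simp add: H_space_def closure_in_eq)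
qed

lemma nW_V: "semi_ip.nrm (ipW G) = nW" by (rule W12_norm_eq[OF G, symmetric])

lemma nL_H: "semi_ip.nrm (L2_pairing G) = nL" by (simp add: L2_pairing_eq L2_norm_eq)

text \<open>The rate 4^(-n) is what \<open>AE_geometric\<close> requires in order to give
  convergence almost everywhere.\<close>

lemma V_approx:
  assumes v: "v \<in> V"
  obtains x where "\<And>n. x n \<in> D0" "\<And>n. nW (v - x n) < (1/4) ^ n" "(\<lambda>n. nW (v - x n)) \<longlonglongrightarrow> 0"
proof -
  have "\<forall>n. \<exists>\<phi>\<in>D0. nW (v - \<phi>) < (1/4) ^ n" using V_dense[OF v geometric_null(1)] by blast
  then obtain x where x: "\<And>n. x n \<in> D0" "\<And>n. nW (v - x n) < (1/4) ^ n" by metis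
  have "(\<lambda>n. nW (v - x n)) \<longlonglongrightarrow> 0"
    by (rule null_squeeze[OF W12_norm_nonneg less_imp_le[OF x(2)] geometric_null(2)])
  then show ?thesis using that x by blast
qed

lemma poincare_V: assumes v: "v \<in> V" and e: "e \<in> Basis" shows "nL v \<le> 2 * \<rho> * nL (D e v)"
proof (rule V_approx[OF v])
  fix x assume x: "\<And>n. x n \<in> D0" and l: "(\<lambda>n. nW (v - x n)) \<longlonglongrightarrow> 0"
  have W: "x n \<in> W12 G" for n using x D0_W12 by blast
  note t = W12_tendsto[OF G W V_W12[OF v] l]
  show ?thesis
  proof (rule LIMSEQ_le[OF t(1) tendsto_mult[OF tendsto_const t(2)[OF e]]])
    show "\<exists>N. \<forall>n\<ge>N. nL (x n) \<le> 2 * \<rho> * nL (D e (x n))"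
      using poincare_test[OF G \<rho> D0_test[OF x] e] test_norm_partial[OF G D0_test[OF x] e] by simp
  qed
qed

lemma nW_sq: "(nW v)^2 = (nL v)^2 + ((nL (D ax1 v))^2 + (nL (D ax2 v))^2)"
  by (simp add: W12_norm_sq sum_Basis_real2)

lemma coercive_V: assumes v: "v \<in> V" shows "(nW v)^2 \<le> (1 + 4 * \<rho>^2) * ((nL (D ax1 v))^2 + (nL (D ax2 v))^2)"
proof -
  have "(nL v)^2 \<le> (2 * \<rho> * nL (D ax1 v))^2" using poincare_V[OF v, of ax1] L2_norm_nonneg by (intro power_mono) auto
  also have "\<dots> = 4 * \<rho>^2 * (nL (D ax1 v))^2" by (simp add: power_mult_distrib)
  also have "\<dots> \<le> 4 * \<rho>^2 * ((nL (D ax1 v))^2 + (nL (D ax2 v))^2)" by (intro mult_left_mono) auto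
  finally show ?thesis unfolding nW_sq by (simp add: algebra_simps)
qed

text \<open>Fourth powers are not controlled by L2-convergence, so the inequality passes from test
  functions to the limit by almost everywhere convergence and Fatou's lemma.\<close>

lemma ladyzhenskaya_V:
  assumes v: "v \<in> V"
  shows "integrable (lebesgue_on G) (\<lambda>x. ((norm (v x))^2)^2)"
    "(\<integral>x. ((norm (v x))^2)^2 \<partial>lebesgue_on G) \<le> 4 * (nL v * nW v)^2"
proof -
  obtain x where x: "\<And>n. x n \<in> D0" and r: "\<And>n. nW (v - x n) < (1/4) ^ n" and l: "(\<lambda>n. nW (v - x n)) \<longlonglongrightarrow> 0"
    by (rule V_approx[OF v]) blast
  have W: "x n \<in> W12 G" for n using x D0_W12 by blast
  note t = W12_tendsto[OF G W V_W12[OF v] l]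
  have vm [measurable]: "v \<in> borel_measurable (lebesgue_on G)" using V_L2[OF v] by (simp add: L2_def)
  have dL: "v - x n \<in> square_integrable (lebesgue_on G)" for n
    using V_L2[OF v] W12_L2[OF W] by (simp add: L2_eq)
  have "AE y in lebesgue_on G. \<exists>C. \<forall>n. \<bar>norm ((v - x n) y)\<bar> \<le> C * (1/2) ^ n"
  proof (rule AE_geometric)
    fix n
    have "v - x n \<in> borel_measurable (lebesgue_on G)" using dL[of n] by (simp add: square_integrable_def)
    then show "(\<lambda>y. norm ((v - x n) y)) \<in> borel_measurable (lebesgue_on G)"
      by (rule measurable_compose[OF _ borel_measurable_norm])
    show "integrable (lebesgue_on G) (\<lambda>y. (norm ((v - x n) y))^2)"
      using dL[of n] by (simp add: square_integrable_def)
    have "(nL (v - x n))^2 \<le> ((1/4) ^ n)^2"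
      using L2_le_W12[of G "v - x n"] r[of n] L2_norm_nonneg by (intro power_mono) auto
    also have "\<dots> = (1/16) ^ n" by (simp add: power2_eq_square power_mult_distrib[symmetric])
    finally show "(\<integral>y. (norm ((v - x n) y))^2 \<partial>lebesgue_on G) \<le> (1/16) ^ n"
      by (simp add: L2_norm_eq sq_nrm_sq)
  qed
  then have ae: "AE y in lebesgue_on G. (\<lambda>n. ((norm (x n y))^2)^2) \<longlonglongrightarrow> ((norm (v y))^2)^2"
  proof eventually_elim
    fix y assume "\<exists>C. \<forall>n. \<bar>norm ((v - x n) y)\<bar> \<le> C * (1/2) ^ n"
    then obtain C where C: "\<And>n. norm (x n y - v y) \<le> C * (1/2) ^ n" by (auto simp: norm_minus_commute)
    have "(\<lambda>n. C * (1/2) ^ n) \<longlonglongrightarrow> C * 0" by (intro tendsto_intros LIMSEQ_realpow_zero) auto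
    then have "(\<lambda>n. x n y - v y) \<longlonglongrightarrow> 0"
      by (intro Lim_null_comparison[OF always_eventually[OF allI[OF C]]]) simp
    then have "(\<lambda>n. x n y) \<longlonglongrightarrow> v y" by (simp add: LIM_zero_iff)
    then show "(\<lambda>n. ((norm (x n y))^2)^2) \<longlonglongrightarrow> ((norm (v y))^2)^2" by (intro tendsto_intros)
  qed
  let ?L = "\<lambda>v. 4 * (nL v)^2 * nL (D ax1 v) * nL (D ax2 v)"
  have lim: "(\<lambda>n. ?L (x n)) \<longlonglongrightarrow> ?L v" by (intro tendsto_intros t) auto
  have i: "integrable (lebesgue_on G) (\<lambda>y. ((norm (x n y))^2)^2)" for n
  proof (rule test_support[OF D0_test[OF x[of n]]])
    fix K assume K: "compact K" "\<And>y. y \<notin> K ==> x n y = 0"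
    have "integrable lborel (\<lambda>y. ((norm (x n y))^2)^2)"
      using K by (intro integrable_continuous_compact_support[of _ K] continuous_intros test_cont[OF D0_test[OF x]]) auto
    then show ?thesis using G by (intro integrable_on_lebesgue_on) auto
  qed
  have le: "(\<integral>y. ((norm (x n y))^2)^2 \<partial>lebesgue_on G) \<le> ?L (x n)" for n
    using ladyzhenskaya_test[OF G D0_test[OF x[of n]]] by (simp add: test_norm_partial[OF G D0_test[OF x]])
  have F: "integrable (lebesgue_on G) (\<lambda>x. ((norm (v x))^2)^2) \<and> (\<integral>x. ((norm (v x))^2)^2 \<partial>lebesgue_on G) \<le> ?L v + \<epsilon>"
    if \<epsilon>: "0 < \<epsilon>" for \<epsilon>
  proof -
    have "\<forall>\<^sub>F n in sequentially. ?L (x n) < ?L v + \<epsilon>" using order_tendstoD(2)[OF lim] \<epsilon> by simp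
    then obtain N where N: "\<And>n. n \<ge> N ==> ?L (x n) < ?L v + \<epsilon>" unfolding eventually_sequentially by blast
    have b: "(\<integral>y. ((norm (x n y))^2)^2 \<partial>lebesgue_on G) \<le> ?L v + \<epsilon>" if "n \<ge> N" for n
      using le[of n] N[OF that] by linarith
    show ?thesis using Fatou_real[OF i _ _ ae b] by auto
  qed
  show "integrable (lebesgue_on G) (\<lambda>x. ((norm (v x))^2)^2)" using F[of 1] by simp
  have "(\<integral>x. ((norm (v x))^2)^2 \<partial>lebesgue_on G) \<le> ?L v" by (rule field_le_epsilon) (use F in blast)
  also have "?L v \<le> 4 * (nL v)^2 * nW v * nW v"
    by (intro mult_mono partial_le_W12 mult_nonneg_nonneg) (auto simp: L2_norm_nonneg W12_norm_nonneg)
  finally show "(\<integral>x. ((norm (v x))^2)^2 \<partial>lebesgue_on G) \<le> 4 * (nL v * nW v)^2"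
    by (simp add: power2_eq_square mult_ac)
qed

text \<open>Each x n is replaced by a solenoidal test function at distance below 1 / (n + 1), so
  Rellich's theorem for test functions applies and the error disappears along the
  subsequence.\<close>

lemma compact_V:
  assumes x: "\<And>n::nat. x n \<in> V" and K: "\<And>n. nW (x n) \<le> K"
  shows "\<exists>r. strict_mono (r :: nat => nat) \<and> semi_ip.Cauchy_seq (L2_pairing G) (x \<circ> r)"
proof -
  interpret V: semi_hilbert V "ipW G" by (rule semi_hilbert_V)
  interpret H: semi_ip H "L2_pairing G" by (rule semi_ip_H)
  have "\<forall>n. \<exists>\<phi>\<in>D0. nW (x n - \<phi>) < 1 / real (Suc n)" using V_dense[OF x] by simp
  then obtain \<phi> where \<phi>: "\<And>n. \<phi> n \<in> D0" "\<And>n. nW (x n - \<phi> n) < 1 / real (Suc n)" by metis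
  have pV: "\<phi> n \<in> V" for n using \<phi>(1) D0_V by blast
  have pK: "nW (\<phi> n) \<le> K + 1" for n
  proof -
    have "nW (\<phi> n) \<le> nW (x n) + nW (x n - \<phi> n)"
      using V.nrm_triangle_diff[OF x[of n], of "x n - \<phi> n"] x pV by (simp add: nW_V)
    moreover have "1 / real (Suc n) \<le> 1" by simp
    ultimately show ?thesis using K[of n] \<phi>(2)[of n] by linarith
  qed
  have "nL (\<phi> n) \<le> K + 1" for n using L2_le_W12 pK order_trans by blast
  moreover have "nL (partial e (\<phi> n)) \<le> K + 1" if "e \<in> Basis" for n e
    using partial_le_W12[OF that, of G "\<phi> n"] pK[of n] test_norm_partial[OF G D0_test[OF \<phi>(1)] that, of n] by simp
  ultimately obtain r :: "nat => nat" where r: "strict_mono r"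
    and C: "\<And>\<epsilon>. 0 < \<epsilon> ==> \<exists>N. \<forall>m\<ge>N. \<forall>n\<ge>N. nL (\<phi> (r m) - \<phi> (r n)) < \<epsilon>"
    using rellich_test[of G \<phi> "K + 1", OF G bounded_G D0_test[OF \<phi>(1)]] unfolding fun_diff_def by blast
  have "H.Cauchy_seq (x \<circ> r)"
    unfolding H.Cauchy_seq_def nL_H comp_def
  proof (intro allI impI)
    fix \<epsilon> :: real assume "0 < \<epsilon>"
    then have e3: "0 < \<epsilon> / 3" by simp
    obtain N1 where N1: "\<And>m n. m \<ge> N1 ==> n \<ge> N1 ==> nL (\<phi> (r m) - \<phi> (r n)) < \<epsilon> / 3" using C[OF e3] by blast
    obtain N2 where N2: "1 / real (Suc N2) < \<epsilon> / 3" using nat_approx_posE[OF e3] by blast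
    have d: "nL (x (r n) - \<phi> (r n)) < \<epsilon> / 3" if "n \<ge> N2" for n
    proof -
      have "1 / real (Suc (r n)) \<le> 1 / real (Suc N2)"
        using seq_suble[OF r, of n] that by (intro divide_left_mono) auto
      then show ?thesis using L2_le_W12[of G "x (r n) - \<phi> (r n)"] \<phi>(2)[of "r n"] N2 by linarith
    qed
    have "nL (x (r m) - x (r n)) < \<epsilon>" if "m \<ge> max N1 N2" "n \<ge> max N1 N2" for m n
    proof -
      have H: "x k \<in> H" "\<phi> k \<in> H" for k using V_H[OF x] V_H[OF pV] by auto
      have "nL (x (r m) - x (r n)) \<le> nL (x (r m) - \<phi> (r m)) + nL (\<phi> (r m) - x (r n))"
        using H.nrm_triangle3[OF H(1)[of "r m"] H(2)[of "r m"] H(1)[of "r n"]] by (simp add: nL_H)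
      moreover have "nL (\<phi> (r m) - x (r n)) \<le> nL (\<phi> (r m) - \<phi> (r n)) + nL (\<phi> (r n) - x (r n))"
        using H.nrm_triangle3[OF H(2)[of "r m"] H(2)[of "r n"] H(1)[of "r n"]] by (simp add: nL_H)
      moreover have "nL (\<phi> (r n) - x (r n)) = nL (x (r n) - \<phi> (r n))"
        using H.nrm_diff_sym[OF H(2)[of "r n"] H(1)[of "r n"]] by (simp add: nL_H)
      ultimately show ?thesis using N1[of m n] d[of m] d[of n] that by simp
    qed
    then show "\<exists>N. \<forall>m\<ge>N. \<forall>n\<ge>N. nL (x (r m) - x (r n)) < \<epsilon>" by blast
  qed
  then show ?thesis using r by blast
qed

end

section \<open>The bilinear and trilinear forms of the equation\<close>

lemma L2_CS: "u \<in> L2 G ==> v \<in> L2 G ==> \<bar>L2_pairing G u v\<bar> \<le> L2_norm G u * L2_norm G v"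
  unfolding L2_eq L2_pairing_eq L2_norm_eq by (rule sq.CS)

lemma L2_pairing_sym: "L2_pairing G u v = L2_pairing G v u"
  by (simp add: L2_pairing_def inner_commute)

lemma L2_pairing_self: "L2_pairing G u u = (L2_norm G u)^2"
  by (simp add: L2_norm_def L2_pairing_def power2_norm_eq_inner)

lemma abs_sum_le:
  "\<bar>- (x + y + 1/4 * (p + (q + r) + s))\<bar> \<le> \<bar>x\<bar> + \<bar>y\<bar> + 1/4 * (\<bar>p\<bar> + (\<bar>q\<bar> + \<bar>r\<bar>) + \<bar>s :: real\<bar>)"
proof -
  have "\<bar>p + (q + r) + s\<bar> \<le> \<bar>p\<bar> + (\<bar>q\<bar> + \<bar>r\<bar>) + \<bar>s\<bar>" by linarith
  moreover have "\<bar>- (x + y + 1/4 * z)\<bar> \<le> \<bar>x\<bar> + \<bar>y\<bar> + 1/4 * \<bar>z\<bar>" for z by linarith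
  ultimately show ?thesis by (meson add_left_mono mult_left_mono order_trans zero_le_divide_1_iff zero_le_numeral)
qed

context solenoidal
begin

text \<open>The density principle for identities: multilinear ones are extended from
  \<open>D0\<close> to V by freezing all arguments but one.\<close>

lemma zero_on_V:
  assumes d: "\<And>x y. x \<in> V ==> y \<in> V ==> g (x - y) = g x - (g y :: real)"
    and b: "\<And>x. x \<in> V ==> \<bar>g x\<bar> \<le> K * nW x" and z: "\<And>\<phi>. \<phi> \<in> D0 ==> g \<phi> = 0" and v: "v \<in> V"
  shows "g v = 0"
proof (rule V_approx[OF v])
  fix x assume x: "\<And>n. x n \<in> D0" and l: "(\<lambda>n. nW (v - x n)) \<longlonglongrightarrow> 0"
  have xV: "x n \<in> V" for n using x D0_V by blast
  have "\<bar>g v\<bar> \<le> K * nW (v - x n)" for n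
    using b[OF subspace_diff[OF subspace_V v xV], of n] d[OF v xV, of n] z[OF x, of n] by simp
  moreover have "(\<lambda>n. K * nW (v - x n)) \<longlonglongrightarrow> K * 0" by (intro tendsto_intros l)
  ultimately have "\<bar>g v\<bar> \<le> K * 0" by (intro LIMSEQ_le_const) auto
  then show ?thesis by simp
qed

lemma D_add:
  assumes u: "u \<in> V" and v: "v \<in> V" and e: "e \<in> Basis" and g: "g \<in> L2 G"
  shows "L2_pairing G (D e (u + v)) g = L2_pairing G (D e u) g + L2_pairing G (D e v) g"
proof -
  have "L2_pairing G (D e (u + v)) g = L2_pairing G (D e u + D e v) g"
    using V_D[OF subspace_add[OF subspace_V u v] e] V_D[OF u e] V_D[OF v e] g
    by (intro L2_pairing_AE_cong) (use W12_add(2)[OF G V_W12[OF u] V_W12[OF v] e] in \<open>simp_all add: L2_eq\<close>)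
  then show ?thesis using V_D[OF u e] V_D[OF v e] g by (simp add: L2_pairing_eq L2_eq sq.ip_add)
qed

lemma D_scale:
  assumes u: "u \<in> V" and e: "e \<in> Basis" and g: "g \<in> L2 G"
  shows "L2_pairing G (D e (c *\<^sub>R u)) g = c * L2_pairing G (D e u) g"
proof -
  have "L2_pairing G (D e (c *\<^sub>R u)) g = L2_pairing G (c *\<^sub>R D e u) g"
    using V_D[OF subspace_scale[OF subspace_V u] e] V_D[OF u e] g
    by (intro L2_pairing_AE_cong) (use W12_scale(2)[OF G V_W12[OF u] e] in \<open>simp_all add: L2_eq\<close>)
  then show ?thesis using V_D[OF u e] g by (simp add: L2_pairing_eq L2_eq sq.ip_scale)
qed

lemma D_diff:
  assumes u: "u \<in> V" and v: "v \<in> V" and e: "e \<in> Basis" and g: "g \<in> L2 G"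
  shows "L2_pairing G (D e (u - v)) g = L2_pairing G (D e u) g - L2_pairing G (D e v) g"
  using D_add[OF u subspace_scale[OF subspace_V v, of "-1"] e g] D_scale[OF v e g, of "-1"] by simp

text \<open>\<open>A1\<close> is a combination of the four pairings of first derivatives, so its
  linearity and its bounds reduce to those of a single kind of term.\<close>

definition gram :: "real^2 => real^2 => vfield => vfield => real" where
  "gram d e u v = L2_pairing G (D d u) (D e v)"

lemma gram_bilinear:
  assumes "u \<in> V" "v \<in> V" "w \<in> V" "d \<in> Basis" "e \<in> Basis"
  shows "gram d e (u + v) w = gram d e u w + gram d e v w" "gram d e (c *\<^sub>R u) w = c * gram d e u w"
    "gram d e w (u + v) = gram d e w u + gram d e w v" "gram d e w (c *\<^sub>R u) = c * gram d e w u"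
proof -
  show "gram d e (u + v) w = gram d e u w + gram d e v w" "gram d e (c *\<^sub>R u) w = c * gram d e u w"
    unfolding gram_def by (intro D_add D_scale V_D assms)+
  show "gram d e w (u + v) = gram d e w u + gram d e w v" "gram d e w (c *\<^sub>R u) = c * gram d e w u"
    unfolding gram_def L2_pairing_sym[of G "D d w"] by (intro D_add D_scale V_D assms)+
qed

lemma gram_bound:
  assumes "u \<in> V" "v \<in> V" "d \<in> Basis" "e \<in> Basis" shows "\<bar>gram d e u v\<bar> \<le> nW u * nW v"
proof -
  have "\<bar>gram d e u v\<bar> \<le> nL (D d u) * nL (D e v)" unfolding gram_def by (intro L2_CS V_D assms)
  also have "\<dots> \<le> nW u * nW v" by (intro mult_mono partial_le_W12 assms) (simp_all add: L2_norm_nonneg W12_norm_nonneg)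
  finally show ?thesis .
qed

lemma E_op_eq: "E_op a1 a2 G u = inverse a1 *\<^sub>R D ax1 u + inverse a2 *\<^sub>R D ax2 u"
  by (simp add: E_op_def fun_eq_iff)

lemma E_op_L2: "u \<in> V ==> E_op a1 a2 G u \<in> L2 G"
  using V_D[of u] by (simp add: E_op_eq L2_eq)

lemma E_op_pairing:
  assumes u: "u \<in> V" and g: "g \<in> L2 G"
  shows "L2_pairing G (E_op a1 a2 G u) g = inverse a1 * L2_pairing G (D ax1 u) g + inverse a2 * L2_pairing G (D ax2 u) g"
  using V_D[OF u] g by (simp add: E_op_eq L2_eq L2_pairing_eq sq.ip_add sq.ip_scale)

lemma A1_gram:
  assumes u: "u \<in> V" and v: "v \<in> V"
  shows "A1 a1 a2 G u v = - (gram ax1 ax1 u v + gram ax2 ax2 u v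
    + 1/4 * ((inverse a1)^2 * gram ax1 ax1 u v + inverse a1 * inverse a2 * (gram ax1 ax2 u v + gram ax2 ax1 u v)
      + (inverse a2)^2 * gram ax2 ax2 u v))"
  unfolding A1_def dual_partial_def gram_def
  by (simp add: E_op_pairing[OF u V_D[OF v]] power2_eq_square algebra_simps)

lemma A1_bilinear:
  assumes "u \<in> V" "v \<in> V" "w \<in> V"
  shows "A1 a1 a2 G (u + v) w = A1 a1 a2 G u w + A1 a1 a2 G v w" "A1 a1 a2 G (c *\<^sub>R u) w = c * A1 a1 a2 G u w"
    "A1 a1 a2 G w (u + v) = A1 a1 a2 G w u + A1 a1 a2 G w v" "A1 a1 a2 G w (c *\<^sub>R u) = c * A1 a1 a2 G w u"
proof -
  have V: "u + v \<in> V" "c *\<^sub>R u \<in> V" using assms subspace_V by (auto intro: subspace_add subspace_scale)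
  show "A1 a1 a2 G (u + v) w = A1 a1 a2 G u w + A1 a1 a2 G v w" "A1 a1 a2 G (c *\<^sub>R u) w = c * A1 a1 a2 G u w"
    "A1 a1 a2 G w (u + v) = A1 a1 a2 G w u + A1 a1 a2 G w v" "A1 a1 a2 G w (c *\<^sub>R u) = c * A1 a1 a2 G w u"
    using assms V by (simp_all add: A1_gram gram_bilinear algebra_simps)
qed

text \<open>Sum of the absolute values of the coefficients in \<open>A1_gram\<close>: 2 from the
  planar Laplacian, and the expanded square from the second order operator built with
  \<open>E_op\<close>.\<close>

definition CA :: real where "CA = 2 + 1/4 * (\<bar>inverse a1\<bar> + \<bar>inverse a2\<bar>)^2"

lemma CA_nonneg: "0 \<le> CA" by (simp add: CA_def)

lemma A1_gram_bound:
  assumes V: "u \<in> V" "v \<in> V" and g: "\<And>d e. d \<in> Basis ==> e \<in> Basis ==> \<bar>gram d e u v\<bar> \<le> p"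
  shows "\<bar>A1 a1 a2 G u v\<bar> \<le> CA * p"
proof -
  have m: "\<bar>c * gram d e u v\<bar> \<le> \<bar>c\<bar> * p" if "d \<in> Basis" "e \<in> Basis" for c d e
    unfolding abs_mult by (intro mult_left_mono g that) simp
  let ?i = "inverse a1" and ?j = "inverse a2"
  have "\<bar>A1 a1 a2 G u v\<bar> \<le> \<bar>gram ax1 ax1 u v\<bar> + \<bar>gram ax2 ax2 u v\<bar> + 1/4 * (\<bar>?i^2 * gram ax1 ax1 u v\<bar>
      + (\<bar>(?i * ?j) * gram ax1 ax2 u v\<bar> + \<bar>(?i * ?j) * gram ax2 ax1 u v\<bar>) + \<bar>?j^2 * gram ax2 ax2 u v\<bar>)"
    unfolding A1_gram[OF V] distrib_left[of "?i * ?j"] by (rule abs_sum_le)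
  also have "\<dots> \<le> p + p + 1/4 * (\<bar>?i^2\<bar> * p + (\<bar>?i * ?j\<bar> * p + \<bar>?i * ?j\<bar> * p) + \<bar>?j^2\<bar> * p)"
    by (intro add_mono mult_left_mono g m) auto
  also have "\<dots> = CA * p" by (simp add: CA_def abs_mult power2_sum power_inverse algebra_simps)
  finally show ?thesis .
qed

lemma A1_bound: "u \<in> V ==> v \<in> V ==> \<bar>A1 a1 a2 G u v\<bar> \<le> CA * nW u * nW v"
  unfolding mult.assoc by (intro A1_gram_bound gram_bound)

text \<open>- \<open>A1\<close> at (u, u) is the squared norm of the gradient plus a quarter of the
  squared norm of \<open>E_op\<close>; the latter is nonnegative, and Poincare's inequality does the
  rest.\<close>

lemma A1_coercive:
  assumes u: "u \<in> V" shows "(nW u)^2 \<le> (1 + 4 * \<rho>^2) * - A1 a1 a2 G u u"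
proof -
  let ?E = "E_op a1 a2 G u"
  have "0 \<le> L2_pairing G ?E ?E" by (simp add: L2_pairing_self)
  also have "L2_pairing G ?E ?E = inverse a1 * L2_pairing G (D ax1 u) ?E + inverse a2 * L2_pairing G (D ax2 u) ?E"
    by (rule E_op_pairing[OF u E_op_L2[OF u]])
  also have "\<dots> = (inverse a1)^2 * gram ax1 ax1 u u + inverse a1 * inverse a2 * (gram ax1 ax2 u u + gram ax2 ax1 u u)
      + (inverse a2)^2 * gram ax2 ax2 u u"
    unfolding L2_pairing_sym[of G _ ?E] gram_def
    by (simp add: E_op_pairing[OF u V_D[OF u]] power2_eq_square algebra_simps L2_pairing_sym[of G "D ax2 u" "D ax1 u"])
  finally have "(nL (D ax1 u))^2 + (nL (D ax2 u))^2 \<le> - A1 a1 a2 G u u"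
    unfolding A1_gram[OF u u] by (simp add: gram_def L2_pairing_self)
  then show ?thesis using coercive_V[OF u] by (meson mult_left_mono order_trans add_nonneg_nonneg zero_le_one mult_nonneg_nonneg zero_le_power2 zero_le_numeral)
qed

lemma D_by_parts:
  assumes \<phi>: "\<phi> \<in> test_functions G" and e: "e \<in> Basis" and u: "u \<in> V"
  shows "L2_pairing G (D e u) \<phi> = - L2_pairing G u (partial e \<phi>)"
proof -
  have pL: "\<phi> \<in> L2 G" "partial e \<phi> \<in> L2 G" using test_L2[OF G] \<phi> test_partial[OF \<phi> e] by auto
  define g where "g u = L2_pairing G (D e u) \<phi> + L2_pairing G u (partial e \<phi>)" for u
  have "g u = 0"
  proof (rule zero_on_V[OF _ _ _ u])
    show "g (x - y) = g x - g y" if "x \<in> V" "y \<in> V" for x y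
      using D_diff[OF that e pL(1)] V_L2[OF that(1)] V_L2[OF that(2)] pL
      by (simp add: g_def L2_pairing_eq L2_eq sq.ip_diff)
    show "\<bar>g x\<bar> \<le> (nL \<phi> + nL (partial e \<phi>)) * nW x" if x: "x \<in> V" for x
    proof -
      have "\<bar>g x\<bar> \<le> \<bar>L2_pairing G (D e x) \<phi>\<bar> + \<bar>L2_pairing G x (partial e \<phi>)\<bar>" unfolding g_def by (rule abs_triangle_ineq)
      also have "\<dots> \<le> nL (D e x) * nL \<phi> + nL x * nL (partial e \<phi>)"
        by (intro add_mono L2_CS V_D V_L2 x e pL)
      also have "\<dots> \<le> nW x * nL \<phi> + nW x * nL (partial e \<phi>)"
        by (intro add_mono mult_right_mono partial_le_W12 L2_le_W12 L2_norm_nonneg e)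
      finally show ?thesis by (simp add: algebra_simps)
    qed
    show "g \<psi> = 0" if "\<psi> \<in> D0" for \<psi>
    proof -
      note \<psi> = D0_test[OF that]
      have "L2_pairing G (D e \<psi>) \<phi> = L2_pairing G (partial e \<psi>) \<phi>"
        using test_W12(2)[OF G \<psi> e] W12_partial(2)[OF G test_W12(1)[OF G \<psi>] e] test_L2[OF G test_partial[OF \<psi> e]] pL
        by (intro L2_pairing_AE_cong) auto
      moreover have "(\<integral>x. partial e \<psi> x \<bullet> \<phi> x \<partial>lebesgue_on G) + (\<integral>x. \<psi> x \<bullet> partial e \<phi> x \<partial>lebesgue_on G) = 0"
      proof -
        have t: "(\<lambda>x. partial e \<psi> x \<bullet> \<phi> x) \<in> test_functions G" "(\<lambda>x. \<psi> x \<bullet> partial e \<phi> x) \<in> test_functions G"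
          by (intro test_inner \<psi> \<phi> test_partial e)+
        have s: "G \<in> sets lebesgue" using G by simp
        have "(\<integral>x. partial e \<psi> x \<bullet> \<phi> x \<partial>lebesgue_on G) + (\<integral>x. \<psi> x \<bullet> partial e \<phi> x \<partial>lebesgue_on G)
          = (\<integral>x. \<psi> x \<bullet> partial e \<phi> x + partial e \<psi> x \<bullet> \<phi> x \<partial>lebesgue_on G)"
          using integrable_on_lebesgue_on[OF test_integrable[OF t(1)] s] integrable_on_lebesgue_on[OF test_integrable[OF t(2)] s]
          by simp
        also have "\<dots> = (\<integral>x. partial e (\<lambda>x. \<psi> x \<bullet> \<phi> x) x \<partial>lebesgue_on G)"
          by (simp add: partial_bilinear[OF bounded_bilinear_inner test_diff[OF \<psi>] test_diff[OF \<phi>]])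
        also have "\<dots> = (\<integral>x. partial e (\<lambda>x. \<psi> x \<bullet> \<phi> x) x \<partial>lborel)"
          using test_partial[OF test_inner[OF \<psi> \<phi>] e] by (intro test_integral_lebesgue_on G test_cont test_outside)
        also have "\<dots> = 0" by (rule integral_partial_zero[OF test_inner[OF \<psi> \<phi>] e])
        finally show ?thesis .
      qed
      ultimately show ?thesis by (simp add: g_def L2_pairing_def)
    qed
  qed
  then show ?thesis by (simp add: g_def)
qed

text \<open>In every \<open>gram\<close> term the derivative of u is moved onto v. This produces
  second derivatives of the smooth v, whose norms are collected in one sum.\<close>

lemma A1_test_bound:
  assumes v: "v \<in> D0" shows "\<exists>K. \<forall>u\<in>V. \<bar>A1 a1 a2 G u v\<bar> \<le> K * nL u"
proof (intro exI ballI)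
  fix u assume u: "u \<in> V"
  have vV: "v \<in> V" using v D0_V by blast
  define N where "N d e = nL (partial d (partial e v))" for d e
  let ?K = "\<Sum>p\<in>Basis \<times> Basis. N (fst p) (snd p)"
  have "\<bar>gram d e u v\<bar> \<le> ?K * nL u" if d: "d \<in> Basis" and e: "e \<in> Basis" for d e
  proof -
    have t: "partial e v \<in> test_functions G" by (rule test_partial[OF D0_test[OF v] e])
    have "gram d e u v = L2_pairing G (D d u) (partial e v)"
      unfolding gram_def using V_D[OF u d] V_D[OF vV e] test_L2[OF G t] test_W12(2)[OF G D0_test[OF v] e]
      by (intro L2_pairing_AE_cong) auto
    also have "\<dots> = - L2_pairing G u (partial d (partial e v))" by (rule D_by_parts[OF t d u])
    finally have "\<bar>gram d e u v\<bar> \<le> N d e * nL u"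
      using L2_CS[OF V_L2[OF u] test_L2[OF G test_partial[OF t d]]] by (simp add: N_def mult.commute)
    also have "N d e \<le> ?K"
      using member_le_sum[of "(d, e)" "Basis \<times> Basis" "\<lambda>p. N (fst p) (snd p)"] d e
      by (simp add: N_def L2_norm_nonneg)
    finally show ?thesis using L2_norm_nonneg mult_right_mono by blast
  qed
  from A1_gram_bound[OF u vV this] show "\<bar>A1 a1 a2 G u v\<bar> \<le> (CA * ?K) * nL u" by (simp add: mult.assoc)
qed

text \<open>The transport velocity of \<open>u\<close> in the direction \<open>e\<close> is \<open>u x \<bullet> col e\<close>.\<close>

definition col :: "real^2 => real^3" where
  "col e = (if e = ax1 then axis 1 1 - (inverse a1 / 2) *\<^sub>R axis 3 1 else axis 2 1 - (inverse a2 / 2) *\<^sub>R axis 3 1)"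

lemma col_ax: "col ax1 = axis 1 1 - (inverse a1 / 2) *\<^sub>R axis 3 1" "col ax2 = axis 2 1 - (inverse a2 / 2) *\<^sub>R axis 3 1"
  by (simp_all add: col_def ax_neq[symmetric])

text \<open>The vectors \<open>col\<close> that define the transport velocity in \<open>B1\<close>
  are those that define the divergence; hence the transport velocity of a field with
  \<open>div_L\<close> zero is divergence free in the plane.\<close>

lemma div_L_col: "div_L a1 a2 \<phi> x = (\<Sum>e\<in>Basis. partial e \<phi> x \<bullet> col e)"
  by (simp add: div_L_def sum_Basis_real2 col_ax inner_diff_right inner_axis algebra_simps)

lemma B1_col: "B1 a1 a2 G u w x = (\<Sum>e\<in>Basis. (u x \<bullet> col e) *\<^sub>R D e w x)"
  by (simp add: B1_def E_op_def sum_Basis_real2 col_ax inner_diff_right inner_axis algebra_simps)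

text \<open>Hoelder's inequality with exponents 4, 4, 2 as two applications of Cauchy-Schwarz. The
  constant 4 of \<open>ladyzhenskaya_V\<close> enters with total exponent 1/2 and becomes the factor
  2.\<close>

lemma product_V:
  assumes u: "u \<in> V" and w: "w \<in> V" and g: "g \<in> L2 G"
  shows "integrable (lebesgue_on G) (\<lambda>x. (u x \<bullet> c) * (g x \<bullet> w x))"
    "\<bar>\<integral>x. (u x \<bullet> c) * (g x \<bullet> w x) \<partial>lebesgue_on G\<bar>
      \<le> 2 * norm c * sqrt (nL u * nW u) * sqrt (nL w * nW w) * L2_norm G g"
proof -
  let ?M = "lebesgue_on G"
  have [measurable]: "u \<in> borel_measurable ?M" "w \<in> borel_measurable ?M" "g \<in> borel_measurable ?M"
    using V_L2[OF u] V_L2[OF w] g by (simp_all add: L2_def)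
  note CS4 = integral_CS[of "\<lambda>x. (norm (u x))^2" ?M "\<lambda>x. (norm (w x))^2", OF _ _ ladyzhenskaya_V(1)[OF u] ladyzhenskaya_V(1)[OF w]]
  have i2: "integrable ?M (\<lambda>x. (norm (u x) * norm (w x))^2)"
    using CS4(1) by (simp add: power_mult_distrib)
  have s: "sqrt (\<integral>x. ((norm (v x))^2)^2 \<partial>?M) \<le> 2 * (nL v * nW v)" if v: "v \<in> V" for v
    using ladyzhenskaya_V(2)[OF v] L2_norm_nonneg[of G v] W12_norm_nonneg[of G v]
    by (intro real_le_lsqrt) (auto simp: power_mult_distrib)
  have "(\<integral>x. (norm (u x) * norm (w x))^2 \<partial>?M) \<le> sqrt (\<integral>x. ((norm (u x))^2)^2 \<partial>?M) * sqrt (\<integral>x. ((norm (w x))^2)^2 \<partial>?M)"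
    using CS4(2) by (simp add: power_mult_distrib)
  also have "\<dots> \<le> 2 * (nL u * nW u) * (2 * (nL w * nW w))"
    by (intro mult_mono s u w) (simp_all add: L2_norm_nonneg W12_norm_nonneg)
  finally have "sqrt (\<integral>x. (norm (u x) * norm (w x))^2 \<partial>?M) \<le> sqrt (2^2 * ((nL u * nW u) * (nL w * nW w)))"
    by (intro real_sqrt_le_mono) simp
  then have q: "sqrt (\<integral>x. (norm (u x) * norm (w x))^2 \<partial>?M) \<le> 2 * (sqrt (nL u * nW u) * sqrt (nL w * nW w))"
    by (simp add: real_sqrt_mult)
  note CS2 = integral_CS[of "\<lambda>x. norm (u x) * norm (w x)" ?M "\<lambda>x. norm (g x)", OF _ _ i2]
  have gi: "integrable ?M (\<lambda>x. (norm (g x))^2)" using g by (simp add: L2_def)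
  have i: "integrable ?M (\<lambda>x. norm c * (norm (u x) * norm (w x) * norm (g x)))"
    using CS2(1)[OF _ _ gi] by simp
  have le: "\<bar>(u x \<bullet> c) * (g x \<bullet> w x)\<bar> \<le> norm c * (norm (u x) * norm (w x) * norm (g x))" for x
  proof -
    have "\<bar>(u x \<bullet> c) * (g x \<bullet> w x)\<bar> \<le> (norm (u x) * norm c) * (norm (g x) * norm (w x))"
      unfolding abs_mult by (intro mult_mono Cauchy_Schwarz_ineq2) auto
    then show ?thesis by (simp add: mult_ac)
  qed
  show I: "integrable ?M (\<lambda>x. (u x \<bullet> c) * (g x \<bullet> w x))"
    by (rule Bochner_Integration.integrable_bound[OF i]) (use le in \<open>auto intro!: AE_I2 order_trans[OF le]\<close>)
  have "\<bar>\<integral>x. (u x \<bullet> c) * (g x \<bullet> w x) \<partial>?M\<bar> \<le> (\<integral>x. \<bar>(u x \<bullet> c) * (g x \<bullet> w x)\<bar> \<partial>?M)"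
    by (rule integral_abs_bound)
  also have "\<dots> \<le> (\<integral>x. norm c * (norm (u x) * norm (w x) * norm (g x)) \<partial>?M)"
    using I i le by (intro integral_mono) auto
  also have "\<dots> = norm c * (\<integral>x. norm (u x) * norm (w x) * norm (g x) \<partial>?M)" by simp
  also have "\<dots> \<le> norm c * (2 * (sqrt (nL u * nW u) * sqrt (nL w * nW w)) * L2_norm G g)"
  proof (rule mult_left_mono)
    have "(\<integral>x. norm (u x) * norm (w x) * norm (g x) \<partial>?M)
      \<le> sqrt (\<integral>x. (norm (u x) * norm (w x))^2 \<partial>?M) * sqrt (\<integral>x. (norm (g x))^2 \<partial>?M)"
      by (rule CS2(2)[OF _ _ gi]) auto
    also have "\<dots> \<le> 2 * (sqrt (nL u * nW u) * sqrt (nL w * nW w)) * sqrt (\<integral>x. (norm (g x))^2 \<partial>?M)"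
      using q by (rule mult_right_mono) simp
    finally show "(\<integral>x. norm (u x) * norm (w x) * norm (g x) \<partial>?M)
      \<le> 2 * (sqrt (nL u * nW u) * sqrt (nL w * nW w)) * L2_norm G g" by (simp add: L2_norm_def)
  qed simp
  finally show "\<bar>\<integral>x. (u x \<bullet> c) * (g x \<bullet> w x) \<partial>?M\<bar>
      \<le> 2 * norm c * sqrt (nL u * nW u) * sqrt (nL w * nW w) * L2_norm G g" by (simp add: mult_ac)
qed

definition B :: "vfield => vfield => vfield => real" where
  "B u v w = L2_pairing G (B1 a1 a2 G u v) w"

lemma B_eq:
  assumes u: "u \<in> V" and v: "v \<in> V" and w: "w \<in> V"
  shows "B u v w = (\<Sum>e\<in>Basis. \<integral>x. (u x \<bullet> col e) * (D e v x \<bullet> w x) \<partial>lebesgue_on G)"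
proof -
  have "B u v w = (\<integral>x. (\<Sum>e\<in>Basis. (u x \<bullet> col e) * (D e v x \<bullet> w x)) \<partial>lebesgue_on G)"
    by (simp add: B_def L2_pairing_def B1_col inner_sum_left)
  also have "\<dots> = (\<Sum>e\<in>Basis. \<integral>x. (u x \<bullet> col e) * (D e v x \<bullet> w x) \<partial>lebesgue_on G)"
    by (intro Bochner_Integration.integral_sum product_V(1) u w V_D v)
  finally show ?thesis .
qed

definition CB :: real where "CB = 2 * norm (col ax1) + 2 * norm (col ax2)"

lemma CB_nonneg: "0 \<le> CB" by (simp add: CB_def)

lemma B_bound:
  assumes u: "u \<in> V" and v: "v \<in> V" and w: "w \<in> V"
  shows "\<bar>B u v w\<bar> \<le> CB * sqrt (nL u * nW u) * sqrt (nL w * nW w) * nW v"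
proof -
  let ?s = "sqrt (nL u * nW u) * sqrt (nL w * nW w)"
  have s0: "0 \<le> ?s" by (simp add: L2_norm_nonneg W12_norm_nonneg)
  have le: "\<bar>\<integral>x. (u x \<bullet> col e) * (D e v x \<bullet> w x) \<partial>lebesgue_on G\<bar> \<le> 2 * norm (col e) * ?s * nW v" if e: "e \<in> Basis" for e
  proof -
    have "\<bar>\<integral>x. (u x \<bullet> col e) * (D e v x \<bullet> w x) \<partial>lebesgue_on G\<bar> \<le> 2 * norm (col e) * ?s * nL (D e v)"
      using product_V(2)[OF u w V_D[OF v e], of "col e"] by (simp add: mult.assoc)
    also have "\<dots> \<le> 2 * norm (col e) * ?s * nW v" using s0 by (intro mult_left_mono partial_le_W12 e) auto
    finally show ?thesis .
  qed
  have "\<bar>B u v w\<bar> \<le> 2 * norm (col ax1) * ?s * nW v + 2 * norm (col ax2) * ?s * nW v"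
    unfolding B_eq[OF u v w] sum_Basis_real2
    by (rule order_trans[OF abs_triangle_ineq]) (intro add_mono le ax_Basis)
  then show ?thesis by (simp add: CB_def algebra_simps)
qed

lemma B_linear:
  assumes x: "x \<in> V" and y: "y \<in> V" and z: "z \<in> V" and w: "w \<in> V"
  shows "B (x + y) z w = B x z w + B y z w" "B (c *\<^sub>R x) z w = c * B x z w"
    "B z (x + y) w = B z x w + B z y w" "B z (c *\<^sub>R x) w = c * B z x w"
    "B z w (x + y) = B z w x + B z w y" "B z w (c *\<^sub>R x) = c * B z w x"
proof -
  have V: "x + y \<in> V" "c *\<^sub>R x \<in> V" using x y subspace_V by (auto intro: subspace_add subspace_scale)
  have p: "integrable (lebesgue_on G) (\<lambda>t. (u t \<bullet> col e) * (D e v t \<bullet> w t))" if "u \<in> V" "v \<in> V" "w \<in> V" "e \<in> Basis" for u v w e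
    by (rule product_V(1)[OF that(1,3) V_D[OF that(2,4)]])
  have pm: "(\<lambda>t. (u t \<bullet> col e) * (D e v t \<bullet> w t)) \<in> borel_measurable (lebesgue_on G)" if "u \<in> V" "v \<in> V" "w \<in> V" "e \<in> Basis" for u v w e
    by (rule borel_measurable_integrable[OF p[OF that]])
  show "B (x + y) z w = B x z w + B y z w" "B (c *\<^sub>R x) z w = c * B x z w"
    using V x y z w by (simp_all add: B_eq sum_Basis_real2 inner_add_left algebra_simps Bochner_Integration.integral_add[OF p p])
  show "B z w (x + y) = B z w x + B z w y" "B z w (c *\<^sub>R x) = c * B z w x"
    using V x y z w by (simp_all add: B_eq sum_Basis_real2 inner_add_right algebra_simps Bochner_Integration.integral_add[OF p p])
  have "(\<integral>t. (z t \<bullet> col e) * (D e (x + y) t \<bullet> w t) \<partial>lebesgue_on G)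
    = (\<integral>t. (z t \<bullet> col e) * (D e x t \<bullet> w t) + (z t \<bullet> col e) * (D e y t \<bullet> w t) \<partial>lebesgue_on G)" if e: "e \<in> Basis" for e
  proof (rule integral_cong_AE[OF pm[OF z V(1) w e]])
    show "AE t in lebesgue_on G. (z t \<bullet> col e) * (D e (x + y) t \<bullet> w t) = (z t \<bullet> col e) * (D e x t \<bullet> w t) + (z t \<bullet> col e) * (D e y t \<bullet> w t)"
      using W12_add(2)[OF G V_W12[OF x] V_W12[OF y] e] by eventually_elim (simp add: inner_add_left algebra_simps)
  qed (intro borel_measurable_add pm z x y w e)
  then show "B z (x + y) w = B z x w + B z y w"
    using V x y z w by (simp add: B_eq sum_Basis_real2 Bochner_Integration.integral_add[OF p p])
  have "(\<integral>t. (z t \<bullet> col e) * (D e (c *\<^sub>R x) t \<bullet> w t) \<partial>lebesgue_on G)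
    = (\<integral>t. c * ((z t \<bullet> col e) * (D e x t \<bullet> w t)) \<partial>lebesgue_on G)" if e: "e \<in> Basis" for e
  proof (rule integral_cong_AE[OF pm[OF z V(2) w e]])
    show "AE t in lebesgue_on G. (z t \<bullet> col e) * (D e (c *\<^sub>R x) t \<bullet> w t) = c * ((z t \<bullet> col e) * (D e x t \<bullet> w t))"
      using W12_scale(2)[OF G V_W12[OF x] e, of c] by eventually_elim simp
  qed (intro borel_measurable_times borel_measurable_const pm z x w e)
  then show "B z (c *\<^sub>R x) w = c * B z x w"
    using V x z w by (simp add: B_eq sum_Basis_real2 distrib_left)
qed

lemma B_diff:
  assumes x: "x \<in> V" and y: "y \<in> V" and z: "z \<in> V" and w: "w \<in> V"
  shows "B (x - y) z w = B x z w - B y z w" "B z (x - y) w = B z x w - B z y w" "B z w (x - y) = B z w x - B z w y"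
proof -
  have m: "(-1) *\<^sub>R y \<in> V" "x - y = x + (-1) *\<^sub>R y" using subspace_scale[OF subspace_V y, of "-1"] by simp_all
  show "B (x - y) z w = B x z w - B y z w" "B z (x - y) w = B z x w - B z y w" "B z w (x - y) = B z w x - B z w y"
    unfolding m(2) using B_linear[OF x m(1) z w] B_linear(2,4,6)[OF y y z w, of "-1"] by simp_all
qed

lemma B_bound_W: assumes "u \<in> V" "v \<in> V" "w \<in> V" shows "\<bar>B u v w\<bar> \<le> CB * nW u * nW v * nW w"
proof -
  have *: "sqrt (nL x * nW x) \<le> nW x" "0 \<le> sqrt (nL x * nW x)" for x
  proof -
    have "nL x * nW x \<le> nW x * nW x" by (intro mult_right_mono L2_le_W12 W12_norm_nonneg)
    then show "sqrt (nL x * nW x) \<le> nW x" by (intro real_le_lsqrt) (auto simp: power2_eq_square W12_norm_nonneg)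
  qed (simp add: L2_norm_nonneg W12_norm_nonneg)
  have "\<bar>B u v w\<bar> \<le> CB * sqrt (nL u * nW u) * sqrt (nL w * nW w) * nW v" by (rule B_bound[OF assms])
  also have "\<dots> \<le> CB * nW u * nW w * nW v"
    by (intro mult_right_mono mult_mono mult_left_mono * CB_nonneg W12_norm_nonneg mult_nonneg_nonneg)
  finally show ?thesis by (simp add: mult_ac)
qed

lemma B_test_eq:
  assumes u: "u \<in> D0" and v: "v \<in> D0" and w: "w \<in> D0"
  shows "B u v w = (\<Sum>e\<in>Basis. \<integral>x. (u x \<bullet> col e) * (partial e v x \<bullet> w x) \<partial>lborel)"
proof -
  have V: "u \<in> V" "v \<in> V" "w \<in> V" using u v w D0_V by auto
  note t = D0_test[OF u] D0_test[OF v] D0_test[OF w]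
  have "(\<integral>x. (u x \<bullet> col e) * (D e v x \<bullet> w x) \<partial>lebesgue_on G) = (\<integral>x. (u x \<bullet> col e) * (partial e v x \<bullet> w x) \<partial>lborel)"
    if e: "e \<in> Basis" for e
  proof -
    have p: "(\<lambda>x. (u x \<bullet> col e) * (partial e v x \<bullet> w x)) \<in> test_functions G"
      by (rule test_bilinear[OF bounded_bilinear_mult test_linear[OF bounded_linear_inner_left t(1)]
            test_Ck[OF test_inner[OF test_partial[OF t(2) e] t(3)]]])
    have "(\<integral>x. (u x \<bullet> col e) * (D e v x \<bullet> w x) \<partial>lebesgue_on G) = (\<integral>x. (u x \<bullet> col e) * (partial e v x \<bullet> w x) \<partial>lebesgue_on G)"
    proof (rule integral_cong_AE)
      show "(\<lambda>x. (u x \<bullet> col e) * (D e v x \<bullet> w x)) \<in> borel_measurable (lebesgue_on G)"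
        by (rule borel_measurable_integrable[OF product_V(1)[OF V(1,3) V_D[OF V(2) e]]])
      show "(\<lambda>x. (u x \<bullet> col e) * (partial e v x \<bullet> w x)) \<in> borel_measurable (lebesgue_on G)"
        using test_L2[OF G p] by (simp add: L2_def)
      show "AE x in lebesgue_on G. (u x \<bullet> col e) * (D e v x \<bullet> w x) = (u x \<bullet> col e) * (partial e v x \<bullet> w x)"
        using test_W12(2)[OF G t(2) e] by eventually_elim simp
    qed
    also have "\<dots> = (\<integral>x. (u x \<bullet> col e) * (partial e v x \<bullet> w x) \<partial>lborel)"
      by (rule test_integral_lebesgue_on[OF G test_cont[OF p] test_outside[OF p]])
    finally show ?thesis .
  qed
  then show ?thesis unfolding B_eq[OF V] by (intro sum.cong) auto
qed

text \<open>The integral of the derivative in direction e of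
  \<open>(u x \<bullet> col e) * (v x \<bullet> w x)\<close> vanishes. Summed over e, the product
  rule leaves the two advective terms and the divergence of u times v . w.\<close>

lemma B_skew_test:
  assumes u: "u \<in> D0" and v: "v \<in> D0" and w: "w \<in> D0"
  shows "B u v w + B u w v = 0"
proof -
  note t = D0_test[OF u] D0_test[OF v] D0_test[OF w]
  have c: "(\<lambda>x. u x \<bullet> k) \<in> test_functions G" for k by (rule test_linear[OF bounded_linear_inner_left t(1)])
  note m = test_bilinear[OF bounded_bilinear_mult]
  have ti: "integrable lborel (\<lambda>x. (u x \<bullet> col e) * (partial e v x \<bullet> w x))"
    "integrable lborel (\<lambda>x. (u x \<bullet> col e) * (partial e w x \<bullet> v x))"
    "integrable lborel (\<lambda>x. (partial e u x \<bullet> col e) * (v x \<bullet> w x))" if e: "e \<in> Basis" for e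
    by (intro test_integrable[of _ G] m c test_Ck[of _ G] test_inner test_partial t e test_linear[OF bounded_linear_inner_left])+
  have e0: "(\<integral>x. (u x \<bullet> col e) * (partial e v x \<bullet> w x) \<partial>lborel) + (\<integral>x. (u x \<bullet> col e) * (partial e w x \<bullet> v x) \<partial>lborel)
    = - (\<integral>x. (partial e u x \<bullet> col e) * (v x \<bullet> w x) \<partial>lborel)" if e: "e \<in> Basis" for e
  proof -
    have p: "(\<lambda>x. (u x \<bullet> col e) * (v x \<bullet> w x)) \<in> test_functions G"
      by (intro m c test_Ck[of _ G] test_inner t)
    have "partial e (\<lambda>x. (u x \<bullet> col e) * (v x \<bullet> w x)) x = (u x \<bullet> col e) * (partial e v x \<bullet> w x)
      + (u x \<bullet> col e) * (partial e w x \<bullet> v x) + (partial e u x \<bullet> col e) * (v x \<bullet> w x)" for x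
      using partial_bilinear[OF bounded_bilinear_mult test_diff[OF c[of "col e"]] test_diff[OF test_inner[OF t(2,3)]], of e x]
        partial_bilinear[OF bounded_bilinear_inner test_diff[OF t(2)] test_diff[OF t(3)], of e x]
        partial_linear[OF bounded_linear_inner_left[of "col e"] test_diff[OF t(1)], of e x]
      by (simp add: algebra_simps inner_commute)
    then have "(\<integral>x. (u x \<bullet> col e) * (partial e v x \<bullet> w x)
      + (u x \<bullet> col e) * (partial e w x \<bullet> v x) + (partial e u x \<bullet> col e) * (v x \<bullet> w x) \<partial>lborel) = 0"
      using integral_partial_zero[OF p e] by simp
    then show ?thesis using ti[OF e] by simp
  qed
  have "B u v w + B u w v = - (\<Sum>e\<in>Basis. \<integral>x. (partial e u x \<bullet> col e) * (v x \<bullet> w x) \<partial>lborel)"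
    unfolding B_test_eq[OF u v w] B_test_eq[OF u w v] sum.distrib[symmetric] sum_negf[symmetric]
    by (intro sum.cong e0) auto
  also have "(\<Sum>e\<in>Basis. \<integral>x. (partial e u x \<bullet> col e) * (v x \<bullet> w x) \<partial>lborel)
    = (\<integral>x. div_L a1 a2 u x * (v x \<bullet> w x) \<partial>lborel)"
    unfolding div_L_col sum_distrib_right by (rule Bochner_Integration.integral_sum[symmetric]) (rule ti)
  also have "(\<lambda>x. div_L a1 a2 u x * (v x \<bullet> w x)) = (\<lambda>x. 0)"
  proof
    fix x show "div_L a1 a2 u x * (v x \<bullet> w x) = 0"
      using u test_outside[OF t(2), of x] by (cases "x \<in> G") (auto simp: div_free_tests_def)
  qed
  finally show ?thesis by simp
qed

text \<open>The identity is extended from test functions by density in one argument at a time: the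
  advecting field, then the second argument, then the third.\<close>

lemma B_skew:
  assumes u: "u \<in> V" and v: "v \<in> V" and w: "w \<in> V" shows "B u v w = - B u w v"
proof -
  have DV: "\<phi> \<in> V" if "\<phi> \<in> D0" for \<phi> using that D0_V by blast
  have b: "\<bar>B x y z + B x z y\<bar> \<le> 2 * CB * nW x * nW y * nW z" if "x \<in> V" "y \<in> V" "z \<in> V" for x y z
    using B_bound_W[OF that] B_bound_W[OF that(1,3,2)] by (simp add: algebra_simps)
  have 1: "B x y z + B x z y = 0" if x: "x \<in> V" and y: "y \<in> D0" and z: "z \<in> D0" for x y z
    by (rule zero_on_V[where g="\<lambda>x. B x y z + B x z y" and K="2 * CB * nW y * nW z", OF _ _ _ x])
      (use B_diff(1)[OF _ _ DV[OF y] DV[OF z]] B_diff(1)[OF _ _ DV[OF z] DV[OF y]] b[OF _ DV[OF y] DV[OF z]]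
        B_skew_test[OF _ y z] in \<open>auto simp: mult_ac\<close>)
  have 2: "B x y z + B x z y = 0" if x: "x \<in> V" and y: "y \<in> V" and z: "z \<in> D0" for x y z
    by (rule zero_on_V[where g="\<lambda>y. B x y z + B x z y" and K="2 * CB * nW x * nW z", OF _ _ _ y])
      (use B_diff(2)[OF _ _ x DV[OF z]] B_diff(3)[OF _ _ x DV[OF z]] b[OF x _ DV[OF z]] 1[OF x _ z] in \<open>auto simp: mult_ac\<close>)
  have "B u v w + B u w v = 0"
    by (rule zero_on_V[where g="\<lambda>z. B u v z + B u z v" and K="2 * CB * nW u * nW v", OF _ _ _ w])
      (use B_diff(2,3)[OF _ _ u v] b[OF u v] 2[OF u v] in \<open>auto simp: mult_ac\<close>)
  then show ?thesis by simp
qed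

text \<open>v sits in the differentiated slot and its gradient is bounded, so the L2-norms of w and
  u suffice.\<close>

lemma B_test_bound:
  assumes v: "v \<in> D0" shows "\<exists>K. \<forall>u\<in>V. \<forall>w\<in>V. \<bar>B w v u\<bar> \<le> K * nL w * nL u"
proof -
  have vV: "v \<in> V" using v D0_V by blast
  have "\<exists>K. \<forall>u\<in>V. \<forall>w\<in>V. \<bar>\<integral>x. (w x \<bullet> col e) * (D e v x \<bullet> u x) \<partial>lebesgue_on G\<bar> \<le> K * (nL w * nL u)"
    if e: "e \<in> Basis" for e
  proof (rule test_bounded[OF test_partial[OF D0_test[OF v] e]])
    fix K assume K: "0 < K" "\<And>x. norm (partial e v x) \<le> K"
    show ?thesis
    proof (intro exI ballI)
      fix u w assume u: "u \<in> V" and w: "w \<in> V"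
      have s: "w \<in> square_integrable (lebesgue_on G)" "u \<in> square_integrable (lebesgue_on G)"
        using V_L2[OF u] V_L2[OF w] by (simp_all add: L2_eq)
      have i: "integrable (lebesgue_on G) (\<lambda>x. norm (col e) * K * (norm (w x) * norm (u x)))"
        using integrable_inner_square_integrable(2)[OF s] by simp
      have [measurable]: "u \<in> borel_measurable (lebesgue_on G)" "w \<in> borel_measurable (lebesgue_on G)"
        using s by (simp_all add: square_integrable_def)
      have "\<bar>\<integral>x. (w x \<bullet> col e) * (D e v x \<bullet> u x) \<partial>lebesgue_on G\<bar> \<le> (\<integral>x. \<bar>(w x \<bullet> col e) * (D e v x \<bullet> u x)\<bar> \<partial>lebesgue_on G)"
        by (rule integral_abs_bound)
      also have "\<dots> \<le> (\<integral>x. norm (col e) * K * (norm (w x) * norm (u x)) \<partial>lebesgue_on G)"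
      proof (rule integral_mono_AE[OF _ i])
        show "integrable (lebesgue_on G) (\<lambda>x. \<bar>(w x \<bullet> col e) * (D e v x \<bullet> u x)\<bar>)"
          using product_V(1)[OF w u V_D[OF vV e]] by (rule integrable_abs)
        show "AE x in lebesgue_on G. \<bar>(w x \<bullet> col e) * (D e v x \<bullet> u x)\<bar> \<le> norm (col e) * K * (norm (w x) * norm (u x))"
          using test_W12(2)[OF G D0_test[OF v] e]
        proof eventually_elim
          fix x assume x: "D e v x = partial e v x"
          have "\<bar>(w x \<bullet> col e) * (D e v x \<bullet> u x)\<bar> \<le> (norm (w x) * norm (col e)) * (norm (D e v x) * norm (u x))"
            unfolding abs_mult by (intro mult_mono Cauchy_Schwarz_ineq2) auto
          also have "\<dots> \<le> (norm (w x) * norm (col e)) * (K * norm (u x))"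
            unfolding x by (intro mult_left_mono mult_right_mono K) auto
          finally show "\<bar>(w x \<bullet> col e) * (D e v x \<bullet> u x)\<bar> \<le> norm (col e) * K * (norm (w x) * norm (u x))" by (simp add: mult_ac)
        qed
      qed
      also have "\<dots> = norm (col e) * K * (\<integral>x. norm (w x) * norm (u x) \<partial>lebesgue_on G)" by simp
      also have "\<dots> \<le> norm (col e) * K * (nL w * nL u)"
      proof (rule mult_left_mono)
        show "(\<integral>x. norm (w x) * norm (u x) \<partial>lebesgue_on G) \<le> nL w * nL u"
          unfolding L2_norm_def using s by (intro integral_CS(2)) (auto simp: square_integrable_def)
      qed (use K in simp)
      finally show "\<bar>\<integral>x. (w x \<bullet> col e) * (D e v x \<bullet> u x) \<partial>lebesgue_on G\<bar> \<le> norm (col e) * K * (nL w * nL u)" .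
    qed
  qed
  then obtain K L where K: "\<forall>u\<in>V. \<forall>w\<in>V. \<bar>\<integral>x. (w x \<bullet> col ax1) * (D ax1 v x \<bullet> u x) \<partial>lebesgue_on G\<bar> \<le> K * (nL w * nL u)"
    and L: "\<forall>u\<in>V. \<forall>w\<in>V. \<bar>\<integral>x. (w x \<bullet> col ax2) * (D ax2 v x \<bullet> u x) \<partial>lebesgue_on G\<bar> \<le> L * (nL w * nL u)"
    using ax_Basis by meson
  have "\<bar>B w v u\<bar> \<le> (K + L) * nL w * nL u" if u: "u \<in> V" and w: "w \<in> V" for u w
  proof -
    have "\<bar>B w v u\<bar> \<le> K * (nL w * nL u) + L * (nL w * nL u)"
      unfolding B_eq[OF w vV u] sum_Basis_real2
      by (rule order_trans[OF abs_triangle_ineq]) (intro add_mono K[rule_format] L[rule_format] u w)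
    then show ?thesis by (simp add: algebra_simps)
  qed
  then show ?thesis by blast
qed

end

section \<open>Functions of time\<close>

lemma integrable_locally_integrable:
  fixes u :: "'a::euclidean_space => 'b::euclidean_space"
  assumes G: "open G" and u: "integrable (lebesgue_on G) u" shows "locally_integrable G u"
  unfolding locally_integrable_def
proof (intro allI impI)
  fix K assume K: "compact K \<and> K \<subseteq> G"
  have k: "K \<in> sets lebesgue" using K by (simp add: lmeasurable_compact fmeasurableD)
  have "set_integrable lebesgue G u" using u G by (simp add: integrable_restrict_space set_integrable_def)
  then have "set_integrable lebesgue K u" using K k by (rule_tac set_integrable_subset) auto
  then show "integrable (lebesgue_on K) u" using k by (simp add: integrable_restrict_space set_integrable_def)
qed

text \<open>By continuity a violation would persist on a nonempty open subset of (0,T), which has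
  positive measure. This reaches the end point 0, where a statement for almost every t says
  nothing.\<close>

lemma AE_bound_imp_bound:
  fixes g :: "real => real"
  assumes T: "0 < T" and g: "continuous_on {0..T} g" and ae: "AE t in lebesgue_on {0<..<T}. \<bar>g t\<bar> \<le> C"
    and t: "t \<in> {0..T}"
  shows "\<bar>g t\<bar> \<le> C"
proof (rule ccontr)
  assume "\<not> \<bar>g t\<bar> \<le> C"
  then have p: "0 < \<bar>g t\<bar> - C" by simp
  obtain d where d: "0 < d" "\<And>s. s \<in> {0..T} ==> dist s t < d ==> dist (g s) (g t) < \<bar>g t\<bar> - C"
    using g t p unfolding continuous_on_iff by meson
  define U where "U = {0<..<T} \<inter> ball t d"
  have o: "open U" unfolding U_def by (intro open_Int) auto
  have "t \<in> closure {0<..<T}" using t T by simp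
  then obtain s where "s \<in> {0<..<T}" "dist s t < d" using d(1) unfolding closure_approachable by blast
  then have ne: "U \<noteq> {}" by (auto simp: U_def dist_commute)
  have big: "\<not> \<bar>g s\<bar> \<le> C" if "s \<in> U" for s
    using d(2)[of s] that by (auto simp: U_def dist_commute dist_real_def)
  have "AE s in lebesgue. s \<in> {0<..<T} \<longrightarrow> \<bar>g s\<bar> \<le> C" using ae by (simp add: AE_lebesgue_on)
  then obtain N where N: "N \<in> null_sets lebesgue" "\<And>s. s \<notin> N ==> s \<in> {0<..<T} \<longrightarrow> \<bar>g s\<bar> \<le> C"
    by (rule AE_E3) auto
  have "U \<subseteq> N"
  proof
    fix s assume s: "s \<in> U"
    then have "s \<in> {0<..<T}" by (simp add: U_def)
    then show "s \<in> N" using N(2)[of s] big[OF s] by blast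
  qed
  then have "negligible U" using N(1) by (meson negligible_iff_null_sets negligible_subset)
  then show False using open_not_negligible[OF o ne] by blast
qed

lemma partial_real_line:
  fixes \<phi> :: "real => real"
  assumes "\<phi> differentiable (at t)" shows "(\<phi> has_vector_derivative partial 1 \<phi> t) (at t within S)"
proof -
  have "(\<phi> has_vector_derivative vector_derivative \<phi> (at t)) (at t)"
    using assms by (simp add: vector_derivative_works)
  moreover have "partial 1 \<phi> t = vector_derivative \<phi> (at t)"
    by (simp add: partial_def frechet_derivative_eq_vector_derivative[OF assms])
  ultimately show ?thesis by (simp add: has_vector_derivative_at_within)
qed

lemma test_tail_integral:
  fixes \<phi> :: "real => real"
  assumes \<phi>: "\<phi> \<in> test_functions {0<..<T}" and s: "0 < s" "s < T"
  shows "(\<integral>t. partial 1 \<phi> t * indicator {..t} s \<partial>lebesgue_on {0<..<T}) = - \<phi> s"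
proof -
  let ?F = "\<lambda>t. indicator {s..T} t *\<^sub>R partial 1 \<phi> t"
  have p: "partial 1 \<phi> \<in> test_functions {0<..<T}" by (rule test_partial[OF \<phi>]) simp
  have "(\<integral>t. partial 1 \<phi> t * indicator {..t} s \<partial>lebesgue_on {0<..<T}) = (\<integral>t. ?F t \<partial>lebesgue_on {0<..<T})"
    by (intro Bochner_Integration.integral_cong refl) (auto simp: indicator_def)
  also have "\<dots> = (\<integral>t. ?F t \<partial>lborel)"
  proof (rule integral_lebesgue_on_zero_outside)
    show "?F \<in> borel_measurable borel"
      by (intro borel_measurable_scaleR borel_measurable_indicator borel_measurable_continuous_onI[OF test_cont[OF p]]) simp
    show "?F t = 0" if "t \<notin> {0<..<T}" for t using test_outside[OF p that] by simp
  qed simp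
  also have "\<dots> = \<phi> T - \<phi> s"
    using s by (intro integral_FTC_Icc partial_real_line test_diff[OF \<phi>] continuous_on_subset[OF test_cont[OF p]]) auto
  also have "\<dots> = - \<phi> s" using test_outside[OF \<phi>, of T] by simp
  finally show ?thesis .
qed

text \<open>Fubini's theorem moves the derivative of the test function inside: its integral over all
  t \<ge> s is minus its value at s. The constant c contributes nothing because that derivative has
  integral 0.\<close>

lemma weak_derivative_indefinite_integral:
  fixes g p :: "real => real"
  assumes g: "integrable (lebesgue_on {0<..<T}) g" and p: "locally_integrable {0<..<T} p"
    and ae: "AE t in lebesgue_on {0<..<T}. p t = c + (\<integral>s. indicator {..t} s * g s \<partial>lebesgue_on {0<..<T})"
  shows "has_weak_partial {0<..<T} 1 p g"
  unfolding has_weak_partial_def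
proof (intro conjI ballI p integrable_locally_integrable g)
  define M where "M = lebesgue_on {0<..<T}"
  interpret M: finite_measure M unfolding M_def by (rule finite_measure_lebesgue_on) simp
  interpret MM: pair_sigma_finite M M ..
  have gM: "integrable M g" using g by (simp add: M_def)
  then have gm [measurable]: "g \<in> borel_measurable M" by simp
  have idm [measurable]: "(\<lambda>t. t) \<in> borel_measurable M"
    unfolding M_def by (intro measurable_restrict_space1 measurable_completion) simp
  fix \<phi> :: "real => real" assume \<phi>: "\<phi> \<in> test_functions {0<..<T}"
  have pt: "partial 1 \<phi> \<in> test_functions {0<..<T}" by (rule test_partial[OF \<phi>]) simp
  obtain K where K: "0 < K" "\<And>t. \<bar>partial 1 \<phi> t\<bar> \<le> K" using test_bounded[OF pt] by auto
  have dm [measurable]: "partial 1 \<phi> \<in> borel_measurable M" using test_L2[OF _ pt] by (simp add: L2_def M_def)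
  have di: "integrable M (partial 1 \<phi>)" by (rule M.integrable_const_bound[of _ K]) (use K dm in auto)
  define P where "P t = (\<integral>s. indicator {..t} s * g s \<partial>M)" for t
  define h where "h t s = partial 1 \<phi> t * (indicator {..t} s * g s)" for t s
  have ind: "indicator {..t} s = (if s \<le> t then 1 else 0 :: real)" for s t :: real by (simp add: indicator_def)
  have hm [measurable]: "case_prod h \<in> borel_measurable (M \<Otimes>\<^sub>M M)"
    unfolding h_def ind by measurable
  have hle: "\<bar>h t s\<bar> \<le> K * \<bar>g s\<bar>" for t s
  proof -
    have "\<bar>h t s\<bar> \<le> \<bar>partial 1 \<phi> t\<bar> * \<bar>g s\<bar>" by (simp add: h_def abs_mult indicator_def)
    also have "\<dots> \<le> K * \<bar>g s\<bar>" using K(2) by (rule mult_right_mono) simp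
    finally show ?thesis .
  qed
  have Kg: "integrable M (\<lambda>s. K * \<bar>g s\<bar>)" using gM by simp
  have hi: "integrable M (h t)" for t
  proof (rule Bochner_Integration.integrable_bound[OF Kg])
    show "h t \<in> borel_measurable M" unfolding h_def[abs_def] ind by measurable
    have "\<bar>h t s\<bar> \<le> \<bar>K * \<bar>g s\<bar>\<bar>" for s using hle[of t s] by linarith
    then show "AE s in M. norm (h t s) \<le> norm (K * \<bar>g s\<bar>)" by simp
  qed
  have hI: "integrable (M \<Otimes>\<^sub>M M) (case_prod h)"
  proof (rule MM.Fubini_integrable[OF hm])
    show "integrable M (\<lambda>t. \<integral>s. norm (case_prod h (t, s)) \<partial>M)"
    proof (rule M.integrable_const_bound[of _ "\<integral>s. K * \<bar>g s\<bar> \<partial>M"])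
      show "AE t in M. norm (\<integral>s. norm (case_prod h (t, s)) \<partial>M) \<le> (\<integral>s. K * \<bar>g s\<bar> \<partial>M)"
      proof (rule AE_I2)
        fix t
        have "(\<integral>s. \<bar>h t s\<bar> \<partial>M) \<le> (\<integral>s. K * \<bar>g s\<bar> \<partial>M)" using hi hle Kg by (intro integral_mono) auto
        then show "norm (\<integral>s. norm (case_prod h (t, s)) \<partial>M) \<le> (\<integral>s. K * \<bar>g s\<bar> \<partial>M)" by simp
      qed
    qed measurable
  qed (use hi in auto)
  have "(\<integral>t. \<integral>s. h t s \<partial>M \<partial>M) = (\<integral>s. \<integral>t. h t s \<partial>M \<partial>M)"
    by (rule MM.Fubini_integral[OF hI, symmetric])
  also have "\<dots> = (\<integral>s. g s * - \<phi> s \<partial>M)"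
  proof (rule Bochner_Integration.integral_cong[OF refl])
    fix s assume "s \<in> space M"
    then have s: "0 < s" "s < T" by (auto simp: M_def)
    have "(\<integral>t. h t s \<partial>M) = (\<integral>t. g s * (partial 1 \<phi> t * indicator {..t} s) \<partial>M)" by (simp add: h_def mult_ac)
    also have "\<dots> = g s * - \<phi> s" using test_tail_integral[OF \<phi> s] by (simp add: M_def)
    finally show "(\<integral>t. h t s \<partial>M) = g s * - \<phi> s" .
  qed
  finally have F: "(\<integral>t. partial 1 \<phi> t * P t \<partial>M) = - (\<integral>s. \<phi> s * g s \<partial>M)"
    by (simp add: h_def P_def mult.commute)
  have Pi: "integrable M (\<lambda>t. partial 1 \<phi> t * P t)"
    using MM.integrable_fst'[OF hI] by (simp add: h_def P_def)
  have "(\<integral>t. partial 1 \<phi> t * p t \<partial>M) = (\<integral>t. partial 1 \<phi> t * c + partial 1 \<phi> t * P t \<partial>M)"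
  proof (rule integral_cong_AE)
    show "(\<lambda>t. partial 1 \<phi> t * p t) \<in> borel_measurable M"
    proof (rule borel_measurable_integrable)
      show "integrable M (\<lambda>t. partial 1 \<phi> t * p t)"
        using locally_integrable_test_mult[OF _ p pt] by (simp add: M_def)
    qed
    show "(\<lambda>t. partial 1 \<phi> t * c + partial 1 \<phi> t * P t) \<in> borel_measurable M"
      using borel_measurable_integrable[OF Pi] by simp
    show "AE t in M. partial 1 \<phi> t * p t = partial 1 \<phi> t * c + partial 1 \<phi> t * P t"
      using ae unfolding M_def[symmetric] by eventually_elim (simp add: P_def distrib_left)
  qed
  also have "\<dots> = (\<integral>t. partial 1 \<phi> t * c \<partial>M) + (\<integral>t. partial 1 \<phi> t * P t \<partial>M)"
    using di Pi by simp
  also have "(\<integral>t. partial 1 \<phi> t * c \<partial>M) = 0"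
  proof -
    have "(\<integral>t. partial 1 \<phi> t \<partial>M) = 0"
      unfolding M_def using test_integral_lebesgue_on[of "{0<..<T}", OF _ test_cont[OF pt] test_outside[OF pt]] integral_partial_zero[OF \<phi>, of 1]
      by (simp del: greaterThanLessThan_iff)
    then show ?thesis by simp
  qed
  finally show "(\<integral>x. partial 1 \<phi> x *\<^sub>R p x \<partial>lebesgue_on {0<..<T}) = - (\<integral>x. \<phi> x *\<^sub>R g x \<partial>lebesgue_on {0<..<T})"
    using F by (simp add: M_def)
qed simp

text \<open>Dominated convergence: the indicators converge at every s other than the limit point t,
  which is a null set.\<close>

lemma indefinite_integral_continuous:
  fixes g :: "real => real"
  assumes g: "integrable (lebesgue_on {0<..<T}) g"
  shows "continuous_on {0..T} (\<lambda>t. \<integral>s. indicator {..t} s * g s \<partial>lebesgue_on {0<..<T})"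
proof (rule continuous_on_sequentiallyI)
  define M where "M = lebesgue_on {0<..<T}"
  have gM: "integrable M g" using g by (simp add: M_def)
  then have gm [measurable]: "g \<in> borel_measurable M" by simp
  have [measurable]: "(\<lambda>s. indicator {..t} s :: real) \<in> borel_measurable M" for t
    unfolding M_def by (rule measurable_restrict_space1, rule borel_measurable_indicator) simp
  fix x :: "nat => real" and t assume l: "x \<longlonglongrightarrow> t"
  have "(\<lambda>n. \<integral>s. indicator {..x n} s * g s \<partial>M) \<longlonglongrightarrow> (\<integral>s. indicator {..t} s * g s \<partial>M)"
  proof (rule integral_dominated_convergence[where w="\<lambda>s. \<bar>g s\<bar>"])
    have "AE s in lebesgue. s \<in> {0<..<T} \<longrightarrow> s \<noteq> t"
      by (rule AE_I'[of "{t}"]) auto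
    then have "AE s in M. s \<noteq> t" unfolding M_def by (subst AE_lebesgue_on) auto
    then show "AE s in M. (\<lambda>n. indicator {..x n} s * g s) \<longlonglongrightarrow> indicator {..t} s * g s"
    proof eventually_elim
      fix s assume "s \<noteq> t"
      then consider "s < t" | "t < s" by linarith
      then have "\<forall>\<^sub>F n in sequentially. indicator {..x n} s = (indicator {..t} s :: real)"
      proof cases
        case 1
        have "\<forall>\<^sub>F n in sequentially. s < x n" by (rule order_tendstoD(1)[OF l 1])
        then show ?thesis using 1 by (auto elim!: eventually_mono simp: indicator_def)
      next
        case 2
        have "\<forall>\<^sub>F n in sequentially. x n < s" by (rule order_tendstoD(2)[OF l 2])
        then show ?thesis using 2 by (auto elim!: eventually_mono simp: indicator_def)
      qed
      then have "(\<lambda>n. indicator {..x n} s :: real) \<longlonglongrightarrow> indicator {..t} s" by (rule tendsto_eventually)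
      then show "(\<lambda>n. indicator {..x n} s * g s) \<longlonglongrightarrow> indicator {..t} s * g s" by (intro tendsto_intros)
    qed
    show "AE s in M. norm (indicator {..x n} s * g s) \<le> \<bar>g s\<bar>" for n
      by (rule AE_I2) (simp add: indicator_def)
  qed (use gM in auto)
  then show "(\<lambda>n. \<integral>s. indicator {..x n} s * g s \<partial>lebesgue_on {0<..<T}) \<longlonglongrightarrow> (\<integral>s. indicator {..t} s * g s \<partial>lebesgue_on {0<..<T})"
    by (simp add: M_def)
qed

lemma borel_measurable_AE_LIMSEQ:
  fixes g :: "'a::euclidean_space => real"
  assumes G: "open G" and h: "\<And>n. h n \<in> borel_measurable (lebesgue_on G)"
    and ae: "AE x in lebesgue_on G. (\<lambda>n. h n x) \<longlonglongrightarrow> g x"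
  shows "g \<in> borel_measurable (lebesgue_on G)"
proof (rule borel_measurable_AE_lebesgue_on[OF G])
  show "(\<lambda>x. lim (\<lambda>n. h n x)) \<in> borel_measurable (lebesgue_on G)" by (rule borel_measurable_lim_metric[OF h])
  show "AE x in lebesgue_on G. lim (\<lambda>n. h n x) = g x" using ae by eventually_elim (rule limI)
qed

lemma borel_measurable_simple_comp:
  "simple_function M y ==> (\<lambda>t. g (y t) :: real) \<in> borel_measurable M"
  by (rule borel_measurable_simple_function[OF simple_function_real_comp])

section \<open>The dual space and functionals depending on time\<close>

context solenoidal
begin

abbreviation V' :: "(vfield => real) set" where "V' \<equiv> dual_space V nW"
abbreviation nV' :: "(vfield => real) => real" where "nV' \<equiv> dual_norm V nW"

lemma dual_iff: "F \<in> V' \<longleftrightarrow> (\<forall>v\<in>V. \<forall>w\<in>V. F (v + w) = F v + F w) \<and> (\<forall>c. \<forall>v\<in>V. F (c *\<^sub>R v) = c * F v)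
    \<and> (\<exists>C. \<forall>v\<in>V. \<bar>F v\<bar> \<le> C * nW v)"
  unfolding dual_space_def plus_fun_def scaleR_fun_def by simp

lemma nW_scale: "v \<in> V ==> nW (c *\<^sub>R v) = \<bar>c\<bar> * nW v"
  using semi_ip.nrm_scale[OF semi_ip_W12[OF G] V_W12, of v c] by (simp add: W12_norm_eq[OF G])

lemma dual_norm_bdd: assumes F: "F \<in> V'" shows "bdd_above ((\<lambda>v. \<bar>F v\<bar>) ` {v \<in> V. nW v \<le> 1})"
proof -
  obtain C where C: "\<And>v. v \<in> V ==> \<bar>F v\<bar> \<le> C * nW v" using F unfolding dual_iff by blast
  have "\<bar>F v\<bar> \<le> \<bar>C\<bar>" if "v \<in> V" "nW v \<le> 1" for v
  proof -
    have "\<bar>F v\<bar> \<le> C * nW v" by (rule C[OF that(1)])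
    also have "\<dots> \<le> \<bar>C\<bar> * nW v" by (intro mult_right_mono W12_norm_nonneg) simp
    also have "\<dots> \<le> \<bar>C\<bar> * 1" by (intro mult_left_mono that) simp
    finally show ?thesis by simp
  qed
  then show ?thesis by (intro bdd_aboveI[of _ "\<bar>C\<bar>"]) auto
qed

lemma dual_norm_nonneg: assumes F: "F \<in> V'" shows "0 \<le> nV' F"
proof -
  have "0 \<in> {v \<in> V. nW v \<le> 1}" using subspace_0[OF subspace_V] nW_scale[of 0 0] by simp
  then have "\<bar>F 0\<bar> \<le> nV' F" unfolding dual_norm_def by (rule cSUP_upper[OF _ dual_norm_bdd[OF F]])
  then show ?thesis using abs_ge_zero[of "F 0"] by linarith
qed

lemma dual_norm_bound: assumes F: "F \<in> V'" and v: "v \<in> V" shows "\<bar>F v\<bar> \<le> nV' F * nW v"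
proof (cases "nW v = 0")
  case True
  \<comment> \<open>Boundedness forces F to vanish on null elements, where rescaling to norm 1 is
    impossible.\<close>
  then show ?thesis using F v unfolding dual_iff by fastforce
next
  case False
  then have n: "0 < nW v" using W12_norm_nonneg[of G v] by simp
  have "(1 / nW v) *\<^sub>R v \<in> {v \<in> V. nW v \<le> 1}"
    using n v subspace_scale[OF subspace_V v] by (simp add: nW_scale)
  then have "\<bar>F ((1 / nW v) *\<^sub>R v)\<bar> \<le> nV' F"
    unfolding dual_norm_def by (rule cSUP_upper[OF _ dual_norm_bdd[OF F]])
  moreover have "F ((1 / nW v) *\<^sub>R v) = (1 / nW v) * F v" using F v unfolding dual_iff by blast
  ultimately show ?thesis using n by (simp add: abs_mult divide_le_eq)
qed

lemma dual_norm_le: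
  assumes C: "0 \<le> C" and b: "\<And>v. v \<in> V ==> \<bar>F v\<bar> \<le> C * nW v" shows "nV' F \<le> C"
  unfolding dual_norm_def
proof (rule cSUP_least)
  show "{v \<in> V. nW v \<le> 1} \<noteq> {}" using subspace_0[OF subspace_V] nW_scale[of 0 0] by (auto intro!: exI[of _ 0])
  fix v assume "v \<in> {v \<in> V. nW v \<le> 1}"
  then show "\<bar>F v\<bar> \<le> C" using b[of v] mult_left_mono[of "nW v" 1 C] C by simp
qed

lemma dual_diff: assumes F: "F \<in> V'" and G': "G' \<in> V'" shows "(\<lambda>v. F v - G' v) \<in> V'"
proof -
  have "\<bar>F v - G' v\<bar> \<le> (nV' F + nV' G') * nW v" if "v \<in> V" for v
    using dual_norm_bound[OF F that] dual_norm_bound[OF G' that] by (simp add: algebra_simps)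
  then have "\<exists>C. \<forall>v\<in>V. \<bar>F v - G' v\<bar> \<le> C * nW v" by blast
  then show ?thesis using F G' unfolding dual_iff by (simp add: right_diff_distrib)
qed

lemma dual_norm_rev: assumes F: "F \<in> V'" and G': "G' \<in> V'" shows "\<bar>nV' F - nV' G'\<bar> \<le> nV' (\<lambda>v. F v - G' v)"
proof -
  note n = dual_norm_nonneg[OF F] dual_norm_nonneg[OF G'] dual_norm_nonneg[OF dual_diff[OF F G']]
  have b: "\<bar>F v - G' v\<bar> \<le> nV' (\<lambda>v. F v - G' v) * nW v" if "v \<in> V" for v
    by (rule dual_norm_bound[OF dual_diff[OF F G'] that])
  have "nV' F \<le> nV' G' + nV' (\<lambda>v. F v - G' v)"
  proof (rule dual_norm_le)
    show "\<bar>F v\<bar> \<le> (nV' G' + nV' (\<lambda>v. F v - G' v)) * nW v" if "v \<in> V" for v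
      using b[OF that] dual_norm_bound[OF G' that] by (simp add: algebra_simps)
  qed (use n in simp)
  moreover have "nV' G' \<le> nV' F + nV' (\<lambda>v. F v - G' v)"
  proof (rule dual_norm_le)
    show "\<bar>G' v\<bar> \<le> (nV' F + nV' (\<lambda>v. F v - G' v)) * nW v" if "v \<in> V" for v
      using b[OF that] dual_norm_bound[OF F that] by (simp add: algebra_simps)
  qed (use n in simp)
  ultimately show ?thesis by linarith
qed

lemma dual_zero: "(\<lambda>v. 0) \<in> V'" unfolding dual_iff by (auto intro: exI[of _ 0])

text \<open>The dual norm is a supremum over possibly uncountably many v, so its measurability in t
  is obtained from simple functions converging in that norm.\<close>

lemma dual_limit_measurable:
  fixes T :: real
  assumes w: "\<And>t. t \<in> {0<..<T} ==> w t \<in> V'"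
    and s: "\<And>n. simple_function (lebesgue_on {0<..<T}) (s n)" "\<And>n t. t \<in> {0<..<T} ==> s n t \<in> V'"
    and l: "AE t in lebesgue_on {0<..<T}. (\<lambda>n. nV' (\<lambda>v. w t v - s n t v)) \<longlonglongrightarrow> 0"
  shows "(\<lambda>t. nV' (w t)) \<in> borel_measurable (lebesgue_on {0<..<T})"
    "v \<in> V ==> (\<lambda>t. w t v) \<in> borel_measurable (lebesgue_on {0<..<T})"
proof -
  have sp: "AE t in lebesgue_on {0<..<T}. t \<in> {0<..<T}" using AE_space[of "lebesgue_on {0<..<T}"] by simp
  show "(\<lambda>t. nV' (w t)) \<in> borel_measurable (lebesgue_on {0<..<T})"
  proof (rule borel_measurable_AE_LIMSEQ[where h="\<lambda>n t. nV' (s n t)"])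
    show "(\<lambda>t. nV' (s n t)) \<in> borel_measurable (lebesgue_on {0<..<T})" for n by (rule borel_measurable_simple_comp[OF s(1)])
    show "AE t in lebesgue_on {0<..<T}. (\<lambda>n. nV' (s n t)) \<longlonglongrightarrow> nV' (w t)"
      using l sp
    proof eventually_elim
      fix t assume l: "(\<lambda>n. nV' (\<lambda>v. w t v - s n t v)) \<longlonglongrightarrow> 0" and t: "t \<in> {0<..<T}"
      have "(\<lambda>n. nV' (s n t) - nV' (w t)) \<longlonglongrightarrow> 0"
      proof (rule Lim_null_comparison[OF _ l], intro always_eventually allI)
        show "norm (nV' (s n t) - nV' (w t)) \<le> nV' (\<lambda>v. w t v - s n t v)" for n
          using dual_norm_rev[OF w[OF t] s(2)[OF t]] by (simp add: abs_minus_commute)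
      qed
      then show "(\<lambda>n. nV' (s n t)) \<longlonglongrightarrow> nV' (w t)" by (simp add: LIM_zero_iff)
    qed
  qed simp
  show "(\<lambda>t. w t v) \<in> borel_measurable (lebesgue_on {0<..<T})" if v: "v \<in> V"
  proof (rule borel_measurable_AE_LIMSEQ[where h="\<lambda>n t. s n t v"])
    show "(\<lambda>t. s n t v) \<in> borel_measurable (lebesgue_on {0<..<T})" for n by (rule borel_measurable_simple_comp[OF s(1)])
    show "AE t in lebesgue_on {0<..<T}. (\<lambda>n. s n t v) \<longlonglongrightarrow> w t v"
      using l sp
    proof eventually_elim
      fix t assume l: "(\<lambda>n. nV' (\<lambda>v. w t v - s n t v)) \<longlonglongrightarrow> 0" and t: "t \<in> {0<..<T}"
      have "(\<lambda>n. s n t v - w t v) \<longlonglongrightarrow> 0"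
      proof (rule Lim_null_comparison[of _ "\<lambda>n. nV' (\<lambda>v. w t v - s n t v) * nW v"], intro always_eventually allI)
        show "norm (s n t v - w t v) \<le> nV' (\<lambda>v. w t v - s n t v) * nW v" for n
          using dual_norm_bound[OF dual_diff[OF w[OF t] s(2)[OF t]] v] by (simp add: abs_minus_commute)
        show "(\<lambda>n. nV' (\<lambda>v. w t v - s n t v) * nW v) \<longlonglongrightarrow> 0" by (rule tendsto_mult_left_zero[OF l])
      qed
      then show "(\<lambda>n. s n t v) \<longlonglongrightarrow> w t v" by (simp add: LIM_zero_iff)
    qed
  qed simp
qed

text \<open>f is replaced by 0 at the exceptional times where it is not a bounded functional,
  because the locale \<open>evolution\<close> asks for linearity and bounds at every t.\<close>

lemma dual_representative:
  assumes f: "f \<in> L2_V_dual T a1 a2 G"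
  obtains g s where "\<And>t. g t \<in> V'" "AE t in lebesgue_on {0<..<T}. g t = f t"
    "\<And>n::nat. simple_function (lebesgue_on {0<..<T}) (s n)" "\<And>n t. t \<in> {0<..<T} ==> s n t \<in> V'"
    "AE t in lebesgue_on {0<..<T}. (\<lambda>n. nV' (\<lambda>v. g t v - s n t v)) \<longlonglongrightarrow> 0"
    "integrable (lebesgue_on {0<..<T}) (\<lambda>t. (nV' (g t))^2)"
proof -
  obtain s where fV: "AE t in lebesgue_on {0<..<T}. f t \<in> V'"
    and s: "\<And>n::nat. simple_function (lebesgue_on {0<..<T}) (s n)" "\<And>n. s n ` {0<..<T} \<subseteq> V'"
    and l: "AE t in lebesgue_on {0<..<T}. (\<lambda>n. nV' (\<lambda>v. f t v - s n t v)) \<longlonglongrightarrow> 0"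
    and i: "integrable (lebesgue_on {0<..<T}) (\<lambda>t. (nV' (f t))^2)"
    using f unfolding L2_V_dual_def L2_time_def strongly_measurable_def by blast
  define g where "g t = (if f t \<in> V' then f t else (\<lambda>v. 0))" for t
  have gV: "g t \<in> V'" for t by (simp add: g_def dual_zero)
  have gf: "AE t in lebesgue_on {0<..<T}. g t = f t" using fV by eventually_elim (simp add: g_def)
  have sV: "s n t \<in> V'" if "t \<in> {0<..<T}" for n t using s(2) that by blast
  have lg: "AE t in lebesgue_on {0<..<T}. (\<lambda>n. nV' (\<lambda>v. g t v - s n t v)) \<longlonglongrightarrow> 0"
    using gf l by eventually_elim simp
  have m: "(\<lambda>t. nV' (g t)) \<in> borel_measurable (lebesgue_on {0<..<T})"
    by (rule dual_limit_measurable(1)[OF gV s(1) sV lg])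
  have "integrable (lebesgue_on {0<..<T}) (\<lambda>t. (nV' (g t))^2)"
    by (rule integrable_cong_AE_imp[OF i]) (use m gf in \<open>auto elim: eventually_mono\<close>)
  then show ?thesis using that[of g s] gV gf s(1) sV lg by blast
qed

text \<open>The minus sign turns \<nu> \<open>A1\<close> into a coercive form; its constant is \<nu>
  divided by the factor in \<open>A1_coercive\<close>.\<close>

lemma evolution_solenoidal:
  assumes T: "0 < T" and \<nu>: "0 < \<nu>" and u0: "u0 \<in> H"
    and g: "\<And>t. g t \<in> V'" "\<And>v. v \<in> V ==> (\<lambda>t. g t v) \<in> borel_measurable (lebesgue_on {0<..<T})"
      "(\<lambda>t. nV' (g t)) \<in> borel_measurable (lebesgue_on {0<..<T})"
      "integrable (lebesgue_on {0<..<T}) (\<lambda>t. (nV' (g t))^2)"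
  shows "evolution V H (ipW G) (L2_pairing G) (\<lambda>u v. - \<nu> * A1 a1 a2 G u v) B g (\<lambda>t. nV' (g t)) u0 T
    (\<nu> * CA) (\<nu> / (1 + 4 * \<rho>^2)) CB D0"
proof (intro evolution.intro semi_hilbert_V semi_ip_H evolution_axioms.intro; (unfold nW_V nL_H)?)
  fix x y z w :: vfield and c e t :: real and xs :: "nat => vfield" and K :: real
  have p: "0 < 1 + 4 * \<rho>^2" by (simp add: add_pos_nonneg)
  show "v \<in> V ==> v \<in> H" for v by (rule V_H)
  show "nL v \<le> nW v" for v by (rule L2_le_W12)
  show "x \<in> V ==> y \<in> V ==> z \<in> V ==> - \<nu> * A1 a1 a2 G (x + y) z = - \<nu> * A1 a1 a2 G x z + - \<nu> * A1 a1 a2 G y z"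
    "x \<in> V ==> z \<in> V ==> - \<nu> * A1 a1 a2 G (c *\<^sub>R x) z = c * (- \<nu> * A1 a1 a2 G x z)"
    "x \<in> V ==> y \<in> V ==> z \<in> V ==> - \<nu> * A1 a1 a2 G z (x + y) = - \<nu> * A1 a1 a2 G z x + - \<nu> * A1 a1 a2 G z y"
    "x \<in> V ==> z \<in> V ==> - \<nu> * A1 a1 a2 G z (c *\<^sub>R x) = c * (- \<nu> * A1 a1 a2 G z x)"
    using A1_bilinear[of x y z] A1_bilinear(2,4)[of x x z] by (simp_all add: algebra_simps)
  show "x \<in> V ==> y \<in> V ==> \<bar>- \<nu> * A1 a1 a2 G x y\<bar> \<le> \<nu> * CA * nW x * nW y"
    using A1_bound[of x y] \<nu> by (simp add: abs_mult mult.assoc)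
  show "\<nu> / (1 + 4 * \<rho>^2) * (nW x)^2 \<le> - \<nu> * A1 a1 a2 G x x" if "x \<in> V"
  proof -
    have "(nW x)^2 / (1 + 4 * \<rho>^2) \<le> - A1 a1 a2 G x x" using A1_coercive[OF that] p by (simp add: divide_le_eq mult.commute)
    then have "\<nu> * ((nW x)^2 / (1 + 4 * \<rho>^2)) \<le> \<nu> * - A1 a1 a2 G x x" using \<nu> by (intro mult_left_mono) auto
    then show ?thesis by simp
  qed
  show "0 < \<nu> / (1 + 4 * \<rho>^2)" using \<nu> p by simp
  show "x \<in> V ==> y \<in> V ==> z \<in> V ==> w \<in> V ==> B (x + y) z w = B x z w + B y z w"
    "x \<in> V ==> y \<in> V ==> z \<in> V ==> w \<in> V ==> B z (x + y) w = B z x w + B z y w" by (rule B_linear; assumption)+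
  show "x \<in> V ==> z \<in> V ==> w \<in> V ==> B (c *\<^sub>R x) z w = c * B x z w"
    "x \<in> V ==> z \<in> V ==> w \<in> V ==> B z (c *\<^sub>R x) w = c * B z x w"
    using B_linear(2,4)[of x x z w c] by simp_all
  show "x \<in> V ==> y \<in> V ==> z \<in> V ==> B x y z = - B x z y" by (rule B_skew)
  show "x \<in> V ==> y \<in> V ==> z \<in> V ==> \<bar>B x y z\<bar> \<le> CB * sqrt (nL x * nW x) * sqrt (nL z * nW z) * nW y" by (rule B_bound)
  show "0 \<le> \<nu> * CA" using \<nu> CA_nonneg by simp
  show "0 \<le> CB" by (rule CB_nonneg)
  show "D0 \<subseteq> V" by (rule D0_V)
  show "v \<in> V ==> 0 < e ==> \<exists>d\<in>D0. nW (v - d) < e" for v by (rule V_dense)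
  show "\<exists>K. \<forall>u\<in>V. \<bar>- \<nu> * A1 a1 a2 G u v\<bar> \<le> K * nL u" if v: "v \<in> D0" for v
  proof -
    obtain K where K: "\<And>u. u \<in> V ==> \<bar>A1 a1 a2 G u v\<bar> \<le> K * nL u" using A1_test_bound[OF v] by blast
    have "\<bar>- \<nu> * A1 a1 a2 G u v\<bar> \<le> \<nu> * K * nL u" if "u \<in> V" for u
      using mult_left_mono[OF K[OF that], of \<nu>] \<nu> by (simp add: abs_mult mult.assoc)
    then show ?thesis by blast
  qed
  show "v \<in> D0 ==> \<exists>K. \<forall>u\<in>V. \<forall>w\<in>V. \<bar>B w v u\<bar> \<le> K * nL w * nL u" for v by (rule B_test_bound)
  show "(\<And>n. xs n \<in> V) ==> (\<And>n. nW (xs n) \<le> K) ==>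
      \<exists>r. strict_mono (r :: nat => nat) \<and> semi_ip.Cauchy_seq (L2_pairing G) (xs \<circ> r)" by (rule compact_V)
  show "0 < T" by (rule T)
  show "u0 \<in> H" by (rule u0)
  show "v \<in> V ==> (\<lambda>t. g t v) \<in> borel_measurable (lebesgue_on {0<..<T})" for v by (rule g)
  show "x \<in> V ==> y \<in> V ==> g t (x + y) = g t x + g t y" "x \<in> V ==> g t (c *\<^sub>R x) = c * g t x"
    using g(1)[of t] unfolding dual_iff by blast+
  show "x \<in> V ==> \<bar>g t x\<bar> \<le> nV' (g t) * nW x" by (rule dual_norm_bound[OF g(1)])
  show "0 \<le> nV' (g t)" by (rule dual_norm_nonneg[OF g(1)])
  show "(\<lambda>t. nV' (g t)) \<in> borel_measurable (lebesgue_on {0<..<T})" "integrable (lebesgue_on {0<..<T}) (\<lambda>t. (nV' (g t))^2)"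
    by (rule g)+
qed

end

lemma L2_pairing_tendsto:
  assumes y: "y \<in> L2 G" and x: "\<And>n. x n \<in> L2 G" and v: "v \<in> L2 G" and l: "(\<lambda>n. L2_norm G (v - x n)) \<longlonglongrightarrow> 0"
  shows "(\<lambda>n. L2_pairing G y (x n)) \<longlonglongrightarrow> L2_pairing G y v"
proof -
  have "(\<lambda>n. L2_pairing G y (x n) - L2_pairing G y v) \<longlonglongrightarrow> 0"
  proof (rule Lim_null_comparison[of _ "\<lambda>n. L2_norm G y * L2_norm G (v - x n)"], intro always_eventually allI)
    fix n
    have d: "v - x n \<in> L2 G" using x v by (simp add: L2_eq)
    have "L2_pairing G y (v - x n) = L2_pairing G y v - L2_pairing G y (x n)"
      using y x v by (simp add: L2_pairing_eq L2_eq sq.ip_diff2)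
    then show "norm (L2_pairing G y (x n) - L2_pairing G y v) \<le> L2_norm G y * L2_norm G (v - x n)"
      using L2_CS[OF y d] by (simp add: abs_minus_commute)
  qed (rule tendsto_mult_right_zero[OF l])
  then show ?thesis by (simp add: LIM_zero_iff)
qed

section \<open>The weak solution on the planar domain\<close>

context solenoidal
begin

text \<open>The value that the equation prescribes for u' as a functional of v, when the forcing is
  F and the solution has the value y.\<close>

definition rhs :: "real => (vfield => real) => vfield => vfield => real" where
  "rhs \<nu> F y v = F v + \<nu> * A1 a1 a2 G y v - B y y v"

lemma rhs_dual:
  assumes F: "F \<in> V'" and y: "y \<in> V" shows "rhs \<nu> F y \<in> V'"
  unfolding dual_iff
proof (intro conjI allI ballI)
  fix v w :: vfield and c :: real assume v: "v \<in> V"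
  show "rhs \<nu> F y (c *\<^sub>R v) = c * rhs \<nu> F y v"
    using F v A1_bilinear(4)[OF v v y] B_linear(6)[OF v v y y] unfolding dual_iff rhs_def by (simp add: algebra_simps)
  assume w: "w \<in> V"
  show "rhs \<nu> F y (v + w) = rhs \<nu> F y v + rhs \<nu> F y w"
    using F v w A1_bilinear(3)[OF v w y] B_linear(5)[OF v w y y] unfolding dual_iff rhs_def by (simp add: algebra_simps)
next
  have "\<bar>rhs \<nu> F y v\<bar> \<le> (nV' F + \<bar>\<nu>\<bar> * (CA * nW y) + CB * nW y * nW y) * nW v" if v: "v \<in> V" for v
  proof -
    have "\<bar>\<nu> * A1 a1 a2 G y v\<bar> \<le> \<bar>\<nu>\<bar> * (CA * nW y * nW v)"
      unfolding abs_mult by (intro mult_left_mono A1_bound y v) simp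
    then show ?thesis using dual_norm_bound[OF F v] B_bound_W[OF y y v] unfolding rhs_def by (simp add: algebra_simps)
  qed
  then show "\<exists>C. \<forall>v\<in>V. \<bar>rhs \<nu> F y v\<bar> \<le> C * nW v" by blast
qed

text \<open>Local Lipschitz continuity in the dual norm: inserting the simple approximations of the
  forcing and of u gives simple approximations of u', hence its strong measurability.\<close>

lemma rhs_diff:
  assumes F: "F \<in> V'" "F' \<in> V'" and y: "y \<in> V" "y' \<in> V" and \<nu>: "0 \<le> \<nu>"
  shows "nV' (\<lambda>v. rhs \<nu> F y v - rhs \<nu> F' y' v)
    \<le> nV' (\<lambda>v. F v - F' v) + (\<nu> * CA + CB * (nW y + nW y')) * nW (y - y')"
proof (rule dual_norm_le)
  have d: "y - y' \<in> V" by (rule subspace_diff[OF subspace_V y])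
  show "0 \<le> nV' (\<lambda>v. F v - F' v) + (\<nu> * CA + CB * (nW y + nW y')) * nW (y - y')"
    by (intro add_nonneg_nonneg mult_nonneg_nonneg dual_norm_nonneg dual_diff F \<nu> CA_nonneg CB_nonneg W12_norm_nonneg)
  fix v assume v: "v \<in> V"
  have "A1 a1 a2 G y v = A1 a1 a2 G (y - y') v + A1 a1 a2 G y' v"
    using A1_bilinear(1)[OF d y(2) v] by simp
  moreover have "B y y v - B y' y' v = B (y - y') y v + B y' (y - y') v"
    using B_diff(1)[OF y y(1) v] B_diff(2)[OF y y(2) v] by simp
  ultimately have e: "rhs \<nu> F y v - rhs \<nu> F' y' v
      = (F v - F' v) + \<nu> * A1 a1 a2 G (y - y') v - (B (y - y') y v + B y' (y - y') v)"
    by (simp add: rhs_def algebra_simps)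
  have "\<bar>\<nu> * A1 a1 a2 G (y - y') v\<bar> \<le> \<nu> * (CA * nW (y - y') * nW v)"
    unfolding abs_mult abs_of_nonneg[OF \<nu>] by (intro mult_left_mono A1_bound d v \<nu>)
  then have "\<bar>rhs \<nu> F y v - rhs \<nu> F' y' v\<bar> \<le> nV' (\<lambda>v. F v - F' v) * nW v + \<nu> * (CA * nW (y - y') * nW v)
      + (CB * nW (y - y') * nW y * nW v + CB * nW y' * nW (y - y') * nW v)"
    unfolding e using dual_norm_bound[OF dual_diff[OF F] v] B_bound_W[OF d y(1) v] B_bound_W[OF y(2) d v] by linarith
  then show "\<bar>rhs \<nu> F y v - rhs \<nu> F' y' v\<bar>
      \<le> (nV' (\<lambda>v. F v - F' v) + (\<nu> * CA + CB * (nW y + nW y')) * nW (y - y')) * nW v"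
    by (simp add: algebra_simps)
qed

theorem weak_solution_exists:
  assumes T: "0 < T" and \<nu>: "0 < \<nu>" and u0: "u0 \<in> H" and f: "f \<in> L2_V_dual T a1 a2 G"
  shows "\<exists>u\<in>VQ_space T a1 a2 G. weak_solution T \<nu> a1 a2 G f u0 u"
proof -
  let ?M = "lebesgue_on {0<..<T}"
  interpret M: finite_measure ?M by (rule finite_measure_lebesgue_on) simp
  obtain g s where g: "\<And>t. g t \<in> V'" and gf: "AE t in ?M. g t = f t"
    and s: "\<And>n::nat. simple_function ?M (s n)" "\<And>n t. t \<in> {0<..<T} ==> s n t \<in> V'"
    and gs: "AE t in ?M. (\<lambda>n. nV' (\<lambda>v. g t v - s n t v)) \<longlonglongrightarrow> 0"
    and gi: "integrable ?M (\<lambda>t. (nV' (g t))^2)"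
    by (rule dual_representative[OF f]) blast
  interpret E: evolution V H "ipW G" "L2_pairing G" "\<lambda>u v. - \<nu> * A1 a1 a2 G u v" B g "\<lambda>t. nV' (g t)" u0 T
    "\<nu> * CA" "\<nu> / (1 + 4 * \<rho>^2)" CB D0
    by (rule evolution_solenoidal[OF T \<nu> u0 g dual_limit_measurable(2)[OF g s gs] dual_limit_measurable(1)[OF g s gs] gi])
  obtain u z where u: "\<And>t. u t \<in> V" and z: "\<And>n::nat. z n \<in> E.S" and zu': "\<And>t. (\<lambda>n. E.V.nrm (z n t - u t)) \<longlonglongrightarrow> 0"
    and ui': "integrable ?M (\<lambda>t. (E.V.nrm (u t))^2)" and uE': "\<And>t. E.H.nrm (u t) \<le> sqrt E.E0"
    and Ri: "\<And>v. v \<in> V ==> integrable ?M (E.RL u v)"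
    and Req: "\<And>v. v \<in> V ==> AE t in ?M. L2_pairing G (u t) v = L2_pairing G u0 v + (\<integral>s. indicator {..t} s * E.RL u v s \<partial>?M)"
    by (rule E.existence) blast
  note zu = zu'[unfolded nW_V] and ui = ui'[unfolded nW_V] and uE = uE'[unfolded nL_H]
  define C where "C = sqrt E.E0"
  have uC: "nL (u t) \<le> C" for t using uE by (simp add: C_def)
  have C0: "0 \<le> C" using uC[of 0] L2_norm_nonneg[of G "u 0"] by linarith
  have zs: "simple_function ?M (z n)" and zV: "z n t \<in> V" for n t using z[of n] by (auto simp: E.S_def)
  have R: "E.RL u v t = rhs \<nu> (g t) (u t) v" for v t unfolding E.RL_def rhs_def by simp
  note RLi = Ri[unfolded R[abs_def]] and RLeq = Req[unfolded R]
  have uz: "(\<lambda>n. nW (u t - z n t)) \<longlonglongrightarrow> 0" for t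
    using zu[of t] E.V.nrm_diff_sym[OF u zV, unfolded nW_V] by simp
  have zl: "(\<lambda>n. nW (z n t)) \<longlonglongrightarrow> nW (u t)" for t
    using E.V.tendsto_nrm[OF zV u, unfolded nW_V, OF zu] .

  have strong: "strongly_measurable T X N u"
    if "\<And>v. v \<in> V ==> v \<in> X" "\<And>t. (\<lambda>n. N (u t - z n t)) \<longlonglongrightarrow> 0" for X N
    unfolding strongly_measurable_def
  proof (intro conjI exI[of _ z] allI zs)
    show "z n ` {0<..<T} \<subseteq> X" for n using that(1) zV by blast
    show "AE t in ?M. (\<lambda>n. N (\<lambda>x. u t x - z n t x)) \<longlonglongrightarrow> 0"
      by (rule AE_I2) (rule that(2)[unfolded fun_diff_def])
  qed (use that(1) u in simp)
  have uL2: "u \<in> L2_time T V nW" unfolding L2_time_def using strong[OF _ uz] ui by simp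
  have "(\<lambda>n. nL (u t - z n t)) \<longlonglongrightarrow> 0" for t
    by (rule null_squeeze[OF L2_norm_nonneg L2_le_W12 uz])
  from strong[OF V_H this] have "strongly_measurable T H nL u" .
  moreover have "AE t in ?M. nL (u t) \<le> C" using uC by simp
  ultimately have uLinf: "u \<in> Linf_time T H nL" unfolding Linf_time_def by blast

  define w where "w t = rhs \<nu> (g t) (u t)" for t
  have wV: "w t \<in> V'" for t unfolding w_def by (rule rhs_dual[OF g u])
  define s' where "s' n t = rhs \<nu> (s n t) (z n t)" for n t
  have s's: "simple_function ?M (s' n)" for n
    unfolding s'_def[abs_def] using s(1) zs by (rule simple_function_compose2)
  have s'V: "s' n t \<in> V'" if "t \<in> {0<..<T}" for n t unfolding s'_def by (rule rhs_dual[OF s(2)[OF that] zV])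
  have ws: "AE t in ?M. (\<lambda>n. nV' (\<lambda>v. w t v - s' n t v)) \<longlonglongrightarrow> 0"
    using gs AE_space
  proof eventually_elim
    fix t assume l: "(\<lambda>n. nV' (\<lambda>v. g t v - s n t v)) \<longlonglongrightarrow> 0" and "t \<in> space ?M"
    then have t: "t \<in> {0<..<T}" by simp
    show "(\<lambda>n. nV' (\<lambda>v. w t v - s' n t v)) \<longlonglongrightarrow> 0"
    proof (rule null_squeeze)
      let ?b = "\<lambda>n. nV' (\<lambda>v. g t v - s n t v) + (\<nu> * CA + CB * (nW (u t) + nW (z n t))) * nW (u t - z n t)"
      show "nV' (\<lambda>v. w t v - s' n t v) \<le> ?b n" for n
        unfolding w_def s'_def by (rule rhs_diff[OF g s(2)[OF t] u zV less_imp_le[OF \<nu>]])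
      have "?b \<longlonglongrightarrow> 0 + (\<nu> * CA + CB * (nW (u t) + nW (u t))) * 0" by (intro tendsto_intros l zl uz)
      then show "?b \<longlonglongrightarrow> 0" by simp
    qed (rule dual_norm_nonneg[OF dual_diff[OF wV s'V[OF t]]])
  qed
  have wi: "integrable ?M (\<lambda>t. (nV' (w t))^2)"
  proof (rule Bochner_Integration.integrable_bound)
    \<comment> \<open>The factor of the V-norm in \<open>majL\<close>, with C for the bound of the
      H-norm.\<close>
    let ?k = "\<nu> * CA + 2 * CB * C"
    show "integrable ?M (\<lambda>t. 2 * (nV' (g t))^2 + 2 * (?k^2 * (nW (u t))^2))" using gi ui by simp
    have "(\<lambda>t. nV' (w t)) \<in> borel_measurable ?M" by (rule dual_limit_measurable(1)[OF wV s's s'V ws])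
    then show "(\<lambda>t. (nV' (w t))^2) \<in> borel_measurable ?M" by simp
    have "(nV' (w t))^2 \<le> 2 * (nV' (g t))^2 + 2 * (?k^2 * (nW (u t))^2)" for t
    proof -
      have k: "0 \<le> ?k" using \<nu> CA_nonneg CB_nonneg C0 by simp
      have "nV' (w t) \<le> nV' (g t) + ?k * nW (u t)"
      proof (rule dual_norm_le)
        show "0 \<le> nV' (g t) + ?k * nW (u t)"
          by (rule add_nonneg_nonneg[OF dual_norm_nonneg[OF g] mult_nonneg_nonneg[OF k W12_norm_nonneg]])
        show "\<bar>w t v\<bar> \<le> (nV' (g t) + ?k * nW (u t)) * nW v" if v: "v \<in> V" for v
          using E.RL_bound[of v u t, OF v u uE'] unfolding R w_def E.majL_def nW_V C_def .
      qed
      then have "(nV' (w t))^2 \<le> (nV' (g t) + ?k * nW (u t))^2" using dual_norm_nonneg[OF wV] by (rule power_mono)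
      also have "\<dots> \<le> 2 * (nV' (g t))^2 + 2 * (?k * nW (u t))^2" by (rule sum2_sq_le)
      finally show ?thesis by (simp add: power_mult_distrib)
    qed
    then show "AE t in ?M. norm ((nV' (w t))^2) \<le> norm (2 * (nV' (g t))^2 + 2 * (?k^2 * (nW (u t))^2))"
      by (intro AE_I2) (simp add: order_trans[OF _ abs_ge_self])
  qed
  have wL2: "w \<in> L2_V_dual T a1 a2 G"
    unfolding L2_V_dual_def L2_time_def strongly_measurable_def using wV s's s'V ws wi by (auto intro!: exI[of _ s'])

  \<comment> \<open>The continuous representative of the pairing of u with v, for v in V. Its value
    at 0 is the prescribed one because the interval of integration then contains no s.\<close>
  define q where "q v t = L2_pairing G u0 v + (\<integral>s. indicator {..t} s * w s v \<partial>?M)" for v t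
  have qc: "continuous_on {0..T} (q v)" if v: "v \<in> V" for v
    unfolding q_def[abs_def] w_def by (intro continuous_intros indefinite_integral_continuous RLi v)
  have qu: "AE t in ?M. q v t = L2_pairing G (u t) v" if v: "v \<in> V" for v
    using RLeq[OF v] by eventually_elim (simp add: q_def w_def)
  have q0: "q v 0 = L2_pairing G u0 v" for v
  proof -
    have "(\<integral>s. indicator {..0} s * w s v \<partial>?M) = (\<integral>s. 0 \<partial>?M)"
      by (intro Bochner_Integration.integral_cong refl) (auto simp: indicator_def)
    then show ?thesis by (simp add: q_def)
  qed
  have pb: "\<bar>L2_pairing G (u t) v\<bar> \<le> C * nL v" if v: "v \<in> H" for v t
    using L2_CS[OF V_L2[OF u] H_L2[OF v], of t] mult_right_mono[OF uC L2_norm_nonneg[of G v], of t] by linarith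
  have weak: "has_weak_partial {0<..<T} 1 (\<lambda>t. L2_pairing G (u t) v) (\<lambda>t. w t v)" if v: "v \<in> V" for v
  proof (rule weak_derivative_indefinite_integral)
    show "integrable ?M (\<lambda>t. w t v)" using RLi[OF v] by (simp add: w_def)
    show "AE t in ?M. L2_pairing G (u t) v = L2_pairing G u0 v + (\<integral>s. indicator {..t} s * w s v \<partial>?M)"
      using RLeq[OF v] by (simp add: w_def)
    have "q v \<in> borel_measurable ?M"
      by (intro continuous_imp_measurable_on_sets_lebesgue continuous_on_subset[OF qc[OF v]]) auto
    then have "(\<lambda>t. L2_pairing G (u t) v) \<in> borel_measurable ?M"
      using qu[OF v] by (rule borel_measurable_AE_lebesgue_on[rotated]) simp
    then have "integrable ?M (\<lambda>t. L2_pairing G (u t) v)"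
      using pb[OF V_H[OF v]] by (intro M.integrable_const_bound[of _ "C * nL v"]) auto
    then show "locally_integrable {0<..<T} (\<lambda>t. L2_pairing G (u t) v)"
      by (rule integrable_locally_integrable[rotated]) simp
  qed
  have uVQ: "u \<in> VQ_space T a1 a2 G" unfolding VQ_space_def using uL2 uLinf wL2 weak by blast

  have eq: "\<exists>h. has_weak_partial {0<..<T} 1 (\<lambda>t. L2_pairing G (u t) v) h \<and>
      (AE t in ?M. h t - \<nu> * A1 a1 a2 G (u t) v + L2_pairing G (B1 a1 a2 G (u t) (u t)) v = f t v)" if v: "v \<in> V" for v
  proof (intro exI[of _ "\<lambda>t. w t v"] conjI weak v)
    show "AE t in ?M. w t v - \<nu> * A1 a1 a2 G (u t) v + L2_pairing G (B1 a1 a2 G (u t) (u t)) v = f t v"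
      using gf by eventually_elim (simp add: w_def rhs_def B_def)
  qed

  \<comment> \<open>The integrated equation is available only for v in V. For v in H the continuous
    representative is the uniform limit of those for approximating test functions.\<close>
  have init: "\<exists>q. continuous_on {0..T} q \<and> (AE t in ?M. q t = L2_pairing G (u t) v) \<and> q 0 = L2_pairing G u0 v"
    if v: "v \<in> H" for v
  proof -
    have "\<forall>n. \<exists>\<phi>\<in>D0. nL (v - \<phi>) < 1 / real (Suc n)" using H_dense[OF v] by simp
    then obtain x where x: "\<And>n. x n \<in> D0" "\<And>n. nL (v - x n) < 1 / real (Suc n)" by metis
    have xV: "x n \<in> V" for n using x(1) D0_V by blast
    have xl: "(\<lambda>n. nL (v - x n)) \<longlonglongrightarrow> 0"
      by (rule null_squeeze[OF L2_norm_nonneg less_imp_le[OF x(2)] inverse_Suc_null])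
    have ae: "AE t in ?M. \<forall>n. q (x n) t = L2_pairing G (u t) (x n)"
      using qu[OF xV] by (simp add: AE_all_countable)
    \<comment> \<open>Almost everywhere this is Cauchy-Schwarz for the pairing with
      \<open>u t\<close>; continuity extends it to all t, in particular to t = 0, so the limit keeps
      the initial value.\<close>
    have dist: "\<bar>q (x m) t - q (x n) t\<bar> \<le> C * (nL (v - x m) + nL (v - x n))" if t: "t \<in> {0..T}" for m n t
    proof (rule AE_bound_imp_bound[OF T _ _ t])
      show "continuous_on {0..T} (\<lambda>t. q (x m) t - q (x n) t)" by (intro continuous_intros qc xV)
      show "AE t in ?M. \<bar>q (x m) t - q (x n) t\<bar> \<le> C * (nL (v - x m) + nL (v - x n))"
        using ae
      proof eventually_elim
        fix t assume a: "\<forall>n. q (x n) t = L2_pairing G (u t) (x n)"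
        have xH: "x n \<in> H" for n by (rule V_H[OF xV])
        have d: "x m - x n \<in> H" by (rule subspace_diff[OF subspace_H xH xH])
        have "\<bar>q (x m) t - q (x n) t\<bar> = \<bar>L2_pairing G (u t) (x m - x n)\<bar>"
          using a E.H.ip_diff2[OF xH[of m] xH[of n] V_H[OF u[of t]]] by simp
        also have "\<dots> \<le> C * nL (x m - x n)" by (rule pb[OF d])
        also have "\<dots> \<le> C * (nL (v - x m) + nL (v - x n))"
        proof (rule mult_left_mono[OF _ C0])
          show "nL (x m - x n) \<le> nL (v - x m) + nL (v - x n)"
            using E.H.nrm_triangle3[OF xH[of m] v xH[of n]] E.H.nrm_diff_sym[OF xH[of m] v] by (simp add: nL_H)
        qed
        finally show "\<bar>q (x m) t - q (x n) t\<bar> \<le> C * (nL (v - x m) + nL (v - x n))" .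
      qed
    qed
    have "uniformly_Cauchy_on {0..T} (\<lambda>n. q (x n))"
      unfolding uniformly_Cauchy_on_def
    proof (intro allI impI)
      fix \<epsilon> :: real assume \<epsilon>: "0 < \<epsilon>"
      \<comment> \<open>C + 1 instead of C, since C may be 0.\<close>
      have p: "0 < \<epsilon> / (2 * (C + 1))" using \<epsilon> C0 by simp
      obtain N where N: "\<And>n. n \<ge> N ==> nL (v - x n) < \<epsilon> / (2 * (C + 1))"
        using order_tendstoD(2)[OF xl p] unfolding eventually_sequentially by blast
      have "dist (q (x m) t) (q (x n) t) < \<epsilon>" if t: "t \<in> {0..T}" and mn: "m \<ge> N" "n \<ge> N" for t m n
      proof -
        have "dist (q (x m) t) (q (x n) t) \<le> C * (nL (v - x m) + nL (v - x n))"
          using dist[OF t] by (simp add: dist_real_def)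
        also have "\<dots> \<le> (C + 1) * (nL (v - x m) + nL (v - x n))"
          by (intro mult_right_mono add_nonneg_nonneg L2_norm_nonneg) simp
        also have "\<dots> < (C + 1) * (\<epsilon> / (2 * (C + 1)) + \<epsilon> / (2 * (C + 1)))"
          using C0 N[OF mn(1)] N[OF mn(2)] by (intro mult_strict_left_mono add_strict_mono) auto
        also have "\<dots> = \<epsilon>"
        proof -
          have "k * (\<epsilon> / (2 * k) + \<epsilon> / (2 * k)) = \<epsilon>" if "0 < k" for k using that by simp
          from this[of "C + 1"] show ?thesis using C0 by simp
        qed
        finally show ?thesis .
      qed
      then show "\<exists>N. \<forall>t\<in>{0..T}. \<forall>m\<ge>N. \<forall>n\<ge>N. dist (q (x m) t) (q (x n) t) < \<epsilon>" by blast
    qed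
    then obtain l where l: "uniform_limit {0..T} (\<lambda>n. q (x n)) l sequentially"
      using Cauchy_uniformly_convergent unfolding uniformly_convergent_on_def by blast
    have "continuous_on {0..T} l"
      by (rule uniform_limit_theorem[OF _ l]) (use qc[OF xV] in \<open>auto intro: always_eventually\<close>)
    moreover have "AE t in ?M. l t = L2_pairing G (u t) v"
      using ae AE_space
    proof eventually_elim
      fix t assume a: "\<forall>n. q (x n) t = L2_pairing G (u t) (x n)" and "t \<in> space ?M"
      then have "(\<lambda>n. q (x n) t) \<longlonglongrightarrow> l t" by (intro tendsto_uniform_limitI[OF l]) auto
      moreover have "(\<lambda>n. q (x n) t) \<longlonglongrightarrow> L2_pairing G (u t) v"
        using L2_pairing_tendsto[OF V_L2[OF u] V_L2[OF xV] H_L2[OF v] xl] a by simp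
      ultimately show "l t = L2_pairing G (u t) v" by (rule LIMSEQ_unique)
    qed
    moreover have "l 0 = L2_pairing G u0 v"
    proof (rule LIMSEQ_unique)
      show "(\<lambda>n. q (x n) 0) \<longlonglongrightarrow> l 0" using T by (intro tendsto_uniform_limitI[OF l]) auto
      show "(\<lambda>n. q (x n) 0) \<longlonglongrightarrow> L2_pairing G u0 v"
        unfolding q0 by (rule L2_pairing_tendsto[OF H_L2[OF u0] V_L2[OF xV] H_L2[OF v] xl])
    qed
    ultimately show ?thesis by blast
  qed
  have "weak_solution T \<nu> a1 a2 G f u0 u" unfolding weak_solution_def using uVQ eq init by blast
  then show ?thesis using uVQ by blast
qed

end

theorem theorem3:
  fixes \<Omega> L :: "(real^3) set" and G :: "(real^2) set"
    and T \<nu> a1 a2 b :: real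
    and u0 :: "real^2 \<Rightarrow> real^3"
    and f :: "real \<Rightarrow> (real^2 \<Rightarrow> real^3) \<Rightarrow> real"
  assumes "Lip_loc_domain \<Omega>" and "bounded \<Omega>"
    and "T > 0" and "\<nu> > 0"
    and "a1 \<noteq> 0" and "a2 \<noteq> 0"
    and "L = {x. x $ 3 = b - a1 * x $ 1 - a2 * x $ 2}"
    and "\<Omega> \<inter> L \<noteq> {}"
    and "G = proj12 ` (\<Omega> \<inter> L)"
    and "u0 \<in> H_space a1 a2 G"
    and "f \<in> L2_V_dual T a1 a2 G"
  shows "\<exists>u \<in> VQ_space T a1 a2 G. weak_solution T \<nu> a1 a2 G f u0 u"
proof -
  \<comment> \<open>Inverse of the projection on the plane L. G is the preimage of \<Omega> under
    this continuous map and hence open.\<close>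
  define lift :: "real^2 \<Rightarrow> real^3" where "lift y = vector [y $ 1, y $ 2, b - a1 * y $ 1 - a2 * y $ 2]" for y
  have lc: "lift y $ 1 = y $ 1" "lift y $ 2 = y $ 2" "lift y $ 3 = b - a1 * y $ 1 - a2 * y $ 2" for y
    by (simp_all add: lift_def)
  have pc: "proj12 x $ 1 = x $ 1" "proj12 x $ 2 = x $ 2" for x by (simp_all add: proj12_def)
  have "G = lift -` \<Omega>"
  proof (intro set_eqI iffI)
    fix y assume "y \<in> G"
    then obtain x where x: "x \<in> \<Omega>" "x \<in> L" "y = proj12 x" using assms(9) by auto
    have "lift y = x" using x by (simp add: vec_eq_iff forall_3 lc pc assms(7))
    then show "y \<in> lift -` \<Omega>" using x by simp
  next
    fix y assume y: "y \<in> lift -` \<Omega>"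
    have "proj12 (lift y) = y" by (simp add: vec_eq_iff forall_2 lc pc)
    then show "y \<in> G" using y unfolding assms(7,9) by (intro image_eqI[of _ _ "lift y"]) (auto simp: lc)
  qed
  moreover have "continuous_on UNIV (\<lambda>y. \<chi> i. lift y $ i)"
  proof (rule continuous_on_vec_lambda)
    fix i :: 3
    show "continuous_on UNIV (\<lambda>y. lift y $ i)"
      using exhaust_3[of i] by (elim disjE) (simp_all add: lc continuous_intros)
  qed
  then have "continuous_on UNIV lift" by simp
  moreover have "open \<Omega>" using assms(1) by (simp add: Lip_loc_domain_def)
  ultimately have G: "open G" by (simp add: continuous_on_open_vimage[OF open_UNIV, of lift])
  obtain \<rho> where \<rho>: "\<And>x. x \<in> \<Omega> \<Longrightarrow> norm x \<le> \<rho>" using assms(2) unfolding bounded_iff by blast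
  have n: "norm y \<le> \<bar>\<rho>\<bar>" if "y \<in> G" for y
  proof -
    have "y \<in> proj12 ` (\<Omega> \<inter> L)" using that assms(9) by simp
    then obtain x where x: "x \<in> \<Omega>" "y = proj12 x" by blast
    have "norm y \<le> norm x"
      unfolding x norm_vec_def L2_set_def sum_2 sum_3 pc by (intro real_sqrt_le_mono) simp
    then show ?thesis using \<rho>[OF x(1)] by linarith
  qed
  interpret solenoidal a1 a2 "\<bar>\<rho>\<bar>" G by unfold_locales (use G n in auto)
  show ?thesis by (rule weak_solution_exists[OF assms(3,4,10,11)])
qed

end
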